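(* Let $\beta>n/2$. If the operator $\mathcal L_\omega$ corresponding to the bilinear form $\mathcal A_\omega$ is such that $\omega$ and $\boldsymbol\alpha$ are defined by $$\omega(\mathbf x,\mathbf y)=|\mathbf y-\mathbf x|\,\phi(|\mathbf y-\mathbf x|)\ \text{ with }\ \phi(|\mathbf y-\mathbf x|)=|\mathbf y-\mathbf x|^{-\beta},\qquad\boldsymbol\alpha(\mathbf x,\mathbf y)=\boldsymbol\rho(\mathbf x,\mathbf y)=\frac{\mathbf y-\mathbf x}{|\mathbf y-\mathbf x|}\ \text{ with }\ \delta=\infty,$$ then the following weak problem is well-posed in $V_c(\Omega\cup\Omega_I^\omega)$: for $f\in V'(\Omega\cup\Omega_I^\omega)$, find $u\in V(\Omega\cup\Omega_I^\omega)$ such that $u=0$ in $\Omega_I^\omega$ and $$\mathcal A_\omega(u,v)=\mathcal F(v)\qquad\text{for all }v\in V_c(\Omega\cup\Omega_I^\omega).$$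
   Context: $\Omega\subset\mathbb R^n$ ($n\in\{1,2,3\}$) is open and bounded; since the interaction radius is $\delta=\infty$, the interaction domain is $\Omega_I^\omega=\mathbb R^n\setminus\Omega$. With $\boldsymbol\eta=\boldsymbol\alpha\omega$, $$\mathcal G_\omega u(\mathbf x)=\int_{\mathbb R^n}(u(\mathbf y)-u(\mathbf x))\boldsymbol\eta(\mathbf x,\mathbf y)\,d\mathbf y,\qquad\mathcal A_\omega(u,v)=\int_{\Omega\cup\Omega_I^\omega}\mathcal G_\omega u\cdot\mathcal G_\omega v\,d\mathbf x,\qquad\mathcal F(v)=\int_\Omega fv\,d\mathbf x,$$ and $\mathcal L_\omega=\mathcal D_\omega\mathcal G_\omega$ with $\mathcal D_\omega\mathbf v(\mathbf x)=\int_{\mathbb R^n}(\omega(\mathbf x,\mathbf y)\mathbf v(\mathbf x)+\omega(\mathbf y,\mathbf x)\mathbf v(\mathbf y))\cdot\boldsymbol\alpha(\mathbf x,\mathbf y)\,d\mathbf y$. The equivalence kernel of $\mathcal L_\omega$ is $$2\gamma_{\rm eq}(\mathbf x,\mathbf y)=\int_{\mathbb R^n}[\boldsymbol\eta(\mathbf x,\mathbf y)\cdot\boldsymbol\eta(\mathbf x,\mathbf z)+\boldsymbol\eta(\mathbf z,\mathbf y)\cdot\boldsymbol\eta(\mathbf x,\mathbf y)+\boldsymbol\eta(\mathbf z,\mathbf y)\cdot\boldsymbol\eta(\mathbf x,\mathbf z)]\,d\mathbf z.$$ The energy is $|||v|||^2=\int_{\Omega\cup\Omega_I^\omega}\int_{\Omega\cup\Omega_I^\omega}(v(\mathbf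 y)-v(\mathbf x))^2\gamma_{\rm eq}(\mathbf x,\mathbf y)\,d\mathbf y\,d\mathbf x$ (with $-\gamma_{\rm eq}$ in place of $\gamma_{\rm eq}$ if $\gamma_{\rm eq}$ is nonpositive), the energy space is $$V(\Omega\cup\Omega_I^\omega)=\{v\in L^2(\Omega\cup\Omega_I^\omega):|||v|||<\infty,\ v|_{\Omega_I^\omega}=0\},$$ $V'$ is its dual, and $V_c(\Omega\cup\Omega_I^\omega)$ denotes the energy space with the zero volume constraint on $\Omega_I^\omega$, that is, this same space. Integrals are intended in the principal value sense where needed. *)

theory Defs
  imports "HOL-Analysis.Analysis"
begin

type_synonym 'n vec_kernel = "real ^ 'n \<Rightarrow> real ^ 'n \<Rightarrow> real ^ 'n"
type_synonym 'n scalar_kernel = "real ^ 'n \<Rightarrow> real ^ 'n \<Rightarrow> real"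

text \<open>The interaction domain for the infinite interaction radius.\<close>

definition interaction_domain :: "(real ^ 'n::finite) set \<Rightarrow> (real ^ 'n) set" where
  "interaction_domain \<Omega> = UNIV - \<Omega>"

definition eta :: "'n::finite scalar_kernel \<Rightarrow> 'n vec_kernel \<Rightarrow> 'n vec_kernel" where
  "eta \<omega> \<alpha> x y = \<omega> x y *\<^sub>R \<alpha> x y"

text \<open>
  Principal values: each kernel \<open>\<eta>(a, b)\<close> occurring in an integral is cut off to
  \<open>\<epsilon> < |b - a| < R\<close>, and the principal value is the limit of the resulting integrals as
  \<open>\<epsilon> \<rightarrow> 0\<close> and \<open>R \<rightarrow> \<infinity>\<close> independently. Where the integral converges absolutely this is the
  Lebesgue integral.
\<close>

definition cutoff :: "real \<Rightarrow> real \<Rightarrow> 'n::finite vec_kernel \<Rightarrow> 'n vec_kernel" where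
  "cutoff \<epsilon> R k x y = (if \<epsilon> < norm (y - x) \<and> norm (y - x) < R then k x y else 0)"

definition pv_filter :: "(real \<times> real) filter" where
  "pv_filter = at_right 0 \<times>\<^sub>F at_top"

definition cutoff_gradient ::
  "'n::finite scalar_kernel \<Rightarrow> 'n vec_kernel \<Rightarrow> (real ^ 'n \<Rightarrow> real) \<Rightarrow> real ^ 'n \<Rightarrow> real \<times> real \<Rightarrow> real ^ 'n"
  where
  "cutoff_gradient \<omega> \<alpha> u x = (\<lambda>(\<epsilon>, R).
     LINT y|lebesgue. (u y - u x) *\<^sub>R cutoff \<epsilon> R (eta \<omega> \<alpha>) x y)"

definition gradient ::
  "'n::finite scalar_kernel \<Rightarrow> 'n vec_kernel \<Rightarrow> (real ^ 'n \<Rightarrow> real) \<Rightarrow> real ^ 'n \<Rightarrow> real ^ 'n"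
  where
  "gradient \<omega> \<alpha> u x = Lim pv_filter (cutoff_gradient \<omega> \<alpha> u x)"

definition bilinear_form ::
  "'n::finite scalar_kernel \<Rightarrow> 'n vec_kernel \<Rightarrow> (real ^ 'n) set \<Rightarrow>
   (real ^ 'n \<Rightarrow> real) \<Rightarrow> (real ^ 'n \<Rightarrow> real) \<Rightarrow> real"
  where
  "bilinear_form \<omega> \<alpha> \<Omega> u v =
     (LINT x : \<Omega> \<union> interaction_domain \<Omega> | lebesgue. gradient \<omega> \<alpha> u x \<bullet> gradient \<omega> \<alpha> v x)"

text \<open>
  The form is defined at \<open>(u, v)\<close> if the principal values exist almost everywhere and the
  integral over \<open>x\<close> converges; otherwise the value of \<^const>\<open>bilinear_form\<close> is arbitrary.
\<close>

definition bilinear_form_defined ::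
  "'n::finite scalar_kernel \<Rightarrow> 'n vec_kernel \<Rightarrow> (real ^ 'n) set \<Rightarrow>
   (real ^ 'n \<Rightarrow> real) \<Rightarrow> (real ^ 'n \<Rightarrow> real) \<Rightarrow> bool"
  where
  "bilinear_form_defined \<omega> \<alpha> \<Omega> u v \<longleftrightarrow>
     (AE x in lebesgue. x \<in> \<Omega> \<union> interaction_domain \<Omega> \<longrightarrow>
        (\<exists>l. (cutoff_gradient \<omega> \<alpha> u x \<longlongrightarrow> l) pv_filter) \<and>
        (\<exists>l. (cutoff_gradient \<omega> \<alpha> v x \<longlongrightarrow> l) pv_filter)) \<and>
     set_integrable lebesgue (\<Omega> \<union> interaction_domain \<Omega>)
       (\<lambda>x. gradient \<omega> \<alpha> u x \<bullet> gradient \<omega> \<alpha> v x)"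

text \<open>
  The principal value is taken in the extended reals: for kernels that are too singular at
  the diagonal, or decay too slowly, it is infinite, and then only constant functions have
  finite energy.
\<close>

definition gamma_eq ::
  "'n::finite scalar_kernel \<Rightarrow> 'n vec_kernel \<Rightarrow> real ^ 'n \<Rightarrow> real ^ 'n \<Rightarrow> ereal" where
  "gamma_eq \<omega> \<alpha> x y =
     Lim pv_filter (\<lambda>(\<epsilon>, R). let \<eta> = cutoff \<epsilon> R (eta \<omega> \<alpha>) in
       ereal (LINT z|lebesgue. \<eta> x y \<bullet> \<eta> x z + \<eta> z y \<bullet> \<eta> x y + \<eta> z y \<bullet> \<eta> x z)) / 2"

text \<open>The sign is tested off the diagonal, where the kernel is singular.\<close>

definition energy_kernel ::
  "'n::finite scalar_kernel \<Rightarrow> 'n vec_kernel \<Rightarrow> real ^ 'n \<Rightarrow> real ^ 'n \<Rightarrow> ennreal" where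
  "energy_kernel \<omega> \<alpha> x y = e2ennreal
     (if \<forall>x' y'. x' \<noteq> y' \<longrightarrow> gamma_eq \<omega> \<alpha> x' y' \<le> 0 then - gamma_eq \<omega> \<alpha> x y
      else gamma_eq \<omega> \<alpha> x y)"

definition energy ::
  "'n::finite scalar_kernel \<Rightarrow> 'n vec_kernel \<Rightarrow> (real ^ 'n) set \<Rightarrow> (real ^ 'n \<Rightarrow> real) \<Rightarrow> ennreal"
  where
  "energy \<omega> \<alpha> \<Omega> v =
     (\<integral>\<^sup>+ x \<in> \<Omega> \<union> interaction_domain \<Omega>.
       (\<integral>\<^sup>+ y \<in> \<Omega> \<union> interaction_domain \<Omega>.
          ennreal ((v y - v x)\<^sup>2) * energy_kernel \<omega> \<alpha> x y \<partial>lebesgue) \<partial>lebesgue)"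

definition energy_norm ::
  "'n::finite scalar_kernel \<Rightarrow> 'n vec_kernel \<Rightarrow> (real ^ 'n) set \<Rightarrow> (real ^ 'n \<Rightarrow> real) \<Rightarrow> real"
  where
  "energy_norm \<omega> \<alpha> \<Omega> v = sqrt (enn2real (energy \<omega> \<alpha> \<Omega> v))"

definition volume_constraint :: "(real ^ 'n::finite) set \<Rightarrow> (real ^ 'n \<Rightarrow> real) \<Rightarrow> bool" where
  "volume_constraint \<Omega> v \<longleftrightarrow> (AE x in lebesgue. x \<in> interaction_domain \<Omega> \<longrightarrow> v x = 0)"

text \<open>
  Elements of the energy space are functions rather than classes modulo null sets; equality
  in the space is equality almost everywhere.
\<close>

definition energy_space ::
  "'n::finite scalar_kernel \<Rightarrow> 'n vec_kernel \<Rightarrow> (real ^ 'n) set \<Rightarrow> (real ^ 'n \<Rightarrow> real) set" where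
  "energy_space \<omega> \<alpha> \<Omega> =
     {v. set_borel_measurable lebesgue (\<Omega> \<union> interaction_domain \<Omega>) v \<and>
         set_integrable lebesgue (\<Omega> \<union> interaction_domain \<Omega>) (\<lambda>x. (v x)\<^sup>2) \<and>
         energy \<omega> \<alpha> \<Omega> v < \<infinity> \<and>
         volume_constraint \<Omega> v}"

text \<open>
  Bounded linear functionals on the energy space; only the values on the space matter, and
  boundedness makes them invariant under changes on null sets. For such an \<open>f\<close>, the right-hand
  side \<open>\<integral>\<^sub>\<Omega> f v\<close> of the weak problem is the duality pairing \<open>f v\<close>.
\<close>

definition dual_energy_space ::
  "'n::finite scalar_kernel \<Rightarrow> 'n vec_kernel \<Rightarrow> (real ^ 'n) set \<Rightarrow> ((real ^ 'n \<Rightarrow> real) \<Rightarrow> real) set"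
  where
  "dual_energy_space \<omega> \<alpha> \<Omega> =
     {f. (\<forall>v\<in>energy_space \<omega> \<alpha> \<Omega>. \<forall>w\<in>energy_space \<omega> \<alpha> \<Omega>. f (\<lambda>x. v x + w x) = f v + f w) \<and>
         (\<forall>c. \<forall>v\<in>energy_space \<omega> \<alpha> \<Omega>. f (\<lambda>x. c * v x) = c * f v) \<and>
         (\<exists>K. \<forall>v\<in>energy_space \<omega> \<alpha> \<Omega>. \<bar>f v\<bar> \<le> K * energy_norm \<omega> \<alpha> \<Omega> v)}"

definition dual_norm ::
  "'n::finite scalar_kernel \<Rightarrow> 'n vec_kernel \<Rightarrow> (real ^ 'n) set \<Rightarrow> ((real ^ 'n \<Rightarrow> real) \<Rightarrow> real) \<Rightarrow> real"
  where
  "dual_norm \<omega> \<alpha> \<Omega> f = (SUP v\<in>{v \<in> energy_space \<omega> \<alpha> \<Omega>. energy_norm \<omega> \<alpha> \<Omega> v \<le> 1}. \<bar>f v\<bar>)"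

definition weak_solution ::
  "'n::finite scalar_kernel \<Rightarrow> 'n vec_kernel \<Rightarrow> (real ^ 'n) set \<Rightarrow>
   ((real ^ 'n \<Rightarrow> real) \<Rightarrow> real) \<Rightarrow> (real ^ 'n \<Rightarrow> real) \<Rightarrow> bool"
  where
  "weak_solution \<omega> \<alpha> \<Omega> f u \<longleftrightarrow>
     u \<in> energy_space \<omega> \<alpha> \<Omega> \<and> volume_constraint \<Omega> u \<and>
     (\<forall>v\<in>energy_space \<omega> \<alpha> \<Omega>. bilinear_form \<omega> \<alpha> \<Omega> u v = f v)"

text \<open>
  Well-posedness in the sense of Hadamard: the problem is meaningful, and for every datum
  there is a solution, it is unique, and it depends continuously on the datum.
\<close>

definition well_posed ::
  "'n::finite scalar_kernel \<Rightarrow> 'n vec_kernel \<Rightarrow> (real ^ 'n) set \<Rightarrow> bool" where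
  "well_posed \<omega> \<alpha> \<Omega> \<longleftrightarrow>
     (\<forall>u\<in>energy_space \<omega> \<alpha> \<Omega>. \<forall>v\<in>energy_space \<omega> \<alpha> \<Omega>. bilinear_form_defined \<omega> \<alpha> \<Omega> u v) \<and>
     (\<forall>f\<in>dual_energy_space \<omega> \<alpha> \<Omega>.
        (\<exists>u. weak_solution \<omega> \<alpha> \<Omega> f u) \<and>
        (\<forall>u u'. weak_solution \<omega> \<alpha> \<Omega> f u \<longrightarrow> weak_solution \<omega> \<alpha> \<Omega> f u' \<longrightarrow>
           (AE x in lebesgue. x \<in> \<Omega> \<union> interaction_domain \<Omega> \<longrightarrow> u x = u' x))) \<and>
     (\<exists>C\<ge>0. \<forall>f\<in>dual_energy_space \<omega> \<alpha> \<Omega>. \<forall>u. weak_solution \<omega> \<alpha> \<Omega> f u \<longrightarrow>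
        energy_norm \<omega> \<alpha> \<Omega> u \<le> C * dual_norm \<omega> \<alpha> \<Omega> f)"

end

theory Submission
  imports Defs
begin

text \<open>
  With \<open>K h = |h|\<^bsup>-\<beta>\<^esup> h\<close> one has \<open>\<eta> (x, y) = K (y - x)\<close>, and by oddness the equivalence kernel is \<open>-1/2\<close> times the
  principal value of the autocorrelation of \<open>K\<close> at \<open>x - y\<close>. It is \<open>-\<infinity>\<close> for \<open>\<beta> \<le> n/2 + 1\<close>, \<open>+\<infinity>\<close> for
  \<open>\<beta> \<ge> n + 2\<close>, and in between, by rotation and scaling invariance, a constant times \<open>|x - y|\<^bsup>n+2-2\<beta>\<^esup>\<close>. As functions in
  the energy space vanish outside a bounded set, an infinite kernel, or a nonzero one with \<open>\<beta> \<le> n + 1\<close>, which is not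
  integrable at infinity, leaves only the zero function. For \<open>\<beta> > n + 1\<close> the form \<open>A (u, u)\<close> is the energy,
  a fractional Gagliardo seminorm, and the problem is solved by minimisation. For \<open>\<beta> = n + 1\<close> with vanishing constant, the energy is
  zero, so is every datum, and uniqueness follows from \<open>A (u, u) = M \<parallel>u\<parallel>\<^sup>2\<close> with \<open>M > 0\<close>, the gradient being a Riesz transform.
  Both formulas for \<open>A (u, u)\<close> are obtained by truncating \<open>K\<close> near the origin; the sharp cut-offs of the principal
  value are compared with mollified truncations at Lebesgue points of \<open>u\<close>.
\<close>

section \<open>Invariance of Lebesgue measure and polar coordinates\<close>

text \<open>Everything rests on one identity in physical space, a substitute for Plancherel: the
  integral of |conv k u|^2 equals that of the autocorrelation of u against the autocorrelation of k.
  The obstacle is that the autocorrelation of K at z, with singularities at 0 and -z, converges in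
  general only as a principal value. Since K is odd, the value of the other factor may be subtracted
  at each singularity; this leaves |w|^(2-\<beta>) there and |w|^(2-2\<beta>) at infinity, and the
  integrability of these two powers yields the thresholds n + 2 and n/2 + 1. The threshold n + 1 is
  where |z|^(n+2-2\<beta>) passes from integrable at the origin to integrable at infinity. The
  constant in front of that power is never computed: one test function, whose truncated gradients
  stay away from 0 in L^2, decides its sign or that it is nonzero. The form is built from pointwise
  principal values, so convergence almost everywhere along all cut-offs is needed, which L^2 limits
  do not give; hence the Lebesgue points, of order \<beta> - 1, which finite energy supplies above n
  + 1.\<close>

abbreviation lborel_nn_integral :: "('a::euclidean_space \<Rightarrow> ennreal) \<Rightarrow> ennreal" (binder "LNINT " 10) where
 "lborel_nn_integral f \<equiv> nn_integral lborel f"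

lemma lborel_shift: "distr lborel borel (\<lambda>x. x + t) = (lborel :: 'a::euclidean_space measure)"
  using lborel_affine[of 1 t] by (simp add: density_1 add.commute)

lemma lborel_reflect: "distr lborel borel (\<lambda>x. t - x) = (lborel :: 'a::euclidean_space measure)"
  using lborel_affine[of "-1" t] by (simp add: density_1)

lemma nn_integral_shift:
  fixes f :: "'a::euclidean_space \<Rightarrow> ennreal"
  assumes "f \<in> borel_measurable borel"
  shows "(LNINT x. f (x + t)) = (LNINT x. f x)"
  using nn_integral_distr[of "\<lambda>x. x + t" lborel borel f] assms by (simp add: lborel_shift)

lemma nn_integral_reflect:
  fixes f :: "'a::euclidean_space \<Rightarrow> ennreal"
  assumes "f \<in> borel_measurable borel"
  shows "(LNINT x. f (t - x)) = (LNINT x. f x)"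
  using nn_integral_distr[of "\<lambda>x. t - x" lborel borel f] assms by (simp add: lborel_reflect)

lemma integral_shift:
  fixes f :: "'a::euclidean_space \<Rightarrow> 'b::{banach, second_countable_topology}"
  assumes "f \<in> borel_measurable borel"
  shows "(\<integral>x. f (x + t) \<partial>lborel) = (\<integral>x. f x \<partial>lborel)"
  using integral_distr[of "\<lambda>x. x + t" lborel borel f] assms by (simp add: lborel_shift)

lemma integral_reflect_lborel:
  fixes f :: "'a::euclidean_space \<Rightarrow> 'b::{banach, second_countable_topology}"
  assumes "f \<in> borel_measurable borel"
  shows "(\<integral>x. f (t - x) \<partial>lborel) = (\<integral>x. f x \<partial>lborel)"
  using integral_distr[of "\<lambda>x. t - x" lborel borel f] assms by (simp add: lborel_reflect)

lemma integrable_shift: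
  fixes f :: "'a::euclidean_space \<Rightarrow> 'b::{banach, second_countable_topology}"
  assumes "integrable lborel f"
  shows "integrable lborel (\<lambda>x. f (x + t))"
  using integrable_distr[of "\<lambda>x. x + t" lborel borel f] assms by (simp add: lborel_shift)

lemma integrable_reflect:
  fixes f :: "'a::euclidean_space \<Rightarrow> 'b::{banach, second_countable_topology}"
  assumes "integrable lborel f"
  shows "integrable lborel (\<lambda>x. f (t - x))"
  using integrable_distr[of "\<lambda>x. t - x" lborel borel f] assms by (simp add: lborel_reflect)

text \<open>Reflection makes the integral its own negative. Non-integrable functions are included,
  since their Bochner integral is 0.\<close>

lemma integral_odd:
  fixes f :: "'a::euclidean_space \<Rightarrow> 'b::{banach, second_countable_topology}"
  assumes "f \<in> borel_measurable borel" and "\<And>x. f (- x) = - f x"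
  shows "(\<integral>x. f x \<partial>lborel) = 0"
proof -
  have "- (\<integral>x. f x \<partial>lborel) = (\<integral>x. f x \<partial>lborel)"
  using integral_reflect_lborel[OF assms(1), of 0] assms(2) by simp
  then have "2 *\<^sub>R (\<integral>x. f x \<partial>lborel) = 0"
  by (metis add.right_inverse scaleR_2)
  then show ?thesis by simp
qed

text \<open>A translation invariant measure is determined by its value on the unit ball; this gives
  the invariance of Lebesgue measure under rotations without determinants.\<close>

lemma lborel_orthogonal:
  fixes T :: "'a::euclidean_space \<Rightarrow> 'a"
  assumes T: "orthogonal_transformation T"
  shows "distr lborel borel T = (lborel :: 'a measure)"
proof -
  have lin: "linear T" and nT: "\<And>x. norm (T x) = norm x"
  using T by (auto simp: orthogonal_transformation_linear orthogonal_transformation_norm)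
  have [measurable]: "T \<in> borel_measurable borel"
  using lin by (intro borel_measurable_continuous_onI linear_continuous_on)
   (simp add: linear_conv_bounded_linear[symmetric])
  define \<mu> where "\<mu> = distr lborel borel T"
  have sets_\<mu>[measurable_cong, simp]: "sets \<mu> = sets borel" and space_\<mu>[simp]: "space \<mu> = UNIV"
  by (auto simp: \<mu>_def)
  have fin: "emeasure \<mu> (ball 0 r) = emeasure lborel (ball 0 r :: 'a set)" for r
  unfolding \<mu>_def by (subst emeasure_distr) (auto simp: ball_def nT dist_norm intro!: arg_cong2[where f=emeasure])
  have "sigma_finite_measure \<mu>"
  proof
  show "\<exists>A. countable A \<and> A \<subseteq> sets \<mu> \<and> \<Union> A = space \<mu> \<and> (\<forall>a\<in>A. emeasure \<mu> a \<noteq> \<infinity>)"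
  proof (intro exI[of _ "range (\<lambda>n::nat. ball 0 (real n))"] conjI ballI)
   show "\<Union> (range (\<lambda>n::nat. ball (0::'a) (real n))) = space \<mu>"
    using reals_Archimedean2 by (auto simp: ball_def)
  qed (auto simp: fin emeasure_lborel_ball_finite[THEN less_imp_neq, simplified])
  qed
  then interpret \<mu>: sigma_finite_measure \<mu> .
  interpret P: pair_sigma_finite \<mu> lborel ..
  have inv: "(\<integral>\<^sup>+x. f (x + t) \<partial>\<mu>) = (\<integral>\<^sup>+x. f x \<partial>\<mu>)"
  if [measurable]: "f \<in> borel_measurable borel" for f :: "'a \<Rightarrow> ennreal" and t
  proof -
  obtain t' where t': "t = T t'"
   using T orthogonal_transformation_surj by (metis surjD)
  have "(\<integral>\<^sup>+x. f (x + t) \<partial>\<mu>) = (LNINT x. f (T (x + t')))"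
   by (simp add: \<mu>_def nn_integral_distr t' linear_add[OF lin])
  also have "\<dots> = (LNINT x. f (T x))"
   by (rule nn_integral_shift) measurable
  finally show ?thesis by (simp add: \<mu>_def nn_integral_distr)
  qed
  let ?B = "ball (0::'a) 1"
  have [measurable]: "?B \<in> sets borel" by (rule borel_open) simp
  have "emeasure \<mu> A = emeasure lborel A" if [measurable]: "A \<in> sets borel" for A
  proof -
  \<comment> \<open>\<mu> A times Lebesgue B, and Lebesgue A times \<mu> B, are both the double
    integral of 1_A (x + y) 1_B y: Fubini and the translation invariance of the two measures turn
    one into the other. T preserves the ball B, so its two measures agree; they are finite and
    positive and cancel.\<close>
  have "emeasure \<mu> A * emeasure lborel ?B = (LNINT y. (\<integral>\<^sup>+x. indicator A x \<partial>\<mu>) * indicator ?B y)"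
   by (subst nn_integral_cmult) (auto intro!: borel_measurable_indicator)
  also have "\<dots> = (LNINT y. (\<integral>\<^sup>+x. indicator A (x + y) \<partial>\<mu>) * indicator ?B y)"
   using inv[of "indicator A"] by simp
  also have "\<dots> = (LNINT y. (\<integral>\<^sup>+x. indicator A (x + y) * indicator ?B y \<partial>\<mu>))"
   by (intro nn_integral_cong nn_integral_multc[symmetric]) measurable
  also have "\<dots> = (\<integral>\<^sup>+x. (LNINT y. indicator A (x + y) * indicator ?B y) \<partial>\<mu>)"
   by (rule P.Fubini') measurable
  also have "\<dots> = (\<integral>\<^sup>+x. (LNINT y. indicator A y * indicator ?B (y - x)) \<partial>\<mu>)"
  proof (rule nn_integral_cong)
   fix x
   show "(LNINT y. indicator A (x + y) * indicator ?B y) = (LNINT y. indicator A y * indicator ?B (y - x))"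
    using nn_integral_shift[of "\<lambda>y. indicator A y * indicator ?B (y - x)" x] by (simp add: add.commute)
  qed
  also have "\<dots> = (LNINT y. (\<integral>\<^sup>+x. indicator A y * indicator ?B (y - x) \<partial>\<mu>))"
   by (rule P.Fubini'[symmetric]) measurable
  also have "\<dots> = (LNINT y. indicator A y * (\<integral>\<^sup>+x. indicator ?B (x + (-y)) \<partial>\<mu>))"
   by (intro nn_integral_cong, subst nn_integral_cmult[symmetric])
    (auto simp: indicator_def dist_norm norm_minus_commute)
  also have "\<dots> = (LNINT y. indicator A y * emeasure \<mu> ?B)"
   using inv[of "indicator ?B" "- y" for y] by simp
  also have "\<dots> = emeasure lborel A * emeasure lborel ?B"
   by (subst nn_integral_multc) (auto simp: fin)
  finally have "emeasure lborel ?B * emeasure \<mu> A = emeasure lborel ?B * emeasure lborel A"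
   by (simp add: mult.commute)
  moreover have "0 < emeasure lborel ?B" "emeasure lborel ?B < \<infinity>"
   by (auto simp: emeasure_lborel_ball_finite emeasure_ball)
  ultimately show ?thesis
   by (auto simp: ennreal_mult_cancel_left)
  qed
  then show ?thesis unfolding \<mu>_def[symmetric] by (intro measure_eqI) auto
qed

lemma integral_orthogonal:
  fixes f :: "'a::euclidean_space \<Rightarrow> 'b::{banach, second_countable_topology}"
  and T :: "'a \<Rightarrow> 'a"
  assumes "orthogonal_transformation T" "f \<in> borel_measurable borel"
  shows "(\<integral>x. f (T x) \<partial>lborel) = (\<integral>x. f x \<partial>lborel)"
proof -
  have "T \<in> borel_measurable borel"
  using assms(1) by (intro borel_measurable_continuous_onI linear_continuous_on)
   (simp add: linear_conv_bounded_linear[symmetric] orthogonal_transformation_linear)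
  then show ?thesis
  using integral_distr[of T lborel borel f] assms(2) unfolding lborel_orthogonal[OF assms(1)] by simp
qed

lemma nn_integral_orthogonal:
  fixes f :: "'a::euclidean_space \<Rightarrow> ennreal"
  and T :: "'a \<Rightarrow> 'a"
  assumes "orthogonal_transformation T" "f \<in> borel_measurable borel"
  shows "(LNINT x. f (T x)) = (LNINT x. f x)"
proof -
  have "T \<in> borel_measurable borel"
  using assms(1) by (intro borel_measurable_continuous_onI linear_continuous_on)
   (simp add: linear_conv_bounded_linear[symmetric] orthogonal_transformation_linear)
  then show ?thesis
  using nn_integral_distr[of T lborel borel f] assms(2) unfolding lborel_orthogonal[OF assms(1)] by simp
qed

section \<open>Polar coordinates for radial integrands and integrals of powers of the norm\<close>

definition sphere_area :: "'a::euclidean_space itself \<Rightarrow> real" where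
  "sphere_area _ = real DIM('a) * unit_ball_vol (real DIM('a))"

lemma sphere_area_pos: "0 < sphere_area TYPE('a::euclidean_space)"
  by (simp add: sphere_area_def unit_ball_vol_pos)

text \<open>The ball of radius r has measure V r^n, V being the volume of the unit ball, and the
  derivative n V r^(n-1) is the density of the norm. Half-lines generate the Borel sets and are
  stable under intersection, so agreement on them suffices, and no measure on the sphere has to be
  constructed.\<close>

lemma distr_norm_lborel:
  "distr (lborel :: 'a::euclidean_space measure) borel norm =
 density lborel (\<lambda>r. ennreal (sphere_area TYPE('a) * r ^ (DIM('a) - 1)) * indicator {0..} r)"
  (is "?M = ?N")
proof (rule measure_eqI_generator_eq[where E="range atMost" and \<Omega>=UNIV and A="\<lambda>i. {..real i}"])
  have ball: "emeasure ?M {..t} = (if t < 0 then 0 else ennreal (unit_ball_vol (real DIM('a)) * t ^ DIM('a)))" for t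
  proof -
  have "emeasure ?M {..t} = emeasure lborel (cball (0::'a) t)"
   by (subst emeasure_distr) (auto intro!: arg_cong2[where f=emeasure])
  then show ?thesis by (simp add: emeasure_cball)
  qed
  show "emeasure ?M X = emeasure ?N X" if X_range: "X \<in> range atMost" for X
  proof -
  obtain t where X: "X = {..t}" using X_range by blast
  let ?w = "unit_ball_vol (real DIM('a))"
  have eq: "emeasure ?N X = (LNINT r. ennreal (sphere_area TYPE('a) * r ^ (DIM('a) - 1)) * indicator {0..t} r)"
   unfolding X by (subst emeasure_density) (auto intro!: nn_integral_cong simp: indicator_def)
  show ?thesis
  proof (cases "t < 0")
   case True
   then show ?thesis unfolding eq using ball[of t] by (simp add: X)
  next
   case False
   have "(LNINT r. ennreal (sphere_area TYPE('a) * r ^ (DIM('a) - 1)) * indicator {0..t} r)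
    = ennreal (?w * t ^ DIM('a) - ?w * 0 ^ DIM('a))"
   proof (rule nn_integral_FTC_Icc)
    show "((\<lambda>r. ?w * r ^ DIM('a)) has_real_derivative sphere_area TYPE('a) * x ^ (DIM('a) - 1)) (at x)"
     for x
     unfolding sphere_area_def
     by (auto intro!: derivative_eq_intros)
   qed (use False in \<open>auto simp: sphere_area_def\<close>)
   then show ?thesis using False ball[of t] unfolding eq by (simp add: X)
  qed
  qed
  show "emeasure ?M {..real i} \<noteq> \<infinity>" for i
  using ball[of "real i"] by auto
  show "sets ?M = sigma_sets UNIV (range atMost)" "sets ?N = sigma_sets UNIV (range atMost)"
  by (simp_all add: borel_eq_atMost full_SetCompr_eq)
  show "(\<Union>i. {..real i}) = UNIV"
  using real_arch_simple by auto
qed (auto simp: Int_stable_def)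

lemma nn_integral_norm:
  fixes f :: "real \<Rightarrow> ennreal"
  assumes [measurable]: "f \<in> borel_measurable borel"
  shows "(LNINT x. f (norm (x::'a::euclidean_space)))
  = (LNINT r. ennreal (sphere_area TYPE('a) * r ^ (DIM('a) - 1)) * indicator {0..} r * f r)"
proof -
  have "(LNINT x. f (norm (x::'a))) = (\<integral>\<^sup>+r. f r \<partial>distr (lborel::'a measure) borel norm)"
  by (simp add: nn_integral_distr)
  then show ?thesis
  unfolding distr_norm_lborel by (simp add: nn_integral_density mult.assoc)
qed

lemma powr_times_power_pred:
  fixes r :: real
  assumes "0 < r" "0 < n"
  shows "r ^ (n - 1) * r powr (- a) = r powr (real n - 1 - a)"
  using assms by (simp add: powr_realpow[symmetric] powr_add[symmetric] of_nat_diff algebra_simps)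

lemma nn_integral_norm_powr_ball:
  assumes "a < real DIM('a::euclidean_space)" "0 < r"
  shows "(LNINT x. ennreal (norm (x::'a) powr (- a)) * indicator (ball 0 r) x)
  = ennreal (sphere_area TYPE('a) / (real DIM('a) - a) * r powr (real DIM('a) - a))"
proof -
  let ?e = "real DIM('a) - 1 - a" and ?w = "sphere_area TYPE('a)"
  have "(LNINT x. ennreal (norm (x::'a) powr (- a)) * indicator (ball 0 r) x)
  = (LNINT x. ennreal (norm (x::'a) powr (- a)) * indicator {..<r} (norm x))"
  by (intro nn_integral_cong) (auto simp: indicator_def)
  also have "\<dots> = (LNINT t. ennreal (?w * t ^ (DIM('a) - 1)) * indicator {0..} t
  * (ennreal (t powr (- a)) * indicator {..<r} t))"
  by (rule nn_integral_norm) measurable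
  also have "\<dots> = (LNINT t. ennreal (?w * t powr ?e) * indicator {0..r} t)"
  proof (rule nn_integral_cong_AE)
  show "AE t in lborel. ennreal (?w * t ^ (DIM('a) - 1)) * indicator {0..} t
   * (ennreal (t powr (- a)) * indicator {..<r} t) = ennreal (?w * t powr ?e) * indicator {0..r} t"
   using AE_lborel_singleton[of 0] AE_lborel_singleton[of r]
  proof eventually_elim
   case (elim t)
   then show ?case
    using powr_times_power_pred[of t "DIM('a)" a]
    by (auto simp: indicator_def ennreal_mult'[symmetric] sphere_area_def mult.assoc)
  qed
  qed
  also have "\<dots> = ennreal (?w * (r powr (?e + 1) / (?e + 1)))"
  using assms sphere_area_pos[where 'a='a]
  by (intro nn_integral_has_integral_lebesgue' has_integral_mult_right has_integral_powr_from_0) auto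
  finally show ?thesis by (simp add: field_simps)
qed

lemma nn_integral_norm_powr_out:
  assumes "a > real DIM('a::euclidean_space)" "0 < r"
  shows "(LNINT x. ennreal (norm (x::'a) powr (- a)) * indicator (- ball 0 r) x)
  = ennreal (sphere_area TYPE('a) / (a - real DIM('a)) * r powr (real DIM('a) - a))"
proof -
  let ?e = "real DIM('a) - 1 - a" and ?w = "sphere_area TYPE('a)"
  have "(LNINT x. ennreal (norm (x::'a) powr (- a)) * indicator (- ball 0 r) x)
  = (LNINT x. ennreal (norm (x::'a) powr (- a)) * indicator {r..} (norm x))"
  by (intro nn_integral_cong) (auto simp: indicator_def)
  also have "\<dots> = (LNINT t. ennreal (?w * t ^ (DIM('a) - 1)) * indicator {0..} t
  * (ennreal (t powr (- a)) * indicator {r..} t))"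
  by (rule nn_integral_norm) measurable
  also have "\<dots> = (LNINT t. ennreal (?w * t powr ?e) * indicator {r..} t)"
  using powr_times_power_pred[of _ "DIM('a)" a] assms
  by (intro nn_integral_cong)
   (auto simp: indicator_def ennreal_mult'[symmetric] sphere_area_def mult.assoc)
  also have "\<dots> = ennreal (?w * (- (r powr (?e + 1)) / (?e + 1)))"
  using assms sphere_area_pos[where 'a='a]
  by (intro nn_integral_has_integral_lebesgue' has_integral_mult_right has_integral_powr_to_inf) auto
  also have "?w * (- (r powr (?e + 1)) / (?e + 1)) = ?w / (a - real DIM('a)) * r powr (real DIM('a) - a)"
  using assms by (simp add: field_simps)
  finally show ?thesis .
qed

text \<open>The source of every logarithmic divergence below: since r^(n-1) r^(-n) = 1/r, the power
  |x|^(-n) has integral \<open>sphere_area\<close> times ln (q / p) over the shell p \<le> |x| \<le>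
  q. Dominating this power on the shell is enough.\<close>

lemma nn_integral_norm_ge_inverse:
  fixes f :: "real \<Rightarrow> ennreal"
  assumes [measurable]: "f \<in> borel_measurable borel" and "0 < p" "p \<le> q"
  and le: "\<And>t. p \<le> t \<Longrightarrow> t \<le> q \<Longrightarrow> ennreal (t powr (- real DIM('a::euclidean_space))) \<le> f t"
  shows "ennreal (sphere_area TYPE('a) * ln (q / p)) \<le> (LNINT x. f (norm (x::'a)))"
proof -
  let ?w = "sphere_area TYPE('a)"
  have w: "0 < ?w" by (rule sphere_area_pos)
  have "ennreal (?w * ln (q / p)) = ennreal (?w * ln q - ?w * ln p)"
  using assms by (simp add: ln_div algebra_simps)
  also have "\<dots> = (LNINT t. ennreal (?w / t) * indicator {p..q} t)"
  proof (rule nn_integral_FTC_Icc[symmetric])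
  show "((\<lambda>t. ?w * ln t) has_real_derivative ?w / x) (at x)" if "x \<in> {p..q}" for x
   using that assms by (auto intro!: derivative_eq_intros)
  show "0 \<le> ?w / x" if "x \<in> {p..q}" for x
   using that assms w by auto
  qed (use assms in auto)
  also have "\<dots> \<le> (LNINT t. ennreal (?w * t ^ (DIM('a) - 1)) * indicator {0..} t * f t)"
  proof (rule nn_integral_mono)
  fix t
  show "ennreal (?w / t) * indicator {p..q} t \<le> ennreal (?w * t ^ (DIM('a) - 1)) * indicator {0..} t * f t"
  proof (cases "t \<in> {p..q}")
   case True
   then have t: "0 < t" "p \<le> t" "t \<le> q" using assms by auto
   have "?w / t = ?w * t ^ (DIM('a) - 1) * t powr (- real DIM('a))"
    using t powr_times_power_pred[of t "DIM('a)" "real DIM('a)"]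
    by (simp add: mult.assoc powr_minus_divide field_simps)
   then have "ennreal (?w / t) = ennreal (?w * t ^ (DIM('a) - 1)) * ennreal (t powr (- real DIM('a)))"
    using t w by (simp add: ennreal_mult)
   also have "\<dots> \<le> ennreal (?w * t ^ (DIM('a) - 1)) * f t"
    using le[OF t(2,3)] by (intro mult_left_mono) auto
   finally show ?thesis using True t by (simp add: indicator_def)
  qed auto
  qed
  also have "\<dots> = (LNINT x. f (norm (x::'a)))"
  by (rule nn_integral_norm[symmetric]) measurable
  finally show ?thesis .
qed

lemma ennreal_unbounded_eq_top:
  assumes "\<And>B::real. ennreal B \<le> x" shows "x = (\<infinity>::ennreal)"
proof (rule ccontr)
  assume "x \<noteq> \<infinity>"
  then obtain r where "x = ennreal r" "0 \<le> r" by (cases x) auto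
  with assms[of "r + 1"] show False by (simp add: ennreal_le_iff)
qed

lemma nn_integral_norm_powr_out_top:
  assumes "a \<le> real DIM('a::euclidean_space)"
  shows "(LNINT x. ennreal (norm (x::'a) powr (- a)) * indicator (- ball 0 r) x) = \<infinity>"
proof (rule ennreal_unbounded_eq_top)
  fix B :: real
  let ?w = "sphere_area TYPE('a)" and ?p = "max r 1"
  \<comment> \<open>With this outer radius the shell starting at \<open>?p\<close> contributes
    exactly |B|.\<close>
  define q where "q = ?p * exp (\<bar>B\<bar> / ?w)"
  have w: "0 < ?w" by (rule sphere_area_pos)
  have q: "?p \<le> q"
  using mult_left_mono[of 1 "exp (\<bar>B\<bar> / ?w)" ?p] w by (auto simp: q_def)
  have "ennreal B \<le> ennreal (?w * ln (q / ?p))"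
  using w by (intro ennreal_leI) (auto simp: q_def)
  also have "\<dots> \<le> (LNINT x. (\<lambda>t. ennreal (t powr (- a)) * indicator {r..} t) (norm (x::'a)))"
  proof (rule nn_integral_norm_ge_inverse)
  fix t assume "?p \<le> t" "t \<le> q"
  then show "ennreal (t powr (- real DIM('a))) \<le> ennreal (t powr (- a)) * indicator {r..} t"
   using assms by (auto intro!: ennreal_leI powr_mono simp: indicator_def)
  qed (use q in auto)
  also have "\<dots> = (LNINT x. ennreal (norm (x::'a) powr (- a)) * indicator (- ball 0 r) x)"
  by (intro nn_integral_cong) (auto simp: indicator_def)
  finally show "ennreal B \<le> \<dots>" .
qed

section \<open>Correlations of truncated kernels\<close>

text \<open>The kernel |h|^(-\<beta>) h with its singular factor frozen inside the ball of radius t;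
  t = 0 gives K itself. Unlike a sharp cut-off this truncation is continuous and, for positive t,
  Lipschitz at scale t everywhere, and it agrees with K outside the ball.\<close>

definition kern :: "real \<Rightarrow> real \<Rightarrow> 'a::euclidean_space \<Rightarrow> 'a" where
  "kern \<beta> t h = max (norm h) t powr (- \<beta>) *\<^sub>R h"

lemma kern_measurable [measurable]: "kern \<beta> t \<in> borel_measurable borel"
  unfolding kern_def[abs_def] by measurable

lemma kern_minus [simp]: "kern \<beta> t (- h) = - kern \<beta> t h"
  by (simp add: kern_def)

lemma kern_zero [simp]: "kern \<beta> t 0 = 0"
  by (simp add: kern_def)

lemma kern_eq: "t \<le> norm h \<Longrightarrow> kern \<beta> t h = norm h powr (- \<beta>) *\<^sub>R h"
  by (simp add: kern_def max_absorb1)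

lemma norm_times_powr: "0 \<le> (x::real) \<Longrightarrow> x * x powr a = x powr (1 + a)"
  by (cases "x = 0") (auto simp: powr_add)

lemma norm_kern_le:
  assumes "0 \<le> \<beta>"
  shows "norm (kern \<beta> t h) \<le> norm h powr (1 - \<beta>)"
proof (cases "h = 0")
  case False
  then have "max (norm h) t powr (- \<beta>) \<le> norm h powr (- \<beta>)"
  using assms by (intro powr_mono2') auto
  then have "norm (kern \<beta> t h) \<le> norm h * norm h powr (- \<beta>)"
  by (simp add: kern_def mult.commute mult_left_mono)
  then show ?thesis by (simp add: norm_times_powr)
qed auto

lemma norm_kern_le_trunc:
  assumes "1 \<le> \<beta>" "0 < t"
  shows "norm (kern \<beta> t h) \<le> t powr (1 - \<beta>)"
proof -
  have "norm (kern \<beta> t h) \<le> max (norm h) t * max (norm h) t powr (- \<beta>)"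
  by (simp add: kern_def mult.commute mult_right_mono)
  also have "\<dots> = max (norm h) t powr (1 - \<beta>)"
  using assms by (subst norm_times_powr) auto
  also have "\<dots> \<le> t powr (1 - \<beta>)"
  using assms by (intro powr_mono2') auto
  finally show ?thesis .
qed

lemma powr_minus_diff_le:
  fixes x y \<beta> :: real
  assumes "0 < x" "x \<le> y" "0 \<le> \<beta>"
  shows "x powr (- \<beta>) - y powr (- \<beta>) \<le> \<beta> * x powr (- \<beta> - 1) * (y - x)"
proof (cases "x = y")
  case False
  then have "x < y" using assms by simp
  moreover have "((\<lambda>u. u powr (- \<beta>)) has_real_derivative (- \<beta>) * u powr (- \<beta> - 1)) (at u)" if "x \<le> u" for u
  using that assms by (auto intro!: derivative_eq_intros)
  ultimately obtain c where c: "x < c" "c < y"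
  "y powr (- \<beta>) - x powr (- \<beta>) = (y - x) * ((- \<beta>) * c powr (- \<beta> - 1))"
  using MVT2[of x y "\<lambda>u. u powr (- \<beta>)" "\<lambda>u. (- \<beta>) * u powr (- \<beta> - 1)"] by auto
  have "c powr (- \<beta> - 1) \<le> x powr (- \<beta> - 1)"
  using c assms by (intro powr_mono2') auto
  then have "(y - x) * (\<beta> * c powr (- \<beta> - 1)) \<le> (y - x) * (\<beta> * x powr (- \<beta> - 1))"
  using assms by (intro mult_left_mono) auto
  then show ?thesis using c(3) by (simp add: algebra_simps)
qed auto

text \<open>The derivative has size radius^(-\<beta>), and m bounds both truncated radii from below.
  The difference is split into a change of the radial factor and a change of the vector; integrating
  the derivative along the segment from u to v could lead through the singularity. For positive t
  the choice m = t is admissible for all pairs of points.\<close>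

lemma kern_lipschitz:
  assumes "0 \<le> \<beta>" "0 < m" "m \<le> max (norm u) t" "m \<le> max (norm v) t"
  shows "norm (kern \<beta> t u - kern \<beta> t v) \<le> (1 + \<beta>) * m powr (- \<beta>) * norm (u - v)"
proof -
  have main: "norm (kern \<beta> t u - kern \<beta> t v) \<le> (1 + \<beta>) * m powr (- \<beta>) * norm (u - v)"
  if le: "norm u \<le> norm v" and m: "m \<le> max (norm u) t" for u v :: 'a
  proof -
  define x y where "x = max (norm u) t" and "y = max (norm v) t"
  have x: "0 < x" "x \<le> y" "m \<le> x" using le m assms by (auto simp: x_def y_def)
  have "y - x \<le> norm v - norm u"
   using le by (auto simp: x_def y_def)
  also have "\<dots> \<le> norm (u - v)"
   using norm_triangle_ineq2[of v u] by (simp add: norm_minus_commute)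
  finally have yx: "y - x \<le> norm (u - v)" .
  have eq: "kern \<beta> t u - kern \<beta> t v = (x powr (- \<beta>) - y powr (- \<beta>)) *\<^sub>R u + y powr (- \<beta>) *\<^sub>R (u - v)"
   by (simp add: kern_def x_def y_def algebra_simps)
  have "x powr (- \<beta>) - y powr (- \<beta>) \<ge> 0"
   using x assms powr_mono2'[of "- \<beta>" x y] by auto
  then have "norm (kern \<beta> t u - kern \<beta> t v) \<le>
    (x powr (- \<beta>) - y powr (- \<beta>)) * norm u + y powr (- \<beta>) * norm (u - v)"
   unfolding eq by (intro norm_triangle_le) simp
  also have "(x powr (- \<beta>) - y powr (- \<beta>)) * norm u \<le> (\<beta> * x powr (- \<beta> - 1) * (y - x)) * x"
   using x assms powr_minus_diff_le[of x y \<beta>]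
   by (intro mult_mono) (auto simp: x_def)
  also have "\<dots> = \<beta> * x powr (- \<beta>) * (y - x)"
   using norm_times_powr[of x "- \<beta> - 1"] x by (simp add: mult_ac)
  also have "\<dots> \<le> \<beta> * x powr (- \<beta>) * norm (u - v)"
   using yx assms by (intro mult_left_mono) auto
  also have "\<beta> * x powr (- \<beta>) * norm (u - v) + y powr (- \<beta>) * norm (u - v)
    = (\<beta> * x powr (- \<beta>) + y powr (- \<beta>)) * norm (u - v)"
   by (simp add: algebra_simps)
  also have "\<dots> \<le> (\<beta> * m powr (- \<beta>) + m powr (- \<beta>)) * norm (u - v)"
   using x assms by (intro mult_right_mono add_mono mult_left_mono powr_mono2') auto
  finally show ?thesis by (simp add: algebra_simps)
  qed
  show ?thesis
  using main[of u v] main[of v u] assms by (cases "norm u \<le> norm v") (auto simp: norm_minus_commute)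
qed

text \<open>What the estimates of a correlation at z use of a kernel: oddness, the size of K, and a
  Lipschitz bound on the ball of radius |z|/2 about z. The constants are those of K, so bounds
  derived from \<open>tame\<close> are uniform in the truncation. Sharp cut-offs qualify as well, as
  long as they do not jump inside that ball.\<close>

definition tame :: "real \<Rightarrow> 'a::euclidean_space \<Rightarrow> ('a \<Rightarrow> 'a) \<Rightarrow> bool" where
  "tame \<beta> z k \<longleftrightarrow> k \<in> borel_measurable borel \<and> (\<forall>w. k (- w) = - k w) \<and>
  (\<forall>w. norm (k w) \<le> norm w powr (1 - \<beta>)) \<and>
  (\<forall>w. norm w < norm z / 2 \<longrightarrow> norm (k (z + w) - k z) \<le> (1 + \<beta>) * (norm z / 2) powr (- \<beta>) * norm w)"

lemma tame_kern:
  fixes z :: "'a::euclidean_space"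
  assumes "0 \<le> \<beta>"
  shows "tame \<beta> z (kern \<beta> t)"
  unfolding tame_def
proof (intro conjI allI impI)
  fix w :: 'a assume w: "norm w < norm z / 2"
  then have "norm z / 2 \<le> norm (z + w)" "0 < norm z / 2"
  using norm_diff_ineq[of z w] norm_ge_zero[of w] by linarith+
  then show "norm (kern \<beta> t (z + w) - kern \<beta> t z) \<le> (1 + \<beta>) * (norm z / 2) powr (- \<beta>) * norm w"
  using kern_lipschitz[of \<beta> "norm z / 2" "z + w" t z] assms by (simp add: le_max_iff_disj)
qed (auto intro: norm_kern_le assms)

section \<open>Regularised correlations and their common majorant\<close>

definition corr :: "('a::euclidean_space \<Rightarrow> 'a) \<Rightarrow> ('a \<Rightarrow> 'a) \<Rightarrow> 'a \<Rightarrow> real" where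
  "corr k k' z = (LBINT w. k w \<bullet> k' (w + z))"

text \<open>The integrand of the correlation at \<open>z \<noteq> 0\<close> after subtracting two terms that integrate to
  zero because the kernels are odd; this one is absolutely integrable even for the untruncated kernel.\<close>

definition corr_reg :: "('a::euclidean_space \<Rightarrow> 'a) \<Rightarrow> ('a \<Rightarrow> 'a) \<Rightarrow> 'a \<Rightarrow> 'a \<Rightarrow> real" where
  "corr_reg k k' z w = k w \<bullet> k' (w + z) - indicator (ball 0 (norm z / 2)) w * (k w \<bullet> k' z)
  + indicator (ball 0 (norm z / 2)) (w + z) * (k z \<bullet> k' (w + z))"

text \<open>A majorant of \<open>corr_reg\<close> for all tame kernels at once. Near each of the
  singularities 0 and -z the subtraction together with the Lipschitz bound gains one power of the
  distance, so |w|^(1-\<beta>) improves to |w|^(2-\<beta>). Elsewhere the product of the two sizes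
  is split by a b \<le> a^2 + b^2, which separates the points w and w + z.\<close>

definition corr_bound :: "real \<Rightarrow> 'a::euclidean_space \<Rightarrow> 'a \<Rightarrow> real" where
  "corr_bound \<beta> z w =
  (if norm w < norm z / 2 then (1 + \<beta>) * (norm z / 2) powr (- \<beta>) * norm w powr (2 - \<beta>)
   else if norm (w + z) < norm z / 2 then (1 + \<beta>) * (norm z / 2) powr (- \<beta>) * norm (w + z) powr (2 - \<beta>)
   else norm w powr (2 - 2 * \<beta>) + norm (w + z) powr (2 - 2 * \<beta>))"

lemma corr_bound_measurable [measurable]: "corr_bound \<beta> z \<in> borel_measurable borel"
  unfolding corr_bound_def[abs_def] by measurable

lemma corr_bound_nonneg: "0 \<le> \<beta> \<Longrightarrow> 0 \<le> corr_bound \<beta> z w"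
  by (auto simp: corr_bound_def)

lemma corr_reg_measurable [measurable (raw)]:
  assumes [measurable]: "k \<in> borel_measurable borel" "k' \<in> borel_measurable borel"
  shows "corr_reg k k' z \<in> borel_measurable borel"
proof -
  have [measurable]: "ball 0 (norm z / 2) \<in> sets borel" by simp
  show ?thesis unfolding corr_reg_def[abs_def] by measurable
qed

lemma norm_add_gt_half:
  fixes w z :: "'a::real_normed_vector"
  assumes "norm w < norm z / 2"
  shows "norm z / 2 < norm (w + z)"
  using norm_diff_ineq[of z w] assms by (simp add: add.commute)

lemma corr_reg_le:
  assumes k: "tame \<beta> z k" and k': "tame \<beta> z k'" and "0 \<le> \<beta>"
  shows "\<bar>corr_reg k k' z w\<bar> \<le> corr_bound \<beta> z w"
proof -
  let ?L = "(1 + \<beta>) * (norm z / 2) powr (- \<beta>)"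
  have le: "\<bar>(k1::'a) \<bullet> k2\<bar> \<le> a * b" if "norm k1 \<le> a" "norm k2 \<le> b" for k1 k2 a b
  using Cauchy_Schwarz_ineq2[of k1 k2] mult_mono[OF that] norm_ge_zero[of k1] that
  by (meson norm_ge_zero order_trans)
  have pw: "x powr (1 - \<beta>) * (?L * x) = ?L * x powr (2 - \<beta>)" if "0 \<le> x" for x
  using that norm_times_powr[of x "1 - \<beta>"] by (simp add: mult_ac)
  consider (a) "norm w < norm z / 2" | (b) "\<not> norm w < norm z / 2" "norm (w + z) < norm z / 2"
  | (c) "\<not> norm w < norm z / 2" "\<not> norm (w + z) < norm z / 2" by blast
  then show ?thesis
  proof cases
  case a
  then have "corr_reg k k' z w = k w \<bullet> (k' (z + w) - k' z)"
   using norm_add_gt_half[OF a] by (simp add: corr_reg_def algebra_simps)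
  moreover have "\<bar>k w \<bullet> (k' (z + w) - k' z)\<bar> \<le> norm w powr (1 - \<beta>) * (?L * norm w)"
   using k k' a by (intro le) (auto simp: tame_def)
  ultimately show ?thesis using a by (simp add: corr_bound_def pw)
  next
  case b
  \<comment> \<open>Near -z oddness gives k w = - k (z - (w + z)), so the correction term again
    completes a difference, this time of k between z - (w + z) and z.\<close>
  have kd: "norm (- (w + z)) < norm z / 2" using b by (metis norm_minus_cancel)
  have "z + - (w + z) = - w" by simp
  then have "k w = - k (z + - (w + z))" using k unfolding tame_def by simp
  then have "corr_reg k k' z w = - ((k (z + - (w + z)) - k z) \<bullet> k' (w + z))"
   using b by (simp add: corr_reg_def inner_diff_left)
  moreover have "\<bar>(k (z + - (w + z)) - k z) \<bullet> k' (w + z)\<bar> \<le> (?L * norm (- (w + z))) * norm (w + z) powr (1 - \<beta>)"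
  proof (rule le)
   show "norm (k (z + - (w + z)) - k z) \<le> ?L * norm (- (w + z))"
    using k kd unfolding tame_def by blast
   show "norm (k' (w + z)) \<le> norm (w + z) powr (1 - \<beta>)"
    using k' unfolding tame_def by blast
  qed
  moreover have "(?L * norm (- (w + z))) * norm (w + z) powr (1 - \<beta>) = ?L * norm (w + z) powr (2 - \<beta>)"
   using pw[of "norm (w + z)"] unfolding norm_minus_cancel by (simp add: mult.commute)
  ultimately have "\<bar>corr_reg k k' z w\<bar> \<le> ?L * norm (w + z) powr (2 - \<beta>)"
   by (simp only: abs_minus_cancel)
  then show ?thesis using b by (simp only: corr_bound_def if_False if_True)
  next
  case c
  have "\<bar>k w \<bullet> k' (w + z)\<bar> \<le> norm w powr (1 - \<beta>) * norm (w + z) powr (1 - \<beta>)"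
   using k k' by (intro le) (auto simp: tame_def)
  also have "\<dots> \<le> (norm w powr (1 - \<beta>))\<^sup>2 + (norm (w + z) powr (1 - \<beta>))\<^sup>2"
  proof -
   have "0 \<le> norm w powr (1 - \<beta>) * norm (w + z) powr (1 - \<beta>)" by simp
   then show ?thesis
    using sum_squares_bound[of "norm w powr (1 - \<beta>)" "norm (w + z) powr (1 - \<beta>)"]
    unfolding mult.assoc by linarith
  qed
  also have "\<dots> = norm w powr (2 - 2 * \<beta>) + norm (w + z) powr (2 - 2 * \<beta>)"
   by (simp add: power2_eq_square powr_add[symmetric] algebra_simps)
  finally show ?thesis using c by (simp add: corr_reg_def corr_bound_def)
  qed
qed

text \<open>The regularised singularity |w|^(2-\<beta>) is integrable exactly because \<beta> < n +
  2. The radius r is kept free since the mass on small balls measures the error of a truncation or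
  cut-off at scale r.\<close>

lemma nn_integral_corr_bound_near:
  fixes z :: "'a::euclidean_space"
  assumes "0 \<le> \<beta>" "\<beta> < real DIM('a) + 2" "0 < r" "r \<le> norm z / 2"
  shows "(LNINT w. ennreal (corr_bound \<beta> z w) * indicator (ball 0 r \<union> ball (- z) r) w)
  \<le> ennreal (2 * (1 + \<beta>) * sphere_area TYPE('a) / (real DIM('a) + 2 - \<beta>) * (norm z / 2) powr (- \<beta>) * r powr (real DIM('a) + 2 - \<beta>))"
proof -
  let ?L = "(1 + \<beta>) * (norm z / 2) powr (- \<beta>)" and ?I = "sphere_area TYPE('a) / (real DIM('a) + 2 - \<beta>) * r powr (real DIM('a) + 2 - \<beta>)"
  let ?f = "\<lambda>w::'a. ennreal (norm w powr (- (\<beta> - 2))) * indicator (ball 0 r) w"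
  have [measurable]: "ball (0::'a) r \<in> sets borel" by simp
  have I: "(LNINT w. ?f w) = ennreal ?I"
  using assms by (subst nn_integral_norm_powr_ball) (auto simp: algebra_simps)
  have "(LNINT w. ennreal (corr_bound \<beta> z w) * indicator (ball 0 r \<union> ball (- z) r) w)
   \<le> (LNINT w. ennreal ?L * (?f w + ?f (w + z)))"
  proof (rule nn_integral_mono)
  fix w
  have *: "dist (- z) w = norm (w + z)"
   by (metis diff_minus_eq_add dist_norm dist_commute)
  consider (a) "norm w < r" | (b) "\<not> norm w < r" "norm (w + z) < r"
   | (c) "\<not> norm w < r" "\<not> norm (w + z) < r" by blast
  then show "ennreal (corr_bound \<beta> z w) * indicator (ball 0 r \<union> ball (- z) r) w \<le> ennreal ?L * (?f w + ?f (w + z))"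
  proof cases
   case a
   then have "ennreal (corr_bound \<beta> z w) = ennreal ?L * ?f w"
    using assms by (simp add: corr_bound_def ennreal_mult'[symmetric])
   also have "\<dots> \<le> ennreal ?L * (?f w + ?f (w + z))"
    by (intro mult_left_mono) auto
   finally show ?thesis using a by simp
  next
   case b
   then have "\<not> norm w < norm z / 2" using norm_add_gt_half[of w z] assms by auto
   then have "ennreal (corr_bound \<beta> z w) = ennreal ?L * ?f (w + z)"
    using assms b by (simp add: corr_bound_def ennreal_mult'[symmetric])
   also have "\<dots> \<le> ennreal ?L * (?f w + ?f (w + z))"
    by (intro mult_left_mono) auto
   finally show ?thesis using b by (simp add: *)
  qed (simp add: *)
  qed
  also have "\<dots> = ennreal ?L * ((LNINT w. ?f w) + (LNINT w. ?f w))"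
  using nn_integral_shift[of ?f z] by (simp add: nn_integral_cmult nn_integral_add)
  also have "\<dots> = ennreal ?L * (ennreal ?I + ennreal ?I)"
  unfolding I ..
  also have "\<dots> = ennreal (?L * (?I + ?I))"
  proof -
  have "0 \<le> ?L" "0 \<le> ?I" using assms sphere_area_pos[where 'a='a] by auto
  then show ?thesis by (simp only: ennreal_plus[symmetric] ennreal_mult'[symmetric])
  qed
  finally show ?thesis by (simp add: algebra_simps)
qed

text \<open>\<beta> > n/2 + 1 makes |w|^(2-2\<beta>) integrable away from the singularities. By
  homogeneity the near and the far part both scale like |z|^(n+2-2\<beta>), which is the degree of
  the limit \<open>kappa\<close>.\<close>

lemma nn_integral_corr_bound:
  fixes z :: "'a::euclidean_space"
  assumes "real DIM('a) / 2 + 1 < \<beta>" "\<beta> < real DIM('a) + 2"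
  obtains C where "0 < C"
  "\<And>z::'a. z \<noteq> 0 \<Longrightarrow> (LNINT w. ennreal (corr_bound \<beta> z w)) \<le> ennreal (C * norm z powr (real DIM('a) + 2 - 2 * \<beta>))"
proof
  let ?n = "real DIM('a)"
  let ?A = "2 * (1 + \<beta>) * sphere_area TYPE('a) / (?n + 2 - \<beta>)" and ?b = "sphere_area TYPE('a) / (2 * \<beta> - 2 - ?n)"
  let ?B = "2 * ?b"
  let ?p = "?n + 2 - 2 * \<beta>"
  define C where "C = (?A + ?B) * (1 / 2) powr ?p"
  have \<beta>: "0 < \<beta>" using assms by (smt (verit) divide_nonneg_nonneg of_nat_0_le_iff)
  have A: "0 < ?A" and B: "0 < ?b"
  using assms \<beta> sphere_area_pos[where 'a='a] by (auto intro!: divide_pos_pos mult_pos_pos)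
  then show "0 < C" by (simp add: C_def add_pos_pos)
  fix z :: 'a assume z: "z \<noteq> 0"
  let ?r = "norm z / 2"
  let ?f = "\<lambda>w::'a. ennreal (norm w powr (- (2 * \<beta> - 2))) * indicator (- ball 0 ?r) w"
  have [measurable]: "ball (0::'a) ?r \<in> sets borel" "ball (- z) ?r \<in> sets borel" by auto
  have I: "(LNINT w. ?f w) = ennreal (?b * ?r powr ?p)"
  proof -
  have *: "2 * \<beta> - 2 > ?n" "?r > 0" "?n - (2 * \<beta> - 2) = ?p" using assms z by auto
  show ?thesis using nn_integral_norm_powr_out[OF *(1,2)] unfolding *(3) by simp
  qed
  have "(LNINT w. ennreal (corr_bound \<beta> z w))
  \<le> (LNINT w. ennreal (corr_bound \<beta> z w) * indicator (ball 0 ?r \<union> ball (- z) ?r) w + (?f w + ?f (w + z)))"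
  proof (rule nn_integral_mono)
  fix w
  have *: "dist (- z) w = norm (w + z)"
   by (metis diff_minus_eq_add dist_norm dist_commute)
  show "ennreal (corr_bound \<beta> z w) \<le> ennreal (corr_bound \<beta> z w) * indicator (ball 0 ?r \<union> ball (- z) ?r) w + (?f w + ?f (w + z))"
   by (cases "w \<in> ball 0 ?r \<union> ball (- z) ?r")
    (auto simp: * corr_bound_def ennreal_plus[symmetric] simp del: ennreal_plus intro!: ennreal_leI)
  qed
  also have "\<dots> = (LNINT w. ennreal (corr_bound \<beta> z w) * indicator (ball 0 ?r \<union> ball (- z) ?r) w)
   + ((LNINT w. ?f w) + (LNINT w. ?f w))"
  using nn_integral_shift[of ?f z] by (simp add: nn_integral_add)
  also have "\<dots> = (LNINT w. ennreal (corr_bound \<beta> z w) * indicator (ball 0 ?r \<union> ball (- z) ?r) w)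
   + (ennreal (?b * ?r powr ?p) + ennreal (?b * ?r powr ?p))"
  unfolding I ..
  also have "\<dots> \<le> ennreal (?A * ?r powr (- \<beta>) * ?r powr (?n + 2 - \<beta>)) + (ennreal (?b * ?r powr ?p) + ennreal (?b * ?r powr ?p))"
  using nn_integral_corr_bound_near[of \<beta> ?r z] \<beta> assms z by (intro add_right_mono) auto
  also have "\<dots> = ennreal (?A * ?r powr (- \<beta>) * ?r powr (?n + 2 - \<beta>) + (?b * ?r powr ?p + ?b * ?r powr ?p))"
  proof -
  have "0 \<le> ?A * ?r powr (- \<beta>) * ?r powr (?n + 2 - \<beta>)" "0 \<le> ?b * ?r powr ?p"
   using A B by (intro mult_nonneg_nonneg; simp)+
  then show ?thesis by (simp only: ennreal_plus[symmetric] add_nonneg_nonneg)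
  qed
  also have "?A * ?r powr (- \<beta>) * ?r powr (?n + 2 - \<beta>) + (?b * ?r powr ?p + ?b * ?r powr ?p) = (?A + ?B) * ?r powr ?p"
  proof -
  have "?r powr (- \<beta>) * ?r powr (?n + 2 - \<beta>) = ?r powr ?p"
   by (simp add: powr_add[symmetric])
  then show ?thesis by (simp only: mult.assoc distrib_right mult_2)
  qed
  also have "\<dots> = C * norm z powr ?p"
  using powr_mult[of "1 / 2" "norm z" ?p] by (simp only: C_def mult.assoc) simp
  finally show "(LNINT w. ennreal (corr_bound \<beta> z w)) \<le> ennreal (C * norm z powr ?p)" .
qed

lemma integrable_bounded_ball:
  fixes f :: "'a::euclidean_space \<Rightarrow> 'b::{banach, second_countable_topology}"
  assumes [measurable]: "f \<in> borel_measurable borel" and b: "\<And>w. norm (f w) \<le> b"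
  and supp: "\<And>w. f w \<noteq> 0 \<Longrightarrow> norm w < r"
  shows "integrable lborel f"
proof (rule Bochner_Integration.integrable_bound)
  show "integrable lborel (\<lambda>w::'a. b * indicator (ball 0 r) w)"
  by (intro integrable_mult_right integrable_real_indicator) (auto simp: emeasure_lborel_ball_finite[unfolded infinity_ennreal_def])
  show "AE w in lborel. norm (f w) \<le> norm (b * indicator (ball 0 r) w)"
  proof (rule AE_I2)
  fix w show "norm (f w) \<le> norm (b * indicator (ball 0 r) w)"
   using b[of w] supp[of w] by (cases "f w = 0") (auto intro: order_trans)
  qed
qed simp

lemma square_integrable_decay:
  fixes k :: "'a::euclidean_space \<Rightarrow> 'a"
  assumes [measurable]: "k \<in> borel_measurable borel" and b: "\<And>w. norm (k w) \<le> b"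
  and d: "\<And>w. norm (k w) \<le> norm w powr (1 - \<beta>)" and \<beta>: "real DIM('a) / 2 + 1 < \<beta>"
  shows "integrable lborel (\<lambda>w. (norm (k w))\<^sup>2)"
proof -
  let ?g = "\<lambda>w::'a. norm w powr (- (2 * \<beta> - 2)) * indicator (- ball 0 1) w"
  have [measurable]: "ball (0::'a) 1 \<in> sets borel" by simp
  have g: "integrable lborel ?g"
  proof (rule integrableI_bounded)
  have "(LNINT w. ennreal (norm (?g w))) = (LNINT w. ennreal (norm (w::'a) powr (- (2 * \<beta> - 2))) * indicator (- ball 0 1) w)"
   by (intro nn_integral_cong) (auto simp: indicator_def)
  also have "\<dots> < \<infinity>"
   using \<beta> by (subst nn_integral_norm_powr_out) auto
  finally show "(LNINT w. ennreal (norm (?g w))) < \<infinity>" .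
  qed simp
  have "integrable lborel (\<lambda>w::'a. b\<^sup>2 * indicator (ball 0 1) w)"
  by (intro integrable_mult_right integrable_real_indicator) (auto simp: emeasure_lborel_ball_finite[unfolded infinity_ennreal_def])
  with g have "integrable lborel (\<lambda>w::'a. b\<^sup>2 * indicator (ball 0 1) w + ?g w)"
  by simp
  then show ?thesis
  proof (rule Bochner_Integration.integrable_bound)
  show "AE w in lborel. norm ((norm (k w))\<^sup>2) \<le> norm (b\<^sup>2 * indicator (ball 0 1) w + ?g w)"
  proof (rule AE_I2)
   fix w :: 'a
   have "(norm (k w))\<^sup>2 \<le> b\<^sup>2" using b[of w] by (intro power_mono) auto
   moreover have "(norm (k w))\<^sup>2 \<le> (norm w powr (1 - \<beta>))\<^sup>2" using d[of w] by (intro power_mono) auto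
   moreover have "(norm w powr (1 - \<beta>))\<^sup>2 = norm w powr (- (2 * \<beta> - 2))"
    by (simp add: power2_eq_square powr_add[symmetric] algebra_simps)
   ultimately show "norm ((norm (k w))\<^sup>2) \<le> norm (b\<^sup>2 * indicator (ball 0 1) w + ?g w)"
    by (cases "norm w < 1") auto
  qed
  qed simp
qed

lemma inner_le_sum_squares: "\<bar>(a::'a::real_inner) \<bullet> b\<bar> \<le> (norm a)\<^sup>2 + (norm b)\<^sup>2"
proof -
  have "2 * (norm a * norm b) \<le> (norm a)\<^sup>2 + (norm b)\<^sup>2"
  using sum_squares_bound[of "norm a" "norm b"] by simp
  with Cauchy_Schwarz_ineq2[of a b] mult_nonneg_nonneg[of "norm a" "norm b"] show ?thesis
  by (smt (verit) norm_ge_zero)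
qed

lemma integrable_inner_L2:
  fixes f g :: "'b \<Rightarrow> 'a::euclidean_space"
  assumes [measurable]: "f \<in> borel_measurable M" "g \<in> borel_measurable M"
  and "integrable M (\<lambda>x. (norm (f x))\<^sup>2)" "integrable M (\<lambda>x. (norm (g x))\<^sup>2)"
  shows "integrable M (\<lambda>x. f x \<bullet> g x)"
proof (rule Bochner_Integration.integrable_bound)
  show "integrable M (\<lambda>x. (norm (f x))\<^sup>2 + (norm (g x))\<^sup>2)" using assms by simp
  show "AE x in M. norm (f x \<bullet> g x) \<le> norm ((norm (f x))\<^sup>2 + (norm (g x))\<^sup>2)"
  using inner_le_sum_squares by (intro AE_I2) auto
qed simp

lemma integrable_corr:
  fixes k k' :: "'a::euclidean_space \<Rightarrow> 'a"
  assumes "k \<in> borel_measurable borel" "k' \<in> borel_measurable borel"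
  and "integrable lborel (\<lambda>w. (norm (k w))\<^sup>2)" "integrable lborel (\<lambda>w. (norm (k' w))\<^sup>2)"
  shows "integrable lborel (\<lambda>w. k w \<bullet> k' (w + z))"
  using assms integrable_shift[OF assms(4), of z] by (intro integrable_inner_L2) auto

text \<open>Boundedness of the kernels makes each correction term integrable on its own, so that
  they can be split off and evaluated; for K itself this separation would break down.\<close>

lemma corr_eq_reg:
  assumes k: "tame \<beta> z k" "\<And>w. norm (k w) \<le> b" and k': "tame \<beta> z k'" "\<And>w. norm (k' w) \<le> b'"
  and i: "integrable lborel (\<lambda>w. k w \<bullet> k' (w + z))"
  shows "integrable lborel (corr_reg k k' z)" "corr k k' z = (LBINT w. corr_reg k k' z w)"
proof -
  let ?B = "indicator (ball 0 (norm z / 2)) :: 'a \<Rightarrow> real"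
  have [measurable]: "k \<in> borel_measurable borel" "k' \<in> borel_measurable borel"
  using k k' by (auto simp: tame_def)
  have [measurable]: "ball (0::'a) (norm z / 2) \<in> sets borel" by simp
  have i1: "integrable lborel (\<lambda>w. ?B w *\<^sub>R k w)"
  using k(2) order_trans[OF norm_ge_zero k(2)]
  by (intro integrable_bounded_ball[where b=b and r="norm z / 2"]) (auto simp: indicator_def split: if_splits)
  have i2: "integrable lborel (\<lambda>w. ?B w *\<^sub>R k' w)"
  using k'(2) order_trans[OF norm_ge_zero k'(2)]
  by (intro integrable_bounded_ball[where b=b' and r="norm z / 2"]) (auto simp: indicator_def split: if_splits)
  have z1: "(LBINT w. ?B w *\<^sub>R k w) = 0" and z2: "(LBINT w. ?B w *\<^sub>R k' w) = 0"
  using k(1) k'(1) by (auto intro!: integral_odd simp: tame_def indicator_def)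
  have eq: "corr_reg k k' z = (\<lambda>w. k w \<bullet> k' (w + z) - (?B w *\<^sub>R k w) \<bullet> k' z + k z \<bullet> (?B (w + z) *\<^sub>R k' (w + z)))"
  by (auto simp: corr_reg_def fun_eq_iff)
  note s = integrable_shift[OF i2, of z]
  have j1: "integrable lborel (\<lambda>w. (?B w *\<^sub>R k w) \<bullet> k' z)"
  by (intro integrable_inner_left i1)
  have j2: "integrable lborel (\<lambda>w. k z \<bullet> (?B (w + z) *\<^sub>R k' (w + z)))"
  by (intro integrable_inner_right s)
  show "integrable lborel (corr_reg k k' z)"
  unfolding eq by (intro Bochner_Integration.integrable_add Bochner_Integration.integrable_diff i j1 j2)
  have "(LBINT w. ?B (w + z) *\<^sub>R k' (w + z)) = 0"
  using integral_shift[of "\<lambda>w. ?B w *\<^sub>R k' w" z] z2 by simp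
  then have "(LBINT w. k z \<bullet> (?B (w + z) *\<^sub>R k' (w + z))) = 0"
  using integral_inner_right[OF s, of "k z"] by simp
  moreover have "(LBINT w. (?B w *\<^sub>R k w) \<bullet> k' z) = 0"
  using integral_inner_left[OF i1, of "k' z"] z1 by simp
  ultimately show "corr k k' z = (LBINT w. corr_reg k k' z w)"
  unfolding eq corr_def using i j1 j2
  by (subst Bochner_Integration.integral_add Bochner_Integration.integral_diff;
    (intro Bochner_Integration.integrable_diff)?; simp)+
qed

text \<open>The principal value of the autocorrelation of K. It is defined through the regularised
  integrand because the plain integrand behaves like |w|^(1-\<beta>) near its singularities and need
  not be integrable there.\<close>

definition kappa :: "real \<Rightarrow> 'a::euclidean_space \<Rightarrow> real" where
  "kappa \<beta> z = (LBINT w. corr_reg (kern \<beta> 0) (kern \<beta> 0) z w)"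

lemma abs_integral_le_nn_integral:
  fixes f :: "'b \<Rightarrow> real"
  assumes "integrable M f" "\<And>x. \<bar>f x\<bar> \<le> g x" "(\<integral>\<^sup>+x. ennreal (g x) \<partial>M) \<le> ennreal c" "0 \<le> c"
  shows "\<bar>integral\<^sup>L M f\<bar> \<le> c"
proof -
  have "ennreal \<bar>integral\<^sup>L M f\<bar> \<le> (\<integral>\<^sup>+x. ennreal (norm (f x)) \<partial>M)"
  using integral_norm_bound_ennreal[OF assms(1)] by simp
  also have "\<dots> \<le> (\<integral>\<^sup>+x. ennreal (g x) \<partial>M)"
  using assms(2) by (intro nn_integral_mono ennreal_leI) auto
  finally show ?thesis using assms(3,4) by (metis ennreal_le_iff order_trans)
qed

lemma integrable_corr_reg_kern:
  fixes z :: "'a::euclidean_space"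
  assumes "real DIM('a) / 2 + 1 < \<beta>" "\<beta> < real DIM('a) + 2" "z \<noteq> 0"
  shows "integrable lborel (corr_reg (kern \<beta> 0) (kern \<beta> 0) z)"
proof (rule integrableI_bounded)
  have \<beta>: "0 \<le> \<beta>" using assms by (smt (verit) divide_nonneg_nonneg of_nat_0_le_iff)
  obtain C where C: "(LNINT w. ennreal (corr_bound \<beta> z w)) \<le> ennreal (C * norm z powr (real DIM('a) + 2 - 2 * \<beta>))"
  using nn_integral_corr_bound[OF assms(1,2)] assms(3) by metis
  have "(LNINT w. ennreal (norm (corr_reg (kern \<beta> 0) (kern \<beta> 0) z w))) \<le> (LNINT w. ennreal (corr_bound \<beta> z w))"
  using corr_reg_le[OF tame_kern tame_kern] \<beta> by (intro nn_integral_mono ennreal_leI) auto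
  with C show "(LNINT w. ennreal (norm (corr_reg (kern \<beta> 0) (kern \<beta> 0) z w))) < \<infinity>"
  by (metis ennreal_less_top infinity_ennreal_def order.strict_trans1 order_trans)
qed simp

text \<open>The bounds b and b' make the correlations absolutely convergent; the constant C comes
  from the common majorant and therefore holds for all truncation levels simultaneously.\<close>

lemma corr_le:
  assumes "real DIM('a::euclidean_space) / 2 + 1 < \<beta>" "\<beta> < real DIM('a) + 2"
  obtains C where "0 < C"
  "\<And>z k k' b b'. z \<noteq> (0::'a) \<Longrightarrow> tame \<beta> z k \<Longrightarrow> tame \<beta> z k' \<Longrightarrow> (\<And>w. norm (k w) \<le> b) \<Longrightarrow> (\<And>w. norm (k' w) \<le> b')
   \<Longrightarrow> \<bar>corr k k' z\<bar> \<le> C * norm z powr (real DIM('a) + 2 - 2 * \<beta>)"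
proof -
  obtain C where C: "0 < C"
  "\<And>z::'a. z \<noteq> 0 \<Longrightarrow> (LNINT w. ennreal (corr_bound \<beta> z w)) \<le> ennreal (C * norm z powr (real DIM('a) + 2 - 2 * \<beta>))"
  using nn_integral_corr_bound[OF assms] by metis
  have \<beta>: "0 \<le> \<beta>" using assms by (smt (verit) divide_nonneg_nonneg of_nat_0_le_iff)
  show thesis
  proof (rule that[OF C(1)])
  fix z :: 'a and k k' :: "'a \<Rightarrow> 'a" and b b' :: real
  assume z: "z \<noteq> 0" and k: "tame \<beta> z k" and k': "tame \<beta> z k'"
   and b: "\<And>w. norm (k w) \<le> b" and b': "\<And>w. norm (k' w) \<le> b'"
  have i: "integrable lborel (\<lambda>w. k w \<bullet> k' (w + z))"
   using k k' b b' assms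
   by (intro integrable_corr square_integrable_decay[where \<beta>=\<beta>]) (auto simp: tame_def)
  note reg = corr_eq_reg[OF k b k' b' i]
  show "\<bar>corr k k' z\<bar> \<le> C * norm z powr (real DIM('a) + 2 - 2 * \<beta>)"
   unfolding reg(2) using reg(1) corr_reg_le[OF k k' \<beta>] C(2)[OF z] C(1)
   by (intro abs_integral_le_nn_integral) auto
  qed
qed

text \<open>Both regularised integrands lie below \<open>corr_bound\<close>, so only the mass of
  this majorant on the set where they differ counts, once for each of them.\<close>

lemma corr_kappa_diff:
  fixes z :: "'a::euclidean_space"
  assumes \<beta>: "real DIM('a) / 2 + 1 < \<beta>" "\<beta> < real DIM('a) + 2" and z: "z \<noteq> 0"
  and k: "tame \<beta> z k" "\<And>w. norm (k w) \<le> b"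
  and [measurable]: "S \<in> sets borel"
  and S: "\<And>w. w \<notin> S \<Longrightarrow> corr_reg k k z w = corr_reg (kern \<beta> 0) (kern \<beta> 0) z w"
  and c: "(LNINT w. ennreal (corr_bound \<beta> z w) * indicator S w) \<le> ennreal c" "0 \<le> c"
  shows "\<bar>corr k k z - kappa \<beta> z\<bar> \<le> 2 * c"
proof -
  have \<beta>0: "0 \<le> \<beta>" using \<beta> by (smt (verit) divide_nonneg_nonneg of_nat_0_le_iff)
  have i: "integrable lborel (\<lambda>w. k w \<bullet> k (w + z))"
  using k \<beta> by (intro integrable_corr square_integrable_decay[where \<beta>=\<beta>]) (auto simp: tame_def)
  have K: "tame \<beta> z (kern \<beta> 0)" by (rule tame_kern[OF \<beta>0])
  note reg = corr_eq_reg[OF k k i]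
  note iK = integrable_corr_reg_kern[OF \<beta> z]
  have "corr k k z - kappa \<beta> z = (LBINT w. corr_reg k k z w - corr_reg (kern \<beta> 0) (kern \<beta> 0) z w)"
  unfolding reg(2) kappa_def using reg(1) iK by simp
  also have "\<bar>\<dots>\<bar> \<le> 2 * c"
  proof (rule abs_integral_le_nn_integral)
  show "integrable lborel (\<lambda>w. corr_reg k k z w - corr_reg (kern \<beta> 0) (kern \<beta> 0) z w)"
   using reg(1) iK by simp
  show "\<bar>corr_reg k k z w - corr_reg (kern \<beta> 0) (kern \<beta> 0) z w\<bar> \<le> 2 * (corr_bound \<beta> z w * indicator S w)" for w
   using corr_reg_le[OF k(1) k(1) \<beta>0, of w] corr_reg_le[OF K K \<beta>0, of w] S[of w]
   by (cases "w \<in> S") auto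
  have "(LNINT w. ennreal (2 * (corr_bound \<beta> z w * indicator S w)))
   = (LNINT w. 2 * (ennreal (corr_bound \<beta> z w) * indicator S w))"
   by (intro nn_integral_cong) (auto simp: indicator_def ennreal_mult')
  also have "\<dots> = 2 * (LNINT w. ennreal (corr_bound \<beta> z w) * indicator S w)"
   by (rule nn_integral_cmult) simp
  also have "\<dots> \<le> 2 * ennreal c" by (intro mult_left_mono c) simp
  finally show "(LNINT w. ennreal (2 * (corr_bound \<beta> z w * indicator S w))) \<le> ennreal (2 * c)"
   by (simp add: ennreal_mult')
  qed (use c in simp)
  finally show ?thesis .
qed

text \<open>Truncation at t alters the integrand only in the balls of radius t about 0 and -z. The
  rate is recorded with its decay |z|^(-\<beta>), because for \<beta> = n + 1 and vanishing
  \<open>kappa\<close> precisely this decay makes the correlation of the truncated kernel integrable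
  at infinity.\<close>

lemma corr_kern_kappa:
  assumes \<beta>: "real DIM('a::euclidean_space) / 2 + 1 < \<beta>" "\<beta> < real DIM('a) + 2"
  obtains C where "0 < C"
  "\<And>z t. 0 < t \<Longrightarrow> t \<le> norm (z::'a) / 2 \<Longrightarrow>
   \<bar>corr (kern \<beta> t) (kern \<beta> t) z - kappa \<beta> z\<bar> \<le> C * norm z powr (- \<beta>) * t powr (real DIM('a) + 2 - \<beta>)"
proof
  have \<beta>0: "1 \<le> \<beta>" using \<beta> by (smt (verit) divide_nonneg_nonneg of_nat_0_le_iff)
  define A where "A = 2 * (1 + \<beta>) * sphere_area TYPE('a) / (real DIM('a) + 2 - \<beta>)"
  have A: "0 < A" using \<beta> \<beta>0 sphere_area_pos[where 'a='a] by (auto simp: A_def intro!: divide_pos_pos mult_pos_pos)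
  show "0 < 2 * A * (1 / 2) powr (- \<beta>)" using A by simp
  fix z :: 'a and t :: real assume t: "0 < t" "t \<le> norm z / 2"
  then have z: "z \<noteq> 0" by auto
  have near: "(LNINT w. ennreal (corr_bound \<beta> z w) * indicator (ball 0 t \<union> ball (- z) t) w)
   \<le> ennreal (A * (norm z / 2) powr (- \<beta>) * t powr (real DIM('a) + 2 - \<beta>))"
  using nn_integral_corr_bound_near[of \<beta> t z] \<beta> \<beta>0 t by (simp add: A_def)
  have "\<bar>corr (kern \<beta> t) (kern \<beta> t) z - kappa \<beta> z\<bar> \<le> 2 * (A * (norm z / 2) powr (- \<beta>) * t powr (real DIM('a) + 2 - \<beta>))"
  proof (rule corr_kappa_diff[OF \<beta> z tame_kern norm_kern_le_trunc _ _ near])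
  fix w assume w: "w \<notin> ball 0 t \<union> ball (- z) t"
  have "dist (- z) w = norm (w + z)"
   by (metis diff_minus_eq_add dist_norm dist_commute)
  with w t show "corr_reg (kern \<beta> t) (kern \<beta> t) z w = corr_reg (kern \<beta> 0) (kern \<beta> 0) z w"
   by (simp add: corr_reg_def kern_eq)
  qed (use \<beta>0 t A in auto)
  also have "\<dots> = 2 * A * (1 / 2) powr (- \<beta>) * norm z powr (- \<beta>) * t powr (real DIM('a) + 2 - \<beta>)"
  using powr_mult[of "1 / 2" "norm z" "- \<beta>"] by simp
  finally show "\<bar>corr (kern \<beta> t) (kern \<beta> t) z - kappa \<beta> z\<bar> \<le>
  2 * A * (1 / 2) powr (- \<beta>) * norm z powr (- \<beta>) * t powr (real DIM('a) + 2 - \<beta>)" .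
qed

lemma tendsto_powr_zero_right:
  assumes "0 < (a::real)" shows "((\<lambda>t. t powr a) \<longlongrightarrow> 0) (at_right 0)"
proof (rule tendsto_eq_rhs)
  show "((\<lambda>t. t powr a) \<longlongrightarrow> 0 powr a) (at_right 0)"
  using assms by (intro tendsto_powr2) (auto intro!: tendsto_intros eventually_at_rightI[of 0 1])
qed simp

lemma tendsto_corr_kern:
  fixes z :: "'a::euclidean_space"
  assumes \<beta>: "real DIM('a) / 2 + 1 < \<beta>" "\<beta> < real DIM('a) + 2" and z: "z \<noteq> 0"
  shows "((\<lambda>t. corr (kern \<beta> t) (kern \<beta> t) z) \<longlongrightarrow> kappa \<beta> z) (at_right 0)"
proof -
  obtain C where C: "\<And>z t. 0 < t \<Longrightarrow> t \<le> norm (z::'a) / 2 \<Longrightarrow>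
   \<bar>corr (kern \<beta> t) (kern \<beta> t) z - kappa \<beta> z\<bar> \<le> C * norm z powr (- \<beta>) * t powr (real DIM('a) + 2 - \<beta>)"
  using corr_kern_kappa[OF \<beta>] by metis
  have "((\<lambda>t. corr (kern \<beta> t) (kern \<beta> t) z - kappa \<beta> z) \<longlongrightarrow> 0) (at_right 0)"
  proof (rule Lim_null_comparison)
  show "\<forall>\<^sub>F t in at_right 0. norm (corr (kern \<beta> t) (kern \<beta> t) z - kappa \<beta> z)
    \<le> C * norm z powr (- \<beta>) * t powr (real DIM('a) + 2 - \<beta>)"
   using C z by (intro eventually_at_rightI[of 0 "norm z / 2"]) auto
  show "((\<lambda>t. C * norm z powr (- \<beta>) * t powr (real DIM('a) + 2 - \<beta>)) \<longlongrightarrow> 0) (at_right 0)"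
   using \<beta> by (intro tendsto_mult_right_zero tendsto_powr_zero_right) auto
  qed
  then show ?thesis by (simp add: LIM_zero_iff)
qed

section \<open>Rotation and scaling behaviour of the limit correlation\<close>

lemma orthogonal_transformation_scaleR: "orthogonal_transformation T \<Longrightarrow> T (c *\<^sub>R x) = c *\<^sub>R T x"
  by (simp add: linear_cmul orthogonal_transformation_linear)

lemma kappa_orthogonal:
  fixes z :: "'a::euclidean_space" and T :: "'a \<Rightarrow> 'a"
  assumes T: "orthogonal_transformation T"
  shows "kappa \<beta> (T z) = kappa \<beta> z"
proof -
  have K: "kern \<beta> 0 (T w) = T (kern \<beta> 0 w)" for w :: 'a
  using T by (simp add: kern_def orthogonal_transformation_norm orthogonal_transformation_scaleR)
  have add: "T w + T z = T (w + z)" for w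
  using T by (simp add: linear_add orthogonal_transformation_linear)
  have "corr_reg (kern \<beta> 0) (kern \<beta> 0) (T z) (T w) = corr_reg (kern \<beta> 0) (kern \<beta> 0) z w" for w
  using T unfolding corr_reg_def add K
  by (simp add: indicator_def orthogonal_transformation_norm orthogonal_transformation_def)
  then show ?thesis
  unfolding kappa_def
  using integral_orthogonal[OF T, of "corr_reg (kern \<beta> 0) (kern \<beta> 0) (T z)"] by simp
qed

lemma kern_scale: "0 < c \<Longrightarrow> kern \<beta> 0 (c *\<^sub>R h) = c powr (1 - \<beta>) *\<^sub>R kern \<beta> 0 h"
  by (simp add: kern_def powr_mult powr_diff powr_minus_divide)

lemma kappa_scale:
  fixes z :: "'a::euclidean_space"
  assumes c: "0 < c"
  shows "kappa \<beta> (c *\<^sub>R z) = c powr (real DIM('a) + 2 - 2 * \<beta>) * kappa \<beta> z"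
proof -
  have add: "c *\<^sub>R w + c *\<^sub>R z = c *\<^sub>R (w + z)" for w
  by (simp add: scaleR_add_right)
  have c2: "c powr (1 - \<beta>) * (c powr (1 - \<beta>) * x) = c powr (2 - 2 * \<beta>) * x" for x
  by (simp add: powr_add[symmetric] mult.assoc[symmetric])
  have eq: "corr_reg (kern \<beta> 0) (kern \<beta> 0) (c *\<^sub>R z) (c *\<^sub>R w) = c powr (2 - 2 * \<beta>) * corr_reg (kern \<beta> 0) (kern \<beta> 0) z w" for w
  using c unfolding corr_reg_def add kern_scale[OF c]
  by (simp add: indicator_def c2 right_diff_distrib distrib_left del: scaleR_add_right)
  have "kappa \<beta> (c *\<^sub>R z) = \<bar>c\<bar> ^ DIM('a) *\<^sub>R (LBINT w. corr_reg (kern \<beta> 0) (kern \<beta> 0) (c *\<^sub>R z) (0 + c *\<^sub>R w))"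
  unfolding kappa_def using c
  by (subst lborel_affine[of c 0]) (auto simp: integral_density integral_distr)
  also have "\<dots> = c ^ DIM('a) * (c powr (2 - 2 * \<beta>) * kappa \<beta> z)"
  using c by (simp add: eq kappa_def)
  finally show ?thesis using c
  by (simp add: powr_realpow[symmetric] powr_add[symmetric] mult.assoc[symmetric] algebra_simps)
qed

text \<open>The constant is the value of \<open>kappa\<close> at a unit vector. Orthogonal maps act
  transitively on the sphere, also in dimension one, where they are the two signs.\<close>

lemma kappa_homogeneous:
  fixes \<beta> :: real
  obtains c where "\<And>z::real ^ 'n. z \<noteq> 0 \<Longrightarrow> kappa \<beta> z = c * norm z powr (real CARD('n) + 2 - 2 * \<beta>)"
proof -
  obtain e :: "real ^ 'n" where e: "norm e = 1" using vector_choose_size[of 1] by auto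
  show thesis
  proof (rule that)
  fix z :: "real ^ 'n" assume z: "z \<noteq> 0"
  obtain T where T: "orthogonal_transformation T" "T e = z /\<^sub>R norm z"
   using orthogonal_transformation_exists[of e "z /\<^sub>R norm z"] e z by auto
  have "kappa \<beta> z = kappa \<beta> (norm z *\<^sub>R T e)" using z by (simp add: T)
  also have "\<dots> = norm z powr (real CARD('n) + 2 - 2 * \<beta>) * kappa \<beta> e"
   using z kappa_scale[of "norm z" \<beta> "T e"] kappa_orthogonal[OF T(1)] by simp
  finally show "kappa \<beta> z = kappa \<beta> e * norm z powr (real CARD('n) + 2 - 2 * \<beta>)" by simp
  qed
qed

section \<open>The equivalence kernel\<close>

definition cutk :: "real \<Rightarrow> real \<Rightarrow> real \<Rightarrow> 'a::euclidean_space \<Rightarrow> 'a" where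
  "cutk \<beta> \<epsilon> R h = (if \<epsilon> < norm h \<and> norm h < R then kern \<beta> 0 h else 0)"

lemma cutk_measurable [measurable]: "cutk \<beta> \<epsilon> R \<in> borel_measurable borel"
  unfolding cutk_def[abs_def] by measurable

lemma cutk_minus [simp]: "cutk \<beta> \<epsilon> R (- h) = - cutk \<beta> \<epsilon> R h"
  by (simp add: cutk_def)

lemma norm_cutk_le: "0 \<le> \<beta> \<Longrightarrow> norm (cutk \<beta> \<epsilon> R h) \<le> norm h powr (1 - \<beta>)"
  using norm_kern_le[of \<beta> 0 h] by (auto simp: cutk_def)

text \<open>For \<beta> < 1, which occurs in dimension one, |h|^(1-\<beta>) increases and is largest
  near the outer radius R; for \<beta> \<ge> 1 it is largest near \<epsilon>. The sum covers both
  cases.\<close>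

lemma norm_cutk_le_const:
  assumes "0 \<le> \<beta>" "0 < \<epsilon>"
  shows "norm (cutk \<beta> \<epsilon> R h) \<le> \<epsilon> powr (1 - \<beta>) + R powr (1 - \<beta>)"
proof (cases "\<epsilon> < norm h \<and> norm h < R")
  case True
  have "norm h powr (1 - \<beta>) \<le> \<epsilon> powr (1 - \<beta>) + R powr (1 - \<beta>)"
  proof (cases "1 \<le> \<beta>")
  case t: True
  then have "norm h powr (1 - \<beta>) \<le> \<epsilon> powr (1 - \<beta>)"
   using True assms by (intro powr_mono2') auto
  then show ?thesis by (simp add: add_increasing2)
  next
  case False
  then have "norm h powr (1 - \<beta>) \<le> R powr (1 - \<beta>)"
   using True assms by (intro powr_mono2) auto
  then show ?thesis by (simp add: add_increasing)
  qed
  then show ?thesis using norm_cutk_le[OF assms(1), of \<epsilon> R h] by linarith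
qed (auto simp: cutk_def)

lemma integrable_cutk:
  assumes "0 \<le> \<beta>" "0 < \<epsilon>"
  shows "integrable lborel (cutk \<beta> \<epsilon> R)"
  using norm_cutk_le_const[OF assms]
  by (rule integrable_bounded_ball[where r=R and b="\<epsilon> powr (1 - \<beta>) + R powr (1 - \<beta>)", rotated])
  (auto simp: cutk_def split: if_splits)

lemma integrable_corr_cutk:
  fixes z :: "'a::euclidean_space"
  assumes "0 \<le> \<beta>" "0 < \<epsilon>"
  shows "integrable lborel (\<lambda>w. cutk \<beta> \<epsilon> R w \<bullet> cutk \<beta> \<epsilon> R (w + z))"
proof (rule integrable_corr)
  have "norm ((norm (cutk \<beta> \<epsilon> R w))\<^sup>2) \<le> (\<epsilon> powr (1 - \<beta>) + R powr (1 - \<beta>))\<^sup>2" for w :: 'a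
  using power_mono[OF norm_cutk_le_const[OF assms] norm_ge_zero, of R w 2] by simp
  then show "integrable lborel (\<lambda>w::'a. (norm (cutk \<beta> \<epsilon> R w))\<^sup>2)"
  by (rule integrable_bounded_ball[where r=R, rotated]) (auto simp: cutk_def split: if_splits)
  then show "integrable lborel (\<lambda>w::'a. (norm (cutk \<beta> \<epsilon> R w))\<^sup>2)" .
qed simp_all

text \<open>The ball of radius |z|/2 about z lies strictly between the spheres of radius |z|/2 and
  3|z|/2 about 0, so the hypotheses on \<epsilon> and R keep both jumps away from it.\<close>

lemma tame_cutk:
  fixes z :: "'a::euclidean_space"
  assumes "0 \<le> \<beta>" "\<epsilon> \<le> norm z / 2" "3 * norm z / 2 \<le> R"
  shows "tame \<beta> z (cutk \<beta> \<epsilon> R)"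
  unfolding tame_def
proof (intro conjI allI impI)
  fix w :: 'a assume w: "norm w < norm z / 2"
  have "norm z / 2 < norm (z + w)" using norm_add_gt_half[OF w] by (simp add: add.commute)
  moreover have "norm (z + w) < 3 * norm z / 2" using norm_triangle_ineq[of z w] w by linarith
  moreover have "0 < norm z" using w norm_ge_zero[of w] by linarith
  ultimately have "cutk \<beta> \<epsilon> R (z + w) = kern \<beta> 0 (z + w)" "cutk \<beta> \<epsilon> R z = kern \<beta> 0 z"
  using assms unfolding cutk_def by (intro if_P; linarith)+
  then show "norm (cutk \<beta> \<epsilon> R (z + w) - cutk \<beta> \<epsilon> R z) \<le> (1 + \<beta>) * (norm z / 2) powr (- \<beta>) * norm w"
  using tame_kern[OF assms(1), of z 0] w by (simp add: tame_def)
qed (auto intro: norm_cutk_le assms)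

text \<open>With both cut-offs in place the kernel is integrable and square integrable, so the three
  products may be integrated separately. The first two are linear in a single shifted kernel of
  integral zero; in the third, oddness reverses one argument and produces the minus sign in front of
  the correlation.\<close>

lemma gamma_eq_eqI:
  fixes x y :: "real ^ 'n::finite"
  assumes eta: "\<And>a b. eta \<omega> \<alpha> a b = kern \<beta> 0 (b - a)" and \<beta>: "0 \<le> \<beta>"
  and lim: "((\<lambda>(\<epsilon>, R). ereal (- corr (cutk \<beta> \<epsilon> R) (cutk \<beta> \<epsilon> R) (x - y))) \<longlongrightarrow> l) pv_filter"
  shows "gamma_eq \<omega> \<alpha> x y = l / 2"
proof -
  have co: "cutoff \<epsilon> R (eta \<omega> \<alpha>) a b = cutk \<beta> \<epsilon> R (b - a)" for \<epsilon> R a b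
  by (simp add: cutoff_def cutk_def eta)
  have eq: "(LINT z|lebesgue. cutk \<beta> \<epsilon> R (y - x) \<bullet> cutk \<beta> \<epsilon> R (z - x) + cutk \<beta> \<epsilon> R (y - z) \<bullet> cutk \<beta> \<epsilon> R (y - x)
    + cutk \<beta> \<epsilon> R (y - z) \<bullet> cutk \<beta> \<epsilon> R (z - x)) = - corr (cutk \<beta> \<epsilon> R) (cutk \<beta> \<epsilon> R) (x - y)"
  if \<epsilon>: "0 < \<epsilon>" for \<epsilon> R
  proof -
  let ?k = "cutk \<beta> \<epsilon> R"
  note k = integrable_cutk[OF \<beta> \<epsilon>, of R, where 'a="real ^ 'n"]
  have i1: "integrable lborel (\<lambda>z. ?k (z - x))" using integrable_shift[OF k, of "- x"] by simp
  have i2: "integrable lborel (\<lambda>z. ?k (y - z))" using integrable_reflect[OF k, of y] by simp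
  have m: "?k (y - z) = - ?k (z - y)" for z by (metis cutk_minus minus_diff_eq)
  have i3: "integrable lborel (\<lambda>z. ?k (y - z) \<bullet> ?k (z - x))"
   using integrable_shift[OF integrable_corr_cutk[OF \<beta> \<epsilon>, of R "x - y"], of "- x"]
   unfolding m by (simp add: inner_commute algebra_simps)
  have j1: "integrable lborel (\<lambda>z. ?k (y - x) \<bullet> ?k (z - x))" by (intro integrable_inner_right i1)
  have j2: "integrable lborel (\<lambda>z. ?k (y - z) \<bullet> ?k (y - x))" by (intro integrable_inner_left i2)
  have z0: "(LBINT z. ?k (z :: real ^ 'n)) = 0" by (rule integral_odd) auto
  have z1: "(LBINT z. ?k (y - x) \<bullet> ?k (z - x)) = 0"
   using integral_inner_right[OF i1, of "?k (y - x)"] integral_shift[of ?k "- x"] z0 by simp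
  have z2: "(LBINT z. ?k (y - z) \<bullet> ?k (y - x)) = 0"
   using integral_inner_left[OF i2, of "?k (y - x)"] integral_reflect_lborel[of ?k y] z0 by simp
  have "(LINT z|lebesgue. ?k (y - x) \<bullet> ?k (z - x) + ?k (y - z) \<bullet> ?k (y - x) + ?k (y - z) \<bullet> ?k (z - x))
   = (LBINT z. ?k (y - x) \<bullet> ?k (z - x) + ?k (y - z) \<bullet> ?k (y - x) + ?k (y - z) \<bullet> ?k (z - x))"
   by (rule integral_completion) measurable
  also have "\<dots> = (LBINT z. ?k (y - z) \<bullet> ?k (z - x))"
   using j1 j2 i3 z1 z2 by simp
  also have "\<dots> = (LBINT w. ?k (y - (w + x)) \<bullet> ?k w)"
   using integral_shift[of "\<lambda>z. ?k (y - z) \<bullet> ?k (z - x)" x] by simp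
  also have "\<dots> = (LBINT w. - (?k w \<bullet> ?k (w + (x - y))))"
   unfolding m by (simp add: inner_commute algebra_simps)
  finally show ?thesis by (simp add: corr_def)
  qed
  have "((\<lambda>(\<epsilon>, R). let \<eta> = cutoff \<epsilon> R (eta \<omega> \<alpha>) in
   ereal (LINT z|lebesgue. \<eta> x y \<bullet> \<eta> x z + \<eta> z y \<bullet> \<eta> x y + \<eta> z y \<bullet> \<eta> x z)) \<longlongrightarrow> l) pv_filter"
  proof (rule Lim_transform_eventually[OF lim])
  have "eventually (\<lambda>p. 0 < fst p) pv_filter"
   unfolding pv_filter_def
   using filterlim_fst[of "at_right (0::real)" "at_top :: real filter"]
   by (rule eventually_compose_filterlim[rotated]) (rule eventually_at_right_less)
  then show "eventually (\<lambda>p. (case p of (\<epsilon>, R) \<Rightarrow> ereal (- corr (cutk \<beta> \<epsilon> R) (cutk \<beta> \<epsilon> R) (x - y))) =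
   (case p of (\<epsilon>, R) \<Rightarrow> let \<eta> = cutoff \<epsilon> R (eta \<omega> \<alpha>) in
   ereal (LINT z|lebesgue. \<eta> x y \<bullet> \<eta> x z + \<eta> z y \<bullet> \<eta> x y + \<eta> z y \<bullet> \<eta> x z))) pv_filter"
   by eventually_elim (simp add: Let_def co eq split_beta)
  qed
  then have "Lim pv_filter (\<lambda>(\<epsilon>, R). let \<eta> = cutoff \<epsilon> R (eta \<omega> \<alpha>) in
   ereal (LINT z|lebesgue. \<eta> x y \<bullet> \<eta> x z + \<eta> z y \<bullet> \<eta> x y + \<eta> z y \<bullet> \<eta> x z)) = l"
  by (intro tendsto_Lim) (auto simp: pv_filter_def prod_filter_eq_bot)
  then show ?thesis unfolding gamma_eq_def by simp
qed

lemma eventually_pv_filter: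
  assumes "0 < \<epsilon>0" "\<And>\<epsilon> R. 0 < \<epsilon> \<Longrightarrow> \<epsilon> < \<epsilon>0 \<Longrightarrow> R0 \<le> R \<Longrightarrow> P (\<epsilon>, R)"
  shows "eventually P pv_filter"
  unfolding pv_filter_def eventually_prod_filter
  using assms eventually_at_rightI[of 0 \<epsilon>0 "\<lambda>\<epsilon>. 0 < \<epsilon> \<and> \<epsilon> < \<epsilon>0"] eventually_ge_at_top[of R0]
  by (intro exI[of _ "\<lambda>\<epsilon>. 0 < \<epsilon> \<and> \<epsilon> < \<epsilon>0"] exI[of _ "\<lambda>R. R0 \<le> R"]) auto

lemma tendsto_corr_cutk:
  fixes z :: "'a::euclidean_space"
  assumes \<beta>: "real DIM('a) / 2 + 1 < \<beta>" "\<beta> < real DIM('a) + 2" and z: "z \<noteq> 0"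
  shows "((\<lambda>(\<epsilon>, R). corr (cutk \<beta> \<epsilon> R) (cutk \<beta> \<epsilon> R) z) \<longlongrightarrow> kappa \<beta> z) pv_filter"
proof -
  have \<beta>0: "1 \<le> \<beta>" using \<beta> by (smt (verit) divide_nonneg_nonneg of_nat_0_le_iff)
  let ?p = "real DIM('a) + 2 - 2 * \<beta>" and ?q = "real DIM('a) + 2 - \<beta>"
  define A where "A = 2 * (1 + \<beta>) * sphere_area TYPE('a) / ?q * (norm z / 2) powr (- \<beta>)"
  define b where "b = sphere_area TYPE('a) / (2 * \<beta> - 2 - real DIM('a))"
  have A: "0 \<le> A" and b: "0 \<le> b"
  using \<beta> \<beta>0 sphere_area_pos[where 'a='a] by (auto simp: A_def b_def)
  \<comment> \<open>A bound for the mass of the majorant on the exceptional set: the first term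
    belongs to the balls about the two singularities, the other two to the regions where |w| or |w +
    z| exceeds R. The exponents are positive and negative respectively, so all three vanish in the
    limit.\<close>
  define c where "c = (\<lambda>p::real \<times> real. A * (2 * fst p) powr ?q + (b * (snd p - norm z) powr ?p + b * (snd p - norm z) powr ?p))"
  have main: "\<bar>corr (cutk \<beta> \<epsilon> R) (cutk \<beta> \<epsilon> R) z - kappa \<beta> z\<bar> \<le> 2 * c (\<epsilon>, R)"
  if \<epsilon>: "0 < \<epsilon>" "\<epsilon> < norm z / 4" and R: "2 * norm z \<le> R" for \<epsilon> R
  proof -
  \<comment> \<open>Radius 2\<epsilon> instead of \<epsilon>: outside the balls |w| and |w + z| must
    be strictly larger than \<epsilon>, as \<open>cutk\<close> is 0 on the sphere of radius
    \<epsilon>.\<close>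
  let ?N = "ball 0 (2 * \<epsilon>) \<union> ball (- z) (2 * \<epsilon>)" and ?F = "{w. R \<le> norm w \<or> R \<le> norm (w + z)}"
  let ?f = "\<lambda>w::'a. ennreal (norm w powr (- (2 * \<beta> - 2))) * indicator (- ball 0 (R - norm z)) w"
  have [measurable]: "ball (0::'a) (2 * \<epsilon>) \<in> sets borel" "ball (- z) (2 * \<epsilon>) \<in> sets borel" "ball (0::'a) (R - norm z) \<in> sets borel" by auto
  have "0 < R - norm z" using R z zero_less_norm_iff[of z] by linarith
  then have f: "(LNINT w. ?f w) = ennreal (b * (R - norm z) powr ?p)"
   using \<beta> nn_integral_norm_powr_out[of "2 * \<beta> - 2" "R - norm z", where 'a='a]
   by (simp add: b_def algebra_simps)
  have near: "(LNINT w. ennreal (corr_bound \<beta> z w) * indicator ?N w) \<le> ennreal (A * (2 * \<epsilon>) powr ?q)"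
   using nn_integral_corr_bound_near[of \<beta> "2 * \<epsilon>" z] \<beta> \<beta>0 \<epsilon> by (simp add: A_def)
  have "(LNINT w. ennreal (corr_bound \<beta> z w) * indicator (?N \<union> ?F) w)
   \<le> (LNINT w. ennreal (corr_bound \<beta> z w) * indicator ?N w + (?f w + ?f (w + z)))"
  proof (rule nn_integral_mono)
   fix w
   show "ennreal (corr_bound \<beta> z w) * indicator (?N \<union> ?F) w
    \<le> ennreal (corr_bound \<beta> z w) * indicator ?N w + (?f w + ?f (w + z))"
   proof (cases "w \<in> ?N \<or> w \<notin> ?F")
    case False
    then have F: "w \<notin> ?N" "R \<le> norm w \<or> R \<le> norm (w + z)" by auto
    have "norm w \<ge> R - norm z" "norm (w + z) \<ge> R - norm z"
     using F(2) norm_triangle_ineq[of w z] norm_triangle_ineq4[of "w + z" z] norm_ge_zero[of z] by auto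
    moreover then have "\<not> norm w < norm z / 2" "\<not> norm (w + z) < norm z / 2" using R norm_ge_zero[of z] by linarith+
    ultimately show ?thesis using F
     by (simp add: corr_bound_def indicator_def ennreal_plus[symmetric] del: ennreal_plus)
   qed (auto simp: indicator_def)
  qed
  also have "\<dots> = (LNINT w. ennreal (corr_bound \<beta> z w) * indicator ?N w) + ((LNINT w. ?f w) + (LNINT w. ?f w))"
   using nn_integral_shift[of ?f z] by (simp add: nn_integral_add)
  also have "\<dots> \<le> ennreal (A * (2 * \<epsilon>) powr ?q) + (ennreal (b * (R - norm z) powr ?p) + ennreal (b * (R - norm z) powr ?p))"
   unfolding f by (intro add_right_mono near)
  also have "\<dots> = ennreal (c (\<epsilon>, R))"
  proof -
   have "0 \<le> A * (2 * \<epsilon>) powr ?q" "0 \<le> b * (R - norm z) powr ?p" using A b by auto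
   then show ?thesis by (simp only: c_def fst_conv snd_conv ennreal_plus[symmetric] add_nonneg_nonneg)
  qed
  finally have *: "(LNINT w. ennreal (corr_bound \<beta> z w) * indicator (?N \<union> ?F) w) \<le> ennreal (c (\<epsilon>, R))" .
  show ?thesis
  proof (rule corr_kappa_diff[OF \<beta> z _ _ _ _ *])
   show "tame \<beta> z (cutk \<beta> \<epsilon> R)" using \<beta>0 \<epsilon> R by (intro tame_cutk) auto
   show "norm (cutk \<beta> \<epsilon> R w) \<le> \<epsilon> powr (1 - \<beta>) + R powr (1 - \<beta>)" for w :: 'a
    using \<beta>0 \<epsilon> by (intro norm_cutk_le_const) auto
   show "?N \<union> ?F \<in> sets borel" by measurable
   show "corr_reg (cutk \<beta> \<epsilon> R) (cutk \<beta> \<epsilon> R) z w = corr_reg (kern \<beta> 0) (kern \<beta> 0) z w"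
    if w: "w \<notin> ?N \<union> ?F" for w
   proof -
    have "dist (- z) w = norm (w + z)"
     by (metis diff_minus_eq_add dist_norm dist_commute)
    then have "\<epsilon> < norm w" "norm w < R" "\<epsilon> < norm (w + z)" "norm (w + z) < R" "\<epsilon> < norm z" "norm z < R"
     using w \<epsilon> R zero_less_norm_iff[of z] z by auto
    then show ?thesis by (simp add: corr_reg_def cutk_def)
   qed
   show "0 \<le> c (\<epsilon>, R)" using A b by (simp add: c_def)
  qed
  qed
  have "((\<lambda>p. case p of (\<epsilon>, R) \<Rightarrow> corr (cutk \<beta> \<epsilon> R) (cutk \<beta> \<epsilon> R) z - kappa \<beta> z) \<longlongrightarrow> 0) pv_filter"
  proof (rule Lim_null_comparison)
  show "eventually (\<lambda>p. norm (case p of (\<epsilon>, R) \<Rightarrow> corr (cutk \<beta> \<epsilon> R) (cutk \<beta> \<epsilon> R) z - kappa \<beta> z) \<le> 2 * c p) pv_filter"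
   using main z by (intro eventually_pv_filter[of "norm z / 4" "2 * norm z"]) auto
  have 1: "LIM p pv_filter. fst p :> at_right 0" and 2: "LIM p pv_filter. snd p :> at_top"
   unfolding pv_filter_def by (rule filterlim_fst filterlim_snd)+
  have "((\<lambda>\<epsilon>::real. (2 * \<epsilon>) powr ?q) \<longlongrightarrow> 0) (at_right 0)"
  proof -
   have "((\<lambda>\<epsilon>. 2 powr ?q * \<epsilon> powr ?q) \<longlongrightarrow> 0) (at_right 0)"
    using \<beta> by (intro tendsto_mult_right_zero tendsto_powr_zero_right) auto
   moreover have "eventually (\<lambda>\<epsilon>. 2 powr ?q * \<epsilon> powr ?q = (2 * \<epsilon>) powr ?q) (at_right 0)"
    by (intro eventually_at_rightI[of 0 1]) (auto simp: powr_mult)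
   ultimately show "((\<lambda>\<epsilon>::real. (2 * \<epsilon>) powr ?q) \<longlongrightarrow> 0) (at_right 0)"
    by (rule Lim_transform_eventually)
  qed
  from filterlim_compose[OF this 1] have t1: "((\<lambda>p. (2 * fst p) powr ?q) \<longlongrightarrow> 0) pv_filter" .
  have "((\<lambda>R::real. (R - norm z) powr ?p) \<longlongrightarrow> 0) at_top"
   using \<beta> by (intro tendsto_neg_powr) (auto intro!: filterlim_tendsto_add_at_top[OF tendsto_const[of "- norm z"] filterlim_ident, simplified] )
  from filterlim_compose[OF this 2] have t2: "((\<lambda>p. (snd p - norm z) powr ?p) \<longlongrightarrow> 0) pv_filter" .
  have "((\<lambda>p. 2 * c p) \<longlongrightarrow> 2 * (A * 0 + (b * 0 + b * 0))) pv_filter"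
   unfolding c_def by (intro tendsto_intros t1 t2)
  then show "((\<lambda>p. 2 * c p) \<longlongrightarrow> 0) pv_filter" by simp
  qed
  then show ?thesis by (simp add: case_prod_unfold LIM_zero_iff)
qed

lemma gamma_eq_kappa:
  fixes x y :: "real ^ 'n::finite"
  assumes eta: "\<And>a b. eta \<omega> \<alpha> a b = kern \<beta> 0 (b - a)"
  and \<beta>: "real CARD('n) / 2 + 1 < \<beta>" "\<beta> < real CARD('n) + 2" and "x \<noteq> y"
  shows "gamma_eq \<omega> \<alpha> x y = ereal (- kappa \<beta> (x - y) / 2)"
proof -
  have \<beta>0: "0 \<le> \<beta>" using \<beta> by (smt (verit) divide_nonneg_nonneg of_nat_0_le_iff)
  have "((\<lambda>p. ereal (- (case p of (\<epsilon>, R) \<Rightarrow> corr (cutk \<beta> \<epsilon> R) (cutk \<beta> \<epsilon> R) (x - y)))) \<longlongrightarrow> ereal (- kappa \<beta> (x - y))) pv_filter"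
  using tendsto_corr_cutk[of \<beta> "x - y"] assms by (intro tendsto_intros) auto
  then have "gamma_eq \<omega> \<alpha> x y = ereal (- kappa \<beta> (x - y)) / 2"
  by (intro gamma_eq_eqI[OF eta \<beta>0]) (simp only: case_prod_unfold)
  then show ?thesis by simp
qed

text \<open>For \<beta> \<le> n/2 + 1 the majorant fails to be integrable at infinity only. On a
  bounded ball it stays integrable, so the singular part of a correlation contributes a finite
  amount, uniformly in the cut-offs.\<close>

lemma integrable_corr_bound_ball:
  fixes z :: "'a::euclidean_space"
  assumes "0 \<le> \<beta>" "\<beta> < real DIM('a) + 2" "z \<noteq> 0"
  shows "integrable lborel (\<lambda>w. corr_bound \<beta> z w * indicator (ball 0 (2 * norm z)) w)"
proof (rule integrableI_bounded)
  let ?r = "norm z / 2"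
  define M where "M = 2 * ((norm z / 2) powr (2 - 2 * \<beta>) + (3 * norm z) powr (2 - 2 * \<beta>))"
  let ?N = "ball 0 ?r \<union> ball (- z) ?r"
  have [measurable]: "ball (0::'a) ?r \<in> sets borel" "ball (- z) ?r \<in> sets borel" "ball (0::'a) (2 * norm z) \<in> sets borel" by auto
  have pw: "x powr (2 - 2 * \<beta>) \<le> (norm z / 2) powr (2 - 2 * \<beta>) + (3 * norm z) powr (2 - 2 * \<beta>)"
  if "norm z / 2 \<le> x" "x \<le> 3 * norm z" for x
  proof (cases "\<beta> \<le> 1")
  case True
  then have "x powr (2 - 2 * \<beta>) \<le> (3 * norm z) powr (2 - 2 * \<beta>)"
   using that assms norm_ge_zero[of z] by (intro powr_mono2) linarith+
  then show ?thesis by (simp add: add_increasing)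
  next
  case False
  then have "x powr (2 - 2 * \<beta>) \<le> (norm z / 2) powr (2 - 2 * \<beta>)"
   using that assms by (intro powr_mono2') auto
  then show ?thesis by (simp add: add_increasing2)
  qed
  have "(LNINT w. ennreal (norm (corr_bound \<beta> z w * indicator (ball 0 (2 * norm z)) w)))
  \<le> (LNINT w. ennreal (corr_bound \<beta> z w) * indicator ?N w + ennreal M * indicator (ball 0 (2 * norm z)) w)"
  proof (rule nn_integral_mono)
  fix w
  have *: "dist (- z) w = norm (w + z)"
   by (metis diff_minus_eq_add dist_norm dist_commute)
  show "ennreal (norm (corr_bound \<beta> z w * indicator (ball 0 (2 * norm z)) w))
   \<le> ennreal (corr_bound \<beta> z w) * indicator ?N w + ennreal M * indicator (ball 0 (2 * norm z)) w"
  proof (cases "w \<in> ball 0 (2 * norm z) \<and> w \<notin> ?N")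
   case True
   then have w: "norm w < 2 * norm z" "\<not> norm w < norm z / 2" "\<not> norm (w + z) < norm z / 2" by (auto simp: *)
   have "corr_bound \<beta> z w \<le> M"
    using w pw[of "norm w"] pw[of "norm (w + z)"] norm_triangle_ineq[of w z] by (simp add: corr_bound_def M_def)
   then show ?thesis using True corr_bound_nonneg[OF assms(1), of z w] by (auto intro!: ennreal_leI)
  next
   case False
   then show ?thesis using corr_bound_nonneg[OF assms(1), of z w]
    by (cases "w \<in> ?N") (auto simp: indicator_def)
  qed
  qed
  also have "\<dots> = (LNINT w. ennreal (corr_bound \<beta> z w) * indicator ?N w) + ennreal M * emeasure lborel (ball 0 (2 * norm z) :: 'a set)"
  by (simp add: nn_integral_add nn_integral_cmult)
  also have "\<dots> < \<infinity>"
  using nn_integral_corr_bound_near[OF assms(1,2), of ?r z] assms(3)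
  by (auto simp: ennreal_mult_less_top emeasure_lborel_ball_finite[unfolded infinity_ennreal_def] less_top
    intro: le_less_trans simp del: ennreal_plus)
  finally show "(LNINT w. ennreal (norm (corr_bound \<beta> z w * indicator (ball 0 (2 * norm z)) w))) < \<infinity>" .
  show "(\<lambda>w. corr_bound \<beta> z w * indicator (ball 0 (2 * norm z)) w) \<in> borel_measurable lborel" by measurable
qed

section \<open>Divergence of the correlation in the extreme ranges of the exponent\<close>

lemma integral_ge_of_nn_integral:
  assumes "integrable M f" "\<And>x. 0 \<le> f x" "ennreal c \<le> (\<integral>\<^sup>+x. ennreal (f x) \<partial>M)"
  shows "c \<le> integral\<^sup>L M f"
proof -
  have "ennreal c \<le> ennreal (integral\<^sup>L M f)"
  using assms nn_integral_eq_integral[OF assms(1)] by simp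
  then show ?thesis
  using assms(2) by (cases "0 \<le> c") (auto simp: ennreal_le_iff intro: order_trans[of c 0])
qed

text \<open>Far from the origin w and w + z are nearly parallel, so the integrand is positive and
  comparable to |w|^(2-2\<beta>), which for \<beta> \<le> n/2 + 1 is at least |w|^(-n) once |w|
  \<ge> 1. This yields a logarithm in R. The bounded region contributes at most C, whatever the
  cut-offs.\<close>

lemma corr_cutk_ge:
  fixes z :: "'a::euclidean_space"
  assumes \<beta>: "0 < \<beta>" "\<beta> \<le> real DIM('a) / 2 + 1" and z: "z \<noteq> 0"
  obtains C c p where "0 < c" "0 < p"
  "\<And>\<epsilon> R. 0 < \<epsilon> \<Longrightarrow> \<epsilon> < norm z / 2 \<Longrightarrow> 2 * p + norm z \<le> R \<Longrightarrow>
   c * ln ((R - norm z) / (2 * p)) - C \<le> corr (cutk \<beta> \<epsilon> R) (cutk \<beta> \<epsilon> R) z"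
proof
  let ?w = "sphere_area TYPE('a)" and ?I = "\<lambda>w. indicator (ball 0 (2 * norm z)) w :: real"
  \<comment> \<open>The power comes from |w + z| \<le> 3/2 |w| and the half from w . (w + z) \<ge>
    |w|^2 / 2, both valid for |w| \<ge> 2|z|.\<close>
  define c0 where "c0 = (3 / 2) powr (- \<beta>) / 2"
  have c0: "0 < c0" by (simp add: c0_def)
  define C where "C = (LBINT w. corr_bound \<beta> z w * ?I w)"
  \<comment> \<open>2|z| is where the lower bound for the integrand starts to hold; the 1 is needed
    to compare the powers s^(-n) \<le> s^(2-2\<beta>).\<close>
  define p where "p = max (2 * norm z) 1"
  have \<beta>2: "\<beta> < real DIM('a) + 2" using \<beta> by (simp add: field_simps)
  show "0 < c0 * ?w" "0 < p" using c0 sphere_area_pos[where 'a='a] by (auto simp: p_def)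
  fix \<epsilon> R assume \<epsilon>: "0 < \<epsilon>" "\<epsilon> < norm z / 2" and R: "2 * p + norm z \<le> R"
  let ?k = "cutk \<beta> \<epsilon> R :: 'a \<Rightarrow> 'a"
  have zp: "0 < norm z" using z by simp
  have R2: "2 * norm z + norm z \<le> R" "2 \<le> R - norm z" "p \<le> (R - norm z) / 2" using R by (auto simp: p_def)
  have t: "tame \<beta> z ?k" using \<epsilon> R2 \<beta> by (intro tame_cutk) auto
  note reg = corr_eq_reg[OF t norm_cutk_le_const t norm_cutk_le_const integrable_corr_cutk, OF _ \<epsilon>(1) _ \<epsilon>(1) _ \<epsilon>(1)]
  define g where "g w = c0 * (norm w powr (2 - 2 * \<beta>) * indicator {2 * norm z..<R - norm z} (norm w))" for w :: 'a
  have [measurable]: "g \<in> borel_measurable borel" unfolding g_def[abs_def] by measurable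
  have [measurable]: "ball (0::'a) (2 * norm z) \<in> sets borel" by simp
  have g0: "0 \<le> g w" for w using c0 by (auto simp: g_def)
  have g_le: "norm (g w) \<le> c0 * ((2 * norm z) powr (2 - 2 * \<beta>) + (R - norm z) powr (2 - 2 * \<beta>))" for w
  proof -
  have "x powr (2 - 2 * \<beta>) \<le> (2 * norm z) powr (2 - 2 * \<beta>) + (R - norm z) powr (2 - 2 * \<beta>)"
   if "2 * norm z \<le> x" "x < R - norm z" for x
  proof (cases "\<beta> \<le> 1")
   case True
   then have "x powr (2 - 2 * \<beta>) \<le> (R - norm z) powr (2 - 2 * \<beta>)"
    using that zp by (intro powr_mono2) linarith+
   then show ?thesis by (simp add: add_increasing)
  next
   case False
   then have "x powr (2 - 2 * \<beta>) \<le> (2 * norm z) powr (2 - 2 * \<beta>)"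
    using that zp by (intro powr_mono2') auto
   then show ?thesis by (simp add: add_increasing2)
  qed
  then show ?thesis using c0 by (auto simp: g_def indicator_def intro!: mult_left_mono)
  qed
  have ig: "integrable lborel g"
  by (rule integrable_bounded_ball[OF _ g_le, where r="R - norm z"]) (auto simp: g_def indicator_def split: if_splits)
  \<comment> \<open>The upper radius is half of R - |z| because the closed shell has to lie inside
    the half-open range on which g is nonzero.\<close>
  have "ennreal (?w * ln ((R - norm z) / 2 / p)) \<le> (LNINT x. (\<lambda>t. ennreal (t powr (2 - 2 * \<beta>) * indicator {2 * norm z..<R - norm z} t)) (norm (x::'a)))"
  proof (rule nn_integral_norm_ge_inverse)
  fix s assume s: "p \<le> s" "s \<le> (R - norm z) / 2"
  then have "s powr (- real DIM('a)) \<le> s powr (2 - 2 * \<beta>)"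
   using \<beta> by (intro powr_mono) (auto simp: p_def field_simps)
  then show "ennreal (s powr (- real DIM('a))) \<le> ennreal (s powr (2 - 2 * \<beta>) * indicator {2 * norm z..<R - norm z} s)"
   using s R2 by (auto simp: p_def indicator_def intro!: ennreal_leI)
  qed (use R2 in \<open>auto simp: p_def\<close>)
  then have "ennreal (?w * ln ((R - norm z) / 2 / p)) \<le> (LNINT w. ennreal (g w / c0))"
  using c0 by (simp add: g_def)
  then have "?w * ln ((R - norm z) / 2 / p) \<le> (LBINT w. g w / c0)"
  using ig c0 g0 by (intro integral_ge_of_nn_integral) auto
  then have lb: "c0 * ?w * ln ((R - norm z) / (2 * p)) \<le> (LBINT w. g w)"
  using c0 by (simp add: field_simps)
  have le: "g w - corr_bound \<beta> z w * ?I w \<le> corr_reg ?k ?k z w" for w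
  proof (cases "norm w < 2 * norm z")
  case True
  then show ?thesis using corr_reg_le[OF t t, of w] \<beta> by (simp add: g_def indicator_def)
  next
  case False
  have nz: "norm z \<le> norm w / 2" "norm z / 2 \<le> norm w" using False zp by linarith+
  have nw: "norm w / 2 \<le> norm (w + z)" "norm (w + z) \<le> 3 / 2 * norm w"
   using norm_diff_ineq[of w z] norm_triangle_ineq[of w z] nz by linarith+
  have nw2: "norm z / 2 \<le> norm (w + z)" using nz nw by linarith
  have eq: "corr_reg ?k ?k z w = ?k w \<bullet> ?k (w + z)"
   using nz(2) nw2 by (simp add: corr_reg_def)
  have "w \<bullet> (w + z) \<ge> (norm w)\<^sup>2 / 2"
  proof -
   have "\<bar>w \<bullet> z\<bar> \<le> norm w * (norm w / 2)"
    using Cauchy_Schwarz_ineq2[of w z] mult_left_mono[OF nz(1), of "norm w"] by simp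
   then show ?thesis by (simp add: inner_add_right power2_norm_eq_inner[symmetric] power2_eq_square)
  qed
  then have pos: "0 \<le> w \<bullet> (w + z)" "(norm w)\<^sup>2 / 2 \<le> w \<bullet> (w + z)"
   using zero_le_power2[of "norm w"] by linarith+
  have k1: "kern \<beta> 0 w \<bullet> kern \<beta> 0 (w + z) = norm w powr (- \<beta>) * norm (w + z) powr (- \<beta>) * (w \<bullet> (w + z))"
   by (simp add: kern_def)
  have nonneg: "0 \<le> ?k w \<bullet> ?k (w + z)"
   using pos k1 by (auto simp: cutk_def)
  show ?thesis
  proof (cases "norm w < R - norm z")
   case T: True
   then have "norm (w + z) < R" "norm w < R" using norm_triangle_ineq[of w z] norm_ge_zero[of z] by linarith+
   then have "?k w \<bullet> ?k (w + z) = norm w powr (- \<beta>) * norm (w + z) powr (- \<beta>) * (w \<bullet> (w + z))"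
    using nz nw2 \<epsilon> k1 by (simp add: cutk_def)
   also have "\<dots> \<ge> norm w powr (- \<beta>) * (3 / 2 * norm w) powr (- \<beta>) * ((norm w)\<^sup>2 / 2)"
    using nw nz zp pos \<beta> by (intro mult_mono mult_left_mono powr_mono2') auto
   also have "norm w powr (- \<beta>) * (3 / 2 * norm w) powr (- \<beta>) * ((norm w)\<^sup>2 / 2)
     = c0 * (norm w powr (- \<beta>) * norm w powr (- \<beta>) * norm w powr 2)"
    unfolding c0_def by (subst powr_mult) (use nz zp in \<open>auto simp: powr_numeral\<close>)
   also have "norm w powr (- \<beta>) * norm w powr (- \<beta>) * norm w powr 2 = norm w powr (2 - 2 * \<beta>)"
    by (simp add: powr_add[symmetric] del: powr_numeral)
   finally show ?thesis using False T by (simp add: eq g_def)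
  qed (use False nonneg in \<open>auto simp: eq g_def\<close>)
  qed
  have icb: "integrable lborel (\<lambda>w. corr_bound \<beta> z w * ?I w)"
  using \<beta> \<beta>2 z by (intro integrable_corr_bound_ball) auto
  have "(LBINT w. g w) - C = (LBINT w. g w - corr_bound \<beta> z w * ?I w)"
  using ig icb by (simp add: C_def)
  also have "\<dots> \<le> (LBINT w. corr_reg ?k ?k z w)"
  using ig icb reg(1) \<beta> le by (intro integral_mono) auto
  finally show "c0 * ?w * ln ((R - norm z) / (2 * p)) - C \<le> corr ?k ?k z"
  using lb reg(2) \<beta> by auto
qed

lemma gamma_eq_minus_infinity:
  fixes x y :: "real ^ 'n::finite"
  assumes eta: "\<And>a b. eta \<omega> \<alpha> a b = kern \<beta> 0 (b - a)"
  and \<beta>: "0 < \<beta>" "\<beta> \<le> real CARD('n) / 2 + 1" and "x \<noteq> y"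
  shows "gamma_eq \<omega> \<alpha> x y = - \<infinity>"
proof -
  let ?z = "x - y"
  obtain C c p where c: "0 < c" "0 < p"
  "\<And>\<epsilon> R. 0 < \<epsilon> \<Longrightarrow> \<epsilon> < norm ?z / 2 \<Longrightarrow> 2 * p + norm ?z \<le> R \<Longrightarrow>
   c * ln ((R - norm ?z) / (2 * p)) - C \<le> corr (cutk \<beta> \<epsilon> R) (cutk \<beta> \<epsilon> R) ?z"
  proof (rule corr_cutk_ge[of \<beta> ?z])
  show "0 < \<beta>" "\<beta> \<le> real DIM(real ^ 'n) / 2 + 1" "?z \<noteq> 0" using \<beta> \<open>x \<noteq> y\<close> by auto
  qed (use that in blast)
  have "((\<lambda>p. ereal (- (case p of (\<epsilon>, R) \<Rightarrow> corr (cutk \<beta> \<epsilon> R) (cutk \<beta> \<epsilon> R) ?z))) \<longlongrightarrow> - \<infinity>) pv_filter"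
  unfolding tendsto_MInfty
  proof
  fix r :: real
  let ?R0 = "2 * p * exp ((\<bar>r\<bar> + \<bar>C\<bar> + 1) / c) + norm ?z"
  show "eventually (\<lambda>p. ereal (- (case p of (\<epsilon>, R) \<Rightarrow> corr (cutk \<beta> \<epsilon> R) (cutk \<beta> \<epsilon> R) ?z)) < ereal r) pv_filter"
  proof (rule eventually_pv_filter[of "norm ?z / 2" ?R0])
   fix \<epsilon> R assume \<epsilon>: "0 < \<epsilon>" "\<epsilon> < norm ?z / 2" and R: "?R0 \<le> R"
   have "1 \<le> exp ((\<bar>r\<bar> + \<bar>C\<bar> + 1) / c)" using c by simp
   then have "2 * p * 1 \<le> 2 * p * exp ((\<bar>r\<bar> + \<bar>C\<bar> + 1) / c)" using c by (intro mult_left_mono) auto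
   then have 1: "2 * p + norm ?z \<le> R" using R by simp
   have "exp ((\<bar>r\<bar> + \<bar>C\<bar> + 1) / c) \<le> (R - norm ?z) / (2 * p)" using R c by (simp add: field_simps)
   then have "(\<bar>r\<bar> + \<bar>C\<bar> + 1) / c \<le> ln ((R - norm ?z) / (2 * p))"
    by (metis exp_gt_zero ln_exp ln_mono order_less_le_trans)
   then have "\<bar>r\<bar> + \<bar>C\<bar> + 1 \<le> c * ln ((R - norm ?z) / (2 * p))" using c by (simp add: field_simps)
   with c(3)[OF \<epsilon> 1] show "ereal (- (case (\<epsilon>, R) of (\<epsilon>, R) \<Rightarrow> corr (cutk \<beta> \<epsilon> R) (cutk \<beta> \<epsilon> R) ?z)) < ereal r" by simp
  qed (use \<open>x \<noteq> y\<close> in simp)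
  qed
  then have "gamma_eq \<omega> \<alpha> x y = - \<infinity> / 2"
  using \<beta> by (intro gamma_eq_eqI[OF eta]) (auto simp: case_prod_unfold)
  then show ?thesis by (simp add: divide_ereal_def)
qed

text \<open>By rotation all unit vectors v give the same integral, and over the coordinate axes the
  squares (v . w)^2 add up to |w|^2; hence the mean of (v . w)^2 on a sphere is |w|^2 / n.\<close>

lemma integral_radial_inner_square:
  fixes f :: "real \<Rightarrow> real" and v :: "real ^ 'n::finite"
  assumes [measurable]: "f \<in> borel_measurable borel"
  and i: "integrable lborel (\<lambda>w::real ^ 'n. f (norm w) * (norm w)\<^sup>2)" and v: "norm v = 1"
  shows "integrable lborel (\<lambda>w. f (norm w) * (v \<bullet> w)\<^sup>2)"
  and "(LBINT w. f (norm w) * (v \<bullet> w)\<^sup>2) = (LBINT w::real ^ 'n. f (norm w) * (norm w)\<^sup>2) / real CARD('n)"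
proof -
  let ?J = "\<lambda>v :: real ^ 'n. LBINT w. f (norm w) * (v \<bullet> w)\<^sup>2"
  have int: "integrable lborel (\<lambda>w. f (norm w) * (v \<bullet> w)\<^sup>2)" if "norm v = 1" for v :: "real ^ 'n"
  proof (rule Bochner_Integration.integrable_bound[OF i])
  show "AE w in lborel. norm (f (norm w) * (v \<bullet> w)\<^sup>2) \<le> norm (f (norm w) * (norm w)\<^sup>2)"
  proof (rule AE_I2)
   fix w
   have "(v \<bullet> w)\<^sup>2 \<le> (norm w)\<^sup>2"
    using abs_le_square_iff[of "v \<bullet> w" "norm w"] Cauchy_Schwarz_ineq2[of v w] that by simp
   then show "norm (f (norm w) * (v \<bullet> w)\<^sup>2) \<le> norm (f (norm w) * (norm w)\<^sup>2)"
    by (simp add: abs_mult mult_left_mono)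
  qed
  qed measurable
  show "integrable lborel (\<lambda>w. f (norm w) * (v \<bullet> w)\<^sup>2)" using int[OF v] .
  have eqJ: "?J (axis i 1) = ?J v" for i :: 'n
  proof -
  obtain T :: "real ^ 'n \<Rightarrow> real ^ 'n" where T: "orthogonal_transformation T" "T v = axis i 1"
   using orthogonal_transformation_exists[of v "axis i 1 :: real ^ 'n"] v by auto
  have "?J (axis i 1) = (LBINT w. f (norm (T w)) * (T v \<bullet> T w)\<^sup>2)"
   using integral_orthogonal[OF T(1), of "\<lambda>w. f (norm w) * (T v \<bullet> w)\<^sup>2"] by (simp add: T(2))
  also have "\<dots> = ?J v"
   using T(1) unfolding orthogonal_transformation_norm[OF T(1)]
   by (simp only: orthogonal_transformation_def)
  finally show ?thesis .
  qed
  have "real CARD('n) * ?J v = (\<Sum>i\<in>(UNIV::'n set). ?J (axis i 1))"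
  by (simp add: eqJ)
  also have "\<dots> = (LBINT w::real ^ 'n. \<Sum>i\<in>(UNIV::'n set). f (norm w) * (axis i 1 \<bullet> w)\<^sup>2)"
  by (rule Bochner_Integration.integral_sum[symmetric]) (rule int, simp)
  also have "\<dots> = (LBINT w::real ^ 'n. f (norm w) * (norm w)\<^sup>2)"
  proof (rule Bochner_Integration.integral_cong)
  fix w :: "real ^ 'n"
  have "(norm w)\<^sup>2 = (\<Sum>i\<in>UNIV. w $ i * w $ i)"
   unfolding power2_norm_eq_inner inner_vec_def by simp
  then have "(norm w)\<^sup>2 = (\<Sum>i\<in>UNIV. (axis i 1 \<bullet> w)\<^sup>2)"
   by (simp only: inner_axis' power2_eq_square) simp
  then show "(\<Sum>i\<in>UNIV. f (norm w) * (axis i 1 \<bullet> w)\<^sup>2) = f (norm w) * (norm w)\<^sup>2"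
   by (simp add: sum_distrib_left)
  qed simp
  finally have eq: "real CARD('n) * ?J v = (LBINT w::real ^ 'n. f (norm w) * (norm w)\<^sup>2)" .
  have "?J v = (real CARD('n) * ?J v) / real CARD('n)"
  by (rule nonzero_mult_div_cancel_left[symmetric]) simp
  then show "?J v = (LBINT w::real ^ 'n. f (norm w) * (norm w)\<^sup>2) / real CARD('n)"
  by (simp only: eq)
qed

lemma has_derivative_kern:
  fixes z :: "'a::euclidean_space"
  assumes z: "z \<noteq> 0"
  shows "(kern \<beta> 0 has_derivative (\<lambda>w. norm z powr (- \<beta>) *\<^sub>R (w - (\<beta> * (z \<bullet> w) / (norm z)\<^sup>2) *\<^sub>R z))) (at z)"
proof -
  let ?a = "- \<beta> / 2"
  have nz: "0 < z \<bullet> z" using z by simp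
  have pw: "norm h powr (- \<beta>) = (h \<bullet> h) powr ?a" if "h \<noteq> 0" for h :: 'a
  proof -
  have "norm h powr (- \<beta>) = norm h powr (2 * ?a)" by simp
  also have "\<dots> = (norm h powr 2) powr ?a" by (simp only: powr_powr)
  also have "norm h powr 2 = h \<bullet> h" using that by (simp add: power2_norm_eq_inner)
  finally show ?thesis .
  qed
  have eq: "kern \<beta> 0 = (\<lambda>h::'a. (h \<bullet> h) powr ?a *\<^sub>R h)"
  proof
  show "kern \<beta> 0 h = (h \<bullet> h) powr ?a *\<^sub>R h" for h :: 'a
   using pw[of h] by (cases "h = 0") (simp_all add: kern_def)
  qed
  have "((\<lambda>h. h \<bullet> h) has_derivative (\<lambda>w. z \<bullet> w + w \<bullet> z)) (at z)"
  by (auto intro!: derivative_eq_intros)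
  moreover have "((\<lambda>r. r powr ?a) has_derivative (*) (?a * (z \<bullet> z) powr (?a - 1))) (at (z \<bullet> z))"
  using nz unfolding has_field_derivative_def[symmetric] by (auto intro!: derivative_eq_intros)
  ultimately have "((\<lambda>h. (h \<bullet> h) powr ?a) has_derivative (\<lambda>w. ?a * (z \<bullet> z) powr (?a - 1) * (z \<bullet> w + w \<bullet> z))) (at z)"
  by (rule has_derivative_compose)
  then have d: "(kern \<beta> 0 has_derivative (\<lambda>w. (z \<bullet> z) powr ?a *\<^sub>R w + (?a * (z \<bullet> z) powr (?a - 1) * (z \<bullet> w + w \<bullet> z)) *\<^sub>R z)) (at z)"
  unfolding eq by (rule has_derivative_scaleR) simp
  have "(z \<bullet> z) powr ?a *\<^sub>R w + (?a * (z \<bullet> z) powr (?a - 1) * (z \<bullet> w + w \<bullet> z)) *\<^sub>R z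
   = norm z powr (- \<beta>) *\<^sub>R (w - (\<beta> * (z \<bullet> w) / (norm z)\<^sup>2) *\<^sub>R z)" for w
  proof -
  have "(z \<bullet> z) powr (?a - 1) = (z \<bullet> z) powr ?a / (norm z)\<^sup>2"
   using nz by (simp add: powr_diff power2_norm_eq_inner)
  then show ?thesis
   unfolding pw[OF z] by (simp add: inner_commute[of w z] scaleR_diff_right)
  qed
  with d show ?thesis by simp
qed

text \<open>The reflection w -> -(w + z) exchanges the singularities 0 and -z, so a one-sided
  estimate near 0 transfers to -z.\<close>

lemma corr_reg_reflect:
  fixes z :: "'a::euclidean_space"
  assumes "tame \<beta> z k"
  shows "corr_reg k k z (- (w + z)) = corr_reg k k z w"
proof -
  have odd: "k (- u) = - k u" for u using assms by (simp add: tame_def)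
  have 1: "- (w + z) + z = - w" by simp
  have 2: "indicator (ball 0 r) (- u) = (indicator (ball 0 r) u :: real)" for r and u :: 'a
  by (simp add: indicator_def mem_ball_0 del: mem_ball)
  show ?thesis unfolding corr_reg_def 1 2 odd by (simp add: inner_commute)
qed

lemma integrable_corr_bound_away:
  fixes z :: "'a::euclidean_space"
  assumes \<beta>: "2 \<le> \<beta>" "real DIM('a) / 2 + 1 < \<beta>" and "z \<noteq> 0" and d: "0 < \<delta>" "\<delta> \<le> norm z / 2"
  shows "integrable lborel (\<lambda>w. if norm w < \<delta> \<or> norm (w + z) < \<delta> then 0 else corr_bound \<beta> z w)"
proof (rule integrableI_bounded)
  let ?r = "norm z / 2"
  let ?g = "\<lambda>w. if norm w < \<delta> \<or> norm (w + z) < \<delta> then 0 else corr_bound \<beta> z w"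
  define M where "M = (1 + \<beta>) * ?r powr (- \<beta>) * \<delta> powr (2 - \<beta>)"
  let ?f = "\<lambda>w::'a. ennreal (norm w powr (- (2 * \<beta> - 2))) * indicator (- ball 0 ?r) w + ennreal M * indicator (ball 0 ?r) w"
  have [measurable]: "ball (0::'a) ?r \<in> sets borel" by simp
  show "?g \<in> borel_measurable lborel" by measurable
  have pw: "x powr (2 - \<beta>) \<le> \<delta> powr (2 - \<beta>)" if "\<delta> \<le> x" for x
  using that \<beta> d by (intro powr_mono2') auto
  have "(LNINT w. ennreal (norm (?g w))) \<le> (LNINT w. ?f w + ?f (w + z))"
  proof (rule nn_integral_mono)
  fix w
  consider (0) "norm w < \<delta> \<or> norm (w + z) < \<delta>" | (a) "\<delta> \<le> norm w" "\<delta> \<le> norm (w + z)" "norm w < ?r"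
   | (b) "\<delta> \<le> norm w" "\<delta> \<le> norm (w + z)" "\<not> norm w < ?r" "norm (w + z) < ?r"
   | (c) "\<delta> \<le> norm w" "\<delta> \<le> norm (w + z)" "\<not> norm w < ?r" "\<not> norm (w + z) < ?r" by fastforce
  then show "ennreal (norm (?g w)) \<le> ?f w + ?f (w + z)"
  proof cases
   case a
   have "corr_bound \<beta> z w \<le> M" "0 \<le> corr_bound \<beta> z w"
    using a \<beta> pw by (auto simp: corr_bound_def M_def intro!: mult_left_mono)
   then have "ennreal (norm (?g w)) \<le> ennreal M" using a by (auto intro!: ennreal_leI)
   also have "\<dots> \<le> ?f w" using a by simp
   also have "\<dots> \<le> ?f w + ?f (w + z)" by simp
   finally show ?thesis .
  next
   case b
   have "corr_bound \<beta> z w \<le> M" "0 \<le> corr_bound \<beta> z w"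
    using b \<beta> pw by (auto simp: corr_bound_def M_def intro!: mult_left_mono)
   then have "ennreal (norm (?g w)) \<le> ennreal M" using b by (auto intro!: ennreal_leI)
   also have "\<dots> \<le> ?f (w + z)" using b by simp
   also have "\<dots> \<le> ?f w + ?f (w + z)" by simp
   finally show ?thesis .
  next
   case c
   then show ?thesis by (simp add: corr_bound_def)
  qed simp
  qed
  also have "\<dots> = (LNINT w. ?f w) + (LNINT w. ?f w)"
  using nn_integral_shift[of ?f z] by (subst nn_integral_add) auto
  also have "\<dots> < \<infinity>"
  proof -
  have "2 * \<beta> - 2 > real DIM('a)" "0 < ?r" using \<beta> d by auto
  then have "(LNINT w. ?f w) < \<infinity>"
   by (subst nn_integral_add)
    (auto simp: nn_integral_norm_powr_out[OF \<open>2 * \<beta> - 2 > real DIM('a)\<close> \<open>0 < ?r\<close>] nn_integral_cmult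
     ennreal_mult_less_top emeasure_lborel_ball_finite[unfolded infinity_ennreal_def] simp del: minus_diff_eq)
  then show ?thesis by simp
  qed
  finally show "(LNINT w. ennreal (norm (?g w))) < \<infinity>" .
qed

text \<open>Near w = 0 a first-order expansion of K at z turns the regularised integrand into
  |w|^(-\<beta>) w . DK(z) w up to a small error. The spherical mean of this quadratic form is
  |z|^(-\<beta>) (1 - \<beta>/n) |w|^2, which is negative, and for \<beta> \<ge> n + 2 the factor
  |w|^(2-\<beta>) is at least |w|^(-n) on the unit ball. So the correlation tends to -\<infinity> at
  least logarithmically as \<epsilon> tends to 0.\<close>

lemma corr_cutk_le:
  fixes z :: "real ^ 'n::finite"
  assumes \<beta>: "real CARD('n) + 2 \<le> \<beta>" and z: "z \<noteq> 0"
  obtains C c \<delta> where "0 < c" "0 < \<delta>"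
  "\<And>\<epsilon> R. 0 < \<epsilon> \<Longrightarrow> 4 * \<epsilon> < \<delta> \<Longrightarrow> 2 * norm z \<le> R \<Longrightarrow>
   corr (cutk \<beta> \<epsilon> R) (cutk \<beta> \<epsilon> R) z \<le> C - c * ln (\<delta> / (4 * \<epsilon>))"
proof -
  let ?n = "real CARD('n)" and ?w = "sphere_area TYPE(real ^ 'n)"
  have n: "1 \<le> ?n" by (simp add: Suc_leI)
  have \<beta>2: "2 \<le> \<beta>" "?n < \<beta>" "?n / 2 + 1 < \<beta>" using \<beta> n by auto
  \<comment> \<open>Half of the absolute value of the coefficient of |w|^2 in the spherical mean: an
    expansion error of at most e |w|^2 still leaves -e |w|^2.\<close>
  define e where "e = norm z powr (- \<beta>) * (\<beta> / ?n - 1) / 2"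
  have e: "0 < e" using z \<beta>2 n by (auto simp: e_def intro!: divide_pos_pos mult_pos_pos simp: field_simps)
  let ?D = "\<lambda>w. norm z powr (- \<beta>) *\<^sub>R (w - (\<beta> * (z \<bullet> w) / (norm z)\<^sup>2) *\<^sub>R z)"
  obtain d where d: "0 < d" "\<And>y. norm (y - z) < d \<Longrightarrow> norm (kern \<beta> 0 y - kern \<beta> 0 z - ?D (y - z)) \<le> e * norm (y - z)"
  using has_derivative_kern[OF z, of \<beta>] e unfolding has_derivative_at_alt by meson
  define \<delta> where "\<delta> = min d (min (norm z / 2) 1)"
  have \<delta>: "0 < \<delta>" "\<delta> \<le> d" "\<delta> \<le> norm z / 2" "\<delta> \<le> 1" using d z by (auto simp: \<delta>_def)
  define g where "g w = (if norm w < \<delta> \<or> norm (w + z) < \<delta> then 0 else corr_bound \<beta> z w)" for w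
  have ig: "integrable lborel g"
  unfolding g_def[abs_def] using \<beta>2 z \<delta> by (intro integrable_corr_bound_away) auto
  define C where "C = (LBINT w. g w)"
  show thesis
  proof (rule that)
  \<comment> \<open>The factor 2 counts the two singularities 0 and -z, which contribute
    equally.\<close>
  show "0 < 2 * e * ?w" "0 < \<delta>" using e \<delta> sphere_area_pos[where 'a="real ^ 'n"] by auto
  fix \<epsilon> R assume \<epsilon>: "0 < \<epsilon>" "4 * \<epsilon> < \<delta>" and R: "2 * norm z \<le> R"
  let ?k = "cutk \<beta> \<epsilon> R :: real ^ 'n \<Rightarrow> real ^ 'n"
  have t: "tame \<beta> z ?k" using \<epsilon> R \<beta>2 \<delta> by (intro tame_cutk) auto
  have \<beta>0: "0 \<le> \<beta>" using \<beta>2 by simp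
  note reg = corr_eq_reg[OF t norm_cutk_le_const[OF \<beta>0 \<epsilon>(1)] t norm_cutk_le_const[OF \<beta>0 \<epsilon>(1)] integrable_corr_cutk[OF \<beta>0 \<epsilon>(1)]]
  define F where "F r = (if \<epsilon> < r \<and> r < \<delta> then r powr (- \<beta>) else 0)" for r :: real
  have [measurable]: "F \<in> borel_measurable borel" unfolding F_def[abs_def] by measurable
  have F0: "0 \<le> F r" "F r \<le> \<epsilon> powr (- \<beta>)" for r
   using \<epsilon> \<beta>0 by (auto simp: F_def intro!: powr_mono2')
  have iF: "integrable lborel (\<lambda>w::real ^ 'n. F (norm w) * (norm w)\<^sup>2)"
  proof (rule integrable_bounded_ball[where r=\<delta> and b="\<epsilon> powr (- \<beta>) * \<delta>\<^sup>2"])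
   show "norm (F (norm w) * (norm w)\<^sup>2) \<le> \<epsilon> powr (- \<beta>) * \<delta>\<^sup>2" for w :: "real ^ 'n"
   proof (cases "norm w < \<delta>")
    case True
    then show ?thesis using F0[of "norm w"] by (auto simp: abs_mult intro!: mult_mono power_mono)
   qed (simp add: F_def)
  qed (auto simp: F_def split: if_splits)
  define M where "M = (LBINT w::real ^ 'n. F (norm w) * (norm w)\<^sup>2)"
  have vz: "norm (z /\<^sub>R norm z) = 1" using z by simp
  note iso = integral_radial_inner_square[OF _ iF vz, unfolded M_def[symmetric]]
  \<comment> \<open>The radial weight F times the quadratic form w . DK(z) w, enlarged by the
    admissible expansion error e |w|^2; it bounds the regularised integrand from above on the ball
    of radius \<delta>.\<close>
  define u where "u w = norm z powr (- \<beta>) * (F (norm w) * (norm w)\<^sup>2 - \<beta> * (F (norm w) * ((z /\<^sub>R norm z) \<bullet> w)\<^sup>2))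
   + e * (F (norm w) * (norm w)\<^sup>2)" for w
  have iu: "integrable lborel u" unfolding u_def[abs_def] using iF iso by auto
  have "(LBINT w. u w) = norm z powr (- \<beta>) * (M - \<beta> * (M / ?n)) + e * M"
   unfolding u_def using iF iso by (simp add: M_def)
  also have "\<dots> = - e * M" by (simp add: e_def field_simps)
  finally have Iu: "(LBINT w. u w) = - e * M" .
  \<comment> \<open>The closed shell from 2\<epsilon> to \<delta>/2 fits inside the open range of F;
    the two factors 2 produce the 4 in the logarithm.\<close>
  have "ennreal (?w * ln (\<delta> / 2 / (2 * \<epsilon>))) \<le> (LNINT x. (\<lambda>r. ennreal (F r * r\<^sup>2)) (norm (x :: real ^ 'n)))"
  proof (rule nn_integral_norm_ge_inverse)
   fix s assume s: "2 * \<epsilon> \<le> s" "s \<le> \<delta> / 2"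
   have "s powr (- real DIM(real ^ 'n)) \<le> s powr (- \<beta> + 2)"
    using s \<epsilon> \<delta> \<beta> by (intro powr_mono') auto
   also have "\<dots> = s powr (- \<beta>) * s\<^sup>2" using s \<epsilon> by (subst powr_add) simp
   also have "\<dots> = F s * s\<^sup>2" using s \<epsilon> \<delta> by (simp add: F_def)
   finally show "ennreal (s powr (- real DIM(real ^ 'n))) \<le> ennreal (F s * s\<^sup>2)" by (rule ennreal_leI)
  qed (use \<epsilon> in auto)
  then have M: "?w * ln (\<delta> / (4 * \<epsilon>)) \<le> M"
   unfolding M_def using iF F0 by (intro integral_ge_of_nn_integral) (auto simp: field_simps)
  have near: "corr_reg ?k ?k z w \<le> u w" if w: "norm w < \<delta>" for w
  proof -
   have wz: "norm w < norm z / 2" using w \<delta> by linarith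
   have "norm z / 2 < norm (w + z)" by (rule norm_add_gt_half[OF wz])
   moreover have "norm (w + z) < R" using norm_triangle_ineq[of w z] wz R norm_ge_zero[of w] by linarith
   moreover have "norm z < R" using R z zero_less_norm_iff[of z] by linarith
   ultimately have k: "?k (w + z) = kern \<beta> 0 (w + z)" "?k z = kern \<beta> 0 z" "\<not> norm (w + z) < norm z / 2"
    using \<epsilon> \<delta> by (auto simp: cutk_def)
   then have eq: "corr_reg ?k ?k z w = ?k w \<bullet> (kern \<beta> 0 (w + z) - kern \<beta> 0 z)"
    using wz by (simp add: corr_reg_def inner_diff_right)
   show ?thesis
   proof (cases "\<epsilon> < norm w")
    case False
    then show ?thesis by (simp add: eq cutk_def u_def F_def)
   next
    case True
    have "norm w < R" using wz R norm_ge_zero[of z] norm_ge_zero[of w] by linarith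
    then have kw: "?k w = F (norm w) *\<^sub>R w" using True w by (simp add: cutk_def F_def kern_def)
    define err where "err = kern \<beta> 0 (w + z) - kern \<beta> 0 z - ?D w"
    have "norm err \<le> e * norm w" using d(2)[of "w + z"] w \<delta> by (simp add: err_def)
    then have "w \<bullet> err \<le> norm w * (e * norm w)"
     using Cauchy_Schwarz_ineq2[of w err] mult_left_mono[of "norm err" "e * norm w" "norm w"] by simp
    moreover have "w \<bullet> ?D w = norm z powr (- \<beta>) * ((norm w)\<^sup>2 - \<beta> * ((z /\<^sub>R norm z) \<bullet> w)\<^sup>2)"
     by (simp add: inner_diff_right power2_norm_eq_inner[symmetric] inner_commute[of w z] power2_eq_square divide_inverse mult_ac)
    moreover have "w \<bullet> (kern \<beta> 0 (w + z) - kern \<beta> 0 z) = w \<bullet> ?D w + w \<bullet> err"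
     unfolding inner_add_right[symmetric] err_def by (rule arg_cong) simp
    moreover have "norm w * (e * norm w) = e * (norm w)\<^sup>2" by (simp add: power2_eq_square)
    ultimately have "w \<bullet> (kern \<beta> 0 (w + z) - kern \<beta> 0 z)
      \<le> norm z powr (- \<beta>) * ((norm w)\<^sup>2 - \<beta> * ((z /\<^sub>R norm z) \<bullet> w)\<^sup>2) + e * (norm w)\<^sup>2"
     by linarith
    then have "corr_reg ?k ?k z w \<le> F (norm w) * (norm z powr (- \<beta>) * ((norm w)\<^sup>2 - \<beta> * ((z /\<^sub>R norm z) \<bullet> w)\<^sup>2) + e * (norm w)\<^sup>2)"
     unfolding eq kw inner_scaleR_left using F0(1) by (intro mult_left_mono) auto
    also have "\<dots> = u w" by (simp add: u_def algebra_simps)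
    finally show ?thesis .
   qed
  qed
  have u0: "u w = 0" if "\<not> norm w < \<delta>" for w using that by (simp add: u_def F_def)
  have le: "corr_reg ?k ?k z w \<le> u w + u (w + z) + g w" for w
  proof -
   consider (a) "norm w < \<delta>" | (b) "\<not> norm w < \<delta>" "norm (w + z) < \<delta>" | (c) "\<not> norm w < \<delta>" "\<not> norm (w + z) < \<delta>" by blast
   then show ?thesis
   proof cases
    case a
    then have "\<not> norm (w + z) < \<delta>" using norm_add_gt_half[of w z] \<delta> by linarith
    then show ?thesis using near[OF a] a by (simp add: u0 g_def)
   next
    case b
    have "corr_reg ?k ?k z w \<le> u (- (w + z))"
     using near[of "- (w + z)"] b(2) unfolding corr_reg_reflect[OF t] norm_minus_cancel by blast
    also have "u (- (w + z)) = u (w + z)"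
     unfolding u_def norm_minus_cancel inner_minus_right by simp
    finally show ?thesis using b by (simp add: u0 g_def)
   next
    case c
    then show ?thesis using corr_reg_le[OF t t \<beta>0, of w] by (simp add: u0 g_def)
   qed
  qed
  note ius = integrable_shift[OF iu, of z]
  have "corr ?k ?k z \<le> (LBINT w. u w + u (w + z) + g w)"
   unfolding reg(2) using reg(1) iu ius ig le by (intro integral_mono) auto
  also have "\<dots> = - e * M + - e * M + C"
   using iu ius ig integral_shift[of u z] borel_measurable_integrable[OF iu] by (simp add: Iu C_def)
  also have "\<dots> \<le> C - 2 * e * ?w * ln (\<delta> / (4 * \<epsilon>))"
   using mult_left_mono[OF M, of "2 * e"] e by (simp add: algebra_simps)
  finally show "corr ?k ?k z \<le> C - 2 * e * ?w * ln (\<delta> / (4 * \<epsilon>))" .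
  qed
qed

lemma gamma_eq_infinity:
  fixes x y :: "real ^ 'n::finite"
  assumes eta: "\<And>a b. eta \<omega> \<alpha> a b = kern \<beta> 0 (b - a)"
  and \<beta>: "real CARD('n) + 2 \<le> \<beta>" and "x \<noteq> y"
  shows "gamma_eq \<omega> \<alpha> x y = \<infinity>"
proof -
  let ?z = "x - y"
  obtain C c \<delta> where c: "0 < c" "0 < \<delta>"
  "\<And>\<epsilon> R. 0 < \<epsilon> \<Longrightarrow> 4 * \<epsilon> < \<delta> \<Longrightarrow> 2 * norm ?z \<le> R \<Longrightarrow>
   corr (cutk \<beta> \<epsilon> R) (cutk \<beta> \<epsilon> R) ?z \<le> C - c * ln (\<delta> / (4 * \<epsilon>))"
  proof (rule corr_cutk_le[of \<beta> ?z])
  show "real CARD('n) + 2 \<le> \<beta>" "?z \<noteq> 0" using \<beta> \<open>x \<noteq> y\<close> by auto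
  qed (use that in blast)
  have "((\<lambda>p. ereal (- (case p of (\<epsilon>, R) \<Rightarrow> corr (cutk \<beta> \<epsilon> R) (cutk \<beta> \<epsilon> R) ?z))) \<longlongrightarrow> \<infinity>) pv_filter"
  unfolding tendsto_PInfty
  proof
  fix r :: real
  let ?E = "exp ((\<bar>r\<bar> + \<bar>C\<bar> + 1) / c)"
  show "eventually (\<lambda>p. ereal r < ereal (- (case p of (\<epsilon>, R) \<Rightarrow> corr (cutk \<beta> \<epsilon> R) (cutk \<beta> \<epsilon> R) ?z))) pv_filter"
  proof (rule eventually_pv_filter[of "\<delta> / (4 * ?E)" "2 * norm ?z"])
   fix \<epsilon> R assume \<epsilon>: "0 < \<epsilon>" "\<epsilon> < \<delta> / (4 * ?E)" and R: "2 * norm ?z \<le> R"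
   have E: "1 \<le> ?E" using c by simp
   have eE: "4 * \<epsilon> * ?E < \<delta>" using \<epsilon> by (simp add: field_simps)
   have "4 * \<epsilon> * 1 \<le> 4 * \<epsilon> * ?E" using E \<epsilon> by (intro mult_left_mono) auto
   with eE have 1: "4 * \<epsilon> < \<delta>" by linarith
   have "?E \<le> \<delta> / (4 * \<epsilon>)" using eE \<epsilon> by (simp add: field_simps)
   then have "(\<bar>r\<bar> + \<bar>C\<bar> + 1) / c \<le> ln (\<delta> / (4 * \<epsilon>))"
    by (metis exp_gt_zero ln_exp ln_mono order_less_le_trans)
   then have "\<bar>r\<bar> + \<bar>C\<bar> + 1 \<le> c * ln (\<delta> / (4 * \<epsilon>))" using c by (simp add: field_simps)
   with c(3)[OF \<epsilon>(1) 1 R] show "ereal r < ereal (- (case (\<epsilon>, R) of (\<epsilon>, R) \<Rightarrow> corr (cutk \<beta> \<epsilon> R) (cutk \<beta> \<epsilon> R) ?z))" by simp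
  qed (use c in simp)
  qed
  then have "gamma_eq \<omega> \<alpha> x y = \<infinity> / 2"
  using \<beta> by (intro gamma_eq_eqI[OF eta]) (auto simp: case_prod_unfold)
  then show ?thesis by (simp add: divide_ereal_def)
qed

section \<open>Convolutions of square integrable functions with compact support\<close>

lemma integrable_inner_shift:
  fixes F G :: "'a::euclidean_space \<Rightarrow> 'b::euclidean_space"
  assumes F: "integrable lborel F" and G: "integrable lborel G"
  shows "integrable (lborel \<Otimes>\<^sub>M lborel) (\<lambda>(y, z). F y \<bullet> G (y + z))"
  and "integral\<^sup>L (lborel \<Otimes>\<^sub>M lborel) (\<lambda>(y, z). F y \<bullet> G (y + z)) = integral\<^sup>L lborel F \<bullet> integral\<^sup>L lborel G"
  and "integrable lborel (\<lambda>z. LBINT y. F y \<bullet> G (y + z))"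
  and "(LBINT z. LBINT y. F y \<bullet> G (y + z)) = integral\<^sup>L lborel F \<bullet> integral\<^sup>L lborel G"
proof -
  have [measurable]: "F \<in> borel_measurable borel" "G \<in> borel_measurable borel"
  using F G by auto
  have Gs: "(LNINT z. ennreal (norm (G (y + z)))) = (LNINT z. ennreal (norm (G z)))" for y
  using nn_integral_shift[of "\<lambda>z. ennreal (norm (G z))" y] by (simp add: add.commute)
  show i: "integrable (lborel \<Otimes>\<^sub>M lborel) (\<lambda>(y, z). F y \<bullet> G (y + z))"
  proof (rule integrableI_bounded)
  have "(\<integral>\<^sup>+p. ennreal (norm (case p of (y, z) \<Rightarrow> F y \<bullet> G (y + z))) \<partial>(lborel \<Otimes>\<^sub>M lborel))
    = (LNINT y. (LNINT z. ennreal (norm (F y \<bullet> G (y + z)))))"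
   by (subst lborel.nn_integral_fst[symmetric]) (auto simp: split_beta')
  also have "\<dots> \<le> (LNINT y. (LNINT z. ennreal (norm (F y)) * ennreal (norm (G (y + z)))))"
   by (intro nn_integral_mono) (auto simp: ennreal_mult'[symmetric] intro!: ennreal_leI Cauchy_Schwarz_ineq2)
  also have "\<dots> = (LNINT y. ennreal (norm (F y))) * (LNINT z. ennreal (norm (G z)))"
   by (simp add: nn_integral_cmult Gs nn_integral_multc)
  also have "\<dots> < \<infinity>"
   using F G by (auto simp: integrable_iff_bounded ennreal_mult_less_top)
  finally show "(\<integral>\<^sup>+p. ennreal (norm (case p of (y, z) \<Rightarrow> F y \<bullet> G (y + z))) \<partial>(lborel \<Otimes>\<^sub>M lborel)) < \<infinity>" .
  qed simp
  have eq: "(LBINT z. F y \<bullet> G (y + z)) = F y \<bullet> integral\<^sup>L lborel G" for y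
  proof -
  have "integrable lborel (\<lambda>z. G (y + z))" "(LBINT z. G (y + z)) = integral\<^sup>L lborel G"
   using integrable_shift[OF G, of y] integral_shift[of G y] by (simp_all add: add.commute)
  then show ?thesis using integral_inner_right by metis
  qed
  have "integral\<^sup>L (lborel \<Otimes>\<^sub>M lborel) (\<lambda>(y, z). F y \<bullet> G (y + z)) = (LBINT y. LBINT z. F y \<bullet> G (y + z))"
  using lborel_pair.integral_fst'[OF i] by simp
  also have "\<dots> = integral\<^sup>L lborel F \<bullet> integral\<^sup>L lborel G"
  unfolding eq using F by simp
  finally show 2: "integral\<^sup>L (lborel \<Otimes>\<^sub>M lborel) (\<lambda>(y, z). F y \<bullet> G (y + z)) = integral\<^sup>L lborel F \<bullet> integral\<^sup>L lborel G" .
  show "integrable lborel (\<lambda>z. LBINT y. F y \<bullet> G (y + z))"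
  using lborel_pair.integrable_snd[OF i] by simp
  show "(LBINT z. LBINT y. F y \<bullet> G (y + z)) = integral\<^sup>L lborel F \<bullet> integral\<^sup>L lborel G"
  using lborel_pair.integral_snd[OF i] 2 by simp
qed

text \<open>The orientation k (y - x) is that of the nonlocal gradient. Its term with u x is missing
  because an odd integrable kernel has integral 0.\<close>

definition conv :: "('a::euclidean_space \<Rightarrow> 'a) \<Rightarrow> ('a \<Rightarrow> real) \<Rightarrow> 'a \<Rightarrow> 'a" where
  "conv k u x = (LBINT y. u y *\<^sub>R k (y - x))"

definition autocorr :: "('a::euclidean_space \<Rightarrow> real) \<Rightarrow> 'a \<Rightarrow> real" where
  "autocorr u z = (LBINT y. u y * u (y + z))"

text \<open>The mean squared difference of u and its translate. Integrated against a kernel k z it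
  gives the double integral of (u y - u x)^2 k (y - x), hence the energy.\<close>

definition msd :: "('a::euclidean_space \<Rightarrow> real) \<Rightarrow> 'a \<Rightarrow> real" where
  "msd u z = (LBINT y. (u (y + z) - u y)\<^sup>2)"

text \<open>Vanishing outside the ball is demanded everywhere and not just almost everywhere, so
  that support arguments for translates and correlations hold pointwise.\<close>

definition L2c :: "real \<Rightarrow> ('a::euclidean_space \<Rightarrow> real) \<Rightarrow> bool" where
  "L2c r u \<longleftrightarrow> 0 < r \<and> u \<in> borel_measurable borel \<and> (\<forall>x. r \<le> norm x \<longrightarrow> u x = 0) \<and> integrable lborel (\<lambda>x. (u x)\<^sup>2)"

lemma L2c_measurable: "L2c r u \<Longrightarrow> u \<in> borel_measurable borel"
  by (simp add: L2c_def)

lemma integrable_indicator_ball: "integrable lborel (\<lambda>x::'a::euclidean_space. indicator (ball c r) x :: real)"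
  by (intro integrable_real_indicator) (auto simp: emeasure_lborel_ball_finite[unfolded infinity_ennreal_def])

lemma L2c_integrable:
  assumes "L2c r u" shows "integrable lborel u"
proof (rule Bochner_Integration.integrable_bound)
  show "integrable lborel (\<lambda>x. (u x)\<^sup>2 + indicator (ball 0 r) x)"
  using assms integrable_indicator_ball[of 0 r] unfolding L2c_def by (intro Bochner_Integration.integrable_add) auto
  have "\<bar>u x\<bar> \<le> (u x)\<^sup>2 + 1" for x
  proof -
  have "0 \<le> (\<bar>u x\<bar> - 1 / 2)\<^sup>2" by simp
  also have "\<dots> = (u x)\<^sup>2 - \<bar>u x\<bar> + 1 / 4" by (simp add: power2_diff power2_eq_square[of "1 / 2"])
  finally show ?thesis by linarith
  qed
  then show "AE x in lborel. norm (u x) \<le> norm ((u x)\<^sup>2 + indicator (ball 0 r) x)"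
  using assms by (intro AE_I2) (auto simp: L2c_def indicator_def)
qed (use assms in \<open>simp add: L2c_def\<close>)

lemma L2c_shift_prod_integrable:
  assumes u: "L2c r u"
  shows "integrable lborel (\<lambda>y. u y * u (y + z))" "integrable lborel (\<lambda>y. (u (y + z))\<^sup>2)"
  "(LBINT y. (u (y + z))\<^sup>2) = (LBINT y. (u y)\<^sup>2)"
proof -
  have [measurable]: "u \<in> borel_measurable borel" and i: "integrable lborel (\<lambda>x. (u x)\<^sup>2)"
  using u by (auto simp: L2c_def)
  show s: "integrable lborel (\<lambda>y. (u (y + z))\<^sup>2)"
  using integrable_shift[OF i] .
  show "integrable lborel (\<lambda>y. u y * u (y + z))"
  using integrable_inner_L2[of u lborel "\<lambda>y. u (y + z)"] i s by simp
  show "(LBINT y. (u (y + z))\<^sup>2) = (LBINT y. (u y)\<^sup>2)"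
  using integral_shift[of "\<lambda>y. (u y)\<^sup>2" z] by simp
qed

lemma msd_integrable:
  assumes "L2c r u" shows "integrable lborel (\<lambda>y. (u (y + z) - u y)\<^sup>2)"
proof -
  have "(u (y + z) - u y)\<^sup>2 = (u (y + z))\<^sup>2 + (u y)\<^sup>2 - 2 * (u y * u (y + z))" for y
  by (simp add: power2_diff mult_ac)
  then show ?thesis
  using L2c_shift_prod_integrable[OF assms, of z] assms by (simp add: L2c_def)
qed

lemma msd_eq: 
  assumes u: "L2c r u"
  shows "msd u z = 2 * (LBINT y. (u y)\<^sup>2) - 2 * autocorr u z"
proof -
  have "msd u z = (LBINT y. (u (y + z))\<^sup>2 + (u y)\<^sup>2 - 2 * (u y * u (y + z)))"
  unfolding msd_def by (simp add: power2_diff mult_ac)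
  also have "\<dots> = (LBINT y. (u (y + z))\<^sup>2) + (LBINT y. (u y)\<^sup>2) - 2 * (LBINT y. u y * u (y + z))"
  using L2c_shift_prod_integrable[OF u, of z] u by (simp add: L2c_def)
  finally show ?thesis using L2c_shift_prod_integrable(3)[OF u, of z] by (simp add: autocorr_def)
qed

lemma msd_nonneg: "0 \<le> msd u z"
  by (simp add: msd_def)

lemma abs_autocorr_le:
  assumes u: "L2c r u" shows "\<bar>autocorr u z\<bar> \<le> (LBINT y. (u y)\<^sup>2)"
proof -
  have "(LBINT y. (u (y + z) + u y)\<^sup>2) = (LBINT y. (u (y + z))\<^sup>2 + (u y)\<^sup>2 + 2 * (u y * u (y + z)))"
  by (simp add: power2_sum mult_ac)
  also have "\<dots> = (LBINT y. (u (y + z))\<^sup>2) + (LBINT y. (u y)\<^sup>2) + 2 * (LBINT y. u y * u (y + z))"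
  using L2c_shift_prod_integrable[OF u, of z] u by (simp add: L2c_def)
  moreover have "0 \<le> (LBINT y. (u (y + z) + u y)\<^sup>2)" by simp
  ultimately have "0 \<le> (LBINT y. (u (y + z))\<^sup>2) + (LBINT y. (u y)\<^sup>2) + 2 * autocorr u z"
  unfolding autocorr_def by linarith
  with msd_eq[OF u, of z] msd_nonneg[of u z] L2c_shift_prod_integrable(3)[OF u, of z]
  show ?thesis by simp
qed

lemma msd_le: "L2c r u \<Longrightarrow> msd u z \<le> 4 * (LBINT y. (u y)\<^sup>2)"
  using abs_autocorr_le[of r u z] msd_eq[of r u z] by linarith

lemma autocorr_eq_0:
  assumes "L2c r u" "2 * r \<le> norm z" shows "autocorr u z = 0"
proof -
  have "u y * u (y + z) = 0" for y
  proof (cases "norm y < r")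
  case True
  then have "r \<le> norm (y + z)" using assms norm_diff_ineq[of z y] by (simp add: add.commute)
  then show ?thesis using assms by (simp add: L2c_def)
  qed (use assms in \<open>simp add: L2c_def\<close>)
  then show ?thesis unfolding autocorr_def by (simp only: Bochner_Integration.integral_zero)
qed

lemma measurable_autocorr [measurable (raw)]:
  fixes u :: "'a::euclidean_space \<Rightarrow> real"
  assumes [measurable]: "u \<in> borel_measurable borel" shows "autocorr u \<in> borel_measurable borel"
  unfolding autocorr_def[abs_def] by (rule lborel.borel_measurable_lebesgue_integral) measurable

lemma measurable_msd [measurable (raw)]:
  fixes u :: "'a::euclidean_space \<Rightarrow> real"
  assumes [measurable]: "u \<in> borel_measurable borel" shows "msd u \<in> borel_measurable borel"
  unfolding msd_def[abs_def] by (rule lborel.borel_measurable_lebesgue_integral) measurable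

lemma measurable_corr [measurable (raw)]:
  fixes k k' :: "'a::euclidean_space \<Rightarrow> 'a"
  assumes [measurable]: "k \<in> borel_measurable borel" "k' \<in> borel_measurable borel"
  shows "corr k k' \<in> borel_measurable borel"
  unfolding corr_def[abs_def] by (rule lborel.borel_measurable_lebesgue_integral) measurable

lemma measurable_conv [measurable (raw)]:
  fixes k :: "'a::euclidean_space \<Rightarrow> 'a"
  assumes [measurable]: "k \<in> borel_measurable borel" "u \<in> borel_measurable borel"
  shows "conv k u \<in> borel_measurable borel"
  unfolding conv_def[abs_def] by (rule lborel.borel_measurable_lebesgue_integral) measurable

lemma integrable_conv:
  fixes k :: "'a::euclidean_space \<Rightarrow> 'a"
  assumes u: "integrable lborel u" and [measurable]: "k \<in> borel_measurable borel" and b: "\<And>w. norm (k w) \<le> b"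
  shows "integrable lborel (\<lambda>y. u y *\<^sub>R k (y - x))"
proof (rule Bochner_Integration.integrable_bound)
  have [measurable]: "u \<in> borel_measurable borel" using u by auto
  show "(\<lambda>y. u y *\<^sub>R k (y - x)) \<in> borel_measurable lborel" by measurable
  show "integrable lborel (\<lambda>y. b * u y)" using u by simp
  have "0 \<le> b" using b[of 0] norm_ge_zero order_trans by blast
  then show "AE y in lborel. norm (u y *\<^sub>R k (y - x)) \<le> norm (b * u y)"
  using b by (intro AE_I2) (auto simp: abs_mult mult.commute[of "\<bar>u _\<bar>"] intro!: mult_right_mono)
qed

text \<open>The expanded square is a triple integral. Integrating over the two points where u is
  evaluated returns |conv k u x|^2, while integrating over x first returns the correlation of k;
  Fubini identifies the two. Absolute convergence follows from |a . b| \<le> |a|^2 + |b|^2 and the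
  square integrability of k.\<close>

lemma conv_square:
  fixes k :: "'a::euclidean_space \<Rightarrow> 'a"
  assumes u: "integrable lborel u" and k[measurable]: "k \<in> borel_measurable borel" and b: "\<And>w. norm (k w) \<le> b"
  and k2: "integrable lborel (\<lambda>w. (norm (k w))\<^sup>2)"
  shows "integrable lborel (\<lambda>x. (norm (conv k u x))\<^sup>2)"
  and "integrable lborel (\<lambda>z. autocorr u z * corr k k z)"
  and "(LBINT x. (norm (conv k u x))\<^sup>2) = (LBINT z. autocorr u z * corr k k z)"
proof -
  let ?M2 = "lborel \<Otimes>\<^sub>M lborel :: ('a \<times> 'a) measure"
  have [measurable]: "u \<in> borel_measurable borel" using u by auto
  have M2: "sigma_finite_measure ?M2" by (simp add: lborel_prod sigma_finite_lborel)
  interpret M2: sigma_finite_measure ?M2 by (rule M2)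
  interpret Q: pair_sigma_finite "lborel :: 'a measure" ?M2
  by (intro pair_sigma_finite.intro sigma_finite_lborel M2)
  define h where "h = (\<lambda>(x, y, z). (u y *\<^sub>R k (y - x)) \<bullet> (u (y + z) *\<^sub>R k (y + z - x)))"
  have [measurable]: "h \<in> borel_measurable (lborel \<Otimes>\<^sub>M ?M2)" unfolding h_def by measurable
  have K: "(LNINT x. ennreal ((norm (k (a - x)))\<^sup>2)) = (LNINT x. ennreal ((norm (k x))\<^sup>2))" for a
  using nn_integral_reflect[of "\<lambda>x. ennreal ((norm (k x))\<^sup>2)" a] by simp
  let ?N = "\<integral>\<^sup>+x. ennreal ((norm (k x))\<^sup>2) \<partial>lborel"
  have N: "?N < \<infinity>" using k2 by (auto simp: integrable_iff_bounded)
  have us: "(LNINT z. ennreal \<bar>u (y + z)\<bar>) = (LNINT z. ennreal \<bar>u z\<bar>)" for y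
  using nn_integral_shift[of "\<lambda>z. ennreal \<bar>u z\<bar>" y] by (simp add: add.commute)
  have ih: "integrable (lborel \<Otimes>\<^sub>M ?M2) h"
  proof (rule integrableI_bounded)
  have "(\<integral>\<^sup>+p. ennreal (norm (h p)) \<partial>(lborel \<Otimes>\<^sub>M ?M2)) = (\<integral>\<^sup>+q. (LNINT x. ennreal (norm (h (x, q)))) \<partial>?M2)"
   by (subst Q.nn_integral_snd[symmetric]) auto
  also have "\<dots> \<le> (\<integral>\<^sup>+q. ennreal (\<bar>u (fst q)\<bar> * \<bar>u (fst q + snd q)\<bar>) * (?N + ?N) \<partial>?M2)"
  proof (rule nn_integral_mono)
   fix q :: "'a \<times> 'a"
   obtain y z where q: "q = (y, z)" by (cases q)
   have "(LNINT x. ennreal (norm (h (x, q))))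
     \<le> (LNINT x. ennreal (\<bar>u y\<bar> * \<bar>u (y + z)\<bar>) * (ennreal ((norm (k (y - x)))\<^sup>2) + ennreal ((norm (k (y + z - x)))\<^sup>2)))"
   proof (rule nn_integral_mono)
    fix x
    have "norm (h (x, q)) = \<bar>u y\<bar> * \<bar>u (y + z)\<bar> * \<bar>k (y - x) \<bullet> k (y + z - x)\<bar>"
     by (simp add: q h_def abs_mult)
    also have "\<dots> \<le> \<bar>u y\<bar> * \<bar>u (y + z)\<bar> * ((norm (k (y - x)))\<^sup>2 + (norm (k (y + z - x)))\<^sup>2)"
     by (intro mult_left_mono inner_le_sum_squares) auto
    finally show "ennreal (norm (h (x, q))) \<le> ennreal (\<bar>u y\<bar> * \<bar>u (y + z)\<bar>) * (ennreal ((norm (k (y - x)))\<^sup>2) + ennreal ((norm (k (y + z - x)))\<^sup>2))"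
     by (simp add: ennreal_leI ennreal_plus[symmetric] ennreal_mult'[symmetric] del: ennreal_plus)
   qed
   also have "\<dots> = ennreal (\<bar>u y\<bar> * \<bar>u (y + z)\<bar>) * (?N + ?N)"
    by (simp add: nn_integral_cmult nn_integral_add K)
   finally show "(LNINT x. ennreal (norm (h (x, q)))) \<le> ennreal (\<bar>u (fst q)\<bar> * \<bar>u (fst q + snd q)\<bar>) * (?N + ?N)"
    by (simp add: q)
  qed
  also have "\<dots> = (\<integral>\<^sup>+q. ennreal (\<bar>u (fst q)\<bar> * \<bar>u (fst q + snd q)\<bar>) \<partial>?M2) * (?N + ?N)"
   by (rule nn_integral_multc) measurable
  also have "(\<integral>\<^sup>+q. ennreal (\<bar>u (fst q)\<bar> * \<bar>u (fst q + snd q)\<bar>) \<partial>?M2) = (LNINT y. (LNINT z. ennreal \<bar>u y\<bar> * ennreal \<bar>u (y + z)\<bar>))"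
   by (subst lborel.nn_integral_fst[symmetric]) (auto simp: ennreal_mult')
  also have "\<dots> = (LNINT y. ennreal \<bar>u y\<bar>) * (LNINT z. ennreal \<bar>u z\<bar>)"
   by (simp add: nn_integral_cmult us nn_integral_multc)
  also have "\<dots> * (?N + ?N) < \<infinity>"
   using u N by (auto simp: integrable_iff_bounded ennreal_mult_less_top)
  finally show "(\<integral>\<^sup>+p. ennreal (norm (h p)) \<partial>(lborel \<Otimes>\<^sub>M ?M2)) < \<infinity>" .
  qed simp
  have 1: "(\<integral>q. h (x, q) \<partial>?M2) = (norm (conv k u x))\<^sup>2" for x
  proof -
  have F: "integrable lborel (\<lambda>y. u y *\<^sub>R k (y - x))" by (rule integrable_conv[OF u k b])
  have "(\<integral>q. h (x, q) \<partial>?M2) = integral\<^sup>L ?M2 (\<lambda>(y, z). (u y *\<^sub>R k (y - x)) \<bullet> (u (y + z) *\<^sub>R k (y + z - x)))"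
   by (intro Bochner_Integration.integral_cong) (auto simp: h_def)
  then show ?thesis using integrable_inner_shift(2)[OF F F] by (simp add: conv_def power2_norm_eq_inner)
  qed
  have 2: "(LBINT x. h (x, q)) = (case q of (y, z) \<Rightarrow> u y * u (y + z) * corr k k z)" for q
  proof -
  obtain y z where q: "q = (y, z)" by (cases q)
  have "(LBINT x. h (x, q)) = (LBINT x. u y * u (y + z) * (k (y - x) \<bullet> k (y - x + z)))"
   by (simp add: q h_def mult_ac algebra_simps)
  also have "\<dots> = u y * u (y + z) * (LBINT x. k (y - x) \<bullet> k (y - x + z))" by simp
  also have "(LBINT x. k (y - x) \<bullet> k (y - x + z)) = corr k k z"
   using integral_reflect_lborel[of "\<lambda>w. k w \<bullet> k (w + z)" y] by (simp add: corr_def)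
  finally show ?thesis by (simp add: q)
  qed
  show "integrable lborel (\<lambda>x. (norm (conv k u x))\<^sup>2)"
  using Q.integrable_fst'[OF ih] unfolding 1 .
  have i2: "integrable ?M2 (\<lambda>(y, z). u y * u (y + z) * corr k k z)"
  using Q.integrable_snd[of "\<lambda>x q. h (x, q)"] ih unfolding 2 by simp
  have 3: "(LBINT y. u y * u (y + z) * corr k k z) = autocorr u z * corr k k z" for z
  by (simp add: autocorr_def)
  show "integrable lborel (\<lambda>z. autocorr u z * corr k k z)"
  using lborel_pair.integrable_snd[OF i2] unfolding 3 .
  have "(LBINT x. (norm (conv k u x))\<^sup>2) = (\<integral>p. h p \<partial>(lborel \<Otimes>\<^sub>M ?M2))"
  using Q.integral_fst'[OF ih] unfolding 1 by simp
  also have "\<dots> = (\<integral>q. (case q of (y, z) \<Rightarrow> u y * u (y + z) * corr k k z) \<partial>?M2)"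
  using Q.integral_snd[of "\<lambda>x q. h (x, q)"] ih unfolding 2 by simp
  also have "\<dots> = (LBINT z. autocorr u z * corr k k z)"
  using lborel_pair.integral_snd[OF i2] unfolding 3 by simp
  finally show "(LBINT x. (norm (conv k u x))\<^sup>2) = (LBINT z. autocorr u z * corr k k z)" .
qed

text \<open>The autocorrelation of u is the squared norm of u minus half of \<open>msd\<close>. The
  constant part drops out because the correlation of k has total integral |integral of k|^2, which
  is 0 for an odd integrable kernel.\<close>

lemma conv_square_msd:
  fixes k :: "'a::euclidean_space \<Rightarrow> 'a"
  assumes u: "L2c r u" and k: "integrable lborel k" and b: "\<And>w. norm (k w) \<le> b"
  and odd: "\<And>w. k (- w) = - k w"
  shows "integrable lborel (\<lambda>x. (norm (conv k u x))\<^sup>2)"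
  and "integrable lborel (\<lambda>z. msd u z * corr k k z)"
  and "(LBINT x. (norm (conv k u x))\<^sup>2) = - (LBINT z. msd u z * corr k k z) / 2"
proof -
  have [measurable]: "k \<in> borel_measurable borel" using k by auto
  let ?N = "LBINT y. (u y)\<^sup>2"
  have k2: "integrable lborel (\<lambda>w. (norm (k w))\<^sup>2)"
  proof (rule Bochner_Integration.integrable_bound)
  show "integrable lborel (\<lambda>w. b * norm (k w))" using k by simp
  show "AE w in lborel. norm ((norm (k w))\<^sup>2) \<le> norm (b * norm (k w))"
   using b by (intro AE_I2) (auto simp: power2_eq_square abs_mult intro!: mult_right_mono order_trans[OF b])
  qed simp
  have "integral\<^sup>L lborel k = 0" using odd by (intro integral_odd) auto
  then have c: "integrable lborel (corr k k)" "(LBINT z. corr k k z) = 0"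
  using integrable_inner_shift(3,4)[OF k k] unfolding corr_def[symmetric] by simp_all
  note sq = conv_square[OF L2c_integrable[OF u] _ b k2]
  show "integrable lborel (\<lambda>x. (norm (conv k u x))\<^sup>2)" by (rule sq(1)) simp
  have eq: "msd u z * corr k k z = 2 * ?N * corr k k z - 2 * (autocorr u z * corr k k z)" for z
  by (simp add: msd_eq[OF u] algebra_simps)
  show "integrable lborel (\<lambda>z. msd u z * corr k k z)"
  unfolding eq using c sq(2) by simp
  show "(LBINT x. (norm (conv k u x))\<^sup>2) = - (LBINT z. msd u z * corr k k z) / 2"
  unfolding eq using c sq(2,3) by simp
qed

text \<open>Converts summability of 2^k a_k^2 into summability of a_k.\<close>

lemma le_powers_of_two_square:
  fixes a :: real assumes "0 \<le> a"
  shows "a \<le> (1 / 2) ^ k + 2 ^ k * a\<^sup>2"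
proof (cases "a \<le> (1 / 2) ^ k")
  case False
  then have "1 \<le> 2 ^ k * a" by (simp add: field_simps power_divide)
  then have "1 * a \<le> (2 ^ k * a) * a" using assms by (intro mult_right_mono) auto
  then show ?thesis by (simp add: power2_eq_square add_increasing)
qed (simp add: add_increasing2)

text \<open>The Riesz-Fischer argument. Along the subsequence the squared increments have integrals
  at most 4^(-k); even with weights 2^k their sum is integrable, hence finite almost everywhere, and
  the sequence converges there. Fatou's lemma gives the L^2 estimate for the whole sequence.\<close>

lemma L2_complete:
  fixes g :: "nat \<Rightarrow> 'b \<Rightarrow> 'a::{banach, second_countable_topology}"
  assumes [measurable]: "\<And>i. g i \<in> borel_measurable M"
  and cauchy: "\<And>e. 0 < e \<Longrightarrow> \<exists>N. \<forall>i\<ge>N. \<forall>j\<ge>N. (\<integral>\<^sup>+x. ennreal ((norm (g i x - g j x))\<^sup>2) \<partial>M) \<le> ennreal e"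
  obtains w r where "w \<in> borel_measurable M" "strict_mono r" "AE x in M. (\<lambda>k. g (r k) x) \<longlonglongrightarrow> w x"
  "\<And>e. 0 < e \<Longrightarrow> \<exists>N. \<forall>i\<ge>N. (\<integral>\<^sup>+x. ennreal ((norm (g i x - w x))\<^sup>2) \<partial>M) \<le> ennreal e"
proof -
  let ?d = "\<lambda>i j. \<integral>\<^sup>+x. ennreal ((norm (g i x - g j x))\<^sup>2) \<partial>M"
  have "\<exists>N. \<forall>i\<ge>N. \<forall>j\<ge>N. ?d i j \<le> ennreal ((1 / 4) ^ k)" for k by (rule cauchy) simp
  then obtain N where N: "\<And>k i j. N k \<le> i \<Longrightarrow> N k \<le> j \<Longrightarrow> ?d i j \<le> ennreal ((1 / 4) ^ k)" by metis
  \<comment> \<open>The partial sum dominates N k, and the added k makes r strictly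
    increasing.\<close>
  define r where "r k = (\<Sum>i\<le>k. N i) + k" for k
  have r: "strict_mono r" unfolding strict_mono_Suc_iff r_def by simp
  have rN: "N k \<le> r k" for k unfolding r_def by (simp add: member_le_sum trans_le_add1)
  have rN': "N k \<le> r (Suc k)" for k using rN[of k] strict_monoD[OF r, of k "Suc k"] by simp
  let ?D = "\<lambda>k x. norm (g (r (Suc k)) x - g (r k) x)"
  have "(\<integral>\<^sup>+x. (\<Sum>k. ennreal (2 ^ k * (?D k x)\<^sup>2)) \<partial>M) = (\<Sum>k. \<integral>\<^sup>+x. ennreal (2 ^ k * (?D k x)\<^sup>2) \<partial>M)"
  by (rule nn_integral_suminf) measurable
  also have "\<dots> \<le> (\<Sum>k. ennreal ((1 / 2) ^ k))"
  proof (rule suminf_le)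
  fix k
  have "(\<integral>\<^sup>+x. ennreal (2 ^ k * (?D k x)\<^sup>2) \<partial>M) = ennreal (2 ^ k) * ?d (r (Suc k)) (r k)"
   by (simp add: ennreal_mult nn_integral_cmult)
  also have "\<dots> \<le> ennreal (2 ^ k) * ennreal ((1 / 4) ^ k)"
   by (intro mult_left_mono N rN rN') simp
  also have "\<dots> = ennreal ((1 / 2) ^ k)"
   by (simp add: ennreal_mult'[symmetric] power_mult_distrib[symmetric])
  finally show "(\<integral>\<^sup>+x. ennreal (2 ^ k * (?D k x)\<^sup>2) \<partial>M) \<le> ennreal ((1 / 2) ^ k)" .
  qed auto
  also have "\<dots> < \<infinity>"
  by (subst suminf_ennreal2) (auto simp: summable_geometric)
  finally have "AE x in M. (\<Sum>k. ennreal (2 ^ k * (?D k x)\<^sup>2)) \<noteq> \<infinity>"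
  by (intro nn_integral_PInf_AE) auto
  then have conv: "AE x in M. convergent (\<lambda>k. g (r k) x)"
  proof eventually_elim
  case (elim x)
  then have "summable (\<lambda>k. 2 ^ k * (?D k x)\<^sup>2)"
   by (intro summable_suminf_not_top) auto
  then have "summable (\<lambda>k. (1 / 2) ^ k + 2 ^ k * (?D k x)\<^sup>2)"
   by (intro summable_add summable_geometric) auto
  then have "summable (\<lambda>k. ?D k x)"
   by (rule summable_comparison_test'[where N=0]) (auto intro: le_powers_of_two_square)
  then have "summable (\<lambda>k. g (r (Suc k)) x - g (r k) x)" by (rule summable_norm_cancel)
  then have "convergent (\<lambda>n. (\<Sum>k<n. g (r (Suc k)) x - g (r k) x) + g (r 0) x)"
   by (intro convergent_add convergent_const) (simp add: summable_iff_convergent)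
  then show ?case
   using sum_lessThan_telescope[of "\<lambda>k. g (r k) x"] by simp
  qed
  define w where "w x = lim (\<lambda>k. g (r k) x)" for x
  have w[measurable]: "w \<in> borel_measurable M" unfolding w_def[abs_def] by measurable
  have lim: "AE x in M. (\<lambda>k. g (r k) x) \<longlonglongrightarrow> w x"
  using conv by eventually_elim (simp add: w_def convergent_LIMSEQ_iff)
  have "\<exists>N. \<forall>i\<ge>N. (\<integral>\<^sup>+x. ennreal ((norm (g i x - w x))\<^sup>2) \<partial>M) \<le> ennreal e" if e: "0 < e" for e
  proof -
  obtain N0 where N0: "\<And>i j. N0 \<le> i \<Longrightarrow> N0 \<le> j \<Longrightarrow> ?d i j \<le> ennreal e" using cauchy[OF e] by blast
  have "(\<integral>\<^sup>+x. ennreal ((norm (g i x - w x))\<^sup>2) \<partial>M) \<le> ennreal e" if i: "N0 \<le> i" for i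
  proof -
   have "(\<integral>\<^sup>+x. ennreal ((norm (g i x - w x))\<^sup>2) \<partial>M) = (\<integral>\<^sup>+x. liminf (\<lambda>k. ennreal ((norm (g i x - g (r k) x))\<^sup>2)) \<partial>M)"
   proof (rule nn_integral_cong_AE)
    show "AE x in M. ennreal ((norm (g i x - w x))\<^sup>2) = liminf (\<lambda>k. ennreal ((norm (g i x - g (r k) x))\<^sup>2))"
     using lim
    proof eventually_elim
     case (elim x)
     then have "(\<lambda>k. ennreal ((norm (g i x - g (r k) x))\<^sup>2)) \<longlonglongrightarrow> ennreal ((norm (g i x - w x))\<^sup>2)"
      by (intro tendsto_intros tendsto_ennrealI)
     then show ?case by (rule lim_imp_Liminf[OF trivial_limit_sequentially, symmetric])
    qed
   qed
   also have "\<dots> \<le> liminf (\<lambda>k. ?d i (r k))" by (rule nn_integral_liminf) measurable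
   also have "\<dots> \<le> ennreal e"
   proof -
    have ev: "eventually (\<lambda>k. ?d i (r k) \<le> ennreal e) sequentially"
     using eventually_ge_at_top[of N0]
     by eventually_elim (auto intro!: N0 i le_trans[OF _ seq_suble[OF r]])
    show ?thesis
     by (intro order_trans[OF Liminf_le_Limsup[OF trivial_limit_sequentially] Limsup_bounded[OF ev]])
   qed
   finally show ?thesis .
  qed
  then show ?thesis by blast
  qed
  with that[OF w r lim] show thesis by blast
qed

section \<open>Continuous approximation and continuity of translations\<close>

lemma tendsto_integral_square_bounded:
  fixes f :: "nat \<Rightarrow> 'a::euclidean_space \<Rightarrow> real"
  assumes [measurable]: "\<And>n. f n \<in> borel_measurable borel" "f0 \<in> borel_measurable borel"
  and lim: "AE x in lborel. (\<lambda>n. f n x) \<longlonglongrightarrow> f0 x"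
  and b: "\<And>n x. \<bar>f n x - f0 x\<bar> \<le> B x" and B: "integrable lborel (\<lambda>x. (B x)\<^sup>2)"
  shows "(\<lambda>n. LBINT x. (f n x - f0 x)\<^sup>2) \<longlonglongrightarrow> 0"
proof -
  have "(\<lambda>n. LBINT x. (f n x - f0 x)\<^sup>2) \<longlonglongrightarrow> (LBINT x::'a. 0)"
  proof (rule integral_dominated_convergence[where w="\<lambda>x. (B x)\<^sup>2"])
  show "AE x in lborel. (\<lambda>n. (f n x - f0 x)\<^sup>2) \<longlonglongrightarrow> 0"
   using lim by eventually_elim (auto intro!: tendsto_eq_intros)
  show "AE x in lborel. norm ((f n x - f0 x)\<^sup>2) \<le> (B x)\<^sup>2" for n
  proof (rule AE_I2)
   fix x
   have "\<bar>f n x - f0 x\<bar>\<^sup>2 \<le> (B x)\<^sup>2" using b[of n x] by (intro power_mono) auto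
   then show "norm ((f n x - f0 x)\<^sup>2) \<le> (B x)\<^sup>2" by simp
  qed
  qed (use B in auto)
  then show ?thesis by simp
qed

text \<open>A measurable function is an almost everywhere limit of continuous ones, but without
  control of their size or support. Clipping the values at a level m and multiplying by a plateau
  function q, equal to 1 on the ball that carries u, provide an integrable majorant for dominated
  convergence.\<close>

lemma L2c_approx_continuous:
  fixes u :: "'a::euclidean_space \<Rightarrow> real"
  assumes u: "L2c r u" and e: "0 < e"
  obtains h where "continuous_on UNIV h" "L2c (r + 1) h" "(LBINT x. (u x - h x)\<^sup>2) < e"
proof -
  have [measurable]: "u \<in> borel_measurable borel" and u2: "integrable lborel (\<lambda>x. (u x)\<^sup>2)" and r: "0 < r"
  using u by (auto simp: L2c_def)
  let ?c = "\<lambda>m x. max (- real m) (min (real m) x)"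
  have "(\<lambda>m. LBINT x. (?c m (u x) - u x)\<^sup>2) \<longlonglongrightarrow> 0"
  proof (rule tendsto_integral_square_bounded[where B="\<lambda>x. \<bar>u x\<bar>"])
  have "(\<lambda>m. ?c m (u x)) \<longlonglongrightarrow> u x" for x
  proof (rule tendsto_eventually)
   obtain m0 :: nat where "\<bar>u x\<bar> \<le> m0" using real_arch_simple by blast
   then show "eventually (\<lambda>m. ?c m (u x) = u x) sequentially"
    by (intro eventually_sequentiallyI[of m0]) auto
  qed
  then show "AE x in lborel. (\<lambda>m. ?c m (u x)) \<longlonglongrightarrow> u x" by simp
  qed (use u2 in auto)
  then have "eventually (\<lambda>m. (LBINT x. (?c m (u x) - u x)\<^sup>2) < e / 4) sequentially"
  using e by (auto dest: order_tendstoD(2)[where a="e / 4"])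
  then obtain m where m: "(LBINT x. (?c m (u x) - u x)\<^sup>2) < e / 4"
  using eventually_happens trivial_limit_sequentially by blast
  have "u measurable_on UNIV"
  by (rule lebesgue_measurable_imp_measurable_on) (auto intro: measurable_completion)
  then obtain Z g where Z: "negligible Z" and g: "\<And>n. continuous_on UNIV (g n)"
  and lim: "\<And>x. x \<notin> Z \<Longrightarrow> (\<lambda>n. g n x) \<longlonglongrightarrow> u x"
  by (auto simp: measurable_on_def)
  define q where "q x = max 0 (min 1 (r + 1 - norm x))" for x :: 'a
  have q: "continuous_on UNIV q" unfolding q_def by (intro continuous_intros)
  have q01: "0 \<le> q x" "q x \<le> 1" "norm x < r \<Longrightarrow> q x = 1" "r + 1 \<le> norm x \<Longrightarrow> q x = 0" for x
  by (auto simp: q_def)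
  define h where "h n x = q x * ?c m (g n x)" for n x
  have h: "continuous_on UNIV (h n)" for n
  unfolding h_def by (intro continuous_intros q g)
  then have [measurable]: "h n \<in> borel_measurable borel" for n by (rule borel_measurable_continuous_onI)
  have hb: "\<bar>h n x\<bar> \<le> real m * indicator (ball 0 (r + 1)) x" for n x
  proof (cases "norm x < r + 1")
  case True
  have "\<bar>h n x\<bar> \<le> 1 * real m" using q01[of x] unfolding h_def abs_mult by (intro mult_mono) auto
  then show ?thesis using True by simp
  qed (use q01 in \<open>simp add: h_def\<close>)
  have ub: "\<bar>?c m (u x)\<bar> \<le> real m * indicator (ball 0 (r + 1)) x" for x
  proof (cases "norm x < r + 1")
  case False
  then have "u x = 0" using u by (auto simp: L2c_def)
  then show ?thesis by simp
  qed auto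
  have ind2: "integrable lborel (\<lambda>x::'a. (c * indicator (ball 0 (r + 1)) x)\<^sup>2)" for c :: real
  proof -
  have "(c * indicator (ball 0 (r + 1)) x)\<^sup>2 = c\<^sup>2 * indicator (ball 0 (r + 1)) x" for x :: 'a
   by (simp add: indicator_def)
  then show ?thesis by (simp add: integrable_indicator_ball)
  qed
  have "(\<lambda>n. LBINT x. (h n x - ?c m (u x))\<^sup>2) \<longlonglongrightarrow> 0"
  proof (rule tendsto_integral_square_bounded[where B="\<lambda>x. (2 * real m) * indicator (ball 0 (r + 1)) x"])
  have "AE x in lebesgue. x \<notin> Z" using Z by (simp add: negligible_iff_null_sets AE_not_in)
  then have "AE x in lborel. x \<notin> Z" by (simp add: AE_completion_iff)
  then show "AE x in lborel. (\<lambda>n. h n x) \<longlonglongrightarrow> ?c m (u x)"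
  proof eventually_elim
   case (elim x)
   have "(\<lambda>n. h n x) \<longlonglongrightarrow> q x * ?c m (u x)"
    unfolding h_def by (intro tendsto_intros lim elim)
   moreover have "q x * ?c m (u x) = ?c m (u x)"
    using q01(3)[of x] u by (cases "norm x < r") (auto simp: L2c_def)
   ultimately show ?case by simp
  qed
  show "\<bar>h n x - ?c m (u x)\<bar> \<le> 2 * real m * indicator (ball 0 (r + 1)) x" for n x
   using hb[of n x] ub[of x] by linarith
  show "integrable lborel (\<lambda>x::'a. (2 * real m * indicator (ball 0 (r + 1)) x)\<^sup>2)" by (rule ind2)
  qed auto
  then have "eventually (\<lambda>n. (LBINT x. (h n x - ?c m (u x))\<^sup>2) < e / 4) sequentially"
  using e by (auto dest: order_tendstoD(2)[where a="e / 4"])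
  then obtain n where n: "(LBINT x. (h n x - ?c m (u x))\<^sup>2) < e / 4"
  using eventually_happens trivial_limit_sequentially by blast
  have ih: "integrable lborel (\<lambda>x. (h n x)\<^sup>2)"
  proof (rule Bochner_Integration.integrable_bound[OF ind2[of "real m"]])
  show "AE x in lborel. norm ((h n x)\<^sup>2) \<le> norm ((real m * indicator (ball 0 (r + 1)) x)\<^sup>2)"
   using hb by (intro AE_I2) (simp add: abs_le_square_iff[symmetric] del: power_mult_distrib)
  qed simp
  have L: "L2c (r + 1) (h n)" using r ih q01(4) by (auto simp: L2c_def h_def)
  have ic: "integrable lborel (\<lambda>x. (?c m (u x))\<^sup>2)"
  by (rule Bochner_Integration.integrable_bound[OF u2]) (auto simp: abs_le_square_iff[symmetric] intro!: AE_I2)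
  have i1: "integrable lborel (\<lambda>x. (h n x - ?c m (u x))\<^sup>2)" "integrable lborel (\<lambda>x. (?c m (u x) - u x)\<^sup>2)"
  "integrable lborel (\<lambda>x. (u x - h n x)\<^sup>2)"
  unfolding power2_diff using ih ic u2
   integrable_inner_L2[of "h n" lborel "\<lambda>x. ?c m (u x)"] integrable_inner_L2[of "\<lambda>x. ?c m (u x)" lborel u] integrable_inner_L2[of u lborel "h n"]
  by (auto simp: mult.assoc)
  have "(LBINT x. (u x - h n x)\<^sup>2) \<le> (LBINT x. 2 * (h n x - ?c m (u x))\<^sup>2 + 2 * (?c m (u x) - u x)\<^sup>2)"
  proof (rule integral_mono)
  fix x
  have "(a - b)\<^sup>2 \<le> 2 * (b - c)\<^sup>2 + 2 * (c - a)\<^sup>2" for a b c :: real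
   using zero_le_power2[of "(b - c) - (c - a)"] by (simp add: power2_eq_square algebra_simps)
  then show "(u x - h n x)\<^sup>2 \<le> 2 * (h n x - ?c m (u x))\<^sup>2 + 2 * (?c m (u x) - u x)\<^sup>2" .
  qed (use i1 in auto)
  also have "\<dots> = 2 * (LBINT x. (h n x - ?c m (u x))\<^sup>2) + 2 * (LBINT x. (?c m (u x) - u x)\<^sup>2)"
  using i1 by simp
  also have "\<dots> < e" using m n by linarith
  finally show thesis using that[OF h L] by blast
qed

lemma msd_le_approx:
  assumes u: "L2c r u" and h: "L2c r' h"
  shows "msd u z \<le> 6 * (LBINT x. (u x - h x)\<^sup>2) + 3 * msd h z"
proof -
  have [measurable]: "u \<in> borel_measurable borel" "h \<in> borel_measurable borel" using u h by (auto simp: L2c_def)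
  have "integrable lborel (\<lambda>x. u x * h x)"
  using integrable_inner_L2[of u lborel h] u h by (simp add: L2c_def)
  then have i: "integrable lborel (\<lambda>x. (u x - h x)\<^sup>2)"
  using u h by (simp add: power2_diff L2c_def mult.assoc)
  note i' = integrable_shift[OF i, of z]
  have s: "(LBINT x. (u (x + z) - h (x + z))\<^sup>2) = (LBINT x. (u x - h x)\<^sup>2)"
  using integral_shift[of "\<lambda>x. (u x - h x)\<^sup>2" z] by simp
  have "msd u z \<le> (LBINT x. 3 * (u (x + z) - h (x + z))\<^sup>2 + 3 * (h (x + z) - h x)\<^sup>2 + 3 * (u x - h x)\<^sup>2)"
  unfolding msd_def
  proof (rule integral_mono)
  fix x
  have "(a - b)\<^sup>2 \<le> 3 * (a - c)\<^sup>2 + 3 * (c - d)\<^sup>2 + 3 * (b - d)\<^sup>2" for a b c d :: real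
   using zero_le_power2[of "(a - c) - (c - d)"] zero_le_power2[of "(c - d) - (d - b)"] zero_le_power2[of "(a - c) - (d - b)"]
   by (simp add: power2_eq_square algebra_simps)
  then show "(u (x + z) - u x)\<^sup>2 \<le> 3 * (u (x + z) - h (x + z))\<^sup>2 + 3 * (h (x + z) - h x)\<^sup>2 + 3 * (u x - h x)\<^sup>2" .
  qed (use i i' msd_integrable[OF u, of z] msd_integrable[OF h, of z] in auto)
  also have "\<dots> = 6 * (LBINT x. (u x - h x)\<^sup>2) + 3 * msd h z"
  using i i' msd_integrable[OF h, of z] by (simp add: s msd_def)
  finally show ?thesis .
qed

text \<open>Translation is continuous in L^2: for a continuous function with compact support this is
  uniform continuity, and the general case follows by approximation.\<close>

lemma msd_small:
  fixes u :: "'a::euclidean_space \<Rightarrow> real"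
  assumes u: "L2c r u" and e: "0 < e"
  obtains d where "0 < d" "\<And>z. norm z < d \<Longrightarrow> msd u z \<le> e"
proof -
  obtain h where h: "continuous_on UNIV h" "L2c (r + 1) h" "(LBINT x. (u x - h x)\<^sup>2) < e / 12"
  using L2c_approx_continuous[OF u, of "e / 12"] e by auto
  let ?B = "cball (0::'a) (r + 3)"
  have "uniformly_continuous_on ?B h"
  using h(1) by (intro compact_uniformly_continuous) (auto intro: continuous_on_subset)
  define V where "V = measure lborel (ball (0::'a) (r + 2))"
  have V: "0 \<le> V" by (simp add: V_def)
  \<comment> \<open>Chosen so that \<eta>^2 V \<le> e/6; then 6 (e/12) + 3 (e/6) = e in the
    approximation inequality for \<open>msd\<close>.\<close>
  define \<eta> where "\<eta> = sqrt (e / (6 * (V + 1)))"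
  have \<eta>: "0 < \<eta>" "\<eta>\<^sup>2 * V \<le> e / 6"
  using e V by (auto simp: \<eta>_def field_simps mult_left_mono intro!: divide_pos_pos)
  obtain d where d: "0 < d" "\<And>x y. x \<in> ?B \<Longrightarrow> y \<in> ?B \<Longrightarrow> dist y x < d \<Longrightarrow> dist (h y) (h x) < \<eta>"
  using \<open>uniformly_continuous_on ?B h\<close> \<eta>(1) unfolding uniformly_continuous_on_def by meson
  show thesis
  proof (rule that)
  show "0 < min d 1" using d by simp
  fix z :: 'a assume z: "norm z < min d 1"
  have r: "0 < r" using u by (simp add: L2c_def)
  have "msd h z \<le> (LBINT x::'a. \<eta>\<^sup>2 * indicator (ball 0 (r + 2)) x)"
   unfolding msd_def
  proof (rule integral_mono)
   fix x
   show "(h (x + z) - h x)\<^sup>2 \<le> \<eta>\<^sup>2 * indicator (ball 0 (r + 2)) x"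
   proof (cases "norm x < r + 2")
    case True
    have "norm (x + z) < r + 3" using norm_triangle_ineq[of x z] True z by simp
    then have "x + z \<in> ?B" "x \<in> ?B" using True unfolding mem_cball_0 by simp_all
    then have "dist (h (x + z)) (h x) < \<eta>" using d(2)[of x "x + z"] z by (simp add: dist_norm)
    then have "\<bar>h (x + z) - h x\<bar>\<^sup>2 \<le> \<eta>\<^sup>2" by (intro power_mono) (auto simp: dist_real_def)
    then show ?thesis using True by simp
   next
    case False
    have "r + 1 \<le> norm (x + z)" using norm_diff_ineq[of x z] False z by simp
    then show ?thesis using False h(2) by (simp add: L2c_def)
   qed
  qed (use msd_integrable[OF h(2), of z] integrable_indicator_ball in auto)
  also have "\<dots> = \<eta>\<^sup>2 * V" by (simp add: V_def)
  finally show "msd u z \<le> e"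
   using msd_le_approx[OF u h(2), of z] h(3) \<eta>(2) by linarith
  qed
qed

section \<open>Differences of truncated kernels\<close>

lemma dim_half_less: "real DIM('a::euclidean_space) / 2 + 1 < \<beta> \<Longrightarrow> 1 < \<beta>"
  by (smt (verit) divide_nonneg_nonneg of_nat_0_le_iff)

lemma kern_square_integrable:
  assumes "real DIM('a::euclidean_space) / 2 + 1 < \<beta>" "0 < t"
  shows "integrable lborel (\<lambda>w::'a. (norm (kern \<beta> t w))\<^sup>2)"
  using dim_half_less[OF assms(1)] assms norm_kern_le_trunc[of \<beta> t] norm_kern_le[of \<beta> t]
  by (intro square_integrable_decay[where \<beta>=\<beta>]) auto

text \<open>Complements the bound by a power of |z|, which is useless for small z. The kernel with
  the larger truncation t is Lipschitz at scale t everywhere, so subtracting its value at -z on the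
  ball of radius t tames the singularity of the other kernel, uniformly in z and in t'.\<close>

lemma corr_trunc_le:
  assumes \<beta>: "real DIM('a::euclidean_space) / 2 + 1 < \<beta>" "\<beta> < real DIM('a) + 2"
  obtains C where "0 < C"
  "\<And>t t' z. 0 < t' \<Longrightarrow> t' \<le> t \<Longrightarrow> \<bar>corr (kern \<beta> t) (kern \<beta> t') (z::'a)\<bar> \<le> C * t powr (real DIM('a) + 2 - 2 * \<beta>)"
proof -
  let ?n = "real DIM('a)" and ?p = "real DIM('a) + 2 - 2 * \<beta>" and ?w = "sphere_area TYPE('a)"
  have \<beta>1: "1 < \<beta>" by (rule dim_half_less[OF \<beta>(1)])
  have w: "0 < ?w" by (rule sphere_area_pos)
  define A where "A = (1 + \<beta>) * (?w / (?n + 2 - \<beta>))"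
  define B where "B = ?w / (2 * \<beta> - 2 - ?n)"
  define V where "V = unit_ball_vol ?n"
  have pos: "0 < A" "0 < B" "0 < V" using \<beta> \<beta>1 w by (auto simp: A_def B_def V_def)
  show thesis
  proof (rule that[of "A + (V + B) + B"])
  show "0 < A + (V + B) + B" using pos by simp
  fix t t' :: real and z :: 'a assume t: "0 < t'" "t' \<le> t"
  let ?a = "kern \<beta> t :: 'a \<Rightarrow> 'a" and ?b = "kern \<beta> t' :: 'a \<Rightarrow> 'a"
  let ?I = "indicator (ball 0 t) :: 'a \<Rightarrow> real"
  have [measurable]: "ball (0::'a) t \<in> sets borel" by simp
  have i1: "integrable lborel (\<lambda>v. ?a (v - z) \<bullet> ?b v)"
   using integrable_shift[OF integrable_corr[of ?a ?b z], of "- z"] kern_square_integrable[OF \<beta>(1)] t by simp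
  have i2: "integrable lborel (\<lambda>v. ?I v *\<^sub>R ?b v)"
   using norm_kern_le_trunc[of \<beta> t'] \<beta>1 t
   by (intro integrable_bounded_ball[where r=t and b="t' powr (1 - \<beta>)"]) (auto simp: indicator_def split: if_splits)
  have z2: "(LBINT v. ?I v *\<^sub>R ?b v) = 0" by (intro integral_odd) (auto simp: indicator_def)
  note i3 = integrable_inner_right[OF i2, of "?a (- z)"]
  let ?F = "\<lambda>v. ?a (v - z) \<bullet> ?b v - ?a (- z) \<bullet> (?I v *\<^sub>R ?b v)"
  have "corr ?a ?b z = (LBINT v. ?a (v - z) \<bullet> ?b v)"
   using integral_shift[of "\<lambda>w. ?a w \<bullet> ?b (w + z)" "- z"] by (simp add: corr_def)
  also have "\<dots> = (LBINT v. ?F v)"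
   using i1 i3 integral_inner_right[OF i2, of "?a (- z)"] z2 by simp
  finally have eq: "corr ?a ?b z = (LBINT v. ?F v)" .
  \<comment> \<open>Inside the ball: the Lipschitz bound of the smoother kernel times the size
    |v|^(1-\<beta>) of the other one. Outside: the sum of the two squares.\<close>
  define G where "G v = ennreal ((1 + \<beta>) * t powr (- \<beta>)) * (ennreal (norm v powr (- (\<beta> - 2))) * indicator (ball 0 t) v)
   + (ennreal ((norm (?a (v - z)))\<^sup>2) + ennreal (norm v powr (- (2 * \<beta> - 2))) * indicator (- ball 0 t) v)" for v
  have FG: "ennreal \<bar>?F v\<bar> \<le> G v" for v
  proof (cases "norm v < t")
   case True
   have "?F v = (?a (v - z) - ?a (- z)) \<bullet> ?b v" using True by (simp add: inner_diff_left inner_add_left)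
   then have "\<bar>?F v\<bar> \<le> norm (?a (v - z) - ?a (- z)) * norm (?b v)" using Cauchy_Schwarz_ineq2 by simp
   also have "\<dots> \<le> ((1 + \<beta>) * t powr (- \<beta>) * norm v) * norm v powr (1 - \<beta>)"
    using kern_lipschitz[of \<beta> t "v - z" t "- z"] norm_kern_le[of \<beta> t' v] \<beta>1 t
    by (intro mult_mono) auto
   also have "\<dots> = (1 + \<beta>) * t powr (- \<beta>) * norm v powr (2 - \<beta>)"
    using norm_times_powr[of "norm v" "1 - \<beta>"] by (simp add: mult_ac)
   finally have "ennreal \<bar>?F v\<bar> \<le> ennreal ((1 + \<beta>) * t powr (- \<beta>) * norm v powr (2 - \<beta>))" by (rule ennreal_leI)
   also have "\<dots> = ennreal ((1 + \<beta>) * t powr (- \<beta>)) * (ennreal (norm v powr (- (\<beta> - 2))) * indicator (ball 0 t) v)"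
    using True \<beta>1 by (simp add: ennreal_mult'[symmetric])
   finally show ?thesis by (simp add: G_def add_increasing2)
  next
   case False
   then have "\<bar>?F v\<bar> \<le> (norm (?a (v - z)))\<^sup>2 + (norm (?b v))\<^sup>2"
    using inner_le_sum_squares[of "?a (v - z)" "?b v"] by simp
   also have "(norm (?b v))\<^sup>2 \<le> (norm v powr (1 - \<beta>))\<^sup>2"
    using norm_kern_le[of \<beta> t' v] \<beta>1 by (intro power_mono) auto
   also have "(norm v powr (1 - \<beta>))\<^sup>2 = norm v powr (- (2 * \<beta> - 2))"
    by (simp add: power2_eq_square powr_add[symmetric] algebra_simps)
   finally have "ennreal \<bar>?F v\<bar> \<le> ennreal ((norm (?a (v - z)))\<^sup>2 + norm v powr (- (2 * \<beta> - 2)))" by (rule ennreal_leI) simp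
   then show ?thesis using False by (simp add: G_def)
  qed
  have a2: "(LNINT v. ennreal ((norm (?a v))\<^sup>2)) \<le> ennreal ((V + B) * t powr ?p)"
  proof -
   have "(LNINT v. ennreal ((norm (?a v))\<^sup>2)) \<le> (LNINT v. ennreal (t powr (2 - 2 * \<beta>)) * indicator (ball 0 t) v
     + ennreal (norm (v::'a) powr (- (2 * \<beta> - 2))) * indicator (- ball 0 t) v)"
   proof (rule nn_integral_mono)
    fix v :: 'a
    have "(norm (?a v))\<^sup>2 \<le> (t powr (1 - \<beta>))\<^sup>2" using norm_kern_le_trunc[of \<beta> t v] \<beta>1 t by (intro power_mono) auto
    moreover have "(norm (?a v))\<^sup>2 \<le> (norm v powr (1 - \<beta>))\<^sup>2" using norm_kern_le[of \<beta> t v] \<beta>1 t by (intro power_mono) auto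
    moreover have "(x powr (1 - \<beta>))\<^sup>2 = x powr (2 - 2 * \<beta>)" for x :: real
     by (simp add: power2_eq_square powr_add[symmetric] algebra_simps)
    ultimately show "ennreal ((norm (?a v))\<^sup>2) \<le> ennreal (t powr (2 - 2 * \<beta>)) * indicator (ball 0 t) v
     + ennreal (norm v powr (- (2 * \<beta> - 2))) * indicator (- ball 0 t) v"
     by (cases "norm v < t") (auto intro!: ennreal_leI)
   qed
   also have "\<dots> = ennreal (t powr (2 - 2 * \<beta>)) * ennreal (V * t ^ DIM('a)) + ennreal (B * t powr ?p)"
   proof -
    have 1: "2 * \<beta> - 2 > ?n" using \<beta> by simp
    have 2: "?n - (2 * \<beta> - 2) = ?p" by simp
    have 3: "(LNINT v. ennreal (norm (v::'a) powr (- (2 * \<beta> - 2))) * indicator (- ball 0 t) v) = ennreal (B * t powr ?p)"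
     using nn_integral_norm_powr_out[OF 1, of t] t unfolding 2 B_def by simp
    have "(LNINT v. ennreal (t powr (2 - 2 * \<beta>)) * indicator (ball 0 t) v
     + ennreal (norm (v::'a) powr (- (2 * \<beta> - 2))) * indicator (- ball 0 t) v)
     = ennreal (t powr (2 - 2 * \<beta>)) * emeasure lborel (ball (0::'a) t) + (LNINT v. ennreal (norm (v::'a) powr (- (2 * \<beta> - 2))) * indicator (- ball 0 t) v)"
     by (subst nn_integral_add) (auto simp: nn_integral_cmult)
    then show ?thesis unfolding 3 using t by (simp add: emeasure_ball V_def)
   qed
   also have "\<dots> = ennreal (V * t powr ?p + B * t powr ?p)"
   proof -
    have 1: "t powr (2 - 2 * \<beta>) * (V * t ^ DIM('a)) = V * t powr ?p"
     using t by (simp add: powr_realpow[symmetric] powr_add[symmetric] algebra_simps)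
    have 2: "ennreal (t powr (2 - 2 * \<beta>)) * ennreal (V * t ^ DIM('a)) = ennreal (V * t powr ?p)"
     unfolding 1[symmetric] by (rule ennreal_mult'[symmetric]) simp
    have "0 \<le> V * t powr ?p" "0 \<le> B * t powr ?p" using pos by auto
    then show ?thesis unfolding 2 by (rule ennreal_plus[symmetric])
   qed
   finally show ?thesis by (simp add: distrib_right)
  qed
  have "(LNINT v. G v) \<le> ennreal ((A + (V + B) + B) * t powr ?p)"
  proof -
   have 1: "2 * \<beta> - 2 > ?n" "\<beta> - 2 < ?n" using \<beta> by auto
   have 2: "?n - (2 * \<beta> - 2) = ?p" "?n - (\<beta> - 2) = ?n + 2 - \<beta>" by auto
   have 3: "(LNINT v. ennreal (norm (v::'a) powr (- (2 * \<beta> - 2))) * indicator (- ball 0 t) v) = ennreal (B * t powr ?p)"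
    using nn_integral_norm_powr_out[OF 1(1), of t] t unfolding 2 B_def by simp
   have 4: "(LNINT v. ennreal (norm (v::'a) powr (- (\<beta> - 2))) * indicator (ball 0 t) v) = ennreal (?w / (?n + 2 - \<beta>) * t powr (?n + 2 - \<beta>))"
    using nn_integral_norm_powr_ball[OF 1(2), of t] t unfolding 2 by simp
   have "(LNINT v. G v) = ennreal ((1 + \<beta>) * t powr (- \<beta>)) * (LNINT v. ennreal (norm (v::'a) powr (- (\<beta> - 2))) * indicator (ball 0 t) v)
    + ((LNINT v. ennreal ((norm (?a (v - z)))\<^sup>2)) + (LNINT v. ennreal (norm (v::'a) powr (- (2 * \<beta> - 2))) * indicator (- ball 0 t) v))"
    unfolding G_def by (simp add: nn_integral_add nn_integral_cmult)
   also have "(LNINT v. ennreal ((norm (?a (v - z)))\<^sup>2)) = (LNINT v. ennreal ((norm (?a v))\<^sup>2))"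
    using nn_integral_shift[of "\<lambda>v. ennreal ((norm (?a v))\<^sup>2)" "- z"] by simp
   also have "ennreal ((1 + \<beta>) * t powr (- \<beta>)) * (LNINT v. ennreal (norm (v::'a) powr (- (\<beta> - 2))) * indicator (ball 0 t) v) = ennreal (A * t powr ?p)"
    unfolding 4 using \<beta>1 by (simp add: ennreal_mult'[symmetric] A_def) (simp add: mult_ac powr_add[symmetric])
   also have "ennreal (A * t powr ?p) + ((LNINT v. ennreal ((norm (?a v))\<^sup>2)) + (LNINT v. ennreal (norm (v::'a) powr (- (2 * \<beta> - 2))) * indicator (- ball 0 t) v))
    \<le> ennreal (A * t powr ?p) + (ennreal ((V + B) * t powr ?p) + ennreal (B * t powr ?p))"
    unfolding 3 using a2 by (intro add_mono) auto
   also have "\<dots> = ennreal (A * t powr ?p + ((V + B) * t powr ?p + B * t powr ?p))"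
    using pos by simp
   finally show ?thesis by (simp add: algebra_simps)
  qed
  then have "(LNINT v. ennreal \<bar>?F v\<bar>) \<le> ennreal ((A + (V + B) + B) * t powr ?p)"
   using nn_integral_mono[of lborel "\<lambda>v. ennreal \<bar>?F v\<bar>" G] FG order_trans by blast
  then show "\<bar>corr ?a ?b z\<bar> \<le> (A + (V + B) + B) * t powr ?p"
   unfolding eq using i1 i3 pos by (intro abs_integral_le_nn_integral[where g="\<lambda>v. \<bar>?F v\<bar>"]) auto
  qed
qed

lemma corr_swap:
  assumes [measurable]: "a \<in> borel_measurable borel" "b \<in> borel_measurable borel"
  shows "corr b a z = corr a b (- z)"
  using integral_shift[of "\<lambda>w. b w \<bullet> a (w + z)" "- z"] by (simp add: corr_def inner_commute)

lemma corr_diff: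
  fixes a b :: "'a::euclidean_space \<Rightarrow> 'a"
  assumes [measurable]: "a \<in> borel_measurable borel" "b \<in> borel_measurable borel"
  and "integrable lborel (\<lambda>w. (norm (a w))\<^sup>2)" "integrable lborel (\<lambda>w. (norm (b w))\<^sup>2)"
  shows "corr (\<lambda>w. a w - b w) (\<lambda>w. a w - b w) z = corr a a z - corr a b z - corr b a z + corr b b z"
proof -
  note i = integrable_corr[of a a z] integrable_corr[of a b z] integrable_corr[of b a z] integrable_corr[of b b z]
  have "corr (\<lambda>w. a w - b w) (\<lambda>w. a w - b w) z
  = (LBINT w. a w \<bullet> a (w + z) - a w \<bullet> b (w + z) - b w \<bullet> a (w + z) + b w \<bullet> b (w + z))"
  unfolding corr_def by (simp add: inner_diff_left inner_diff_right algebra_simps)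
  also have "\<dots> = corr a a z - corr a b z - corr b a z + corr b b z"
  unfolding corr_def using i assms by simp
  finally show ?thesis .
qed

text \<open>The difference of two truncations has compact support, so it is integrable for every exponent.\<close>

definition kdiff :: "real \<Rightarrow> real \<Rightarrow> real \<Rightarrow> 'a::euclidean_space \<Rightarrow> 'a" where
  "kdiff \<beta> t t' w = kern \<beta> t w - kern \<beta> t' w"

lemma kdiff_eq_0: "t \<le> norm w \<Longrightarrow> t' \<le> norm w \<Longrightarrow> kdiff \<beta> t t' w = 0"
  by (simp add: kdiff_def kern_eq)

lemma corr_kdiff_eq_0:
  fixes z :: "'a::euclidean_space"
  assumes "t' \<le> t" "2 * t \<le> norm z"
  shows "corr (kdiff \<beta> t t') (kdiff \<beta> t t') z = 0"
proof -
  have "kdiff \<beta> t t' w \<bullet> kdiff \<beta> t t' (w + z) = 0" for w :: 'a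
  proof (cases "norm w < t")
  case True
  then have "t \<le> norm (w + z)" using assms norm_diff_ineq[of z w] by (simp add: add.commute)
  then show ?thesis using assms by (simp add: kdiff_eq_0)
  qed (use assms in \<open>simp add: kdiff_eq_0\<close>)
  then show ?thesis unfolding corr_def by (simp only: Bochner_Integration.integral_zero)
qed

lemma conv_diff_square:
  fixes u :: "'a::euclidean_space \<Rightarrow> real"
  assumes \<beta>: "1 \<le> \<beta>" and t: "0 < t'" "t' \<le> t" and u: "L2c r u"
  shows "integrable lborel (\<lambda>z. msd u z * corr (kdiff \<beta> t t') (kdiff \<beta> t t') z)"
  "integrable lborel (\<lambda>x. (norm (conv (kern \<beta> t) u x - conv (kern \<beta> t') u x))\<^sup>2)"
  "(LBINT x. (norm (conv (kern \<beta> t) u x - conv (kern \<beta> t') u x))\<^sup>2)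
   = - (LBINT z. msd u z * corr (kdiff \<beta> t t') (kdiff \<beta> t t') z) / 2"
proof -
  let ?k = "kdiff \<beta> t t' :: 'a \<Rightarrow> 'a" and ?b = "t powr (1 - \<beta>) + t' powr (1 - \<beta>)"
  have [measurable]: "?k \<in> borel_measurable borel" unfolding kdiff_def[abs_def] by measurable
  have b: "norm (?k w) \<le> ?b" for w
  unfolding kdiff_def using norm_kern_le_trunc[of \<beta> t w] norm_kern_le_trunc[of \<beta> t' w] \<beta> t
  by (intro norm_triangle_le_diff) auto
  have k: "integrable lborel ?k"
  proof (rule integrable_bounded_ball[OF _ b, where r=t])
  show "norm w < t" if "?k w \<noteq> 0" for w
   using that kdiff_eq_0[of t w t' \<beta>] t by fastforce
  qed simp
  have odd: "?k (- w) = - ?k w" for w by (simp add: kdiff_def)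
  note sq = conv_square_msd[OF u k b odd]
  have i: "integrable lborel (\<lambda>y. u y *\<^sub>R kern \<beta> s (y - x))" if "0 < s" for s x
  using \<beta> that by (intro integrable_conv[OF L2c_integrable[OF u] _ norm_kern_le_trunc]) auto
  have eq: "conv ?k u x = conv (kern \<beta> t) u x - conv (kern \<beta> t') u x" for x
  unfolding conv_def kdiff_def using i[of t x] i[of t' x] t by (simp add: scaleR_diff_right)
  show "integrable lborel (\<lambda>z. msd u z * corr ?k ?k z)" by (rule sq(2))
  show "integrable lborel (\<lambda>x. (norm (conv (kern \<beta> t) u x - conv (kern \<beta> t') u x))\<^sup>2)"
  using sq(1) unfolding eq .
  show "(LBINT x. (norm (conv (kern \<beta> t) u x - conv (kern \<beta> t') u x))\<^sup>2) = - (LBINT z. msd u z * corr ?k ?k z) / 2"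
  using sq(3) unfolding eq .
qed

lemma integrable_small_ball:
  fixes f :: "'a::euclidean_space \<Rightarrow> real"
  assumes f: "integrable lborel f" "\<And>x. 0 \<le> f x" and e: "0 < e"
  obtains d where "0 < d" "(LBINT x. f x * indicator (ball 0 d) x) \<le> e"
proof -
  have [measurable]: "f \<in> borel_measurable borel" using f by auto
  have "(\<lambda>n. LBINT x. f x * indicator (ball 0 (inverse (real (Suc n)))) x) \<longlonglongrightarrow> (LBINT x::'a. 0)"
  proof (rule integral_dominated_convergence[where w=f])
  show "AE x in lborel. (\<lambda>n. f x * indicator (ball 0 (inverse (real (Suc n)))) x) \<longlonglongrightarrow> 0"
   using AE_lborel_singleton[of "0::'a"]
  proof eventually_elim
   case (elim x)
   then have "eventually (\<lambda>n. inverse (real (Suc n)) < norm x) sequentially"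
    using order_tendstoD(2)[OF LIMSEQ_inverse_real_of_nat, of "norm x"] by simp
   then have "eventually (\<lambda>n. f x * indicator (ball 0 (inverse (real (Suc n)))) x = 0) sequentially"
    by eventually_elim auto
   then show ?case by (rule tendsto_eventually)
  qed
  show "AE x in lborel. norm (f x * indicator (ball 0 (inverse (real (Suc n)))) x) \<le> f x" for n
   using f(2) by (intro AE_I2) (auto simp: indicator_def)
  show "(\<lambda>x. f x * indicator (ball 0 (inverse (real (Suc n)))) x) \<in> borel_measurable lborel" for n
  proof -
   have [measurable]: "ball (0::'a) (inverse (real (Suc n))) \<in> sets borel" by simp
   show ?thesis by measurable
  qed
  qed (use f in auto)
  then have "eventually (\<lambda>n. (LBINT x. f x * indicator (ball 0 (inverse (real (Suc n)))) x) < e) sequentially"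
  using e by (auto dest: order_tendstoD(2)[where a=e])
  then obtain n where "(LBINT x. f x * indicator (ball 0 (inverse (real (Suc n)))) x) < e"
  using eventually_happens trivial_limit_sequentially by blast
  then show thesis using that[of "inverse (real (Suc n))"] by (simp add: less_imp_le)
qed

section \<open>Limits of regularised convolutions\<close>

definition regularizable :: "real \<Rightarrow> ('a::euclidean_space \<Rightarrow> real) \<Rightarrow> bool" where
  "regularizable \<beta> u \<longleftrightarrow> (\<forall>e>0. \<exists>d>0. \<forall>t t'. 0 < t' \<longrightarrow> t' \<le> t \<longrightarrow> t < d \<longrightarrow>
  (LBINT x. (norm (conv (kern \<beta> t) u x - conv (kern \<beta> t') u x))\<^sup>2) \<le> e)"

lemma tame_kern': "1 < \<beta> \<Longrightarrow> tame \<beta> z (kern \<beta> t)"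
  by (rule tame_kern) simp

text \<open>The correlation of a difference of truncations is at most a constant times
  |z|^(n+2-2\<beta>) and vanishes for |z| \<ge> 2t. The L^2 distance of two truncated gradients is
  therefore controlled by the part of the energy with |z| < 2t, which is small by absolute
  continuity of the integral.\<close>

lemma regularizable_finite_energy:
  fixes u :: "'a::euclidean_space \<Rightarrow> real"
  assumes \<beta>: "real DIM('a) / 2 + 1 < \<beta>" "\<beta> < real DIM('a) + 2" and u: "L2c r u"
  and E: "integrable lborel (\<lambda>z. msd u z * norm z powr (real DIM('a) + 2 - 2 * \<beta>))"
  shows "regularizable \<beta> u"
  unfolding regularizable_def
proof (intro allI impI)
  fix e :: real assume e: "0 < e"
  let ?p = "real DIM('a) + 2 - 2 * \<beta>"
  have \<beta>1: "1 < \<beta>" by (rule dim_half_less[OF \<beta>(1)])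
  obtain C where C: "0 < C"
  "\<And>z k k' b b'. z \<noteq> (0::'a) \<Longrightarrow> tame \<beta> z k \<Longrightarrow> tame \<beta> z k' \<Longrightarrow> (\<And>w. norm (k w) \<le> b) \<Longrightarrow> (\<And>w. norm (k' w) \<le> b')
   \<Longrightarrow> \<bar>corr k k' z\<bar> \<le> C * norm z powr ?p"
  using corr_le[OF \<beta>] by metis
  have Ck: "\<bar>corr (kern \<beta> a) (kern \<beta> b) z\<bar> \<le> C * norm z powr ?p" if "0 < a" "0 < b" "z \<noteq> 0" for a b and z :: 'a
  using norm_kern_le_trunc[of \<beta> a] norm_kern_le_trunc[of \<beta> b] \<beta>1 that by (intro C(2) tame_kern') auto
  \<comment> \<open>Four correlations bounded with the constant C and the factor 1/2 in the identity
    for the square turn e / (2 C) into e.\<close>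
  obtain d where d: "0 < d" "(LBINT z. msd u z * norm z powr ?p * indicator (ball 0 d) z) \<le> e / (2 * C)"
  proof (rule integrable_small_ball[OF E, of "e / (2 * C)"])
  show "0 \<le> msd u z * norm z powr ?p" for z by (simp add: msd_nonneg)
  show "0 < e / (2 * C)" using e C(1) by simp
  qed (use that in blast)
  show "\<exists>d>0. \<forall>t t'. 0 < t' \<longrightarrow> t' \<le> t \<longrightarrow> t < d \<longrightarrow>
  (LBINT x. (norm (conv (kern \<beta> t) u x - conv (kern \<beta> t') u x))\<^sup>2) \<le> e"
  proof (intro exI[of _ "d / 2"] conjI allI impI)
  show "0 < d / 2" using d by simp
  fix t t' assume t: "0 < t'" "t' \<le> t" "t < d / 2"
  let ?k = "kdiff \<beta> t t' :: 'a \<Rightarrow> 'a"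
  have [measurable]: "ball (0::'a) d \<in> sets borel" by simp
  note sq = conv_diff_square[OF _ t(1,2) u, of \<beta>]
  have k4: "\<bar>corr ?k ?k z\<bar> \<le> 4 * C * norm z powr ?p" if "z \<noteq> 0" for z
  proof -
   have "corr ?k ?k z = corr (kern \<beta> t) (kern \<beta> t) z - corr (kern \<beta> t) (kern \<beta> t') z - corr (kern \<beta> t') (kern \<beta> t) z + corr (kern \<beta> t') (kern \<beta> t') z"
    unfolding kdiff_def[abs_def] using t \<beta> by (intro corr_diff kern_square_integrable) auto
   then show ?thesis
    using Ck[of t t z] Ck[of t t' z] Ck[of t' t z] Ck[of t' t' z] t that by linarith
  qed
  have "- (LBINT z. msd u z * corr ?k ?k z) \<le> \<bar>LBINT z. msd u z * corr ?k ?k z\<bar>" by simp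
  also have "\<dots> \<le> (LBINT z. \<bar>msd u z * corr ?k ?k z\<bar>)" by (rule integral_abs_bound)
  also have "\<dots> \<le> (LBINT z. 4 * C * (msd u z * norm z powr ?p * indicator (ball 0 d) z))"
  proof (rule integral_mono_AE)
   show "integrable lborel (\<lambda>z. \<bar>msd u z * corr ?k ?k z\<bar>)" using sq(1) \<beta>1 by simp
   show "integrable lborel (\<lambda>z. 4 * C * (msd u z * norm z powr ?p * indicator (ball 0 d) z))"
   proof (rule integrable_mult_right, rule Bochner_Integration.integrable_bound[OF E])
    show "AE z in lborel. norm (msd u z * norm z powr ?p * indicator (ball 0 d) z) \<le> norm (msd u z * norm z powr ?p)"
     by (intro AE_I2) (auto simp: indicator_def)
    show "(\<lambda>z. msd u z * norm z powr ?p * indicator (ball 0 d) z) \<in> borel_measurable lborel"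
     using L2c_measurable[OF u] by measurable
   qed
   show "AE z in lborel. \<bar>msd u z * corr ?k ?k z\<bar> \<le> 4 * C * (msd u z * norm z powr ?p * indicator (ball 0 d) z)"
    using AE_lborel_singleton[of "0::'a"]
   proof eventually_elim
    case (elim z)
    show ?case
    proof (cases "norm z < d")
     case True
     have "msd u z * \<bar>corr ?k ?k z\<bar> \<le> msd u z * (4 * C * norm z powr ?p)"
      by (intro mult_left_mono k4 elim msd_nonneg)
     then show ?thesis using True by (simp add: abs_mult msd_nonneg mult_ac)
    next
     case False
     then have "corr ?k ?k z = 0" using t by (intro corr_kdiff_eq_0) auto
     then show ?thesis using False by simp
    qed
   qed
  qed
  also have "\<dots> \<le> 4 * C * (e / (2 * C))"
   using d(2) C(1) by (simp only: integral_mult_right_zero) (intro mult_left_mono, auto)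
  also have "\<dots> = 2 * e" using C(1) by simp
  finally show "(LBINT x. (norm (conv (kern \<beta> t) u x - conv (kern \<beta> t') u x))\<^sup>2) \<le> e"
   using sq(3) \<beta>1 by simp
  qed
qed

text \<open>At \<beta> = n + 1 the power |z|^(-n) is integrable neither at 0 nor at infinity. On the
  ball of radius 2t the uniform bound t^(-n) replaces it and contributes a constant; outside, the
  vanishing of \<open>kappa\<close> leaves t |z|^(-n-1), whose integral is again a constant. So the
  L^1 norms are bounded uniformly in t.\<close>

lemma corr_kern_integrable_critical:
  assumes \<beta>: "\<beta> = real DIM('a::euclidean_space) + 1" and kappa: "\<And>z::'a. z \<noteq> 0 \<Longrightarrow> kappa \<beta> z = 0"
  obtains C where "0 < C" "\<And>t. 0 < t \<Longrightarrow> integrable lborel (corr (kern \<beta> t) (kern \<beta> t) :: 'a \<Rightarrow> real)"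
  "\<And>t. 0 < t \<Longrightarrow> (LBINT z::'a. \<bar>corr (kern \<beta> t) (kern \<beta> t) z\<bar>) \<le> C"
proof -
  let ?n = "real DIM('a)" and ?w = "sphere_area TYPE('a)"
  have n: "1 \<le> ?n" by (simp add: Suc_leI)
  have \<beta>b: "?n / 2 + 1 < \<beta>" "\<beta> < ?n + 2" using \<beta> n by auto
  have p: "?n + 2 - 2 * \<beta> = - ?n" "?n + 2 - \<beta> = 1" using \<beta> by auto
  obtain C1 where C1: "0 < C1" "\<And>t t' z. 0 < t' \<Longrightarrow> t' \<le> t \<Longrightarrow> \<bar>corr (kern \<beta> t) (kern \<beta> t') (z::'a)\<bar> \<le> C1 * t powr (- ?n)"
  using corr_trunc_le[OF \<beta>b] unfolding p by metis
  obtain C2 where C2: "0 < C2" "\<And>z t. 0 < t \<Longrightarrow> t \<le> norm (z::'a) / 2 \<Longrightarrow>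
   \<bar>corr (kern \<beta> t) (kern \<beta> t) z - kappa \<beta> z\<bar> \<le> C2 * norm z powr (- \<beta>) * t powr 1"
  using corr_kern_kappa[OF \<beta>b] unfolding p by metis
  define V where "V = unit_ball_vol ?n"
  have V: "0 < V" and w: "0 < ?w" by (auto simp: V_def sphere_area_pos)
  define C where "C = C1 * V * 2 ^ DIM('a) + C2 * ?w / 2"
  have C: "0 < C" using C1(1) C2(1) V w by (simp add: C_def add_pos_pos)
  have nn: "(LNINT z. ennreal \<bar>corr (kern \<beta> t) (kern \<beta> t) (z::'a)\<bar>) \<le> ennreal C" if t: "0 < t" for t
  proof -
  have [measurable]: "ball (0::'a) (2 * t) \<in> sets borel" by simp
  have "(LNINT z. ennreal \<bar>corr (kern \<beta> t) (kern \<beta> t) (z::'a)\<bar>)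
   \<le> (LNINT z. ennreal (C1 * t powr (- ?n)) * indicator (ball 0 (2 * t)) z
    + ennreal (C2 * t) * (ennreal (norm (z::'a) powr (- \<beta>)) * indicator (- ball 0 (2 * t)) z))"
  proof (rule nn_integral_mono)
   fix z :: 'a
   show "ennreal \<bar>corr (kern \<beta> t) (kern \<beta> t) z\<bar> \<le> ennreal (C1 * t powr (- ?n)) * indicator (ball 0 (2 * t)) z
    + ennreal (C2 * t) * (ennreal (norm (z::'a) powr (- \<beta>)) * indicator (- ball 0 (2 * t)) z)"
   proof (cases "norm z < 2 * t")
    case True
    then show ?thesis using C1(2)[of t t z] t by (auto intro!: ennreal_leI)
   next
    case False
    then have "z \<noteq> 0" using t by auto
    then have "\<bar>corr (kern \<beta> t) (kern \<beta> t) z\<bar> \<le> C2 * t * norm z powr (- \<beta>)"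
     using False C2(2)[of t z] t kappa[of z] by (simp add: mult_ac)
    then show ?thesis using False C2(1) t by (auto simp: ennreal_mult'[symmetric] intro!: ennreal_leI)
   qed
  qed
  also have "\<dots> = ennreal (C1 * t powr (- ?n)) * emeasure lborel (ball (0::'a) (2 * t))
   + ennreal (C2 * t) * (LNINT z. ennreal (norm (z::'a) powr (- \<beta>)) * indicator (- ball 0 (2 * t)) z)"
   by (subst nn_integral_add) (auto simp: nn_integral_cmult)
  also have "(LNINT z. ennreal (norm (z::'a) powr (- \<beta>)) * indicator (- ball 0 (2 * t)) z) = ennreal (?w * (2 * t) powr (- 1))"
   using nn_integral_norm_powr_out[of \<beta> "2 * t", where 'a='a] t by (simp add: \<beta>)
  also have "emeasure lborel (ball (0::'a) (2 * t)) = ennreal (V * (2 * t) ^ DIM('a))"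
   using t by (simp add: emeasure_ball V_def)
  also have "ennreal (C1 * t powr (- ?n)) * ennreal (V * (2 * t) ^ DIM('a)) = ennreal (C1 * V * 2 ^ DIM('a))"
  proof -
   have "C1 * t powr (- ?n) * (V * (2 * t) ^ DIM('a)) = C1 * V * 2 ^ DIM('a)"
    using t by (simp add: powr_minus powr_realpow power_mult_distrib)
   then show ?thesis using C1(1) by (metis ennreal_mult' mult_nonneg_nonneg less_imp_le powr_ge_zero)
  qed
  also have "ennreal (C2 * t) * ennreal (?w * (2 * t) powr (- 1)) = ennreal (C2 * ?w / 2)"
   using t C2 by (simp add: ennreal_mult'[symmetric] powr_minus_divide)
  also have "ennreal (C1 * V * 2 ^ DIM('a)) + ennreal (C2 * ?w / 2) = ennreal C"
   unfolding C_def using C1(1) C2(1) V w by (intro ennreal_plus[symmetric]) auto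
  finally show ?thesis .
  qed
  have i: "integrable lborel (corr (kern \<beta> t) (kern \<beta> t) :: 'a \<Rightarrow> real)" if "0 < t" for t
  using nn[OF that] by (intro integrableI_bounded) (auto intro: le_less_trans)
  show thesis
  proof (rule that[OF C i])
  show "(LBINT z::'a. \<bar>corr (kern \<beta> t) (kern \<beta> t) z\<bar>) \<le> C" if "0 < t" for t
  proof -
   have "\<bar>LBINT z::'a. \<bar>corr (kern \<beta> t) (kern \<beta> t) z\<bar>\<bar> \<le> C"
    using i[OF that] nn[OF that] C by (intro abs_integral_le_nn_integral[where g="\<lambda>z. \<bar>corr (kern \<beta> t) (kern \<beta> t) z\<bar>"]) auto
   then show ?thesis by simp
  qed
  qed
qed

text \<open>No energy is at hand to make the near-diagonal part small. Instead continuity of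
  translations makes \<open>msd\<close> small for |z| < 2t, and the correlation of the difference
  has an L^1 norm bounded independently of t and t'.\<close>

lemma regularizable_critical:
  fixes u :: "'a::euclidean_space \<Rightarrow> real"
  assumes \<beta>: "\<beta> = real DIM('a) + 1" and kappa: "\<And>z::'a. z \<noteq> 0 \<Longrightarrow> kappa \<beta> z = 0" and u: "L2c r u"
  shows "regularizable \<beta> u"
  unfolding regularizable_def
proof (intro allI impI)
  fix e :: real assume e: "0 < e"
  let ?n = "real DIM('a)"
  have n: "1 \<le> ?n" by (simp add: Suc_leI)
  have \<beta>b: "?n / 2 + 1 < \<beta>" "\<beta> < ?n + 2" and \<beta>1: "1 < \<beta>" using \<beta> n by auto
  have p: "?n + 2 - 2 * \<beta> = - ?n" using \<beta> by auto
  obtain C1 where C1: "0 < C1" "\<And>t t' z. 0 < t' \<Longrightarrow> t' \<le> t \<Longrightarrow> \<bar>corr (kern \<beta> t) (kern \<beta> t') (z::'a)\<bar> \<le> C1 * t powr (- ?n)"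
  using corr_trunc_le[OF \<beta>b] unfolding p by metis
  obtain C2 where C2: "0 < C2" "\<And>t. 0 < t \<Longrightarrow> integrable lborel (corr (kern \<beta> t) (kern \<beta> t) :: 'a \<Rightarrow> real)"
  "\<And>t. 0 < t \<Longrightarrow> (LBINT z::'a. \<bar>corr (kern \<beta> t) (kern \<beta> t) z\<bar>) \<le> C2"
  using corr_kern_integrable_critical[OF \<beta> kappa] by metis
  define V where "V = unit_ball_vol ?n"
  have V: "0 < V" by (simp add: V_def)
  define A where "A = 3 * C1 * V * 2 ^ DIM('a) + C2"
  have A: "0 < A" using C1(1) C2(1) V by (simp add: A_def add_pos_pos)
  define \<eta> where "\<eta> = e / A"
  have \<eta>: "0 < \<eta>" "\<eta> * A = e" using A e by (auto simp: \<eta>_def)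
  obtain d where d: "0 < d" "\<And>z. norm z < d \<Longrightarrow> msd u z \<le> \<eta>" using msd_small[OF u \<eta>(1)] by metis
  show "\<exists>d>0. \<forall>t t'. 0 < t' \<longrightarrow> t' \<le> t \<longrightarrow> t < d \<longrightarrow>
  (LBINT x. (norm (conv (kern \<beta> t) u x - conv (kern \<beta> t') u x))\<^sup>2) \<le> e"
  proof (intro exI[of _ "d / 2"] conjI allI impI)
  show "0 < d / 2" using d by simp
  fix t t' assume t: "0 < t'" "t' \<le> t" "t < d / 2"
  let ?k = "kdiff \<beta> t t' :: 'a \<Rightarrow> 'a" and ?c = "\<lambda>z. \<bar>corr (kern \<beta> t') (kern \<beta> t') (z::'a)\<bar>"
  note sq = conv_diff_square[OF _ t(1,2) u, of \<beta>]
  have k4: "\<bar>corr ?k ?k z\<bar> \<le> 3 * C1 * t powr (- ?n) + ?c z" for z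
  proof -
   have "corr ?k ?k z = corr (kern \<beta> t) (kern \<beta> t) z - corr (kern \<beta> t) (kern \<beta> t') z - corr (kern \<beta> t') (kern \<beta> t) z + corr (kern \<beta> t') (kern \<beta> t') z"
    unfolding kdiff_def[abs_def] using t \<beta>b by (intro corr_diff kern_square_integrable) auto
   moreover have "\<bar>corr (kern \<beta> t') (kern \<beta> t) z\<bar> \<le> C1 * t powr (- ?n)"
    using C1(2)[of t' t "- z"] t corr_swap[of "kern \<beta> t" "kern \<beta> t'" z] by simp
   ultimately show ?thesis using C1(2)[of t t z] C1(2)[of t' t z] t by linarith
  qed
  have ib: "integrable lborel (\<lambda>z. 3 * C1 * t powr (- ?n) * indicator (ball 0 (2 * t)) z + ?c z)"
   using C2(2)[OF t(1)] by (intro Bochner_Integration.integrable_add integrable_mult_right integrable_indicator_ball integrable_abs)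
  have "- (LBINT z. msd u z * corr ?k ?k z) \<le> \<bar>LBINT z. msd u z * corr ?k ?k z\<bar>" by simp
  also have "\<dots> \<le> (LBINT z. \<bar>msd u z * corr ?k ?k z\<bar>)" by (rule integral_abs_bound)
  also have "\<dots> \<le> (LBINT z. \<eta> * (3 * C1 * t powr (- ?n) * indicator (ball 0 (2 * t)) z + ?c z))"
  proof (rule integral_mono)
   show "integrable lborel (\<lambda>z. \<bar>msd u z * corr ?k ?k z\<bar>)" using sq(1) \<beta>1 by simp
   show "integrable lborel (\<lambda>z. \<eta> * (3 * C1 * t powr (- ?n) * indicator (ball 0 (2 * t)) z + ?c z))"
    using ib by simp
   fix z :: 'a
   show "\<bar>msd u z * corr ?k ?k z\<bar> \<le> \<eta> * (3 * C1 * t powr (- ?n) * indicator (ball 0 (2 * t)) z + ?c z)"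
   proof (cases "norm z < 2 * t")
    case True
    have "msd u z * \<bar>corr ?k ?k z\<bar> \<le> \<eta> * (3 * C1 * t powr (- ?n) + ?c z)"
     using d(2)[of z] True t \<eta>(1) by (intro mult_mono k4) auto
    then show ?thesis using True by (simp add: abs_mult msd_nonneg)
   next
    case False
    then have "corr ?k ?k z = 0" using t by (intro corr_kdiff_eq_0) auto
    then show ?thesis using False \<eta>(1) by simp
   qed
  qed
  also have "\<dots> = \<eta> * (3 * C1 * t powr (- ?n) * measure lborel (ball (0::'a) (2 * t)) + (LBINT z. ?c z))"
   using C2(2)[OF t(1)] integrable_indicator_ball[of "0::'a" "2 * t"] by simp
  also have "measure lborel (ball (0::'a) (2 * t)) = V * (2 * t) ^ DIM('a)"
   using t by (simp add: measure_def emeasure_ball V_def)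
  also have "3 * C1 * t powr (- ?n) * (V * (2 * t) ^ DIM('a)) = 3 * C1 * V * 2 ^ DIM('a)"
   using t by (simp add: powr_minus powr_realpow power_mult_distrib)
  also have "\<eta> * (3 * C1 * V * 2 ^ DIM('a) + (LBINT z. ?c z)) \<le> \<eta> * A"
   using C2(3)[OF t(1)] \<eta>(1) by (intro mult_left_mono) (auto simp: A_def)
  also have "\<dots> \<le> 2 * e" using \<eta> e by simp
  finally show "(LBINT x. (norm (conv (kern \<beta> t) u x - conv (kern \<beta> t') u x))\<^sup>2) \<le> e"
   using sq(3) \<beta>1 by simp
  qed
qed

section \<open>The limit in L^2 of the truncated gradients\<close>

lemma tendsto_integral_norm_square:
  fixes g :: "nat \<Rightarrow> 'b \<Rightarrow> 'a::euclidean_space"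
  assumes [measurable]: "\<And>i. g i \<in> borel_measurable M" "w \<in> borel_measurable M"
  and g: "\<And>i. integrable M (\<lambda>x. (norm (g i x))\<^sup>2)" and w: "integrable M (\<lambda>x. (norm (w x))\<^sup>2)"
  and lim: "(\<lambda>i. LINT x|M. (norm (g i x - w x))\<^sup>2) \<longlonglongrightarrow> 0"
  shows "(\<lambda>i. LINT x|M. (norm (g i x))\<^sup>2) \<longlonglongrightarrow> (LINT x|M. (norm (w x))\<^sup>2)"
proof -
  let ?W = "LINT x|M. (norm (w x))\<^sup>2" and ?d = "\<lambda>i. LINT x|M. (norm (g i x - w x))\<^sup>2"
  have eq: "(norm (g i x - w x))\<^sup>2 = (norm (g i x))\<^sup>2 + (norm (w x))\<^sup>2 - 2 * (g i x \<bullet> w x)" for i x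
  by (simp add: power2_norm_eq_inner inner_diff_left inner_diff_right inner_commute)
  have id: "integrable M (\<lambda>x. (norm (g i x - w x))\<^sup>2)" for i
  unfolding eq using g w integrable_inner_L2[of "g i" M w] by simp
  have iw: "integrable M (\<lambda>x. w x \<bullet> (g i x - w x))" for i
  using w id by (intro integrable_inner_L2) auto
  have eq2: "(norm (g i x))\<^sup>2 = (norm (g i x - w x))\<^sup>2 + 2 * (w x \<bullet> (g i x - w x)) + (norm (w x))\<^sup>2" for i x
  by (simp add: power2_norm_eq_inner inner_diff_left inner_diff_right inner_commute)
  have diff: "(LINT x|M. (norm (g i x))\<^sup>2) - ?W = ?d i + 2 * (LINT x|M. w x \<bullet> (g i x - w x))" for i
  unfolding eq2 using id iw w by simp
  have bound: "\<bar>(LINT x|M. (norm (g i x))\<^sup>2) - ?W\<bar> \<le> ?d i + (\<eta> * ?W + ?d i / \<eta>)" if \<eta>: "0 < \<eta>" for i \<eta>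
  proof -
  have le: "\<bar>2 * (a \<bullet> b)\<bar> \<le> \<eta> * (norm a)\<^sup>2 + (norm b)\<^sup>2 / \<eta>" for a b :: 'a
  proof -
   have "0 \<le> (sqrt \<eta> * norm a - norm b / sqrt \<eta>)\<^sup>2" by simp
   then have "2 * (norm a * norm b) \<le> \<eta> * (norm a)\<^sup>2 + (norm b)\<^sup>2 / \<eta>"
    using \<eta> by (simp add: power2_diff power_mult_distrib power_divide)
   then show ?thesis using Cauchy_Schwarz_ineq2[of a b] by (simp add: abs_mult)
  qed
  have "\<bar>LINT x|M. 2 * (w x \<bullet> (g i x - w x))\<bar> \<le> (LINT x|M. \<bar>2 * (w x \<bullet> (g i x - w x))\<bar>)"
   by (rule integral_abs_bound)
  also have "\<dots> \<le> (LINT x|M. \<eta> * (norm (w x))\<^sup>2 + (norm (g i x - w x))\<^sup>2 / \<eta>)"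
   using iw id w le by (intro integral_mono) auto
  also have "\<dots> = \<eta> * ?W + ?d i / \<eta>" using id w by simp
  finally have "\<bar>2 * (LINT x|M. w x \<bullet> (g i x - w x))\<bar> \<le> \<eta> * ?W + ?d i / \<eta>" by simp
  moreover have "0 \<le> ?d i" by simp
  ultimately show ?thesis unfolding diff by linarith
  qed
  show ?thesis
  proof (rule LIMSEQ_I)
  fix e :: real assume e: "0 < e"
  define W where "W = ?W"
  have W: "0 \<le> W" by (simp add: W_def)
  define \<eta> where "\<eta> = e / (4 * (W + 1))"
  have \<eta>0: "0 < \<eta>" "\<eta> * (W + 1) = e / 4" using e W by (auto simp: \<eta>_def divide_simps)
  then have \<eta>: "0 < \<eta>" "\<eta> * ?W \<le> e / 4" unfolding W_def[symmetric] by (auto simp: distrib_left)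
  have "(\<lambda>i. ?d i + ?d i / \<eta>) \<longlonglongrightarrow> 0 + 0 / \<eta>" using \<eta> by (intro tendsto_intros lim) auto
  then have "eventually (\<lambda>i. ?d i + ?d i / \<eta> < e / 4) sequentially"
   using e by (auto dest: order_tendstoD(2)[where a="e / 4"])
  then obtain N where N: "\<And>i. N \<le> i \<Longrightarrow> ?d i + ?d i / \<eta> < e / 4" by (auto simp: eventually_sequentially)
  have "norm ((LINT x|M. (norm (g i x))\<^sup>2) - ?W) < e" if "N \<le> i" for i
   using bound[OF \<eta>(1), of i] N[OF that] \<eta>(2) e unfolding real_norm_def by linarith
  then show "\<exists>N. \<forall>i\<ge>N. norm ((LINT x|M. (norm (g i x))\<^sup>2) - ?W) < e" by blast
  qed
qed

definition trunc_seq :: "nat \<Rightarrow> real" where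
  "trunc_seq i = inverse (real (Suc i))"

lemma trunc_seq_pos [simp]: "0 < trunc_seq i"
  by (simp add: trunc_seq_def)

lemma trunc_seq_tendsto: "filterlim trunc_seq (at_right 0) sequentially"
  unfolding filterlim_at using LIMSEQ_inverse_real_of_nat unfolding trunc_seq_def[abs_def] by auto

lemma conv_kern_square_integrable:
  fixes u :: "'a::euclidean_space \<Rightarrow> real"
  assumes \<beta>: "real DIM('a) / 2 + 1 < \<beta>" and t: "0 < t" and u: "L2c r u"
  shows "integrable lborel (\<lambda>x. (norm (conv (kern \<beta> t) u x))\<^sup>2)"
  and "integrable lborel (\<lambda>z. autocorr u z * corr (kern \<beta> t) (kern \<beta> t) z)"
  and "(LBINT x. (norm (conv (kern \<beta> t) u x))\<^sup>2) = (LBINT z. autocorr u z * corr (kern \<beta> t) (kern \<beta> t) z)"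
  using conv_square[OF L2c_integrable[OF u] _ norm_kern_le_trunc kern_square_integrable[OF \<beta> t]] dim_half_less[OF \<beta>] t
  by auto

lemma regularizable_limit:
  fixes u :: "'a::euclidean_space \<Rightarrow> real"
  assumes \<beta>: "real DIM('a) / 2 + 1 < \<beta>" and u: "L2c r u" and reg: "regularizable \<beta> u"
  obtains w where "w \<in> borel_measurable borel" "integrable lborel (\<lambda>x. (norm (w x))\<^sup>2)"
  "\<And>i. integrable lborel (\<lambda>x. (norm (conv (kern \<beta> (trunc_seq i)) u x - w x))\<^sup>2)"
  "(\<lambda>i. LBINT x. (norm (conv (kern \<beta> (trunc_seq i)) u x - w x))\<^sup>2) \<longlonglongrightarrow> 0"
  "(\<lambda>i. LBINT x. (norm (conv (kern \<beta> (trunc_seq i)) u x))\<^sup>2) \<longlonglongrightarrow> (LBINT x. (norm (w x))\<^sup>2)"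
proof -
  let ?g = "\<lambda>i. conv (kern \<beta> (trunc_seq i)) u"
  have \<beta>1: "1 < \<beta>" by (rule dim_half_less[OF \<beta>])
  have [measurable]: "u \<in> borel_measurable borel" by (rule L2c_measurable[OF u])
  have ig: "integrable lborel (\<lambda>x. (norm (?g i x))\<^sup>2)" for i
  by (rule conv_kern_square_integrable[OF \<beta> _ u]) simp
  have dec: "trunc_seq j \<le> trunc_seq i" if "i \<le> j" for i j
  using that by (simp add: trunc_seq_def field_simps)
  have cauchy: "\<exists>N. \<forall>i\<ge>N. \<forall>j\<ge>N. (LNINT x. ennreal ((norm (?g i x - ?g j x))\<^sup>2)) \<le> ennreal e" if e: "0 < e" for e
  proof -
  obtain d where d: "0 < d" "\<And>t t'. 0 < t' \<Longrightarrow> t' \<le> t \<Longrightarrow> t < d \<Longrightarrow>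
  (LBINT x. (norm (conv (kern \<beta> t) u x - conv (kern \<beta> t') u x))\<^sup>2) \<le> e"
   using reg e unfolding regularizable_def by meson
  obtain N where N: "\<And>i. N \<le> i \<Longrightarrow> trunc_seq i < d"
   using order_tendstoD(2)[OF LIMSEQ_inverse_real_of_nat d(1)] by (auto simp: eventually_sequentially trunc_seq_def)
  have main: "(LNINT x. ennreal ((norm (?g i x - ?g j x))\<^sup>2)) \<le> ennreal e" if "N \<le> i" "i \<le> j" for i j
  proof -
   have "integrable lborel (\<lambda>x. (norm (?g i x - ?g j x))\<^sup>2)"
    using dec[OF that(2)] \<beta>1 by (intro conv_diff_square(2)[OF _ _ _ u]) auto
   then have "(LNINT x. ennreal ((norm (?g i x - ?g j x))\<^sup>2)) = ennreal (LBINT x. (norm (?g i x - ?g j x))\<^sup>2)"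
    by (intro nn_integral_eq_integral) auto
   then show ?thesis using d(2)[OF _ dec[OF that(2)] N[OF that(1)]] by (simp add: ennreal_leI)
  qed
  have "(LNINT x. ennreal ((norm (?g i x - ?g j x))\<^sup>2)) \<le> ennreal e" if "N \<le> i" "N \<le> j" for i j
   using main[of i j] main[of j i] that by (cases "i \<le> j") (auto simp: norm_minus_commute)
  then show ?thesis by blast
  qed
  have mg: "?g i \<in> borel_measurable lborel" for i by simp
  obtain w where w: "w \<in> borel_measurable lborel"
  "\<And>e. 0 < e \<Longrightarrow> \<exists>N. \<forall>i\<ge>N. (LNINT x. ennreal ((norm (?g i x - w x))\<^sup>2)) \<le> ennreal e"
  using L2_complete[of ?g lborel, OF mg cauchy] by metis
  have [measurable]: "w \<in> borel_measurable borel" using w(1) by simp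
  have w2: "integrable lborel (\<lambda>x. (norm (w x))\<^sup>2)"
  proof -
  obtain i where i: "(LNINT x. ennreal ((norm (?g i x - w x))\<^sup>2)) \<le> ennreal 1" using w(2)[of 1] by auto
  have "integrable lborel (\<lambda>x. (norm (?g i x - w x))\<^sup>2)"
   using i by (intro integrableI_bounded) (auto intro: le_less_trans)
  then have "integrable lborel (\<lambda>x. 2 * (norm (?g i x - w x))\<^sup>2 + 2 * (norm (?g i x))\<^sup>2)" using ig by simp
  then show ?thesis
  proof (rule Bochner_Integration.integrable_bound)
   have "(norm b)\<^sup>2 \<le> 2 * (norm (a - b))\<^sup>2 + 2 * (norm a)\<^sup>2" for a b :: 'a
   proof -
    have "0 \<le> (norm (2 *\<^sub>R a - b))\<^sup>2" by simp
    then show ?thesis by (simp only: power2_norm_eq_inner) (simp add: inner_diff_left inner_diff_right inner_commute)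
   qed
   then show "AE x in lborel. norm ((norm (w x))\<^sup>2) \<le> norm (2 * (norm (?g i x - w x))\<^sup>2 + 2 * (norm (?g i x))\<^sup>2)"
    by (intro AE_I2) auto
  qed simp
  qed
  have id: "integrable lborel (\<lambda>x. (norm (?g i x - w x))\<^sup>2)" for i
  proof -
  have eq: "(norm (?g i x - w x))\<^sup>2 = (norm (?g i x))\<^sup>2 + (norm (w x))\<^sup>2 - 2 * (?g i x \<bullet> w x)" for x
   by (simp add: power2_norm_eq_inner inner_diff_left inner_diff_right inner_commute)
  show ?thesis unfolding eq using ig w2 integrable_inner_L2[of "?g i" lborel w] by simp
  qed
  have lim: "(\<lambda>i. LBINT x. (norm (?g i x - w x))\<^sup>2) \<longlonglongrightarrow> 0"
  proof (rule LIMSEQ_I)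
  fix e :: real assume e: "0 < e"
  obtain N where N: "\<And>i. N \<le> i \<Longrightarrow> (LNINT x. ennreal ((norm (?g i x - w x))\<^sup>2)) \<le> ennreal (e / 2)"
   using w(2)[of "e / 2"] e by auto
  have "norm ((LBINT x. (norm (?g i x - w x))\<^sup>2) - 0) < e" if "N \<le> i" for i
  proof -
   have "\<bar>LBINT x. (norm (?g i x - w x))\<^sup>2\<bar> \<le> e / 2"
    using id N[OF that] e by (intro abs_integral_le_nn_integral[where g="\<lambda>x. (norm (?g i x - w x))\<^sup>2"]) auto
   then show ?thesis using e by simp
  qed
  then show "\<exists>N. \<forall>i\<ge>N. norm ((LBINT x. (norm (?g i x - w x))\<^sup>2) - 0) < e" by blast
  qed
  show thesis
  proof (rule that[OF _ w2 id lim])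
  show "(\<lambda>i. LBINT x. (norm (?g i x))\<^sup>2) \<longlonglongrightarrow> (LBINT x. (norm (w x))\<^sup>2)"
   using ig w2 lim by (intro tendsto_integral_norm_square) auto
  qed simp
qed

section \<open>Limits of the squared norms in the three ranges around the critical exponent\<close>

lemma kern_integrable:
  assumes \<beta>: "real DIM('a::euclidean_space) + 1 < \<beta>" and t: "0 < t"
  shows "integrable lborel (kern \<beta> t :: 'a \<Rightarrow> 'a)"
proof (rule Bochner_Integration.integrable_bound)
  let ?g = "\<lambda>w::'a. norm w powr (- (\<beta> - 1)) * indicator (- ball 0 1) w"
  have [measurable]: "ball (0::'a) 1 \<in> sets borel" by simp
  have \<beta>1: "1 \<le> \<beta>" using \<beta> by (smt (verit) of_nat_0_le_iff)
  have g: "integrable lborel ?g"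
  proof (rule integrableI_bounded)
  have "(LNINT w. ennreal (norm (?g w))) = (LNINT w. ennreal (norm (w::'a) powr (- (\<beta> - 1))) * indicator (- ball 0 1) w)"
   by (intro nn_integral_cong) (auto simp: indicator_def)
  also have "\<dots> < \<infinity>" using \<beta> by (subst nn_integral_norm_powr_out) auto
  finally show "(LNINT w. ennreal (norm (?g w))) < \<infinity>" .
  qed measurable
  show "integrable lborel (\<lambda>w::'a. t powr (1 - \<beta>) * indicator (ball 0 1) w + ?g w)"
  using g integrable_indicator_ball[of "0::'a" 1] by (intro Bochner_Integration.integrable_add integrable_mult_right)
  show "AE w in lborel. norm (kern \<beta> t w) \<le> norm (t powr (1 - \<beta>) * indicator (ball 0 1) w + ?g w)"
  proof (rule AE_I2)
  fix w :: 'a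
  show "norm (kern \<beta> t w) \<le> norm (t powr (1 - \<beta>) * indicator (ball 0 1) w + ?g w)"
   using norm_kern_le_trunc[OF \<beta>1 t, of w] norm_kern_le[of \<beta> t w] \<beta>1
   by (cases "norm w < 1") auto
  qed
qed simp

lemma kappa_le:
  assumes \<beta>: "real DIM('a::euclidean_space) / 2 + 1 < \<beta>" "\<beta> < real DIM('a) + 2"
  obtains C where "0 < C"
  "\<And>t z. 0 < t \<Longrightarrow> z \<noteq> (0::'a) \<Longrightarrow> \<bar>corr (kern \<beta> t) (kern \<beta> t) z\<bar> \<le> C * norm z powr (real DIM('a) + 2 - 2 * \<beta>)"
  "\<And>z. z \<noteq> (0::'a) \<Longrightarrow> \<bar>kappa \<beta> z\<bar> \<le> C * norm z powr (real DIM('a) + 2 - 2 * \<beta>)"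
proof -
  let ?p = "real DIM('a) + 2 - 2 * \<beta>"
  have \<beta>1: "1 < \<beta>" by (rule dim_half_less[OF \<beta>(1)])
  obtain C where C: "0 < C"
  "\<And>z k k' b b'. z \<noteq> (0::'a) \<Longrightarrow> tame \<beta> z k \<Longrightarrow> tame \<beta> z k' \<Longrightarrow> (\<And>w. norm (k w) \<le> b) \<Longrightarrow> (\<And>w. norm (k' w) \<le> b')
   \<Longrightarrow> \<bar>corr k k' z\<bar> \<le> C * norm z powr ?p"
  using corr_le[OF \<beta>] by metis
  have 1: "\<bar>corr (kern \<beta> t) (kern \<beta> t) z\<bar> \<le> C * norm z powr ?p" if "0 < t" "z \<noteq> 0" for t and z :: 'a
  using norm_kern_le_trunc[of \<beta> t] \<beta>1 that by (intro C(2) tame_kern') auto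
  have 2: "\<bar>kappa \<beta> z\<bar> \<le> C * norm z powr ?p" if "z \<noteq> 0" for z :: 'a
  proof (rule tendsto_upperbound)
  show "((\<lambda>t. \<bar>corr (kern \<beta> t) (kern \<beta> t) z\<bar>) \<longlongrightarrow> \<bar>kappa \<beta> z\<bar>) (at_right 0)"
   by (intro tendsto_rabs tendsto_corr_kern \<beta> that)
  show "eventually (\<lambda>t. \<bar>corr (kern \<beta> t) (kern \<beta> t) z\<bar> \<le> C * norm z powr ?p) (at_right 0)"
   using 1 that by (intro eventually_at_rightI[of 0 1]) auto
  qed simp
  show thesis using that[OF C(1) 1 2] .
qed

lemma kappa_measurable [measurable]:
  "kappa \<beta> \<in> borel_measurable (borel :: 'a::euclidean_space measure)"
proof -
  have "(\<lambda>(z, w). corr_reg (kern \<beta> 0) (kern \<beta> 0) z w) \<in> borel_measurable (borel \<Otimes>\<^sub>M lborel :: ('a \<times> 'a) measure)"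
  proof -
  \<comment> \<open>The radius of the balls varies with z; with conditionals in place of indicators
    the integrand is visibly jointly measurable.\<close>
  have m: "(\<lambda>(z, w). kern \<beta> 0 w \<bullet> kern \<beta> 0 (w + z) - (if norm w < norm z / 2 then 1 else 0) * (kern \<beta> 0 w \<bullet> kern \<beta> 0 z)
   + (if norm (w + z) < norm z / 2 then 1 else 0) * (kern \<beta> 0 z \<bullet> kern \<beta> 0 (w + z))) \<in> borel_measurable (borel \<Otimes>\<^sub>M lborel :: ('a \<times> 'a) measure)"
   by measurable
  have eq: "(\<lambda>(z, w). kern \<beta> 0 w \<bullet> kern \<beta> 0 (w + z) - (if norm w < norm z / 2 then 1 else 0) * (kern \<beta> 0 w \<bullet> kern \<beta> 0 z)
   + (if norm (w + z) < norm z / 2 then 1 else 0) * (kern \<beta> 0 z \<bullet> kern \<beta> 0 (w + z)))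
   = (\<lambda>(z::'a, w). corr_reg (kern \<beta> 0) (kern \<beta> 0) z w)"
   by (auto simp: fun_eq_iff corr_reg_def indicator_def)
  show ?thesis using m unfolding eq .
  qed
  then show ?thesis
  unfolding kappa_def[abs_def] by (intro lborel.borel_measurable_lebesgue_integral) simp
qed

text \<open>For \<beta> > n + 1 each truncated kernel is integrable with integral zero, so its
  square can be expressed through \<open>msd\<close> instead of the autocorrelation of u. The energy
  density then dominates, which is what makes the limit legitimate although |z|^(n+2-2\<beta>) is
  not integrable at 0.\<close>

lemma conv_square_limit_finite_energy:
  fixes u :: "'a::euclidean_space \<Rightarrow> real"
  assumes \<beta>: "real DIM('a) + 1 < \<beta>" "\<beta> < real DIM('a) + 2" and u: "L2c r u"
  and E: "integrable lborel (\<lambda>z. msd u z * norm z powr (real DIM('a) + 2 - 2 * \<beta>))"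
  shows "(\<lambda>i. LBINT x. (norm (conv (kern \<beta> (trunc_seq i)) u x))\<^sup>2) \<longlonglongrightarrow> - (LBINT z. msd u z * kappa \<beta> z) / 2"
proof -
  let ?p = "real DIM('a) + 2 - 2 * \<beta>"
  have \<beta>b: "real DIM('a) / 2 + 1 < \<beta>" using \<beta> by (smt (verit) field_sum_of_halves of_nat_0_le_iff)
  have \<beta>1: "1 < \<beta>" by (rule dim_half_less[OF \<beta>b])
  have [measurable]: "u \<in> borel_measurable borel" by (rule L2c_measurable[OF u])
  obtain C where C: "0 < C"
  "\<And>t z. 0 < t \<Longrightarrow> z \<noteq> (0::'a) \<Longrightarrow> \<bar>corr (kern \<beta> t) (kern \<beta> t) z\<bar> \<le> C * norm z powr ?p"
  using kappa_le[OF \<beta>b \<beta>(2)] by metis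
  have "(\<lambda>i. LBINT z. msd u z * corr (kern \<beta> (trunc_seq i)) (kern \<beta> (trunc_seq i)) z) \<longlonglongrightarrow> (LBINT z. msd u z * kappa \<beta> z)"
  proof (rule integral_dominated_convergence[where w="\<lambda>z. C * (msd u z * norm z powr ?p)"])
  show "AE z in lborel. (\<lambda>i. msd u z * corr (kern \<beta> (trunc_seq i)) (kern \<beta> (trunc_seq i)) z) \<longlonglongrightarrow> msd u z * kappa \<beta> z"
   using AE_lborel_singleton[of "0::'a"]
  proof eventually_elim
   case (elim z)
   then show ?case
    using filterlim_compose[OF tendsto_corr_kern[OF \<beta>b \<beta>(2) elim] trunc_seq_tendsto] by (intro tendsto_intros)
  qed
  show "AE z in lborel. norm (msd u z * corr (kern \<beta> (trunc_seq i)) (kern \<beta> (trunc_seq i)) z) \<le> C * (msd u z * norm z powr ?p)" for i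
   using AE_lborel_singleton[of "0::'a"]
  proof eventually_elim
   case (elim z)
   have "msd u z * \<bar>corr (kern \<beta> (trunc_seq i)) (kern \<beta> (trunc_seq i)) z\<bar> \<le> msd u z * (C * norm z powr ?p)"
    using elim by (intro mult_left_mono C(2) msd_nonneg) auto
   then show ?case by (simp add: abs_mult msd_nonneg mult_ac)
  qed
  qed (use E in simp_all)
  then have "(\<lambda>i. - (LBINT z. msd u z * corr (kern \<beta> (trunc_seq i)) (kern \<beta> (trunc_seq i)) z) / 2) \<longlonglongrightarrow> - (LBINT z. msd u z * kappa \<beta> z) / 2"
  by (intro tendsto_intros) auto
  moreover have "(LBINT x. (norm (conv (kern \<beta> (trunc_seq i)) u x))\<^sup>2) = - (LBINT z. msd u z * corr (kern \<beta> (trunc_seq i)) (kern \<beta> (trunc_seq i)) z) / 2" for i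
  using \<beta>1 norm_kern_le_trunc[of \<beta> "trunc_seq i"] by (intro conv_square_msd(3)[OF u kern_integrable[OF \<beta>(1)]]) auto
  ultimately show ?thesis by simp
qed

lemma kern_scale_trunc: "0 < t \<Longrightarrow> kern \<beta> t (t *\<^sub>R h) = t powr (1 - \<beta>) *\<^sub>R kern \<beta> 1 h"
proof -
  assume t: "0 < t"
  have "max (norm (t *\<^sub>R h)) t = t * max (norm h) 1" using t by (simp add: max_mult_distrib_left)
  then show ?thesis using t by (simp add: kern_def powr_mult powr_diff powr_minus_divide)
qed

lemma integral_scale:
  fixes f :: "'a::euclidean_space \<Rightarrow> real"
  assumes [measurable]: "f \<in> borel_measurable borel" and c: "0 < c"
  shows "(LBINT x. f x) = c ^ DIM('a) * (LBINT x. f (c *\<^sub>R x))"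
proof -
  have "(LBINT x. f x) = \<bar>c\<bar> ^ DIM('a) *\<^sub>R (LBINT x. f (0 + c *\<^sub>R x))"
  using c by (subst lborel_affine[of c 0]) (auto simp: integral_density integral_distr)
  then show ?thesis using c by simp
qed

lemma corr_kern_scale:
  fixes z :: "'a::euclidean_space"
  assumes t: "0 < t"
  shows "corr (kern \<beta> t) (kern \<beta> t) (t *\<^sub>R z) = t powr (real DIM('a) + 2 - 2 * \<beta>) * corr (kern \<beta> 1) (kern \<beta> 1) z"
proof -
  have add: "t *\<^sub>R w + t *\<^sub>R z = t *\<^sub>R (w + z)" for w by (simp add: scaleR_add_right)
  have c2: "t powr (1 - \<beta>) * (t powr (1 - \<beta>) * x) = t powr (2 - 2 * \<beta>) * x" for x
  by (simp add: powr_add[symmetric] mult.assoc[symmetric])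
  have "corr (kern \<beta> t) (kern \<beta> t) (t *\<^sub>R z) = t ^ DIM('a) * (LBINT w. kern \<beta> t (t *\<^sub>R w) \<bullet> kern \<beta> t (t *\<^sub>R w + t *\<^sub>R z))"
  unfolding corr_def using t by (intro integral_scale) auto
  also have "\<dots> = t ^ DIM('a) * (t powr (2 - 2 * \<beta>) * corr (kern \<beta> 1) (kern \<beta> 1) z)"
  unfolding add kern_scale_trunc[OF t] corr_def by (simp add: c2)
  finally show ?thesis using t
  by (simp add: powr_realpow[symmetric] powr_add[symmetric] mult.assoc[symmetric] algebra_simps)
qed

text \<open>At \<beta> = n + 1 the correlation of the kernel truncated at t is t^(-n) times that of
  the kernel truncated at 1, evaluated at z/t: a family concentrating at 0 with fixed total integral
  M. Against the autocorrelation of u, continuous at 0 with value the squared norm, it acts in the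
  limit as M times a point mass.\<close>

lemma conv_square_limit_critical:
  assumes \<beta>: "\<beta> = real DIM('a::euclidean_space) + 1" and kappa: "\<And>z::'a. z \<noteq> 0 \<Longrightarrow> kappa \<beta> z = 0"
  obtains M where "\<And>r u. L2c r (u :: 'a \<Rightarrow> real) \<Longrightarrow>
  (\<lambda>i. LBINT x. (norm (conv (kern \<beta> (trunc_seq i)) u x))\<^sup>2) \<longlonglongrightarrow> M * (LBINT x. (u x)\<^sup>2)"
proof
  let ?n = "real DIM('a)" and ?c = "corr (kern \<beta> 1) (kern \<beta> 1) :: 'a \<Rightarrow> real"
  have n: "1 \<le> ?n" by (simp add: Suc_leI)
  have \<beta>b: "?n / 2 + 1 < \<beta>" using \<beta> n by auto
  have p: "?n + 2 - 2 * \<beta> = - ?n" using \<beta> by auto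
  have ic: "integrable lborel ?c"
  using corr_kern_integrable_critical[OF \<beta> kappa] zero_less_one by metis
  fix r and u :: "'a \<Rightarrow> real" assume u: "L2c r u"
  have [measurable]: "u \<in> borel_measurable borel" by (rule L2c_measurable[OF u])
  let ?N = "LBINT x. (u x)\<^sup>2"
  have cont: "(autocorr u \<longlongrightarrow> ?N) (at 0)"
  proof (rule LIM_I)
  fix e :: real assume e: "0 < e"
  obtain d where d: "0 < d" "\<And>z. norm z < d \<Longrightarrow> msd u z \<le> e" using msd_small[OF u e] by metis
  have "norm (autocorr u z - ?N) < e" if "norm z < d" for z
   using msd_eq[OF u, of z] d(2)[OF that] msd_nonneg[of u z] e by (simp add: abs_less_iff)
  then show "\<exists>s>0. \<forall>x. x \<noteq> 0 \<and> norm (x - 0) < s \<longrightarrow> norm (autocorr u x - ?N) < e" using d(1) by auto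
  qed
  have t0: "trunc_seq \<longlonglongrightarrow> 0" using LIMSEQ_inverse_real_of_nat unfolding trunc_seq_def[abs_def] .
  have "(\<lambda>i. LBINT y. autocorr u (trunc_seq i *\<^sub>R y) * ?c y) \<longlonglongrightarrow> (LBINT y. ?N * ?c y)"
  proof (rule integral_dominated_convergence[where w="\<lambda>y. ?N * \<bar>?c y\<bar>"])
  show "AE y in lborel. (\<lambda>i. autocorr u (trunc_seq i *\<^sub>R y) * ?c y) \<longlonglongrightarrow> ?N * ?c y"
   using AE_lborel_singleton[of "0::'a"]
  proof eventually_elim
   case (elim y)
   have "filterlim (\<lambda>i. trunc_seq i *\<^sub>R y) (at 0) sequentially"
    unfolding filterlim_at using elim less_imp_neq[OF trunc_seq_pos] by (auto intro!: tendsto_eq_intros t0)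
   from filterlim_compose[OF cont this] show ?case by (intro tendsto_intros)
  qed
  show "AE y in lborel. norm (autocorr u (trunc_seq i *\<^sub>R y) * ?c y) \<le> ?N * \<bar>?c y\<bar>" for i
   using abs_autocorr_le[OF u] by (intro AE_I2) (auto simp: abs_mult intro!: mult_right_mono)
  have [measurable]: "autocorr u \<in> borel_measurable borel" "?c \<in> borel_measurable borel" by simp_all
  show "(\<lambda>y. autocorr u (trunc_seq i *\<^sub>R y) * ?c y) \<in> borel_measurable lborel" for i by measurable
  qed (use ic in auto)
  moreover have "(LBINT x. (norm (conv (kern \<beta> t) u x))\<^sup>2) = (LBINT y. autocorr u (t *\<^sub>R y) * ?c y)" if t: "0 < t" for t
  proof -
  have "(LBINT x. (norm (conv (kern \<beta> t) u x))\<^sup>2) = (LBINT z. autocorr u z * corr (kern \<beta> t) (kern \<beta> t) z)"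
   by (rule conv_kern_square_integrable(3)[OF \<beta>b t u])
  also have "\<dots> = t ^ DIM('a) * (LBINT y. autocorr u (t *\<^sub>R y) * corr (kern \<beta> t) (kern \<beta> t) (t *\<^sub>R y))"
   using t by (intro integral_scale) auto
  also have "\<dots> = t ^ DIM('a) * (LBINT y. t powr (- ?n) * (autocorr u (t *\<^sub>R y) * ?c y))"
   unfolding corr_kern_scale[OF t] p by (simp add: mult_ac)
  also have "\<dots> = t ^ DIM('a) * (t powr (- ?n) * (LBINT y. autocorr u (t *\<^sub>R y) * ?c y))" by simp
  also have "\<dots> = (LBINT y. autocorr u (t *\<^sub>R y) * ?c y)"
   using t by (simp add: powr_minus powr_realpow)
  finally show ?thesis .
  qed
  ultimately show "(\<lambda>i. LBINT x. (norm (conv (kern \<beta> (trunc_seq i)) u x))\<^sup>2) \<longlonglongrightarrow> (LBINT y. ?c y) * ?N"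
  by (simp add: mult.commute)
qed

text \<open>Below n + 1 the power |z|^(n+2-2\<beta>) is locally integrable and the autocorrelation
  of u has compact support, so \<open>kappa\<close> acts as a potential and dominated convergence
  applies without any energy assumption.\<close>

lemma conv_square_limit_potential:
  fixes u :: "'a::euclidean_space \<Rightarrow> real"
  assumes \<beta>: "real DIM('a) / 2 + 1 < \<beta>" "\<beta> < real DIM('a) + 1" and u: "L2c r u"
  shows "(\<lambda>i. LBINT x. (norm (conv (kern \<beta> (trunc_seq i)) u x))\<^sup>2) \<longlonglongrightarrow> (LBINT z. autocorr u z * kappa \<beta> z)"
proof -
  let ?p = "real DIM('a) + 2 - 2 * \<beta>" and ?N = "LBINT x. (u x)\<^sup>2"
  have \<beta>2: "\<beta> < real DIM('a) + 2" using \<beta> by simp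
  have r: "0 < r" using u by (simp add: L2c_def)
  have [measurable]: "u \<in> borel_measurable borel" by (rule L2c_measurable[OF u])
  have [measurable]: "ball (0::'a) (2 * r) \<in> sets borel" by simp
  obtain C where C: "0 < C"
  "\<And>t z. 0 < t \<Longrightarrow> z \<noteq> (0::'a) \<Longrightarrow> \<bar>corr (kern \<beta> t) (kern \<beta> t) z\<bar> \<le> C * norm z powr ?p"
  using kappa_le[OF \<beta>(1) \<beta>2] by metis
  have ip: "integrable lborel (\<lambda>z::'a. norm z powr ?p * indicator (ball 0 (2 * r)) z)"
  proof (rule integrableI_bounded)
  have 1: "2 * \<beta> - 2 - real DIM('a) < real DIM('a)" "0 < 2 * r" using \<beta> r by auto
  have 2: "- (2 * \<beta> - 2 - real DIM('a)) = ?p" by simp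
  have "(LNINT z. ennreal (norm (norm z powr ?p * indicator (ball (0::'a) (2 * r)) z)))
   = (LNINT z. ennreal (norm (z::'a) powr ?p) * indicator (ball 0 (2 * r)) z)"
   by (intro nn_integral_cong) (auto simp: indicator_def)
  also have "\<dots> < \<infinity>" using nn_integral_norm_powr_ball[OF 1] unfolding 2 by simp
  finally show "(LNINT z. ennreal (norm (norm z powr ?p * indicator (ball (0::'a) (2 * r)) z))) < \<infinity>" .
  show "(\<lambda>z. norm z powr ?p * indicator (ball (0::'a) (2 * r)) z) \<in> borel_measurable lborel" by measurable
  qed
  have N: "0 \<le> ?N" by simp
  have "(\<lambda>i. LBINT z. autocorr u z * corr (kern \<beta> (trunc_seq i)) (kern \<beta> (trunc_seq i)) z) \<longlonglongrightarrow> (LBINT z. autocorr u z * kappa \<beta> z)"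
  proof (rule integral_dominated_convergence[where w="\<lambda>z::'a. ?N * C * (norm z powr ?p * indicator (ball 0 (2 * r)) z)"])
  show "AE z in lborel. (\<lambda>i. autocorr u z * corr (kern \<beta> (trunc_seq i)) (kern \<beta> (trunc_seq i)) z) \<longlonglongrightarrow> autocorr u z * kappa \<beta> z"
   using AE_lborel_singleton[of "0::'a"]
  proof eventually_elim
   case (elim z)
   then show ?case
    using filterlim_compose[OF tendsto_corr_kern[OF \<beta>(1) \<beta>2 elim] trunc_seq_tendsto] by (intro tendsto_intros)
  qed
  show "AE z in lborel. norm (autocorr u z * corr (kern \<beta> (trunc_seq i)) (kern \<beta> (trunc_seq i)) z) \<le> ?N * C * (norm z powr ?p * indicator (ball 0 (2 * r)) z)" for i
   using AE_lborel_singleton[of "0::'a"]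
  proof eventually_elim
   case (elim z)
   show ?case
   proof (cases "norm z < 2 * r")
    case True
    have "\<bar>autocorr u z\<bar> * \<bar>corr (kern \<beta> (trunc_seq i)) (kern \<beta> (trunc_seq i)) z\<bar> \<le> ?N * (C * norm z powr ?p)"
     using elim by (intro mult_mono C(2) abs_autocorr_le[OF u]) auto
    then show ?thesis using True by (simp add: abs_mult mult_ac)
   qed (use autocorr_eq_0[OF u] in auto)
  qed
  show "integrable lborel (\<lambda>z::'a. ?N * C * (norm z powr ?p * indicator (ball 0 (2 * r)) z))"
   by (intro integrable_mult_right ip)
  qed simp_all
  then show ?thesis unfolding conv_kern_square_integrable(3)[OF \<beta>(1) trunc_seq_pos u] .
qed

section \<open>A test function that decides the sign of the constants\<close>

definition bump :: "'a::euclidean_space \<Rightarrow> real" where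
  "bump x = max 0 (1 - norm x)"

lemma bump_measurable [measurable]: "bump \<in> borel_measurable borel"
  unfolding bump_def[abs_def] by measurable

lemma bump_bounds: "0 \<le> bump x" "bump x \<le> 1" "1 \<le> norm x \<Longrightarrow> bump x = 0"
  by (auto simp: bump_def)

lemma bump_lipschitz: "\<bar>bump x - bump y\<bar> \<le> norm (x - y)"
  unfolding bump_def using norm_triangle_ineq3[of x y] by (smt (verit))

lemma bump_minus [simp]: "bump (- x) = bump x"
  by (simp add: bump_def)

lemma L2c_bump: "L2c 1 (bump :: 'a::euclidean_space \<Rightarrow> real)"
proof -
  have "integrable lborel (\<lambda>x::'a. (bump x)\<^sup>2)"
  proof (rule integrable_bounded_ball[where b=1 and r=1])
  show "norm ((bump x)\<^sup>2) \<le> 1" for x :: 'a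
   using power_mono[OF bump_bounds(2) bump_bounds(1), of x 2] by simp
  qed (auto simp: bump_def max_def split: if_splits)
  then show ?thesis by (simp add: L2c_def bump_bounds)
qed

lemma integral_bump_pos: "0 < (LBINT x::'a::euclidean_space. bump x)"
proof -
  have "0 < (1 / 2) * measure lborel (ball (0::'a) (1 / 2))"
  by (simp add: measure_def emeasure_ball)
  also have "\<dots> = (LBINT x::'a. (1 / 2) * indicator (ball 0 (1 / 2)) x)" by simp
  also have "\<dots> \<le> (LBINT x::'a. bump x)"
  proof (rule integral_mono)
  show "integrable lborel (\<lambda>x::'a. (1 / 2) * indicator (ball 0 (1 / 2)) x :: real)"
   by (intro integrable_mult_right integrable_indicator_ball)
  show "(1 / 2) * indicator (ball 0 (1 / 2)) x \<le> bump x" for x :: 'a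
   by (auto simp: bump_def indicator_def)
  qed (rule L2c_integrable[OF L2c_bump])
  finally show ?thesis .
qed

text \<open>Seen from points near 4e the support of the bump lies entirely in the direction -e, so
  there is no cancellation, and it is farther away than the truncation radius t \<le> 1. The
  resulting lower bound does not depend on t and survives the limit, where it forbids the squared
  norm to vanish or a formula for it to have the wrong sign.\<close>

lemma conv_bump_lower_bound:
  assumes "0 \<le> \<beta>" "1 < \<beta>"
  obtains \<delta> where "0 < \<delta>" "\<And>t. 0 < t \<Longrightarrow> t \<le> 1 \<Longrightarrow> integrable lborel (\<lambda>x. (norm (conv (kern \<beta> t) (bump :: 'a \<Rightarrow> real) x))\<^sup>2) \<Longrightarrow>
  \<delta> \<le> (LBINT x. (norm (conv (kern \<beta> t) (bump :: 'a::euclidean_space \<Rightarrow> real) x))\<^sup>2)"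
proof -
  obtain e :: 'a where e: "norm e = 1" using vector_choose_size[of 1] by auto
  let ?I = "LBINT x::'a. bump x"
  have I: "0 < ?I" by (rule integral_bump_pos)
  \<comment> \<open>For x within distance 1 of 4e and |y| < 1 one has |y - x| \<le> 6, x . e \<ge> 3
    and y . e \<le> 1; this accounts for the 6 and the factor 2.\<close>
  define m where "m = 2 * 6 powr (- \<beta>) * ?I"
  have m: "0 < m" using I by (simp add: m_def)
  let ?V = "measure lborel (ball (4 *\<^sub>R e) 1)"
  have V: "0 < ?V" by (simp add: measure_def emeasure_ball)
  show thesis
  proof (rule that)
  show "0 < m\<^sup>2 * ?V" using m V by simp
  fix t :: real assume t: "0 < t" "t \<le> 1" and i: "integrable lborel (\<lambda>x. (norm (conv (kern \<beta> t) (bump :: 'a \<Rightarrow> real) x))\<^sup>2)"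
  have low: "m \<le> norm (conv (kern \<beta> t) (bump :: 'a \<Rightarrow> real) x)" if x: "norm (x - 4 *\<^sub>R e) < 1" for x :: 'a
  proof -
   have ci: "integrable lborel (\<lambda>y. bump y *\<^sub>R kern \<beta> t (y - x))"
    using assms t norm_kern_le_trunc[of \<beta> t] by (intro integrable_conv[OF L2c_integrable[OF L2c_bump]]) auto
   have xe: "3 \<le> x \<bullet> e"
    using Cauchy_Schwarz_ineq2[of "x - 4 *\<^sub>R e" e] x e by (simp add: inner_diff_left power2_norm_eq_inner[symmetric])
   have nx: "norm x \<le> 5" "3 \<le> norm x"
    using norm_triangle_ineq2[of x "4 *\<^sub>R e"] norm_triangle_ineq2[of "4 *\<^sub>R e" x] x e by (auto simp: norm_minus_commute)
   have pt: "6 powr (- \<beta>) * 2 * bump y \<le> - ((bump y *\<^sub>R kern \<beta> t (y - x)) \<bullet> e)" for y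
   proof (cases "norm y < 1")
    case True
    have d: "2 \<le> norm (y - x)" "norm (y - x) \<le> 6"
     using norm_triangle_ineq2[of x y] norm_triangle_ineq4[of y x] True nx by (auto simp: norm_minus_commute)
    have ye: "y \<bullet> e \<le> 1" using Cauchy_Schwarz_ineq2[of y e] True e by simp
    have "6 powr (- \<beta>) * 2 \<le> norm (y - x) powr (- \<beta>) * (x \<bullet> e - y \<bullet> e)"
     using d xe ye assms by (intro mult_mono powr_mono2') auto
    then have "bump y * (6 powr (- \<beta>) * 2) \<le> bump y * (norm (y - x) powr (- \<beta>) * (x \<bullet> e - y \<bullet> e))"
     by (intro mult_left_mono bump_bounds)
    moreover have "kern \<beta> t (y - x) = norm (y - x) powr (- \<beta>) *\<^sub>R (y - x)" using d t by (intro kern_eq) auto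
    then have "(bump y *\<^sub>R kern \<beta> t (y - x)) \<bullet> e = - (bump y * (norm (y - x) powr (- \<beta>) * (x \<bullet> e - y \<bullet> e)))"
     by (simp only: inner_scaleR_left inner_diff_left) (simp add: right_diff_distrib)
    ultimately show ?thesis by (simp only: minus_minus mult_ac)
   qed (simp add: bump_bounds)
   have "m = (LBINT y. 6 powr (- \<beta>) * 2 * bump (y::'a))" by (simp add: m_def)
   also have "\<dots> \<le> (LBINT y. - ((bump y *\<^sub>R kern \<beta> t (y - x)) \<bullet> e))"
   proof (rule integral_mono)
    show "integrable lborel (\<lambda>y. 6 powr (- \<beta>) * 2 * bump (y::'a))"
     by (intro integrable_mult_right L2c_integrable[OF L2c_bump])
    show "integrable lborel (\<lambda>y. - ((bump y *\<^sub>R kern \<beta> t (y - x)) \<bullet> e))"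
     by (intro Bochner_Integration.integrable_minus integrable_inner_left ci)
   qed (rule pt)
   also have "\<dots> = - (conv (kern \<beta> t) bump x \<bullet> e)"
    unfolding conv_def using integral_inner_left[OF ci, of e] by simp
   also have "\<dots> \<le> norm (conv (kern \<beta> t) (bump :: 'a \<Rightarrow> real) x)"
    using Cauchy_Schwarz_ineq2[of "conv (kern \<beta> t) bump x" e] e by simp
   finally show ?thesis .
  qed
  have "m\<^sup>2 * ?V = (LBINT x. m\<^sup>2 * indicator (ball (4 *\<^sub>R e) 1) x)" by simp
  also have "\<dots> \<le> (LBINT x. (norm (conv (kern \<beta> t) (bump :: 'a \<Rightarrow> real) x))\<^sup>2)"
  proof (rule integral_mono[OF _ i])
   show "m\<^sup>2 * indicator (ball (4 *\<^sub>R e) 1) x \<le> (norm (conv (kern \<beta> t) (bump :: 'a \<Rightarrow> real) x))\<^sup>2" for x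
    using low[of x] m by (auto simp: indicator_def dist_norm norm_minus_commute intro!: power_mono)
  qed (simp add: integrable_indicator_ball)
  finally show "m\<^sup>2 * ?V \<le> (LBINT x. (norm (conv (kern \<beta> t) (bump :: 'a \<Rightarrow> real) x))\<^sup>2)" .
  qed
qed

text \<open>The bump is Lipschitz, so \<open>msd\<close> is of order |z|^2 near 0, where \<beta> < n
  + 2 suffices; at infinity \<open>msd\<close> is bounded and \<beta> > n + 1 gives
  convergence.\<close>

lemma bump_finite_energy:
  assumes \<beta>: "real DIM('a) + 1 < \<beta>" "\<beta> < real DIM('a::euclidean_space) + 2"
  shows "integrable lborel (\<lambda>z. msd (bump :: 'a \<Rightarrow> real) z * norm z powr (real DIM('a) + 2 - 2 * \<beta>))"
proof (rule integrableI_bounded)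
  let ?n = "real DIM('a)" and ?p = "real DIM('a) + 2 - 2 * \<beta>"
  let ?N = "LBINT x. (bump (x::'a))\<^sup>2" and ?V = "measure lborel (ball (0::'a) 2)"
  have [measurable]: "ball (0::'a) 1 \<in> sets borel" by simp
  have small: "msd (bump :: 'a \<Rightarrow> real) z \<le> ?V * (norm z)\<^sup>2" if z: "norm z < 1" for z
  proof -
  have "msd (bump :: 'a \<Rightarrow> real) z \<le> (LBINT y::'a. (norm z)\<^sup>2 * indicator (ball 0 2) y)"
   unfolding msd_def
  proof (rule integral_mono[OF msd_integrable[OF L2c_bump]])
   fix y :: 'a
   show "(bump (y + z) - bump y)\<^sup>2 \<le> (norm z)\<^sup>2 * indicator (ball 0 2) y"
   proof (cases "norm y < 2")
    case True
    then show ?thesis using power_mono[OF bump_lipschitz[of "y + z" y], of 2] by simp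
   next
    case False
    then have "1 \<le> norm (y + z)" using norm_diff_ineq[of y z] z by simp
    then show ?thesis using False by (simp add: bump_bounds)
   qed
  qed (simp add: integrable_indicator_ball)
  then show ?thesis by (simp add: mult.commute)
  qed
  have 1: "2 * \<beta> - ?n - 4 < ?n" "2 * \<beta> - ?n - 2 > ?n" using \<beta> by auto
  have 2: "- (2 * \<beta> - ?n - 4) = 2 + ?p" "- (2 * \<beta> - ?n - 2) = ?p" by auto
  have fin: "(LNINT z. ennreal (norm (z::'a) powr (2 + ?p)) * indicator (ball 0 1) z) < \<infinity>"
  "(LNINT z. ennreal (norm (z::'a) powr ?p) * indicator (- ball 0 1) z) < \<infinity>"
  using nn_integral_norm_powr_ball[OF 1(1) zero_less_one] nn_integral_norm_powr_out[OF 1(2) zero_less_one] unfolding 2 by simp_all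
  have "(LNINT z. ennreal (norm (msd (bump :: 'a \<Rightarrow> real) z * norm z powr ?p)))
  \<le> (LNINT z. ennreal ?V * (ennreal (norm (z::'a) powr (2 + ?p)) * indicator (ball 0 1) z)
   + ennreal (4 * ?N) * (ennreal (norm (z::'a) powr ?p) * indicator (- ball 0 1) z))"
  proof (rule nn_integral_mono)
  fix z :: 'a
  show "ennreal (norm (msd (bump :: 'a \<Rightarrow> real) z * norm z powr ?p)) \<le> ennreal ?V * (ennreal (norm z powr (2 + ?p)) * indicator (ball 0 1) z)
   + ennreal (4 * ?N) * (ennreal (norm z powr ?p) * indicator (- ball 0 1) z)"
  proof (cases "norm z < 1")
   case True
   have "msd (bump :: 'a \<Rightarrow> real) z * norm z powr ?p \<le> (?V * (norm z)\<^sup>2) * norm z powr ?p"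
    by (intro mult_right_mono small True) simp
   also have "(norm z)\<^sup>2 * norm z powr ?p = norm z powr (2 + ?p)"
   proof -
    have "norm z powr (2 + ?p) = norm z powr 2 * norm z powr ?p" by (rule powr_add)
    then show ?thesis by simp
   qed
   then have "(?V * (norm z)\<^sup>2) * norm z powr ?p = ?V * norm z powr (2 + ?p)" by (simp only: mult.assoc)
   finally show ?thesis using True
    by (simp add: ennreal_mult'[symmetric] abs_mult msd_nonneg ennreal_leI del: powr_add)
  next
   case False
   have "msd (bump :: 'a \<Rightarrow> real) z * norm z powr ?p \<le> (4 * ?N) * norm z powr ?p"
    by (intro mult_right_mono msd_le[OF L2c_bump]) simp
   then show ?thesis using False
    by (simp add: ennreal_mult'[symmetric] abs_mult msd_nonneg ennreal_leI del: ennreal_mult)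
  qed
  qed
  also have "\<dots> < \<infinity>"
  using fin by (subst nn_integral_add) (auto simp: nn_integral_cmult ennreal_mult_less_top)
  finally show "(LNINT z. ennreal (norm (msd (bump :: 'a \<Rightarrow> real) z * norm z powr ?p))) < \<infinity>" .
qed simp

text \<open>The limit of the squared norms for the bump is at least \<delta> > 0 and equals minus
  half of the integral of \<open>msd\<close> against \<open>kappa\<close>; a nonnegative constant
  would make it nonpositive.\<close>

lemma kappa_negative_supercritical:
  fixes c :: real
  assumes \<beta>: "real DIM('a::euclidean_space) + 1 < \<beta>" "\<beta> < real DIM('a) + 2"
  and c: "\<And>z::'a. z \<noteq> 0 \<Longrightarrow> kappa \<beta> z = c * norm z powr (real DIM('a) + 2 - 2 * \<beta>)"
  shows "c < 0"
proof (rule ccontr)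
  assume "\<not> c < 0"
  have \<beta>b: "real DIM('a) / 2 + 1 < \<beta>" using \<beta> by (smt (verit) field_sum_of_halves of_nat_0_le_iff)
  have \<beta>1: "1 < \<beta>" by (rule dim_half_less[OF \<beta>b])
  obtain \<delta> where \<delta>: "0 < \<delta>" "\<And>t. 0 < t \<Longrightarrow> t \<le> 1 \<Longrightarrow> integrable lborel (\<lambda>x. (norm (conv (kern \<beta> t) (bump :: 'a \<Rightarrow> real) x))\<^sup>2) \<Longrightarrow>
  \<delta> \<le> (LBINT x. (norm (conv (kern \<beta> t) (bump :: 'a \<Rightarrow> real) x))\<^sup>2)"
  using conv_bump_lower_bound[of \<beta>, where 'a='a] \<beta>1 by auto
  have lim: "(\<lambda>i. LBINT x. (norm (conv (kern \<beta> (trunc_seq i)) (bump :: 'a \<Rightarrow> real) x))\<^sup>2) \<longlonglongrightarrow> - (LBINT z. msd (bump :: 'a \<Rightarrow> real) z * kappa \<beta> z) / 2"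
  by (rule conv_square_limit_finite_energy[OF \<beta> L2c_bump bump_finite_energy[OF \<beta>]])
  have "\<delta> \<le> - (LBINT z. msd (bump :: 'a \<Rightarrow> real) z * kappa \<beta> z) / 2"
  proof (rule LIMSEQ_le_const[OF lim], intro exI allI impI)
  fix i
  have "trunc_seq i \<le> 1" by (simp add: trunc_seq_def field_simps)
  then show "\<delta> \<le> (LBINT x. (norm (conv (kern \<beta> (trunc_seq i)) (bump :: 'a \<Rightarrow> real) x))\<^sup>2)"
   by (intro \<delta>(2) conv_kern_square_integrable(1)[OF \<beta>b _ L2c_bump]) auto
  qed
  moreover have "0 \<le> (LBINT z. msd (bump :: 'a \<Rightarrow> real) z * kappa \<beta> z)"
  proof (rule integral_nonneg_AE)
  show "AE z in lborel. 0 \<le> msd (bump :: 'a \<Rightarrow> real) z * kappa \<beta> z"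
   using AE_lborel_singleton[of "0::'a"]
   by eventually_elim (use c \<open>\<not> c < 0\<close> in \<open>auto simp: msd_nonneg\<close>)
  qed
  ultimately show False using \<delta>(1) by linarith
qed

text \<open>If the constant vanished, the limit of the squared norms for the bump, an integral
  against \<open>kappa\<close>, would be 0 instead of at least \<delta>.\<close>

lemma kappa_nonzero_subcritical:
  fixes c :: real
  assumes \<beta>: "real DIM('a::euclidean_space) / 2 + 1 < \<beta>" "\<beta> < real DIM('a) + 1"
  and c: "\<And>z::'a. z \<noteq> 0 \<Longrightarrow> kappa \<beta> z = c * norm z powr (real DIM('a) + 2 - 2 * \<beta>)"
  shows "c \<noteq> 0"
proof
  assume "c = 0"
  have \<beta>1: "1 < \<beta>" by (rule dim_half_less[OF \<beta>(1)])
  obtain \<delta> where \<delta>: "0 < \<delta>" "\<And>t. 0 < t \<Longrightarrow> t \<le> 1 \<Longrightarrow> integrable lborel (\<lambda>x. (norm (conv (kern \<beta> t) (bump :: 'a \<Rightarrow> real) x))\<^sup>2) \<Longrightarrow>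
  \<delta> \<le> (LBINT x. (norm (conv (kern \<beta> t) (bump :: 'a \<Rightarrow> real) x))\<^sup>2)"
  using conv_bump_lower_bound[of \<beta>, where 'a='a] \<beta>1 by auto
  have lim: "(\<lambda>i. LBINT x. (norm (conv (kern \<beta> (trunc_seq i)) (bump :: 'a \<Rightarrow> real) x))\<^sup>2) \<longlonglongrightarrow> (LBINT z. autocorr (bump :: 'a \<Rightarrow> real) z * kappa \<beta> z)"
  by (rule conv_square_limit_potential[OF \<beta> L2c_bump])
  have "\<delta> \<le> (LBINT z. autocorr (bump :: 'a \<Rightarrow> real) z * kappa \<beta> z)"
  proof (rule LIMSEQ_le_const[OF lim], intro exI allI impI)
  fix i
  have "trunc_seq i \<le> 1" by (simp add: trunc_seq_def field_simps)
  then show "\<delta> \<le> (LBINT x. (norm (conv (kern \<beta> (trunc_seq i)) (bump :: 'a \<Rightarrow> real) x))\<^sup>2)"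
   by (intro \<delta>(2) conv_kern_square_integrable(1)[OF \<beta>(1) _ L2c_bump]) auto
  qed
  moreover have "(LBINT z. autocorr (bump :: 'a \<Rightarrow> real) z * kappa \<beta> z) = 0"
  proof (rule integral_eq_zero_AE)
  show "AE z in lborel. autocorr (bump :: 'a \<Rightarrow> real) z * kappa \<beta> z = 0"
   using AE_lborel_singleton[of "0::'a"] by eventually_elim (use c \<open>c = 0\<close> in auto)
  qed
  ultimately show False using \<delta>(1) by linarith
qed

lemma critical_mass_pos:
  fixes M :: real
  assumes \<beta>: "\<beta> = real DIM('a::euclidean_space) + 1"
  and M: "\<And>r u. L2c r (u :: 'a \<Rightarrow> real) \<Longrightarrow>
   (\<lambda>i. LBINT x. (norm (conv (kern \<beta> (trunc_seq i)) u x))\<^sup>2) \<longlonglongrightarrow> M * (LBINT x. (u x)\<^sup>2)"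
  shows "0 < M"
proof -
  have "1 \<le> real DIM('a)" by (simp add: Suc_leI)
  then have \<beta>b: "real DIM('a) / 2 + 1 < \<beta>" and \<beta>1: "1 < \<beta>" using \<beta> by auto
  obtain \<delta> where \<delta>: "0 < \<delta>" "\<And>t. 0 < t \<Longrightarrow> t \<le> 1 \<Longrightarrow> integrable lborel (\<lambda>x. (norm (conv (kern \<beta> t) (bump :: 'a \<Rightarrow> real) x))\<^sup>2) \<Longrightarrow>
  \<delta> \<le> (LBINT x. (norm (conv (kern \<beta> t) (bump :: 'a \<Rightarrow> real) x))\<^sup>2)"
  using conv_bump_lower_bound[of \<beta>, where 'a='a] \<beta>1 by auto
  have "\<delta> \<le> M * (LBINT x. (bump (x::'a))\<^sup>2)"
  proof (rule LIMSEQ_le_const[OF M[OF L2c_bump]], intro exI allI impI)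
  fix i
  have "trunc_seq i \<le> 1" by (simp add: trunc_seq_def field_simps)
  then show "\<delta> \<le> (LBINT x. (norm (conv (kern \<beta> (trunc_seq i)) (bump :: 'a \<Rightarrow> real) x))\<^sup>2)"
   by (intro \<delta>(2) conv_kern_square_integrable(1)[OF \<beta>b _ L2c_bump]) auto
  qed
  then have "0 < M * (LBINT x. (bump (x::'a))\<^sup>2)" using \<delta>(1) by linarith
  moreover have "0 \<le> (LBINT x. (bump (x::'a))\<^sup>2)" by simp
  ultimately show ?thesis by (simp add: zero_less_mult_iff)
qed

section \<open>Lebesgue points and almost everywhere convergence\<close>

text \<open>The reflection of the coordinates in \<open>S\<close>. The library's differentiation theorem averages
  over boxes having the point as lowest corner; applying it to all reflections of the function
  covers a full neighbourhood of the point.\<close>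

definition flip :: "'a::euclidean_space set \<Rightarrow> 'a \<Rightarrow> 'a" where
  "flip S x = (\<Sum>b\<in>Basis. ((if b \<in> S then - 1 else 1) * (x \<bullet> b)) *\<^sub>R b)"

lemma flip_inner: "b \<in> Basis \<Longrightarrow> flip S x \<bullet> b = (if b \<in> S then - 1 else 1) * (x \<bullet> b)"
  by (simp add: flip_def inner_sum_left_Basis)

lemma flip_flip [simp]: "flip S (flip S x) = x"
  by (rule euclidean_eqI) (simp add: flip_inner)

lemma orthogonal_transformation_flip: "orthogonal_transformation (flip S)"
proof -
  have "linear (flip S)"
  by (rule linearI) (rule euclidean_eqI; simp add: flip_inner inner_add_left algebra_simps)+
  moreover have "flip S v \<bullet> flip S w = v \<bullet> w" for v w :: 'a
  proof -
  have "flip S v \<bullet> flip S w = (\<Sum>b\<in>Basis. (flip S v \<bullet> b) * (flip S w \<bullet> b))" by (rule euclidean_inner)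
  also have "\<dots> = (\<Sum>b\<in>Basis. (v \<bullet> b) * (w \<bullet> b))" by (rule sum.cong) (auto simp: flip_inner)
  also have "\<dots> = v \<bullet> w" by (rule euclidean_inner[symmetric])
  finally show ?thesis .
  qed
  ultimately show ?thesis by (simp add: orthogonal_transformation_def)
qed

lemma flip_measurable [measurable]: "flip S \<in> borel_measurable borel"
  unfolding flip_def[abs_def] by measurable

lemma AE_flip:
  assumes "AE x in lborel. P x" shows "AE x in lborel. P (flip S x :: 'a::euclidean_space)"
proof -
  have "AE x in distr lborel borel (flip S). P (x::'a)"
  unfolding lborel_orthogonal[OF orthogonal_transformation_flip] by (rule assms)
  then obtain N where N: "N \<in> null_sets (distr lborel borel (flip S :: 'a \<Rightarrow> 'a))" "{x. \<not> P x} \<subseteq> N"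
  by (auto simp: eventually_ae_filter)
  then have "N \<in> sets borel" "emeasure lborel (flip S -` N) = 0"
  by (auto simp: null_sets_def emeasure_distr)
  then have "flip S -` N \<in> null_sets lborel"
  using measurable_sets_borel[OF flip_measurable, of N S] by (auto simp: null_sets_def)
  then show ?thesis using N(2) by (auto intro!: AE_I'[of "flip S -` N"])
qed

lemma corner_lebesgue_points:
  fixes f :: "'a::euclidean_space \<Rightarrow> real"
  assumes [measurable]: "f \<in> borel_measurable borel" and nonneg: "\<And>x. 0 \<le> f x"
  and loc: "\<And>r. (LNINT y. ennreal (f y) * indicator (ball 0 r) y) < \<infinity>"
  shows "AE x in lborel. \<forall>e>0. \<exists>d>0. \<forall>h. 0 < h \<and> h < d \<longrightarrow>
  (LNINT y. ennreal (f y) * indicator (cbox x (x + h *\<^sub>R One)) y) \<le> ennreal ((f x + e) * h ^ DIM('a))"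
proof -
  have int: "f integrable_on cbox a b" for a b
  proof -
  obtain r where r: "cbox a b \<subseteq> ball 0 r"
   using bounded_subset_ballD[OF bounded_cbox] by blast
  have "integrable lborel (\<lambda>y. indicator (cbox a b) y *\<^sub>R f y)"
  proof (rule integrableI_bounded)
   have "(LNINT y. ennreal (norm (indicator (cbox a b) y *\<^sub>R f y))) \<le> (LNINT y. ennreal (f y) * indicator (ball 0 r) y)"
    using r nonneg by (intro nn_integral_mono) (auto simp: indicator_def)
   also have "\<dots> < \<infinity>" by (rule loc)
   finally show "(LNINT y. ennreal (norm (indicator (cbox a b) y *\<^sub>R f y))) < \<infinity>" .
  qed simp
  then have "set_integrable lborel (cbox a b) f" by (simp add: set_integrable_def)
  then show ?thesis by (rule set_borel_integral_eq_integral)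
  qed
  obtain N where N: "negligible N" "\<And>x e. \<lbrakk>x \<notin> N; 0 < e\<rbrakk> \<Longrightarrow>
   \<exists>d>0. \<forall>h. 0 < h \<and> h < d \<longrightarrow> norm (integral (cbox x (x + h *\<^sub>R One)) f /\<^sub>R h ^ DIM('a) - f x) < e"
  using integrable_ccontinuous_explicit[OF int] by metis
  have "AE x in lebesgue. x \<notin> N" using N(1) by (simp add: negligible_iff_null_sets AE_not_in)
  then have "AE x in lborel. x \<notin> N" by (simp add: AE_completion_iff)
  then show ?thesis
  proof eventually_elim
  case (elim x)
  show ?case
  proof (intro allI impI)
   fix e :: real assume "0 < e"
   then obtain d where d: "0 < d" "\<And>h. 0 < h \<Longrightarrow> h < d \<Longrightarrow> norm (integral (cbox x (x + h *\<^sub>R One)) f /\<^sub>R h ^ DIM('a) - f x) < e"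
    using N(2)[OF elim] by blast
   have "(LNINT y. ennreal (f y) * indicator (cbox x (x + h *\<^sub>R One)) y) \<le> ennreal ((f x + e) * h ^ DIM('a))"
    if h: "0 < h" "h < d" for h
   proof -
    have "(LNINT y. ennreal (f y) * indicator (cbox x (x + h *\<^sub>R One)) y) = ennreal (integral (cbox x (x + h *\<^sub>R One)) f)"
     using nonneg int by (intro nn_integral_has_integral_lebesgue' integrable_integral) auto
    moreover have "integral (cbox x (x + h *\<^sub>R One)) f / h ^ DIM('a) < f x + e"
     using d(2)[OF h] by (auto simp: abs_less_iff divide_inverse_commute)
    then have "integral (cbox x (x + h *\<^sub>R One)) f \<le> (f x + e) * h ^ DIM('a)"
     using h by (simp add: field_simps)
    ultimately show ?thesis by (simp add: ennreal_leI)
   qed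
   with d(1) show "\<exists>d>0. \<forall>h. 0 < h \<and> h < d \<longrightarrow>
    (LNINT y. ennreal (f y) * indicator (cbox x (x + h *\<^sub>R One)) y) \<le> ennreal ((f x + e) * h ^ DIM('a))" by blast
  qed
  qed
qed

text \<open>The ball about x with radius h is covered by the 2^n cubes of side h that have x as a
  corner, one for each pattern of signs; this is the factor 2^n.\<close>

lemma ball_lebesgue_points:
  fixes f :: "'a::euclidean_space \<Rightarrow> real"
  assumes [measurable]: "f \<in> borel_measurable borel" and nonneg: "\<And>x. 0 \<le> f x"
  and loc: "\<And>r. (LNINT y. ennreal (f y) * indicator (ball 0 r) y) < \<infinity>"
  shows "AE x in lborel. \<forall>e>0. \<exists>d>0. \<forall>h. 0 < h \<and> h < d \<longrightarrow>
  (LNINT y. ennreal (f y) * indicator (ball x h) y) \<le> ennreal (2 ^ DIM('a) * (f x + e) * h ^ DIM('a))"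
proof -
  let ?P = "\<lambda>S x. \<forall>e>0. \<exists>d>0. \<forall>h. 0 < h \<and> h < d \<longrightarrow>
  (LNINT y. ennreal (f (flip S y)) * indicator (cbox x (x + h *\<^sub>R One)) y) \<le> ennreal ((f (flip S x) + e) * h ^ DIM('a))"
  have AES: "AE x in lborel. ?P S x" for S
  proof (rule corner_lebesgue_points)
  fix r
  have "(LNINT y. ennreal (f (flip S y)) * indicator (ball 0 r) y) = (LNINT y. ennreal (f (flip S y)) * indicator (ball 0 r) (flip S y))"
  proof -
   have "norm (flip S y) = norm y" for y :: 'a
    by (rule orthogonal_transformation_norm[OF orthogonal_transformation_flip])
   then show ?thesis by (simp add: indicator_def)
  qed
  also have "\<dots> = (LNINT y. ennreal (f y) * indicator (ball 0 r) y)"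
  proof -
   have [measurable]: "ball (0::'a) r \<in> sets borel" by simp
   show ?thesis
    using nn_integral_orthogonal[OF orthogonal_transformation_flip, of "\<lambda>y. ennreal (f y) * indicator (ball 0 r) y"] by simp
  qed
  finally show "(LNINT y. ennreal (f (flip S y)) * indicator (ball 0 r) y) < \<infinity>" using loc by simp
  qed (auto simp: nonneg)
  have "AE x in lborel. ?P S (flip S x)" for S by (rule AE_flip[OF AES])
  then have "AE x in lborel. \<forall>S\<in>Pow Basis. ?P S (flip S x)"
  by (intro AE_finite_allI) auto
  then show ?thesis
  proof eventually_elim
  case (elim x)
  show ?case
  proof (intro allI impI)
   fix e :: real assume e: "0 < e"
   have "\<forall>S\<in>Pow Basis. \<exists>d>0. \<forall>h. 0 < h \<and> h < d \<longrightarrow>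
    (LNINT y. ennreal (f (flip S y)) * indicator (cbox (flip S x) (flip S x + h *\<^sub>R One)) y) \<le> ennreal ((f x + e) * h ^ DIM('a))"
    using elim e by (simp only: flip_flip) blast
   from bchoice[OF this] obtain d where d0: "\<forall>S\<in>Pow Basis. 0 < d S \<and> (\<forall>h. 0 < h \<and> h < d S \<longrightarrow>
    (LNINT y. ennreal (f (flip S y)) * indicator (cbox (flip S x) (flip S x + h *\<^sub>R One)) y) \<le> ennreal ((f x + e) * h ^ DIM('a)))" ..
   then have d: "\<And>S. S \<in> Pow Basis \<Longrightarrow> 0 < d S" "\<And>S h. S \<in> Pow Basis \<Longrightarrow> 0 < h \<Longrightarrow> h < d S \<Longrightarrow>
    (LNINT y. ennreal (f (flip S y)) * indicator (cbox (flip S x) (flip S x + h *\<^sub>R One)) y) \<le> ennreal ((f x + e) * h ^ DIM('a))"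
    by blast+
   define D where "D = Min (d ` Pow Basis)"
   have D: "0 < D" "\<And>S. S \<in> Pow Basis \<Longrightarrow> D \<le> d S"
   proof -
    have fin: "finite (d ` Pow Basis)" "d ` Pow Basis \<noteq> {}" by auto
    show "0 < D" unfolding D_def using d(1) by (subst Min_gr_iff[OF fin]) auto
    show "D \<le> d S" if "S \<in> Pow Basis" for S unfolding D_def using that by (intro Min_le fin) auto
   qed
   have "(LNINT y. ennreal (f y) * indicator (ball x h) y) \<le> ennreal (2 ^ DIM('a) * (f x + e) * h ^ DIM('a))"
    if h: "0 < h" "h < D" for h
   proof -
    let ?C = "\<lambda>S. cbox (flip S x) (flip S x + h *\<^sub>R One)"
    have "(LNINT y. ennreal (f y) * indicator (ball x h) y)
     \<le> (LNINT y. (\<Sum>S\<in>Pow Basis. ennreal (f y) * indicator (?C S) (flip S y)))"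
    proof (rule nn_integral_mono)
     fix y
     show "ennreal (f y) * indicator (ball x h) y \<le> (\<Sum>S\<in>Pow Basis. ennreal (f y) * indicator (?C S) (flip S y))"
     proof (cases "y \<in> ball x h")
      case True
      \<comment> \<open>The coordinates in which y lies below x: reflecting them moves y into the
        cube with lowest corner at the reflected x.\<close>
      define S where "S = {b\<in>Basis. y \<bullet> b < x \<bullet> b}"
      have "flip S y \<in> ?C S"
       unfolding mem_box
      proof (intro ballI conjI)
       fix b :: 'a assume b: "b \<in> Basis"
       have "\<bar>(y - x) \<bullet> b\<bar> \<le> norm (y - x)" by (rule Basis_le_norm[OF b])
       then have yb: "\<bar>y \<bullet> b - x \<bullet> b\<bar> < h" using True by (simp add: inner_diff_left dist_norm norm_minus_commute)
       show "flip S x \<bullet> b \<le> flip S y \<bullet> b" using b by (auto simp: flip_inner S_def)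
       show "flip S y \<bullet> b \<le> (flip S x + h *\<^sub>R One) \<bullet> b"
        using b yb by (auto simp: flip_inner S_def inner_add_left)
      qed
      then have "ennreal (f y) * indicator (ball x h) y = ennreal (f y) * indicator (?C S) (flip S y)" using True by simp
      also have "\<dots> \<le> (\<Sum>S\<in>Pow Basis. ennreal (f y) * indicator (?C S) (flip S y))"
       by (rule member_le_sum) (auto simp: S_def)
      finally show ?thesis .
     qed simp
    qed
    also have "\<dots> = (\<Sum>S\<in>Pow Basis. \<integral>\<^sup>+y. ennreal (f y) * indicator (?C S) (flip S y) \<partial>lborel)"
     by (rule nn_integral_sum) measurable
    also have "\<dots> \<le> (\<Sum>S\<in>Pow (Basis::'a set). ennreal ((f x + e) * h ^ DIM('a)))"
    proof (rule sum_mono)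
     fix S :: "'a set" assume S: "S \<in> Pow Basis"
     have "(LNINT y. ennreal (f y) * indicator (?C S) (flip S y)) = (LNINT y. ennreal (f (flip S y)) * indicator (?C S) y)"
      using nn_integral_orthogonal[OF orthogonal_transformation_flip[of S], of "\<lambda>y. ennreal (f y) * indicator (?C S) (flip S y)"] by simp
     also have "\<dots> \<le> ennreal ((f x + e) * h ^ DIM('a))"
      using d(2)[OF S h(1)] D(2)[OF S] h by simp
     finally show "(LNINT y. ennreal (f y) * indicator (?C S) (flip S y)) \<le> ennreal ((f x + e) * h ^ DIM('a))" .
    qed
    also have "\<dots> = ennreal (2 ^ DIM('a) * (f x + e) * h ^ DIM('a))"
     using nonneg[of x] e h by (simp add: card_Pow ennreal_mult mult.assoc ennreal_power[symmetric])
    finally show ?thesis .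
   qed
   with D(1) show "\<exists>d>0. \<forall>h. 0 < h \<and> h < d \<longrightarrow>
    (LNINT y. ennreal (f y) * indicator (ball x h) y) \<le> ennreal (2 ^ DIM('a) * (f x + e) * h ^ DIM('a))" by blast
  qed
  qed
qed

text \<open>With a = n these are, up to normalisation, the usual Lebesgue points. A larger a demands
  faster decay of the oscillation; the order a = \<beta> - 1 is what the comparison of cut-offs
  requires.\<close>

definition lebesgue_point :: "real \<Rightarrow> ('a::euclidean_space \<Rightarrow> 'b::euclidean_space) \<Rightarrow> 'a \<Rightarrow> bool" where
  "lebesgue_point a w x \<longleftrightarrow> (\<forall>e>0. \<exists>d>0. \<forall>h. 0 < h \<and> h < d \<longrightarrow>
  (LNINT y. ennreal (norm (w y - w x)) * indicator (ball x h) y) \<le> ennreal (e * h powr a))"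

text \<open>The statement for nonnegative functions is applied to |w - q| with q in a countable
  dense set, which keeps the union of exceptional sets null; then w x is approximated by such a
  q.\<close>

lemma AE_lebesgue_point:
  fixes w :: "'a::euclidean_space \<Rightarrow> 'b::euclidean_space"
  assumes [measurable]: "w \<in> borel_measurable borel"
  and loc: "\<And>r. (LNINT y. ennreal (norm (w y)) * indicator (ball 0 r) y) < \<infinity>"
  shows "AE x in lborel. lebesgue_point (real DIM('a)) w x"
proof -
  obtain Q :: "'b set" where Q: "countable Q" "\<And>X. open X \<Longrightarrow> X \<noteq> {} \<Longrightarrow> \<exists>q\<in>Q. q \<in> X"
  using countable_dense_setE by blast
  let ?P = "\<lambda>q x. \<forall>e>0. \<exists>d>0. \<forall>h. 0 < h \<and> h < d \<longrightarrow>
  (LNINT y. ennreal (norm (w y - q)) * indicator (ball x h) y) \<le> ennreal (2 ^ DIM('a) * (norm (w x - q) + e) * h ^ DIM('a))"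
  have "AE x in lborel. ?P q x" for q
  proof (rule ball_lebesgue_points)
  fix r
  have [measurable]: "ball (0::'a) r \<in> sets borel" by simp
  have "(LNINT y. ennreal (norm (w y - q)) * indicator (ball 0 r) y)
   \<le> (LNINT y. ennreal (norm (w y)) * indicator (ball 0 r) y + ennreal (norm q) * indicator (ball 0 r) y)"
  proof (rule nn_integral_mono)
   fix y :: 'a
   show "ennreal (norm (w y - q)) * indicator (ball 0 r) y \<le> ennreal (norm (w y)) * indicator (ball 0 r) y + ennreal (norm q) * indicator (ball 0 r) y"
    using norm_triangle_ineq4[of "w y" q]
    by (auto simp: indicator_def ennreal_plus[symmetric] simp del: ennreal_plus intro!: ennreal_leI)
  qed
  also have "\<dots> = (LNINT y. ennreal (norm (w y)) * indicator (ball 0 r) y) + ennreal (norm q) * emeasure lborel (ball (0::'a) r)"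
   by (simp add: nn_integral_add nn_integral_cmult)
  also have "\<dots> < \<infinity>" using loc[of r] by (auto simp: ennreal_mult_less_top emeasure_lborel_ball_finite[unfolded infinity_ennreal_def])
  finally show "(LNINT y. ennreal (norm (w y - q)) * indicator (ball 0 r) y) < \<infinity>" .
  qed auto
  then have "AE x in lborel. \<forall>q\<in>Q. ?P q x" using Q(1) by (simp add: AE_ball_countable)
  then show ?thesis
  proof eventually_elim
  case (elim x)
  show ?case
   unfolding lebesgue_point_def
  proof (intro allI impI)
   fix e :: real assume e: "0 < e"
   define V where "V = unit_ball_vol (real DIM('a))"
   have V: "0 < V" by (simp add: V_def)
   \<comment> \<open>The average of |w - q| costs at most 2^n times 2 e', and replacing q by w x
     costs e' times the volume V of the unit ball.\<close>
   define e' where "e' = e / (2 * 2 ^ DIM('a) + V)"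
   have e': "0 < e'" "e' * (2 * 2 ^ DIM('a) + V) = e" using e V
    by (auto simp: e'_def intro!: divide_pos_pos add_pos_pos) (smt (verit) zero_less_power)
   obtain q where q: "q \<in> Q" "norm (w x - q) < e'"
    using Q(2)[of "ball (w x) e'"] e'(1) by (auto simp: dist_norm)
   obtain d where d: "0 < d" "\<And>h. 0 < h \<Longrightarrow> h < d \<Longrightarrow>
    (LNINT y. ennreal (norm (w y - q)) * indicator (ball x h) y) \<le> ennreal (2 ^ DIM('a) * (norm (w x - q) + e') * h ^ DIM('a))"
    using bspec[OF elim q(1)] e'(1) by meson
   have "(LNINT y. ennreal (norm (w y - w x)) * indicator (ball x h) y) \<le> ennreal (e * h powr real DIM('a))"
    if h: "0 < h" "h < d" for h
   proof -
    have [measurable]: "ball x h \<in> sets borel" by simp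
    have "(LNINT y. ennreal (norm (w y - w x)) * indicator (ball x h) y)
     \<le> (LNINT y. ennreal (norm (w y - q)) * indicator (ball x h) y + ennreal e' * indicator (ball x h) y)"
    proof (rule nn_integral_mono)
     fix y :: 'a
     have "norm (w y - w x) \<le> norm (w y - q) + e'"
      using norm_triangle_ineq4[of "w y - q" "w x - q"] q(2) by simp
     then show "ennreal (norm (w y - w x)) * indicator (ball x h) y \<le> ennreal (norm (w y - q)) * indicator (ball x h) y + ennreal e' * indicator (ball x h) y"
      using e'(1) by (auto simp: indicator_def ennreal_plus[symmetric] simp del: ennreal_plus intro!: ennreal_leI)
    qed
    also have "\<dots> = (LNINT y. ennreal (norm (w y - q)) * indicator (ball x h) y) + ennreal e' * ennreal (V * h ^ DIM('a))"
     using h by (simp add: nn_integral_add nn_integral_cmult emeasure_ball V_def)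
    also have "\<dots> \<le> ennreal (2 ^ DIM('a) * (norm (w x - q) + e') * h ^ DIM('a)) + ennreal e' * ennreal (V * h ^ DIM('a))"
     by (intro add_right_mono d(2) h)
    also have "\<dots> \<le> ennreal (2 ^ DIM('a) * (e' + e') * h ^ DIM('a)) + ennreal e' * ennreal (V * h ^ DIM('a))"
     using q(2) h by (intro add_right_mono ennreal_leI mult_right_mono mult_left_mono) auto
    also have "\<dots> = ennreal (2 ^ DIM('a) * (e' + e') * h ^ DIM('a) + e' * (V * h ^ DIM('a)))"
     using e'(1) V h by (simp add: ennreal_mult'[symmetric])
    also have "2 ^ DIM('a) * (e' + e') * h ^ DIM('a) + e' * (V * h ^ DIM('a)) = e * h powr real DIM('a)"
     unfolding e'(2)[symmetric] using h by (simp add: powr_realpow algebra_simps)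
    finally show ?thesis .
   qed
   with d(1) show "\<exists>d>0. \<forall>h. 0 < h \<and> h < d \<longrightarrow>
    (LNINT y. ennreal (norm (w y - w x)) * indicator (ball x h) y) \<le> ennreal (e * h powr real DIM('a))" by blast
  qed
  qed
qed

lemma ennreal_square_le_imp_le:
  assumes "x\<^sup>2 \<le> (ennreal b)\<^sup>2" "0 \<le> b" shows "x \<le> ennreal b"
proof (cases x)
  case (real l)
  then have "l\<^sup>2 \<le> b\<^sup>2" using assms by (simp add: ennreal_power)
  then show ?thesis using real assms(2) by (auto intro!: ennreal_leI power2_le_imp_le)
next
  case top
  then show ?thesis using assms by (auto simp: power2_eq_square ennreal_top_mult ennreal_mult_eq_top_iff top_unique)
qed

text \<open>At almost every x the energy density, the integral of |u (x + z) - u x|^2 |z|^p over z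
  with p = n + 2 - 2\<beta>, is finite. By Cauchy-Schwarz the oscillation over the ball of radius h
  is at most the square root of its part on the ball times that of the integral of |z|^(-p), which
  is B h^(2\<beta>-2). The first factor tends to 0.\<close>

lemma AE_lebesgue_point_finite_energy:
  fixes u :: "'a::euclidean_space \<Rightarrow> real"
  assumes \<beta>: "real DIM('a) / 2 + 1 < \<beta>" and u: "L2c r u"
  and E: "integrable lborel (\<lambda>z. msd u z * norm z powr (real DIM('a) + 2 - 2 * \<beta>))"
  shows "AE x in lborel. lebesgue_point (\<beta> - 1) u x"
proof -
  let ?n = "real DIM('a)" and ?p = "real DIM('a) + 2 - 2 * \<beta>" and ?w = "sphere_area TYPE('a)"
  have \<beta>1: "1 < \<beta>" by (rule dim_half_less[OF \<beta>])
  have [measurable]: "u \<in> borel_measurable borel" by (rule L2c_measurable[OF u])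
  let ?F = "\<lambda>x z. (u (x + z) - u x)\<^sup>2 * norm z powr ?p"
  have "(LNINT x. (LNINT z. ennreal (?F x z))) = (LNINT z. (LNINT x. ennreal (?F x z)))"
  by (rule lborel_pair.Fubini') measurable
  also have "\<dots> = (LNINT z. ennreal (msd u z * norm z powr ?p))"
  proof (rule nn_integral_cong)
  fix z
  have "(LNINT x. ennreal (?F x z)) = (LNINT x. ennreal ((u (x + z) - u x)\<^sup>2)) * ennreal (norm z powr ?p)"
   by (simp add: ennreal_mult' nn_integral_multc)
  also have "(LNINT x. ennreal ((u (x + z) - u x)\<^sup>2)) = ennreal (msd u z)"
   unfolding msd_def using msd_integrable[OF u] by (intro nn_integral_eq_integral) auto
  finally show "(LNINT x. ennreal (?F x z)) = ennreal (msd u z * norm z powr ?p)"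
   by (simp add: ennreal_mult'' msd_nonneg)
  qed
  also have "\<dots> < \<infinity>" using E by (simp add: integrable_iff_bounded msd_nonneg)
  finally have "AE x in lborel. (LNINT z. ennreal (?F x z)) \<noteq> \<infinity>"
  by (intro nn_integral_PInf_AE) (auto simp: less_top)
  then show ?thesis
  proof eventually_elim
  case (elim x)
  have iF: "integrable lborel (?F x)"
   using elim by (intro integrableI_bounded) (auto simp: less_top)
  define B where "B = ?w / (2 * \<beta> - 2)"
  have B: "0 < B" using \<beta>1 sphere_area_pos[where 'a='a] by (simp add: B_def)
  show ?case
   unfolding lebesgue_point_def
  proof (intro allI impI)
   fix e :: real assume e: "0 < e"
   obtain d where d: "0 < d" "(LBINT z. ?F x z * indicator (ball 0 d) z) \<le> e\<^sup>2 / B"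
   proof (rule integrable_small_ball[OF iF, of "e\<^sup>2 / B"])
    show "0 < e\<^sup>2 / B" using e B by simp
   qed (use that in auto)
   have "(LNINT y. ennreal (norm (u y - u x)) * indicator (ball x h) y) \<le> ennreal (e * h powr (\<beta> - 1))"
    if h: "0 < h" "h < d" for h
   proof -
    have [measurable]: "ball (0::'a) h \<in> sets borel" "ball x h \<in> sets borel" "ball (0::'a) d \<in> sets borel" by auto
    have "(LNINT y. ennreal (norm (u y - u x)) * indicator (ball x h) y)
     = (LNINT z. ennreal (norm (u (z + x) - u x)) * indicator (ball x h) (z + x))"
     using nn_integral_shift[of "\<lambda>y. ennreal (norm (u y - u x)) * indicator (ball x h) y" x] by simp
    also have "\<dots> = (LNINT z. (ennreal (\<bar>u (x + z) - u x\<bar> * norm z powr (?p / 2)) * indicator (ball 0 h) z)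
      * (ennreal (norm z powr (- ?p / 2)) * indicator (ball 0 h) z))"
    proof (rule nn_integral_cong_AE)
     show "AE z in lborel. ennreal (norm (u (z + x) - u x)) * indicator (ball x h) (z + x)
      = (ennreal (\<bar>u (x + z) - u x\<bar> * norm z powr (?p / 2)) * indicator (ball 0 h) z) * (ennreal (norm z powr (- ?p / 2)) * indicator (ball 0 h) z)"
      using AE_lborel_singleton[of "0::'a"]
     proof eventually_elim
      case (elim z)
      have 1: "norm z powr (?p / 2) * norm z powr (- ?p / 2) = 1"
       unfolding minus_divide_left[symmetric] powr_minus using elim by (intro right_inverse) simp
      have 2: "z + x \<in> ball x h \<longleftrightarrow> z \<in> ball 0 h" by (simp add: dist_norm)
      have "ennreal (\<bar>u (x + z) - u x\<bar> * norm z powr (?p / 2)) * ennreal (norm z powr (- ?p / 2)) = ennreal \<bar>u (x + z) - u x\<bar>"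
       using 1 by (simp only: ennreal_mult'[symmetric] abs_ge_zero mult_nonneg_nonneg powr_ge_zero mult.assoc) simp
      then show ?case using 2 by (auto simp: indicator_def add.commute)
     qed
    qed
    finally have eq: "(LNINT y. ennreal (norm (u y - u x)) * indicator (ball x h) y) = \<dots>" .
    let ?L = "\<integral>\<^sup>+y. ennreal (norm (u y - u x)) * indicator (ball x h) y \<partial>lborel"
    have "?L\<^sup>2 \<le> (LNINT z. (ennreal (\<bar>u (x + z) - u x\<bar> * norm z powr (?p / 2)) * indicator (ball 0 h) z)\<^sup>2)
      * (LNINT z. (ennreal (norm z powr (- ?p / 2)) * indicator (ball 0 h) (z::'a))\<^sup>2)"
     unfolding eq by (rule Cauchy_Schwarz_nn_integral) measurable
    also have "(LNINT z. (ennreal (norm z powr (- ?p / 2)) * indicator (ball 0 h) (z::'a))\<^sup>2) = ennreal (B * h powr (2 * \<beta> - 2))"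
    proof -
     have 1: "?p < ?n" using \<beta>1 by simp
     have 2: "?n - ?p = 2 * \<beta> - 2" by simp
     have "(LNINT z. (ennreal (norm z powr (- ?p / 2)) * indicator (ball 0 h) (z::'a))\<^sup>2) = (LNINT z. ennreal (norm (z::'a) powr (- ?p)) * indicator (ball 0 h) z)"
     proof (rule nn_integral_cong)
      fix z :: 'a
      have "norm z powr (- ?p) = (norm z powr (- ?p / 2))\<^sup>2"
       unfolding power2_eq_square powr_add[symmetric] by simp
      then show "(ennreal (norm z powr (- ?p / 2)) * indicator (ball 0 h) z)\<^sup>2 = ennreal (norm z powr (- ?p)) * indicator (ball 0 h) z"
       by (simp add: indicator_def ennreal_power)
     qed
     also have "\<dots> = ennreal (B * h powr (2 * \<beta> - 2))"
      using nn_integral_norm_powr_ball[OF 1 h(1)] unfolding 2 B_def .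
     finally show ?thesis .
    qed
    also have "(LNINT z. (ennreal (\<bar>u (x + z) - u x\<bar> * norm z powr (?p / 2)) * indicator (ball 0 h) z)\<^sup>2) \<le> ennreal (e\<^sup>2 / B)"
    proof -
     have "(LNINT z. (ennreal (\<bar>u (x + z) - u x\<bar> * norm z powr (?p / 2)) * indicator (ball 0 h) z)\<^sup>2) \<le> (LNINT z. ennreal (?F x z * indicator (ball 0 d) z))"
     proof (rule nn_integral_mono)
      fix z :: 'a
      have "(\<bar>u (x + z) - u x\<bar> * norm z powr (?p / 2))\<^sup>2 = ?F x z"
       unfolding power_mult_distrib power2_eq_square[of "norm z powr _"] powr_add[symmetric] by simp
      then show "(ennreal (\<bar>u (x + z) - u x\<bar> * norm z powr (?p / 2)) * indicator (ball 0 h) z)\<^sup>2 \<le> ennreal (?F x z * indicator (ball 0 d) z)"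
       using h by (auto simp: indicator_def ennreal_power)
     qed
     also have "\<dots> = ennreal (LBINT z. ?F x z * indicator (ball 0 d) z)"
     proof (rule nn_integral_eq_integral)
      show "integrable lborel (\<lambda>z. ?F x z * indicator (ball 0 d) z)"
      proof (rule Bochner_Integration.integrable_bound[OF iF])
       show "(\<lambda>z. ?F x z * indicator (ball 0 d) z) \<in> borel_measurable lborel" by measurable
      qed (auto intro!: AE_I2 simp: indicator_def)
     qed (auto intro!: AE_I2)
     also have "\<dots> \<le> ennreal (e\<^sup>2 / B)" by (rule ennreal_leI[OF d(2)])
     finally show ?thesis .
    qed
    finally have "?L\<^sup>2 \<le> ennreal (e\<^sup>2 / B) * ennreal (B * h powr (2 * \<beta> - 2))" by (simp add: mult_right_mono)
    also have "\<dots> = ennreal ((e * h powr (\<beta> - 1))\<^sup>2)"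
    proof -
     have "h powr (2 * \<beta> - 2) = (h powr (\<beta> - 1))\<^sup>2" unfolding power2_eq_square powr_add[symmetric] by simp
     then show ?thesis using B by (simp add: ennreal_mult'[symmetric] power_mult_distrib)
    qed
    also have "\<dots> = (ennreal (e * h powr (\<beta> - 1)))\<^sup>2" using e by (simp add: ennreal_power)
    finally show ?thesis using e by (intro ennreal_square_le_imp_le) auto
   qed
   with d(1) show "\<exists>d>0. \<forall>h. 0 < h \<and> h < d \<longrightarrow>
    (LNINT y. ennreal (norm (u y - u x)) * indicator (ball x h) y) \<le> ennreal (e * h powr (\<beta> - 1))" by blast
  qed
  qed
qed

section \<open>Comparison of sharp cut-offs with mollified truncations\<close>

definition shk :: "real \<Rightarrow> real \<Rightarrow> 'a::euclidean_space \<Rightarrow> 'a" where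
  "shk \<beta> \<epsilon> h = (if \<epsilon> < norm h then kern \<beta> 0 h else 0)"

lemma shk_measurable [measurable]: "shk \<beta> \<epsilon> \<in> borel_measurable borel"
  unfolding shk_def[abs_def] by measurable

lemma shk_minus [simp]: "shk \<beta> \<epsilon> (- h) = - shk \<beta> \<epsilon> h"
  by (simp add: shk_def)

lemma norm_shk_le: "1 \<le> \<beta> \<Longrightarrow> 0 < \<epsilon> \<Longrightarrow> norm (shk \<beta> \<epsilon> h) \<le> \<epsilon> powr (1 - \<beta>)"
  using norm_kern_le[of \<beta> 0 h] powr_mono2'[of "1 - \<beta>" \<epsilon> "norm h"] by (auto simp: shk_def)

text \<open>The bump rescaled to radius \<epsilon> and total mass one: the mollifier at scale
  \<epsilon>. Its evenness keeps mollified kernels odd.\<close>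

definition mk :: "real \<Rightarrow> 'a::euclidean_space \<Rightarrow> real" where
  "mk \<epsilon> y = bump (inverse \<epsilon> *\<^sub>R y) / (\<epsilon> ^ DIM('a) * (LBINT x::'a. bump x))"

lemma mk_measurable [measurable]: "mk \<epsilon> \<in> borel_measurable borel"
  unfolding mk_def[abs_def] by measurable

lemma mk_minus [simp]: "mk \<epsilon> (- y) = mk \<epsilon> y"
  by (simp add: mk_def)

lemma mk_nonneg: "0 < \<epsilon> \<Longrightarrow> 0 \<le> mk \<epsilon> y"
  by (simp add: mk_def bump_bounds less_imp_le)

lemma mk_le: "0 < \<epsilon> \<Longrightarrow> mk \<epsilon> (y::'a) \<le> 1 / (\<epsilon> ^ DIM('a::euclidean_space) * (LBINT x::'a. bump x))"
  unfolding mk_def using integral_bump_pos[where 'a='a] by (intro divide_right_mono bump_bounds) simp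

lemma mk_eq_0: "0 < \<epsilon> \<Longrightarrow> \<epsilon> \<le> norm y \<Longrightarrow> mk \<epsilon> y = 0"
  by (simp add: mk_def bump_bounds field_simps)

lemma mk_lipschitz:
  fixes y :: "'a::euclidean_space"
  assumes "0 < \<epsilon>"
  shows "\<bar>mk \<epsilon> y - mk \<epsilon> y'\<bar> \<le> norm (y - y') / (\<epsilon> ^ Suc DIM('a) * (LBINT x::'a. bump x))"
proof -
  let ?c = "\<epsilon> ^ DIM('a) * (LBINT x::'a. bump x)"
  have c: "0 < ?c" using assms integral_bump_pos[where 'a='a] by simp
  have "\<bar>mk \<epsilon> y - mk \<epsilon> y'\<bar> = \<bar>bump (inverse \<epsilon> *\<^sub>R y) - bump (inverse \<epsilon> *\<^sub>R y')\<bar> / ?c"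
  unfolding mk_def using c by (simp add: diff_divide_distrib[symmetric])
  also have "\<dots> \<le> norm (inverse \<epsilon> *\<^sub>R y - inverse \<epsilon> *\<^sub>R y') / ?c"
  using c by (intro divide_right_mono bump_lipschitz) auto
  also have "norm (inverse \<epsilon> *\<^sub>R y - inverse \<epsilon> *\<^sub>R y') = norm (y - y') / \<epsilon>"
  unfolding scaleR_diff_right[symmetric] using assms by (simp add: divide_inverse mult.commute)
  finally show ?thesis by (simp add: mult_ac)
qed

lemma mk_integrable:
  fixes \<epsilon> :: real
  assumes "0 < \<epsilon>" shows "integrable lborel (mk \<epsilon> :: 'a::euclidean_space \<Rightarrow> real)"
  using mk_le[OF assms, where 'a='a] mk_nonneg[OF assms, where 'a='a] mk_eq_0[OF assms, where 'a='a]
  by (intro integrable_bounded_ball[where r=\<epsilon> and b="1 / (\<epsilon> ^ DIM('a) * (LBINT x::'a. bump x))"]) (auto simp: not_less[symmetric])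

lemma mk_integral:
  assumes "0 < \<epsilon>" shows "(LBINT y::'a::euclidean_space. mk \<epsilon> y) = 1"
proof -
  have "(LBINT y::'a. mk \<epsilon> y) = \<epsilon> ^ DIM('a) * (LBINT y::'a. mk \<epsilon> (\<epsilon> *\<^sub>R y))"
  using assms by (intro integral_scale) auto
  also have "(LBINT y::'a. mk \<epsilon> (\<epsilon> *\<^sub>R y)) = (LBINT y::'a. bump y) / (\<epsilon> ^ DIM('a) * (LBINT x::'a. bump x))"
  using assms by (simp add: mk_def)
  finally show ?thesis using assms integral_bump_pos[where 'a='a] by simp
qed

definition mkern :: "real \<Rightarrow> real \<Rightarrow> real \<Rightarrow> 'a::euclidean_space \<Rightarrow> 'a" where
  "mkern \<beta> \<epsilon> t h = (LBINT y. mk \<epsilon> y *\<^sub>R kern \<beta> t (h - y))"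

lemma mkern_integrable:
  fixes h :: "'a::euclidean_space"
  assumes "1 \<le> \<beta>" "0 < t" "0 < \<epsilon>"
  shows "integrable lborel (\<lambda>y. mk \<epsilon> y *\<^sub>R kern \<beta> t (h - y))"
proof (rule Bochner_Integration.integrable_bound)
  show "integrable lborel (\<lambda>y::'a. t powr (1 - \<beta>) * mk \<epsilon> y)" by (intro integrable_mult_right mk_integrable assms)
  show "AE y in lborel. norm (mk \<epsilon> y *\<^sub>R kern \<beta> t (h - y)) \<le> norm (t powr (1 - \<beta>) * mk \<epsilon> y)"
  using norm_kern_le_trunc[OF assms(1,2)] mk_nonneg[OF assms(3)]
  by (intro AE_I2) (auto simp: abs_mult mult.commute[of "t powr (1 - \<beta>)"] intro!: mult_left_mono)
qed simp

lemma mkern_measurable [measurable]: "mkern \<beta> \<epsilon> t \<in> borel_measurable borel"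
  unfolding mkern_def[abs_def] by (rule lborel.borel_measurable_lebesgue_integral) measurable

lemma mkern_minus: "mkern \<beta> \<epsilon> t (- h) = - mkern \<beta> \<epsilon> t h"
proof -
  have "mkern \<beta> \<epsilon> t (- h) = (LBINT y. mk \<epsilon> (- y) *\<^sub>R kern \<beta> t (- h - (- y)))"
  unfolding mkern_def using integral_reflect_lborel[of "\<lambda>y. mk \<epsilon> y *\<^sub>R kern \<beta> t (- h - y)" 0] by simp
  also have "\<dots> = (LBINT y. - (mk \<epsilon> y *\<^sub>R kern \<beta> t (h - y)))"
  proof (rule Bochner_Integration.integral_cong)
  fix y
  have "- h - (- y) = - (h - y)" by simp
  then show "mk \<epsilon> (- y) *\<^sub>R kern \<beta> t (- h - (- y)) = - (mk \<epsilon> y *\<^sub>R kern \<beta> t (h - y))"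
   by (simp only: kern_minus mk_minus scaleR_minus_right)
  qed simp
  finally show ?thesis by (simp add: mkern_def)
qed

lemma norm_integral_le_nn_integral:
  fixes f :: "'b \<Rightarrow> 'a::{banach, second_countable_topology}"
  assumes "integrable M f" "(\<integral>\<^sup>+x. ennreal (norm (f x)) \<partial>M) \<le> ennreal c" "0 \<le> c"
  shows "norm (integral\<^sup>L M f) \<le> c"
  using order_trans[OF integral_norm_bound_ennreal[OF assms(1)] assms(2)] assms(3) by (simp add: ennreal_le_iff)

text \<open>For |h| \<ge> 2\<epsilon> the sharp cut-off and the truncation coincide at h, and
  mollification moves the argument by at most \<epsilon>, so the Lipschitz bound gives \<epsilon>
  |h|^(-\<beta>). For smaller h both kernels are of size \<epsilon>^(1-\<beta>). The constant is
  independent of t, and the majorant is integrable for \<beta> > n.\<close>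

lemma shk_mkern_diff:
  assumes \<beta>: "1 \<le> \<beta>" "\<beta> < real DIM('a::euclidean_space) + 2"
  obtains C where "0 < C"
  "\<And>\<epsilon> t h. 0 < t \<Longrightarrow> t \<le> \<epsilon> \<Longrightarrow> norm (shk \<beta> \<epsilon> h - mkern \<beta> \<epsilon> t (h::'a)) \<le> C * (\<epsilon> * max (norm h) \<epsilon> powr (- \<beta>))"
proof -
  let ?n = "real DIM('a)" and ?I = "LBINT x::'a. bump x"
  have I: "0 < ?I" by (rule integral_bump_pos)
  define A where "A = (1 + \<beta>) * (1 / 2) powr (- \<beta>)"
  define B where "B = sphere_area TYPE('a) / (?n + 2 - \<beta>) * 3 powr (?n + 2 - \<beta>) / ?I"
  define C where "C = A + (1 + B) * 2 powr \<beta>"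
  have pos: "0 < A" "0 < B" using \<beta> I sphere_area_pos[where 'a='a] by (auto simp: A_def B_def)
  show thesis
  proof (rule that)
  show "0 < C" using pos by (simp add: C_def add_pos_pos)
  fix \<epsilon> t :: real and h :: 'a assume t: "0 < t" "t \<le> \<epsilon>"
  then have \<epsilon>: "0 < \<epsilon>" by simp
  note im = mkern_integrable[OF \<beta>(1) t(1) \<epsilon>, of h]
  show "norm (shk \<beta> \<epsilon> h - mkern \<beta> \<epsilon> t h) \<le> C * (\<epsilon> * max (norm h) \<epsilon> powr (- \<beta>))"
  proof (cases "2 * \<epsilon> \<le> norm h")
   case True
   have "shk \<beta> \<epsilon> h = kern \<beta> t h" using True t \<epsilon> by (simp add: shk_def kern_eq)
   also have "\<dots> = (LBINT y::'a. mk \<epsilon> y *\<^sub>R kern \<beta> t h)"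
    using mk_integrable[OF \<epsilon>, where 'a='a] mk_integral[OF \<epsilon>, where 'a='a] by simp
   finally have eq: "shk \<beta> \<epsilon> h - mkern \<beta> \<epsilon> t h = (LBINT y. mk \<epsilon> y *\<^sub>R kern \<beta> t h - mk \<epsilon> y *\<^sub>R kern \<beta> t (h - y))"
    unfolding mkern_def using im mk_integrable[OF \<epsilon>, where 'a='a] by simp
   have "norm (shk \<beta> \<epsilon> h - mkern \<beta> \<epsilon> t h) \<le> (LBINT y. norm (mk \<epsilon> y *\<^sub>R kern \<beta> t h - mk \<epsilon> y *\<^sub>R kern \<beta> t (h - y)))"
    unfolding eq by (rule integral_norm_bound)
   also have "\<dots> \<le> (LBINT y. (A * norm h powr (- \<beta>) * \<epsilon>) * mk \<epsilon> (y::'a))"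
   proof (rule integral_mono)
    show "integrable lborel (\<lambda>y. norm (mk \<epsilon> y *\<^sub>R kern \<beta> t h - mk \<epsilon> y *\<^sub>R kern \<beta> t (h - y)))"
     using im mk_integrable[OF \<epsilon>, where 'a='a] by simp
    show "integrable lborel (\<lambda>y. (A * norm h powr (- \<beta>) * \<epsilon>) * mk \<epsilon> (y::'a))"
     using mk_integrable[OF \<epsilon>, where 'a='a] by simp
    fix y :: 'a
    show "norm (mk \<epsilon> y *\<^sub>R kern \<beta> t h - mk \<epsilon> y *\<^sub>R kern \<beta> t (h - y)) \<le> (A * norm h powr (- \<beta>) * \<epsilon>) * mk \<epsilon> y"
    proof (cases "norm y < \<epsilon>")
     case y: True
     have hy: "norm h / 2 \<le> norm (h - y)" using norm_triangle_ineq2[of h y] y True by simp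
     have "norm (kern \<beta> t h - kern \<beta> t (h - y)) \<le> (1 + \<beta>) * (norm h / 2) powr (- \<beta>) * norm (h - (h - y))"
      using \<beta> True \<epsilon> hy by (intro kern_lipschitz) (auto simp: le_max_iff_disj)
     also have "\<dots> = A * norm h powr (- \<beta>) * norm y"
      using powr_mult[of "1 / 2" "norm h" "- \<beta>"] by (simp add: A_def)
     also have "\<dots> \<le> A * norm h powr (- \<beta>) * \<epsilon>" using y pos by (intro mult_left_mono) auto
     finally have "mk \<epsilon> y * norm (kern \<beta> t h - kern \<beta> t (h - y)) \<le> mk \<epsilon> y * (A * norm h powr (- \<beta>) * \<epsilon>)"
      by (intro mult_left_mono mk_nonneg \<epsilon>)
     then show ?thesis
      unfolding scaleR_diff_right[symmetric] norm_scaleR using mk_nonneg[OF \<epsilon>, of y] by (simp add: mult.commute)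
    qed (simp add: mk_eq_0 \<epsilon>)
   qed
   also have "\<dots> = A * (\<epsilon> * norm h powr (- \<beta>))"
    using mk_integral[OF \<epsilon>, where 'a='a] by simp
   also have "\<dots> \<le> C * (\<epsilon> * norm h powr (- \<beta>))"
    using pos \<epsilon> by (intro mult_right_mono) (auto simp: C_def)
   also have "norm h = max (norm h) \<epsilon>" using True \<epsilon> by simp
   finally show ?thesis .
  next
   case False
   \<comment> \<open>As |h| < 2\<epsilon> and the mollifier has radius \<epsilon>, only |v| <
     3\<epsilon> matters.\<close>
   let ?J = "indicator (ball 0 (3 * \<epsilon>)) :: 'a \<Rightarrow> real"
   have [measurable]: "ball (0::'a) (3 * \<epsilon>) \<in> sets borel" by simp
   have sh: "norm (shk \<beta> \<epsilon> h) \<le> \<epsilon> powr (1 - \<beta>)" by (rule norm_shk_le[OF \<beta>(1) \<epsilon>])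
   have i1: "integrable lborel (\<lambda>v. mk \<epsilon> (h - v) *\<^sub>R kern \<beta> t v)"
    using integrable_reflect[OF im, of h] by simp
   have i2: "integrable lborel (\<lambda>v. ?J v *\<^sub>R kern \<beta> t v)"
    using norm_kern_le_trunc[OF \<beta>(1) t(1)]
    by (intro integrable_bounded_ball[where r="3 * \<epsilon>" and b="t powr (1 - \<beta>)"]) (auto simp: indicator_def split: if_splits)
   have j2: "integrable lborel (\<lambda>v. mk \<epsilon> h *\<^sub>R (?J v *\<^sub>R kern \<beta> t v))"
    by (intro integrable_scaleR_right i2)
   \<comment> \<open>Subtracting the constant \<open>mk \<epsilon> h\<close> is free by oddness; the
     Lipschitz bound of the mollifier then gains the factor |v| that makes the estimate uniform in
     t.\<close>
   have z2: "(LBINT v. ?J v *\<^sub>R kern \<beta> t v) = 0" by (intro integral_odd) (auto simp: indicator_def)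
   have "mkern \<beta> \<epsilon> t h = (LBINT v. mk \<epsilon> (h - v) *\<^sub>R kern \<beta> t v)"
    unfolding mkern_def using integral_reflect_lborel[of "\<lambda>y. mk \<epsilon> y *\<^sub>R kern \<beta> t (h - y)" h] by simp
   also have "\<dots> = (LBINT v. mk \<epsilon> (h - v) *\<^sub>R kern \<beta> t v - mk \<epsilon> h *\<^sub>R (?J v *\<^sub>R kern \<beta> t v))"
    unfolding Bochner_Integration.integral_diff[OF i1 j2] integral_scaleR_right z2 by simp
   finally have eq: "mkern \<beta> \<epsilon> t h = (LBINT v. mk \<epsilon> (h - v) *\<^sub>R kern \<beta> t v - mk \<epsilon> h *\<^sub>R (?J v *\<^sub>R kern \<beta> t v))" .
   have "norm (mkern \<beta> \<epsilon> t h) \<le> B * \<epsilon> powr (1 - \<beta>)"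
    unfolding eq
   proof (rule norm_integral_le_nn_integral)
    show "integrable lborel (\<lambda>v. mk \<epsilon> (h - v) *\<^sub>R kern \<beta> t v - mk \<epsilon> h *\<^sub>R (?J v *\<^sub>R kern \<beta> t v))"
     by (intro Bochner_Integration.integrable_diff i1 j2)
    let ?c = "1 / (\<epsilon> ^ Suc DIM('a) * ?I)"
    have c: "0 \<le> ?c" using \<epsilon> I by simp
    have "(LNINT v. ennreal (norm (mk \<epsilon> (h - v) *\<^sub>R kern \<beta> t v - mk \<epsilon> h *\<^sub>R (?J v *\<^sub>R kern \<beta> t v))))
     \<le> (LNINT v. ennreal ?c * (ennreal (norm (v::'a) powr (- (\<beta> - 2))) * indicator (ball 0 (3 * \<epsilon>)) v))"
    proof (rule nn_integral_mono)
     fix v :: 'a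
     show "ennreal (norm (mk \<epsilon> (h - v) *\<^sub>R kern \<beta> t v - mk \<epsilon> h *\<^sub>R (?J v *\<^sub>R kern \<beta> t v)))
      \<le> ennreal ?c * (ennreal (norm v powr (- (\<beta> - 2))) * indicator (ball 0 (3 * \<epsilon>)) v)"
     proof (cases "norm v < 3 * \<epsilon>")
      case True
      have "norm ((mk \<epsilon> (h - v) - mk \<epsilon> h) *\<^sub>R kern \<beta> t v) \<le> (norm v / (\<epsilon> ^ Suc DIM('a) * ?I)) * norm v powr (1 - \<beta>)"
       unfolding norm_scaleR using mk_lipschitz[OF \<epsilon>, of "h - v" h] norm_kern_le[of \<beta> t v] \<beta> I \<epsilon>
       by (intro mult_mono) auto
      also have "\<dots> = ?c * norm v powr (2 - \<beta>)"
       using norm_times_powr[of "norm v" "1 - \<beta>"] by simp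
      finally show ?thesis using True c
       by (simp add: scaleR_diff_left ennreal_mult'[symmetric] ennreal_leI)
     next
      case v: False
      have "\<epsilon> \<le> norm (h - v)" using norm_triangle_ineq2[of v h] v False by (simp add: norm_minus_commute)
      then show ?thesis using v by (simp add: mk_eq_0[OF \<epsilon>])
     qed
    qed
    also have "\<dots> = ennreal ?c * ennreal (sphere_area TYPE('a) / (?n + 2 - \<beta>) * (3 * \<epsilon>) powr (?n + 2 - \<beta>))"
    proof -
     have 1: "\<beta> - 2 < ?n" using \<beta> by simp
     have 2: "?n - (\<beta> - 2) = ?n + 2 - \<beta>" by simp
     have 3: "0 < 3 * \<epsilon>" using \<epsilon> by simp
     show ?thesis using nn_integral_norm_powr_ball[OF 1 3] unfolding 2 by (simp add: nn_integral_cmult)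
    qed
    also have "\<dots> = ennreal (B * \<epsilon> powr (1 - \<beta>))"
    proof -
     have "\<epsilon> powr (?n + 2 - \<beta>) = \<epsilon> powr (1 + ?n + (1 - \<beta>))" by (simp add: algebra_simps)
     also have "\<dots> = \<epsilon> ^ Suc DIM('a) * \<epsilon> powr (1 - \<beta>)" using \<epsilon> by (simp only: powr_add) (simp add: powr_realpow)
     finally have "?c * (sphere_area TYPE('a) / (?n + 2 - \<beta>) * (3 * \<epsilon>) powr (?n + 2 - \<beta>)) = B * \<epsilon> powr (1 - \<beta>)"
      using \<epsilon> by (simp add: powr_mult B_def mult_ac)
     then show ?thesis using c by (simp only: ennreal_mult'[symmetric])
    qed
    finally show "(LNINT v. ennreal (norm (mk \<epsilon> (h - v) *\<^sub>R kern \<beta> t v - mk \<epsilon> h *\<^sub>R (?J v *\<^sub>R kern \<beta> t v)))) \<le> ennreal (B * \<epsilon> powr (1 - \<beta>))" .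
   qed (use pos in simp)
   then have "norm (shk \<beta> \<epsilon> h - mkern \<beta> \<epsilon> t h) \<le> (1 + B) * \<epsilon> powr (1 - \<beta>)"
    using sh norm_triangle_ineq4[of "shk \<beta> \<epsilon> h" "mkern \<beta> \<epsilon> t h"] by (simp add: distrib_right)
   also have "\<epsilon> powr (1 - \<beta>) \<le> 2 powr \<beta> * (\<epsilon> * max (norm h) \<epsilon> powr (- \<beta>))"
   proof -
    have "(2 * \<epsilon>) powr (- \<beta>) \<le> max (norm h) \<epsilon> powr (- \<beta>)" using False \<epsilon> \<beta> by (intro powr_mono2') auto
    then have "2 powr \<beta> * (\<epsilon> * (2 * \<epsilon>) powr (- \<beta>)) \<le> 2 powr \<beta> * (\<epsilon> * max (norm h) \<epsilon> powr (- \<beta>))"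
     using \<epsilon> by (intro mult_left_mono) auto
    moreover have "2 powr \<beta> * (\<epsilon> * (2 * \<epsilon>) powr (- \<beta>)) = \<epsilon> powr (1 - \<beta>)"
    proof -
     have "2 powr \<beta> * 2 powr (- \<beta>) = (1::real)" unfolding powr_add[symmetric] by simp
     moreover have "\<epsilon> * \<epsilon> powr (- \<beta>) = \<epsilon> powr (1 - \<beta>)" using norm_times_powr[of \<epsilon> "- \<beta>"] \<epsilon> by simp
     moreover have "(2 * \<epsilon>) powr (- \<beta>) = 2 powr (- \<beta>) * \<epsilon> powr (- \<beta>)" by (rule powr_mult)
     ultimately show ?thesis by (metis mult.assoc mult.left_commute mult_1)
    qed
    ultimately show ?thesis by simp
   qed
   also have "(1 + B) * (2 powr \<beta> * (\<epsilon> * max (norm h) \<epsilon> powr (- \<beta>))) \<le> C * (\<epsilon> * max (norm h) \<epsilon> powr (- \<beta>))"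
    unfolding mult.assoc[symmetric] using pos \<epsilon> by (intro mult_right_mono) (auto simp: C_def)
   finally show ?thesis using pos by (simp add: mult_left_mono)
  qed
  qed
qed

text \<open>Writes a radial weight as a superposition of indicators of balls, so that integrals
  against it reduce to integrals over balls, the quantity controlled at a Lebesgue point.\<close>

lemma powr_layer_cake:
  assumes "0 < \<beta>" "0 < m" "m \<le> \<rho>"
  shows "ennreal (m powr (- \<beta>)) = ennreal (\<rho> powr (- \<beta>)) + (LNINT s. ennreal (\<beta> * s powr (- \<beta> - 1)) * indicator {m..\<rho>} s)"
proof -
  have le: "\<rho> powr (- \<beta>) \<le> m powr (- \<beta>)" using assms by (intro powr_mono2') auto
  have "(LNINT s. ennreal (\<beta> * s powr (- \<beta> - 1)) * indicator {m..\<rho>} s) = ennreal (- (\<rho> powr (- \<beta>)) - (- (m powr (- \<beta>))))"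
  proof (rule nn_integral_FTC_Icc)
  show "((\<lambda>s. - (s powr (- \<beta>))) has_real_derivative \<beta> * x powr (- \<beta> - 1)) (at x)" if "x \<in> {m..\<rho>}" for x
   using that assms by (auto intro!: derivative_eq_intros)
  qed (use assms in auto)
  then show ?thesis using le by (simp add: ennreal_plus[symmetric] del: ennreal_plus)
qed

text \<open>In the layer decomposition a ball of radius s contributes a small multiple of
  s^(\<beta>-1) with weight \<beta> s^(-\<beta>-1). The integral of the resulting s^(-2) over s
  \<ge> \<epsilon> is at most 1/\<epsilon>, which the prefactor \<epsilon> of the weight
  compensates. This balance dictates the order \<beta> - 1. The part far from x is of order
  \<epsilon>.\<close>

lemma lebesgue_point_average:
  fixes u :: "'a::euclidean_space \<Rightarrow> real"
  assumes \<beta>: "real DIM('a) < \<beta>" and u: "L2c r u" and x: "lebesgue_point (\<beta> - 1) u x" and e: "0 < e"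
  obtains d where "0 < d" "\<And>\<epsilon>. 0 < \<epsilon> \<Longrightarrow> \<epsilon> < d \<Longrightarrow>
  (LNINT y. ennreal (\<bar>u y - u x\<bar> * (\<epsilon> * max (norm (y - x)) \<epsilon> powr (- \<beta>)))) \<le> ennreal e"
proof -
  let ?n = "real DIM('a)" and ?w = "sphere_area TYPE('a)"
  have [measurable]: "u \<in> borel_measurable borel" by (rule L2c_measurable[OF u])
  have \<beta>0: "0 < \<beta>" using \<beta> by (smt (verit) of_nat_0_le_iff)
  define K0 where "K0 = 1 + \<beta> * 2 powr (\<beta> - 1)"
  have K0: "0 < K0" using \<beta>0 by (simp add: K0_def add_pos_pos)
  define e' where "e' = e / (2 * K0)"
  have e': "0 < e'" using e K0 by (simp add: e'_def)
  obtain d0 where d0: "0 < d0" "\<And>h. 0 < h \<Longrightarrow> h < d0 \<Longrightarrow>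
  (LNINT y. ennreal \<bar>u y - u x\<bar> * indicator (ball x h) y) \<le> ennreal (e' * h powr (\<beta> - 1))"
  using x e' unfolding lebesgue_point_def real_norm_def by meson
  \<comment> \<open>The layers are closed balls of radius s \<le> \<rho>, enclosed in open balls of
    radius 2s, which must stay below d0. The doubling is the origin of 2^(\<beta>-1) in K0.\<close>
  define \<rho> where "\<rho> = d0 / 4"
  have \<rho>: "0 < \<rho>" "2 * \<rho> < d0" using d0(1) by (auto simp: \<rho>_def)
  define K where "K = \<rho> powr (- \<beta>) * (LBINT y. \<bar>u y\<bar>) + \<bar>u x\<bar> * (?w / (\<beta> - ?n) * \<rho> powr (?n - \<beta>))"
  have K: "0 \<le> K" using \<beta> sphere_area_pos[where 'a='a] by (auto simp: K_def intro!: add_nonneg_nonneg mult_nonneg_nonneg divide_nonneg_nonneg)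
  let ?\<Psi> = "\<lambda>\<epsilon> y. \<epsilon> * max (norm (y - x)) \<epsilon> powr (- \<beta>)"
  have [measurable]: "ball x \<rho> \<in> sets borel" by simp
  have near: "(LNINT y. ennreal (\<bar>u y - u x\<bar> * ?\<Psi> \<epsilon> y) * indicator (ball x \<rho>) y) \<le> ennreal (e / 2)"
  if \<epsilon>: "0 < \<epsilon>" "\<epsilon> < \<rho>" for \<epsilon>
  proof -
  let ?g = "\<lambda>y s. ennreal \<bar>u y - u x\<bar> * (ennreal (\<beta> * s powr (- \<beta> - 1)) * (if norm (y - x) \<le> s \<and> \<epsilon> \<le> s \<and> s \<le> \<rho> then 1 else 0))"
  have "(LNINT y. ennreal (\<bar>u y - u x\<bar> * ?\<Psi> \<epsilon> y) * indicator (ball x \<rho>) y)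
   \<le> (LNINT y. ennreal \<epsilon> * (ennreal (\<rho> powr (- \<beta>)) * (ennreal \<bar>u y - u x\<bar> * indicator (ball x \<rho>) y) + (LNINT s. ?g y s)))"
  proof (rule nn_integral_mono)
   fix y
   show "ennreal (\<bar>u y - u x\<bar> * ?\<Psi> \<epsilon> y) * indicator (ball x \<rho>) y
    \<le> ennreal \<epsilon> * (ennreal (\<rho> powr (- \<beta>)) * (ennreal \<bar>u y - u x\<bar> * indicator (ball x \<rho>) y) + (LNINT s. ?g y s))"
   proof (cases "y \<in> ball x \<rho>")
    case True
    let ?m = "max (norm (y - x)) \<epsilon>"
    have m: "0 < ?m" "?m \<le> \<rho>" using True \<epsilon> by (auto simp: dist_norm norm_minus_commute)
    have "(LNINT s. ?g y s) = ennreal \<bar>u y - u x\<bar> * (LNINT s. ennreal (\<beta> * s powr (- \<beta> - 1)) * (if norm (y - x) \<le> s \<and> \<epsilon> \<le> s \<and> s \<le> \<rho> then 1 else 0))"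
     by (rule nn_integral_cmult) measurable
    also have "(LNINT s. ennreal (\<beta> * s powr (- \<beta> - 1)) * (if norm (y - x) \<le> s \<and> \<epsilon> \<le> s \<and> s \<le> \<rho> then 1 else 0))
     = (LNINT s. ennreal (\<beta> * s powr (- \<beta> - 1)) * indicator {?m..\<rho>} s)"
     by (intro nn_integral_cong) (auto simp: indicator_def)
    finally have "ennreal \<epsilon> * (ennreal (\<rho> powr (- \<beta>)) * ennreal \<bar>u y - u x\<bar> + (LNINT s. ?g y s))
     = ennreal \<epsilon> * (ennreal \<bar>u y - u x\<bar> * ennreal (?m powr (- \<beta>)))"
     unfolding powr_layer_cake[OF \<beta>0 m] by (simp add: distrib_left mult.commute)
    then show ?thesis using True \<epsilon> by (simp add: ennreal_mult' ennreal_mult'' mult_ac)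
   qed simp
  qed
  also have "\<dots> = ennreal \<epsilon> * (ennreal (\<rho> powr (- \<beta>)) * (LNINT y. ennreal \<bar>u y - u x\<bar> * indicator (ball x \<rho>) y) + (LNINT y. (LNINT s. ?g y s)))"
   by (simp add: nn_integral_cmult nn_integral_add)
  also have "(LNINT y. (LNINT s. ?g y s)) = (LNINT s. (LNINT y. ?g y s))"
   by (rule lborel_pair.Fubini') measurable
  also have "\<dots> \<le> (LNINT s. ennreal (e' * \<beta> * 2 powr (\<beta> - 1)) * (ennreal (1 / s\<^sup>2) * indicator {\<epsilon>..\<rho>} s))"
  proof (rule nn_integral_mono)
   fix s :: real
   show "(LNINT y. ?g y s) \<le> ennreal (e' * \<beta> * 2 powr (\<beta> - 1)) * (ennreal (1 / s\<^sup>2) * indicator {\<epsilon>..\<rho>} s)"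
   proof (cases "s \<in> {\<epsilon>..\<rho>}")
    case True
    then have s: "0 < s" "2 * s < d0" using \<epsilon> \<rho> by auto
    have "(LNINT y. ?g y s) \<le> (LNINT y. ennreal (\<beta> * s powr (- \<beta> - 1)) * (ennreal \<bar>u y - u x\<bar> * indicator (ball x (2 * s)) y))"
     using s by (intro nn_integral_mono) (auto simp: indicator_def dist_norm norm_minus_commute mult_ac)
    also have "\<dots> = ennreal (\<beta> * s powr (- \<beta> - 1)) * (LNINT y. ennreal \<bar>u y - u x\<bar> * indicator (ball x (2 * s)) y)"
    proof -
     have [measurable]: "ball x (2 * s) \<in> sets borel" by simp
     show ?thesis by (rule nn_integral_cmult) measurable
    qed
    also have "\<dots> \<le> ennreal (\<beta> * s powr (- \<beta> - 1)) * ennreal (e' * (2 * s) powr (\<beta> - 1))"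
     using s by (intro mult_left_mono d0(2)) auto
    also have "\<dots> = ennreal (e' * \<beta> * 2 powr (\<beta> - 1) * (1 / s\<^sup>2))"
    proof -
     have "s powr (- \<beta> - 1) * s powr (\<beta> - 1) = s powr (- 2)"
      unfolding powr_add[symmetric] by simp
     also have "\<dots> = 1 / s\<^sup>2" using s by (simp add: powr_minus_divide)
     finally have ss: "s powr (- \<beta> - 1) * s powr (\<beta> - 1) = 1 / s\<^sup>2" .
     have "(2 * s) powr (\<beta> - 1) = 2 powr (\<beta> - 1) * s powr (\<beta> - 1)" by (rule powr_mult)
     then have "\<beta> * s powr (- \<beta> - 1) * (e' * (2 * s) powr (\<beta> - 1)) = e' * \<beta> * 2 powr (\<beta> - 1) * (s powr (- \<beta> - 1) * s powr (\<beta> - 1))"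
      by (simp only: mult_ac)
     then have "\<beta> * s powr (- \<beta> - 1) * (e' * (2 * s) powr (\<beta> - 1)) = e' * \<beta> * 2 powr (\<beta> - 1) * (1 / s\<^sup>2)"
      unfolding ss .
     then show ?thesis using \<beta>0 by (simp only: ennreal_mult'[symmetric] mult_nonneg_nonneg powr_ge_zero less_imp_le)
    qed
    also have "\<dots> = ennreal (e' * \<beta> * 2 powr (\<beta> - 1)) * ennreal (1 / s\<^sup>2)"
     using e' \<beta>0 by (intro ennreal_mult) auto
    finally show ?thesis using True by simp
   next
    case False
    then have "(LNINT y. ?g y s) = (nn_integral lborel (\<lambda>y::'a. 0))" by (intro nn_integral_cong) auto
    then show ?thesis by simp
   qed
  qed
  also have "\<dots> = ennreal (e' * \<beta> * 2 powr (\<beta> - 1)) * (LNINT s. ennreal (1 / s\<^sup>2) * indicator {\<epsilon>..\<rho>} s)"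
   by (rule nn_integral_cmult) measurable
  also have "(LNINT s. ennreal (1 / s\<^sup>2) * indicator {\<epsilon>..\<rho>} s) = ennreal (- (1 / \<rho>) - (- (1 / \<epsilon>)))"
  proof (rule nn_integral_FTC_Icc)
   show "((\<lambda>s. - (1 / s)) has_real_derivative 1 / x\<^sup>2) (at x)" if "x \<in> {\<epsilon>..\<rho>}" for x
    using that \<epsilon> by (auto intro!: derivative_eq_intros simp: power2_eq_square)
  qed (use \<epsilon> in auto)
  also have "\<dots> \<le> ennreal (1 / \<epsilon>)" using \<rho> by (intro ennreal_leI) auto
  also have "(LNINT y. ennreal \<bar>u y - u x\<bar> * indicator (ball x \<rho>) y) \<le> ennreal (e' * \<rho> powr (\<beta> - 1))"
   using \<rho> by (intro d0(2)) auto
  finally have "(LNINT y. ennreal (\<bar>u y - u x\<bar> * ?\<Psi> \<epsilon> y) * indicator (ball x \<rho>) y)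
   \<le> ennreal \<epsilon> * (ennreal (\<rho> powr (- \<beta>)) * ennreal (e' * \<rho> powr (\<beta> - 1)) + ennreal (e' * \<beta> * 2 powr (\<beta> - 1)) * ennreal (1 / \<epsilon>))"
   by (simp add: mult_left_mono add_mono)
  also have "\<dots> = ennreal (\<epsilon> * (\<rho> powr (- \<beta>) * (e' * \<rho> powr (\<beta> - 1)) + (e' * \<beta> * 2 powr (\<beta> - 1)) * (1 / \<epsilon>)))"
  proof -
   have n: "0 \<le> e' * \<rho> powr (\<beta> - 1)" "0 \<le> e' * \<beta> * 2 powr (\<beta> - 1)" "0 \<le> 1 / \<epsilon>" "0 \<le> \<epsilon>" "0 \<le> \<rho> powr (- \<beta>)"
    using e' \<beta>0 \<epsilon> by simp_all
   show ?thesis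
    unfolding ennreal_mult[OF n(4) add_nonneg_nonneg[OF mult_nonneg_nonneg[OF n(5,1)] mult_nonneg_nonneg[OF n(2,3)]]]
     ennreal_plus[OF mult_nonneg_nonneg[OF n(5,1)] mult_nonneg_nonneg[OF n(2,3)]] ennreal_mult[OF n(5,1)] ennreal_mult[OF n(2,3)] ..
  qed
  also have "\<dots> \<le> ennreal (e' * K0)"
  proof (rule ennreal_leI)
   have "\<rho> powr (- \<beta>) * \<rho> powr (\<beta> - 1) = 1 / \<rho>"
    unfolding powr_add[symmetric] using \<rho> by (simp add: powr_minus_divide)
   then have "\<rho> powr (- \<beta>) * (e' * \<rho> powr (\<beta> - 1)) = e' / \<rho>" by (simp add: mult.left_commute)
   then have "\<epsilon> * (\<rho> powr (- \<beta>) * (e' * \<rho> powr (\<beta> - 1)) + (e' * \<beta> * 2 powr (\<beta> - 1)) * (1 / \<epsilon>)) = e' * (\<epsilon> / \<rho>) + e' * (\<beta> * 2 powr (\<beta> - 1))"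
    using \<epsilon> by (simp add: distrib_left)
   also have "\<dots> \<le> e' * 1 + e' * (\<beta> * 2 powr (\<beta> - 1))"
    using e' \<epsilon> by (intro add_right_mono mult_left_mono) auto
   finally show "\<epsilon> * (\<rho> powr (- \<beta>) * (e' * \<rho> powr (\<beta> - 1)) + (e' * \<beta> * 2 powr (\<beta> - 1)) * (1 / \<epsilon>)) \<le> e' * K0"
    by (simp add: K0_def distrib_left)
  qed
  also have "e' * K0 = e / 2" using K0 by (simp add: e'_def)
  finally show ?thesis .
  qed
  have far: "(LNINT y. ennreal (\<bar>u y - u x\<bar> * ?\<Psi> \<epsilon> y) * indicator (- ball x \<rho>) y) \<le> ennreal (\<epsilon> * K)"
  if \<epsilon>: "0 < \<epsilon>" "\<epsilon> < \<rho>" for \<epsilon>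
  proof -
  let ?f = "\<lambda>z. ennreal (norm z powr (- \<beta>)) * indicator (- ball (0::'a) \<rho>) z"
  have [measurable]: "ball (0::'a) \<rho> \<in> sets borel" by simp
  have "(LNINT y. ennreal (\<bar>u y - u x\<bar> * ?\<Psi> \<epsilon> y) * indicator (- ball x \<rho>) y)
   \<le> (LNINT y. ennreal \<epsilon> * (ennreal (\<rho> powr (- \<beta>)) * ennreal \<bar>u y\<bar> + ennreal \<bar>u x\<bar> * ?f (y + - x)))"
  proof (rule nn_integral_mono)
   fix y
   show "ennreal (\<bar>u y - u x\<bar> * ?\<Psi> \<epsilon> y) * indicator (- ball x \<rho>) y \<le> ennreal \<epsilon> * (ennreal (\<rho> powr (- \<beta>)) * ennreal \<bar>u y\<bar> + ennreal \<bar>u x\<bar> * ?f (y + - x))"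
   proof (cases "y \<in> ball x \<rho>")
    case False
    then have yx: "\<rho> \<le> norm (y - x)" by (simp add: dist_norm norm_minus_commute)
    then have m: "max (norm (y - x)) \<epsilon> = norm (y - x)" using \<epsilon> by simp
    have le: "norm (y - x) powr (- \<beta>) \<le> \<rho> powr (- \<beta>)" using yx \<rho> \<beta>0 by (intro powr_mono2') auto
    have "\<bar>u y - u x\<bar> * norm (y - x) powr (- \<beta>) \<le> (\<bar>u y\<bar> + \<bar>u x\<bar>) * norm (y - x) powr (- \<beta>)"
     by (intro mult_right_mono) auto
    also have "\<dots> \<le> \<rho> powr (- \<beta>) * \<bar>u y\<bar> + \<bar>u x\<bar> * norm (y - x) powr (- \<beta>)"
     using mult_right_mono[OF le, of "\<bar>u y\<bar>"] by (simp add: distrib_right mult.commute)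
    finally have "\<epsilon> * (\<bar>u y - u x\<bar> * norm (y - x) powr (- \<beta>)) \<le> \<epsilon> * (\<rho> powr (- \<beta>) * \<bar>u y\<bar> + \<bar>u x\<bar> * norm (y - x) powr (- \<beta>))"
     using \<epsilon> by (intro mult_left_mono) auto
    then have "ennreal (\<bar>u y - u x\<bar> * ?\<Psi> \<epsilon> y) \<le> ennreal (\<epsilon> * (\<rho> powr (- \<beta>) * \<bar>u y\<bar> + \<bar>u x\<bar> * norm (y - x) powr (- \<beta>)))"
     unfolding m by (intro ennreal_leI) (simp add: mult_ac)
    also have "\<dots> = ennreal \<epsilon> * (ennreal (\<rho> powr (- \<beta>)) * ennreal \<bar>u y\<bar> + ennreal \<bar>u x\<bar> * ennreal (norm (y - x) powr (- \<beta>)))"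
     using \<epsilon> by (simp add: ennreal_mult ennreal_plus)
    finally show ?thesis using yx by (simp add: indicator_def)
   qed simp
  qed
  also have "\<dots> = ennreal \<epsilon> * (ennreal (\<rho> powr (- \<beta>)) * (LNINT y. ennreal \<bar>u y\<bar>) + ennreal \<bar>u x\<bar> * (LNINT z. ?f z))"
   using nn_integral_shift[of ?f "- x"] by (simp add: nn_integral_cmult nn_integral_add)
  also have "(LNINT y. ennreal \<bar>u y\<bar>) = ennreal (LBINT y. \<bar>u y\<bar>)"
   using L2c_integrable[OF u] by (intro nn_integral_eq_integral) auto
  also have "(LNINT z. ?f z) = ennreal (?w / (\<beta> - ?n) * \<rho> powr (?n - \<beta>))"
   by (rule nn_integral_norm_powr_out[OF \<beta> \<rho>(1)])
  also have "ennreal \<epsilon> * (ennreal (\<rho> powr (- \<beta>)) * ennreal (LBINT y. \<bar>u y\<bar>) + ennreal \<bar>u x\<bar> * ennreal (?w / (\<beta> - ?n) * \<rho> powr (?n - \<beta>))) = ennreal (\<epsilon> * K)"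
  proof -
   have 0: "0 \<le> ?w / (\<beta> - ?n) * \<rho> powr (?n - \<beta>)" "0 \<le> (LBINT y. \<bar>u y\<bar>)"
    using \<beta> sphere_area_pos[where 'a='a] by auto
   have n: "0 \<le> \<epsilon>" "0 \<le> \<rho> powr (- \<beta>) * (LBINT y. \<bar>u y\<bar>)" "0 \<le> \<bar>u x\<bar> * (?w / (\<beta> - ?n) * \<rho> powr (?n - \<beta>))"
    using \<epsilon> mult_nonneg_nonneg[OF powr_ge_zero 0(2)] mult_nonneg_nonneg[OF abs_ge_zero 0(1)] by simp_all
   show ?thesis
    unfolding K_def ennreal_mult[OF n(1) add_nonneg_nonneg[OF n(2,3)]] ennreal_plus[OF n(2,3)]
     ennreal_mult[OF powr_ge_zero 0(2)] ennreal_mult[OF abs_ge_zero 0(1)] ..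
  qed
  finally show ?thesis .
  qed
  show thesis
  proof (rule that)
  show "0 < min \<rho> (e / (2 * (K + 1)))" using \<rho> e K by auto
  fix \<epsilon> assume \<epsilon>: "0 < \<epsilon>" "\<epsilon> < min \<rho> (e / (2 * (K + 1)))"
  then have \<epsilon>\<rho>: "\<epsilon> < \<rho>" and "\<epsilon> * (2 * (K + 1)) < e" using K by (auto simp: field_simps)
  then have eK: "\<epsilon> * K \<le> e / 2" using \<epsilon> by (simp add: algebra_simps)
  have "(LNINT y. ennreal (\<bar>u y - u x\<bar> * ?\<Psi> \<epsilon> y))
   = (LNINT y. ennreal (\<bar>u y - u x\<bar> * ?\<Psi> \<epsilon> y) * indicator (ball x \<rho>) y + ennreal (\<bar>u y - u x\<bar> * ?\<Psi> \<epsilon> y) * indicator (- ball x \<rho>) y)"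
   by (intro nn_integral_cong) (auto simp: indicator_def)
  also have "\<dots> = (LNINT y. ennreal (\<bar>u y - u x\<bar> * ?\<Psi> \<epsilon> y) * indicator (ball x \<rho>) y)
    + (LNINT y. ennreal (\<bar>u y - u x\<bar> * ?\<Psi> \<epsilon> y) * indicator (- ball x \<rho>) y)"
   by (rule nn_integral_add) measurable
  also have "\<dots> \<le> ennreal (e / 2) + ennreal (e / 2)"
   by (rule add_mono[OF near[OF \<epsilon>(1) \<epsilon>\<rho>] order_trans[OF far[OF \<epsilon>(1) \<epsilon>\<rho>] ennreal_leI[OF eK]]])
  also have "\<dots> = ennreal e" using e by (simp add: ennreal_plus[symmetric] del: ennreal_plus)
  finally show "(LNINT y. ennreal (\<bar>u y - u x\<bar> * ?\<Psi> \<epsilon> y)) \<le> ennreal e" .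
  qed
qed

definition mollify :: "real \<Rightarrow> ('a::euclidean_space \<Rightarrow> 'b::euclidean_space) \<Rightarrow> 'a \<Rightarrow> 'b" where
  "mollify \<epsilon> g x = (LBINT y. mk \<epsilon> (y - x) *\<^sub>R g y)"

lemma mk_shift_integrable:
  fixes x :: "'a::euclidean_space"
  assumes "0 < \<epsilon>"
  shows "integrable lborel (\<lambda>y. mk \<epsilon> (y - x))" "(LBINT y. mk \<epsilon> (y - x)) = 1"
proof -
  show "integrable lborel (\<lambda>y. mk \<epsilon> (y - x))"
  using integrable_shift[OF mk_integrable[OF assms], of "- x"] by simp
  show "(LBINT y. mk \<epsilon> (y - x)) = 1"
  using integral_shift[of "mk \<epsilon>" "- x"] mk_integral[OF assms, where 'a='a] by simp
qed

lemma mk_square_integrable: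
  fixes x :: "'a::euclidean_space"
  assumes "0 < \<epsilon>"
  shows "integrable lborel (\<lambda>y. (mk \<epsilon> (y - x))\<^sup>2)"
proof (rule Bochner_Integration.integrable_bound)
  let ?c = "1 / (\<epsilon> ^ DIM('a) * (LBINT x::'a. bump x))"
  show "integrable lborel (\<lambda>y. ?c * mk \<epsilon> (y - x))" by (intro integrable_mult_right mk_shift_integrable assms)
  have "(mk \<epsilon> (y - x))\<^sup>2 \<le> ?c * mk \<epsilon> (y - x)" for y
  unfolding power2_eq_square by (intro mult_right_mono mk_le mk_nonneg assms)
  then show "AE y in lborel. norm ((mk \<epsilon> (y - x))\<^sup>2) \<le> norm (?c * mk \<epsilon> (y - x))"
  unfolding real_norm_def abs_power2 by (intro AE_I2 order_trans[OF _ abs_ge_self])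
qed simp

lemma mollify_integrable:
  fixes g :: "'a::euclidean_space \<Rightarrow> 'b::euclidean_space"
  assumes "0 < \<epsilon>" and [measurable]: "g \<in> borel_measurable borel" and g: "integrable lborel (\<lambda>y. (norm (g y))\<^sup>2)"
  shows "integrable lborel (\<lambda>y. mk \<epsilon> (y - x) *\<^sub>R g y)"
proof (rule Bochner_Integration.integrable_bound)
  show "integrable lborel (\<lambda>y. (mk \<epsilon> (y - x))\<^sup>2 + (norm (g y))\<^sup>2)"
  by (intro Bochner_Integration.integrable_add mk_square_integrable assms)
  show "AE y in lborel. norm (mk \<epsilon> (y - x) *\<^sub>R g y) \<le> norm ((mk \<epsilon> (y - x))\<^sup>2 + (norm (g y))\<^sup>2)"
  using inner_le_sum_squares[of "mk \<epsilon> (_ - x)" "norm (g _)"] by (intro AE_I2) (auto simp: abs_mult)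
qed simp

lemma norm_mollify_le:
  fixes g :: "'a::euclidean_space \<Rightarrow> 'b::euclidean_space"
  assumes \<epsilon>: "0 < \<epsilon>" and [measurable]: "g \<in> borel_measurable borel" and g: "integrable lborel (\<lambda>y. (norm (g y))\<^sup>2)" and \<eta>: "0 < \<eta>"
  shows "norm (mollify \<epsilon> g x) \<le> \<eta> * (LBINT y. (mk \<epsilon> (y - x))\<^sup>2) + (LBINT y. (norm (g y))\<^sup>2) / \<eta>"
proof -
  have "norm (mollify \<epsilon> g x) \<le> (LBINT y. norm (mk \<epsilon> (y - x) *\<^sub>R g y))"
  unfolding mollify_def by (rule integral_norm_bound)
  also have "\<dots> \<le> (LBINT y. \<eta> * (mk \<epsilon> (y - x))\<^sup>2 + (norm (g y))\<^sup>2 / \<eta>)"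
  proof (rule integral_mono)
  show "integrable lborel (\<lambda>y. norm (mk \<epsilon> (y - x) *\<^sub>R g y))"
   by (intro Bochner_Integration.integrable_norm mollify_integrable \<epsilon> g) simp
  show "integrable lborel (\<lambda>y. \<eta> * (mk \<epsilon> (y - x))\<^sup>2 + (norm (g y))\<^sup>2 / \<eta>)"
   by (intro Bochner_Integration.integrable_add integrable_mult_right integrable_divide mk_square_integrable \<epsilon> g)
  fix y
  have "0 \<le> (sqrt \<eta> * \<bar>mk \<epsilon> (y - x)\<bar> - norm (g y) / sqrt \<eta>)\<^sup>2" by simp
  then have "2 * (\<bar>mk \<epsilon> (y - x)\<bar> * norm (g y)) \<le> \<eta> * (mk \<epsilon> (y - x))\<^sup>2 + (norm (g y))\<^sup>2 / \<eta>"
   using \<eta> by (simp add: power2_diff power_mult_distrib power_divide)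
  moreover have "0 \<le> \<bar>mk \<epsilon> (y - x)\<bar> * norm (g y)" by simp
  ultimately show "norm (mk \<epsilon> (y - x) *\<^sub>R g y) \<le> \<eta> * (mk \<epsilon> (y - x))\<^sup>2 + (norm (g y))\<^sup>2 / \<eta>"
   unfolding norm_scaleR by linarith
  qed
  also have "\<dots> = \<eta> * (LBINT y. (mk \<epsilon> (y - x))\<^sup>2) + (LBINT y. (norm (g y))\<^sup>2) / \<eta>"
  using mk_square_integrable[OF \<epsilon>, of x] g by simp
  finally show ?thesis .
qed

text \<open>At a fixed scale mollification is a pairing with a square integrable function, so
  convergence in L^2 becomes convergence at every point.\<close>

lemma tendsto_mollify:
  fixes g :: "nat \<Rightarrow> 'a::euclidean_space \<Rightarrow> 'b::euclidean_space"
  assumes \<epsilon>: "0 < \<epsilon>" and [measurable]: "\<And>i. g i \<in> borel_measurable borel" "w \<in> borel_measurable borel"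
  and g: "\<And>i. integrable lborel (\<lambda>y. (norm (g i y))\<^sup>2)" and w: "integrable lborel (\<lambda>y. (norm (w y))\<^sup>2)"
  and d: "\<And>i. integrable lborel (\<lambda>y. (norm (g i y - w y))\<^sup>2)"
  and lim: "(\<lambda>i. LBINT y. (norm (g i y - w y))\<^sup>2) \<longlonglongrightarrow> 0"
  shows "(\<lambda>i. mollify \<epsilon> (g i) x) \<longlonglongrightarrow> mollify \<epsilon> w x"
proof (rule LIMSEQ_I)
  fix e :: real assume e: "0 < e"
  define A where "A = (LBINT y. (mk \<epsilon> (y - x))\<^sup>2)"
  have A: "0 \<le> A" by (simp add: A_def)
  define \<eta> where "\<eta> = e / (2 * (A + 1))"
  have \<eta>0: "0 < \<eta>" and "\<eta> * (A + 1) = e / 2" using e A by (auto simp: \<eta>_def divide_simps)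
  then have \<eta>: "\<eta> * A < e / 2" by (simp add: distrib_left)
  have "(\<lambda>i. (LBINT y. (norm (g i y - w y))\<^sup>2) / \<eta>) \<longlonglongrightarrow> 0 / \<eta>"
  using \<eta>0 by (intro tendsto_intros lim) auto
  then have "eventually (\<lambda>i. (LBINT y. (norm (g i y - w y))\<^sup>2) / \<eta> < e / 2) sequentially"
  using e by (auto dest: order_tendstoD(2)[where a="e / 2"])
  then obtain N where N: "\<And>i. N \<le> i \<Longrightarrow> (LBINT y. (norm (g i y - w y))\<^sup>2) / \<eta> < e / 2" by (auto simp: eventually_sequentially)
  have "norm (mollify \<epsilon> (g i) x - mollify \<epsilon> w x) < e" if "N \<le> i" for i
  proof -
  have "mollify \<epsilon> (g i) x - mollify \<epsilon> w x = mollify \<epsilon> (\<lambda>y. g i y - w y) x"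
   unfolding mollify_def using mollify_integrable[OF \<epsilon> _ g[of i], of x] mollify_integrable[OF \<epsilon> _ w, of x]
   by (simp add: scaleR_diff_right)
  then have "norm (mollify \<epsilon> (g i) x - mollify \<epsilon> w x) \<le> \<eta> * A + (LBINT y. (norm (g i y - w y))\<^sup>2) / \<eta>"
   unfolding A_def using norm_mollify_le[OF \<epsilon> _ d[of i] \<eta>0, of x] by simp
  then show ?thesis using N[OF that] \<eta> by linarith
  qed
  then show "\<exists>N. \<forall>i\<ge>N. norm (mollify \<epsilon> (g i) x - mollify \<epsilon> w x) < e" by blast
qed

lemma mollify_conv:
  fixes u :: "'a::euclidean_space \<Rightarrow> real"
  assumes \<beta>: "1 \<le> \<beta>" and t: "0 < t" and \<epsilon>: "0 < \<epsilon>" and u: "integrable lborel u"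
  shows "mollify \<epsilon> (conv (kern \<beta> t) u) x = (LBINT z. u z *\<^sub>R mkern \<beta> \<epsilon> t (z - x))"
proof -
  have [measurable]: "u \<in> borel_measurable borel" using u by auto
  let ?f = "\<lambda>y z. mk \<epsilon> (y - x) *\<^sub>R (u z *\<^sub>R kern \<beta> t (z - y))"
  have i: "integrable (lborel \<Otimes>\<^sub>M lborel) (\<lambda>(y, z). ?f y z)"
  proof (rule integrableI_bounded)
  let ?b = "t powr (1 - \<beta>)"
  have "(\<integral>\<^sup>+p. ennreal (norm (case p of (y, z) \<Rightarrow> ?f y z)) \<partial>(lborel \<Otimes>\<^sub>M lborel))
   = (LNINT y. (LNINT z. ennreal (norm (?f y z))))"
   by (subst lborel.nn_integral_fst[symmetric]) (auto simp: split_beta')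
  also have "\<dots> \<le> (LNINT y. (LNINT z. ennreal (?b * \<bar>mk \<epsilon> (y - x)\<bar>) * ennreal \<bar>u z\<bar>))"
  proof (intro nn_integral_mono)
   fix y z
   have "norm (?f y z) = \<bar>mk \<epsilon> (y - x)\<bar> * \<bar>u z\<bar> * norm (kern \<beta> t (z - y))" by (simp only: norm_scaleR mult.assoc)
   also have "\<dots> \<le> \<bar>mk \<epsilon> (y - x)\<bar> * \<bar>u z\<bar> * ?b" by (intro mult_left_mono norm_kern_le_trunc \<beta> t) auto
   finally show "ennreal (norm (?f y z)) \<le> ennreal (?b * \<bar>mk \<epsilon> (y - x)\<bar>) * ennreal \<bar>u z\<bar>"
    by (simp add: ennreal_mult'[symmetric] ennreal_leI mult_ac)
  qed
  also have "\<dots> = (LNINT y. ennreal (?b * \<bar>mk \<epsilon> (y - x)\<bar>)) * (LNINT z. ennreal \<bar>u z\<bar>)"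
   by (simp add: nn_integral_cmult nn_integral_multc)
  also have "\<dots> < \<infinity>"
  proof -
   have "integrable lborel (\<lambda>y. ?b * \<bar>mk \<epsilon> (y - x)\<bar>)" by (intro integrable_mult_right integrable_abs mk_shift_integrable \<epsilon>)
   then have "(LNINT y. ennreal (?b * \<bar>mk \<epsilon> (y - x)\<bar>)) < \<infinity>"
    by (simp only: integrable_iff_bounded real_norm_def abs_mult abs_abs abs_of_nonneg[OF powr_ge_zero])
   then show ?thesis using u by (auto simp: integrable_iff_bounded ennreal_mult_less_top)
  qed
  finally show "(\<integral>\<^sup>+p. ennreal (norm (case p of (y, z) \<Rightarrow> ?f y z)) \<partial>(lborel \<Otimes>\<^sub>M lborel)) < \<infinity>" .
  qed simp
  have "mollify \<epsilon> (conv (kern \<beta> t) u) x = (LBINT y. LBINT z. ?f y z)"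
  unfolding mollify_def conv_def integral_scaleR_right ..
  also have "\<dots> = (LBINT z. LBINT y. ?f y z)"
  by (rule lborel_pair.Fubini_integral[symmetric, OF i])
  also have "\<dots> = (LBINT z. u z *\<^sub>R mkern \<beta> \<epsilon> t (z - x))"
  proof (rule Bochner_Integration.integral_cong)
  fix z
  have "(LBINT y. ?f y z) = (LBINT y. u z *\<^sub>R (mk \<epsilon> (y - x) *\<^sub>R kern \<beta> t ((z - x) - (y - x))))"
   by (simp add: mult.commute)
  also have "\<dots> = u z *\<^sub>R (LBINT y. mk \<epsilon> (y - x) *\<^sub>R kern \<beta> t ((z - x) - (y - x)))" by (rule integral_scaleR_right)
  also have "(LBINT y. mk \<epsilon> (y - x) *\<^sub>R kern \<beta> t ((z - x) - (y - x))) = mkern \<beta> \<epsilon> t (z - x)"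
   unfolding mkern_def using integral_shift[of "\<lambda>y. mk \<epsilon> y *\<^sub>R kern \<beta> t ((z - x) - y)" "- x"] by simp
  finally show "(LBINT y. ?f y z) = u z *\<^sub>R mkern \<beta> \<epsilon> t (z - x)" .
  qed simp
  finally show ?thesis .
qed

lemma psi_integrable:
  assumes \<beta>: "real DIM('a::euclidean_space) < \<beta>" and \<epsilon>: "0 < \<epsilon>"
  shows "integrable lborel (\<lambda>h::'a. \<epsilon> * max (norm h) \<epsilon> powr (- \<beta>))"
proof (intro integrable_mult_right, rule integrableI_bounded)
  have [measurable]: "ball (0::'a) \<epsilon> \<in> sets borel" by simp
  have "(LNINT h. ennreal (norm (max (norm (h::'a)) \<epsilon> powr (- \<beta>))))
  \<le> (LNINT h. ennreal (\<epsilon> powr (- \<beta>)) * indicator (ball (0::'a) \<epsilon>) h + ennreal (norm h powr (- \<beta>)) * indicator (- ball 0 \<epsilon>) h)"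
  by (intro nn_integral_mono) (auto simp: indicator_def max_def)
  also have "\<dots> = ennreal (\<epsilon> powr (- \<beta>)) * emeasure lborel (ball (0::'a) \<epsilon>) + (LNINT h. ennreal (norm (h::'a) powr (- \<beta>)) * indicator (- ball 0 \<epsilon>) h)"
  by (simp add: nn_integral_add nn_integral_cmult)
  also have "\<dots> < \<infinity>"
  using nn_integral_norm_powr_out[OF \<beta> \<epsilon>] by (auto simp: ennreal_mult_less_top emeasure_lborel_ball_finite[unfolded infinity_ennreal_def])
  finally show "(LNINT h. ennreal (norm (max (norm (h::'a)) \<epsilon> powr (- \<beta>)))) < \<infinity>" .
qed simp

text \<open>The difference of the two kernels is odd and integrable, hence of integral 0. So u y may
  be replaced by u y - u x, and the kernel by its majorant.\<close>

lemma conv_shk_mollify_diff: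
  assumes \<beta>: "1 \<le> \<beta>" "real DIM('a::euclidean_space) < \<beta>" "\<beta> < real DIM('a) + 2"
  obtains C where "0 < C"
  "\<And>\<epsilon> t r u x e. 0 < t \<Longrightarrow> t \<le> \<epsilon> \<Longrightarrow> L2c r u \<Longrightarrow> 0 \<le> e \<Longrightarrow>
   (LNINT y. ennreal (\<bar>u y - u x\<bar> * (\<epsilon> * max (norm (y - x)) \<epsilon> powr (- \<beta>)))) \<le> ennreal e \<Longrightarrow>
   norm (conv (shk \<beta> \<epsilon>) u (x::'a) - mollify \<epsilon> (conv (kern \<beta> t) u) x) \<le> C * e"
proof -
  obtain C where C: "0 < C"
  "\<And>\<epsilon> t h. 0 < t \<Longrightarrow> t \<le> \<epsilon> \<Longrightarrow> norm (shk \<beta> \<epsilon> h - mkern \<beta> \<epsilon> t (h::'a)) \<le> C * (\<epsilon> * max (norm h) \<epsilon> powr (- \<beta>))"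
  using shk_mkern_diff[OF \<beta>(1,3)] by metis
  show thesis
  proof (rule that[OF C(1)])
  fix \<epsilon> t r e :: real and u :: "'a \<Rightarrow> real" and x :: 'a
  assume t: "0 < t" "t \<le> \<epsilon>" and u: "L2c r u" and e: "0 \<le> e"
   and le: "(LNINT y. ennreal (\<bar>u y - u x\<bar> * (\<epsilon> * max (norm (y - x)) \<epsilon> powr (- \<beta>)))) \<le> ennreal e"
  have \<epsilon>: "0 < \<epsilon>" using t by simp
  have [measurable]: "u \<in> borel_measurable borel" by (rule L2c_measurable[OF u])
  let ?D = "\<lambda>h. shk \<beta> \<epsilon> h - mkern \<beta> \<epsilon> t (h::'a)"
  have iD: "integrable lborel ?D"
  proof (rule Bochner_Integration.integrable_bound)
   show "integrable lborel (\<lambda>h::'a. C * (\<epsilon> * max (norm h) \<epsilon> powr (- \<beta>)))"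
    by (intro integrable_mult_right psi_integrable \<beta> \<epsilon>)
   show "AE h in lborel. norm (?D h) \<le> norm (C * (\<epsilon> * max (norm h) \<epsilon> powr (- \<beta>)))"
    using C(2)[OF t] by (intro AE_I2) (auto intro: order_trans[OF _ abs_ge_self])
  qed simp
  have "integral\<^sup>L lborel ?D = 0" by (intro integral_odd) (auto simp: mkern_minus)
  then have D0: "(LBINT z. ?D (z - x)) = 0" "integrable lborel (\<lambda>z. ?D (z - x))"
   using integral_shift[of ?D "- x"] integrable_shift[OF iD, of "- x"] by simp_all
  have mk_b: "norm (mkern \<beta> \<epsilon> t h) \<le> t powr (1 - \<beta>)" for h :: 'a
  proof -
   have "norm (mkern \<beta> \<epsilon> t h) \<le> (LBINT y. norm (mk \<epsilon> y *\<^sub>R kern \<beta> t (h - y)))"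
    unfolding mkern_def by (rule integral_norm_bound)
   also have "\<dots> \<le> (LBINT y::'a. t powr (1 - \<beta>) * mk \<epsilon> y)"
   proof (rule integral_mono)
    show "integrable lborel (\<lambda>y. norm (mk \<epsilon> y *\<^sub>R kern \<beta> t (h - y)))"
     by (intro Bochner_Integration.integrable_norm mkern_integrable \<beta> t \<epsilon>)
    show "integrable lborel (\<lambda>y::'a. t powr (1 - \<beta>) * mk \<epsilon> y)" by (intro integrable_mult_right mk_integrable \<epsilon>)
    show "norm (mk \<epsilon> y *\<^sub>R kern \<beta> t (h - y)) \<le> t powr (1 - \<beta>) * mk \<epsilon> y" for y :: 'a
     using mult_left_mono[OF norm_kern_le_trunc[OF \<beta>(1) t(1), of "h - y"] mk_nonneg[OF \<epsilon>, of y]] mk_nonneg[OF \<epsilon>, of y]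
     by (simp add: mult.commute)
   qed
   also have "\<dots> = t powr (1 - \<beta>)" using mk_integral[OF \<epsilon>, where 'a='a] by simp
   finally show ?thesis .
  qed
  have i1: "integrable lborel (\<lambda>z. u z *\<^sub>R shk \<beta> \<epsilon> (z - x))"
   using norm_shk_le[OF \<beta>(1) \<epsilon>] by (intro integrable_conv[OF L2c_integrable[OF u]]) auto
  have i2: "integrable lborel (\<lambda>z. u z *\<^sub>R mkern \<beta> \<epsilon> t (z - x))"
   using mk_b by (intro integrable_conv[OF L2c_integrable[OF u]]) auto
  have i3: "integrable lborel (\<lambda>z. u z *\<^sub>R ?D (z - x))"
   using Bochner_Integration.integrable_diff[OF i1 i2] by (simp add: scaleR_diff_right)
  have i4: "integrable lborel (\<lambda>z. u x *\<^sub>R ?D (z - x))" by (intro integrable_scaleR_right D0)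
  have "conv (shk \<beta> \<epsilon>) u x - mollify \<epsilon> (conv (kern \<beta> t) u) x = (LBINT z. u z *\<^sub>R ?D (z - x))"
   unfolding mollify_conv[OF \<beta>(1) t(1) \<epsilon> L2c_integrable[OF u]] conv_def
   using Bochner_Integration.integral_diff[OF i1 i2] by (simp add: scaleR_diff_right)
  also have "\<dots> = (LBINT z. u z *\<^sub>R ?D (z - x) - u x *\<^sub>R ?D (z - x))"
   unfolding Bochner_Integration.integral_diff[OF i3 i4] integral_scaleR_right D0(1) by simp
  finally have eq: "conv (shk \<beta> \<epsilon>) u x - mollify \<epsilon> (conv (kern \<beta> t) u) x = (LBINT z. u z *\<^sub>R ?D (z - x) - u x *\<^sub>R ?D (z - x))" .
  show "norm (conv (shk \<beta> \<epsilon>) u x - mollify \<epsilon> (conv (kern \<beta> t) u) x) \<le> C * e"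
   unfolding eq
  proof (rule norm_integral_le_nn_integral)
   show "integrable lborel (\<lambda>z. u z *\<^sub>R ?D (z - x) - u x *\<^sub>R ?D (z - x))"
    by (intro Bochner_Integration.integrable_diff i3 i4)
   have "(LNINT z. ennreal (norm (u z *\<^sub>R ?D (z - x) - u x *\<^sub>R ?D (z - x))))
    \<le> (LNINT z. ennreal C * ennreal (\<bar>u z - u x\<bar> * (\<epsilon> * max (norm (z - x)) \<epsilon> powr (- \<beta>))))"
   proof (rule nn_integral_mono)
    fix z
    have "norm (u z *\<^sub>R ?D (z - x) - u x *\<^sub>R ?D (z - x)) = \<bar>u z - u x\<bar> * norm (?D (z - x))"
     unfolding scaleR_diff_left[symmetric] by simp
    also have "\<dots> \<le> \<bar>u z - u x\<bar> * (C * (\<epsilon> * max (norm (z - x)) \<epsilon> powr (- \<beta>)))"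
     by (intro mult_left_mono C(2) t) auto
    finally show "ennreal (norm (u z *\<^sub>R ?D (z - x) - u x *\<^sub>R ?D (z - x))) \<le> ennreal C * ennreal (\<bar>u z - u x\<bar> * (\<epsilon> * max (norm (z - x)) \<epsilon> powr (- \<beta>)))"
     using C(1) by (simp add: ennreal_mult'[symmetric] mult.left_commute ennreal_leI)
   qed
   also have "\<dots> = ennreal C * (LNINT z. ennreal (\<bar>u z - u x\<bar> * (\<epsilon> * max (norm (z - x)) \<epsilon> powr (- \<beta>))))"
    by (rule nn_integral_cmult) measurable
   also have "\<dots> \<le> ennreal C * ennreal e" by (intro mult_left_mono le) simp
   finally show "(LNINT z. ennreal (norm (u z *\<^sub>R ?D (z - x) - u x *\<^sub>R ?D (z - x)))) \<le> ennreal (C * e)"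
    using C(1) by (simp add: ennreal_mult')
  qed (use C e in simp)
  qed
qed

lemma mollify_lebesgue_point:
  fixes w :: "'a::euclidean_space \<Rightarrow> 'b::euclidean_space"
  assumes [measurable]: "w \<in> borel_measurable borel" and w: "integrable lborel (\<lambda>y. (norm (w y))\<^sup>2)"
  and x: "lebesgue_point (real DIM('a)) w x"
  shows "((\<lambda>\<epsilon>. mollify \<epsilon> w x) \<longlongrightarrow> w x) (at_right 0)"
proof (rule tendstoI)
  fix e :: real assume e: "0 < e"
  let ?I = "LBINT x::'a. bump x"
  have I: "0 < ?I" by (rule integral_bump_pos)
  define e' where "e' = e * ?I / 2"
  have e': "0 < e'" using e I by (simp add: e'_def)
  obtain d where d: "0 < d" "\<And>h. 0 < h \<Longrightarrow> h < d \<Longrightarrow>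
  (LNINT y. ennreal (norm (w y - w x)) * indicator (ball x h) y) \<le> ennreal (e' * h powr real DIM('a))"
  using x e' unfolding lebesgue_point_def by meson
  have "dist (mollify \<epsilon> w x) (w x) < e" if \<epsilon>: "0 < \<epsilon>" "\<epsilon> < d" for \<epsilon>
  proof -
  let ?c = "1 / (\<epsilon> ^ DIM('a) * ?I)"
  have c: "0 \<le> ?c" using \<epsilon> I by simp
  have [measurable]: "ball x \<epsilon> \<in> sets borel" by simp
  note i1 = mollify_integrable[OF \<epsilon>(1) assms(1) w, of x]
  have i2: "integrable lborel (\<lambda>y. mk \<epsilon> (y - x) *\<^sub>R w x)" by (intro integrable_scaleR_left mk_shift_integrable \<epsilon>)
  have "(LBINT y. mk \<epsilon> (y - x) *\<^sub>R w x) = w x"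
   using mk_shift_integrable[OF \<epsilon>(1), of x] by simp
  then have eq: "mollify \<epsilon> w x - w x = (LBINT y. mk \<epsilon> (y - x) *\<^sub>R w y - mk \<epsilon> (y - x) *\<^sub>R w x)"
   unfolding mollify_def Bochner_Integration.integral_diff[OF i1 i2] by simp
  have "norm (mollify \<epsilon> w x - w x) \<le> e / 2"
   unfolding eq
  proof (rule norm_integral_le_nn_integral)
   show "integrable lborel (\<lambda>y. mk \<epsilon> (y - x) *\<^sub>R w y - mk \<epsilon> (y - x) *\<^sub>R w x)"
    by (intro Bochner_Integration.integrable_diff i1 i2)
   have "(LNINT y. ennreal (norm (mk \<epsilon> (y - x) *\<^sub>R w y - mk \<epsilon> (y - x) *\<^sub>R w x)))
    \<le> (LNINT y. ennreal ?c * (ennreal (norm (w y - w x)) * indicator (ball x \<epsilon>) y))"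
   proof (rule nn_integral_mono)
    fix y
    show "ennreal (norm (mk \<epsilon> (y - x) *\<^sub>R w y - mk \<epsilon> (y - x) *\<^sub>R w x)) \<le> ennreal ?c * (ennreal (norm (w y - w x)) * indicator (ball x \<epsilon>) y)"
    proof (cases "y \<in> ball x \<epsilon>")
     case True
     have "norm (mk \<epsilon> (y - x) *\<^sub>R w y - mk \<epsilon> (y - x) *\<^sub>R w x) = mk \<epsilon> (y - x) * norm (w y - w x)"
      unfolding scaleR_diff_right[symmetric] norm_scaleR using mk_nonneg[OF \<epsilon>(1), of "y - x"] by simp
     also have "\<dots> \<le> ?c * norm (w y - w x)" by (intro mult_right_mono mk_le \<epsilon>) auto
     finally show ?thesis using True c by (simp add: ennreal_mult'[symmetric] ennreal_leI)
    next
     case False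
     then have "mk \<epsilon> (y - x) = 0" using \<epsilon> by (intro mk_eq_0) (auto simp: dist_norm norm_minus_commute)
     then show ?thesis by simp
    qed
   qed
   also have "\<dots> = ennreal ?c * (LNINT y. ennreal (norm (w y - w x)) * indicator (ball x \<epsilon>) y)"
    by (rule nn_integral_cmult) measurable
   also have "\<dots> \<le> ennreal ?c * ennreal (e' * \<epsilon> powr real DIM('a))" by (intro mult_left_mono d(2) \<epsilon>) simp
   also have "\<dots> = ennreal (?c * (e' * \<epsilon> powr real DIM('a)))" using c by (rule ennreal_mult'[symmetric])
   also have "?c * (e' * \<epsilon> powr real DIM('a)) = e / 2"
    using \<epsilon> I by (simp add: e'_def powr_realpow)
   finally show "(LNINT y. ennreal (norm (mk \<epsilon> (y - x) *\<^sub>R w y - mk \<epsilon> (y - x) *\<^sub>R w x))) \<le> ennreal (e / 2)" .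
  qed (use e in simp)
  then show ?thesis using e by (simp add: dist_norm)
  qed
  then show "eventually (\<lambda>\<epsilon>. dist (mollify \<epsilon> w x) (w x) < e) (at_right 0)"
  using d(1) by (intro eventually_at_rightI[of 0 d]) auto
qed

lemma AE_lebesgue_point_L2:
  fixes w :: "'a::euclidean_space \<Rightarrow> 'b::euclidean_space"
  assumes [measurable]: "w \<in> borel_measurable borel" and w: "integrable lborel (\<lambda>y. (norm (w y))\<^sup>2)"
  shows "AE x in lborel. lebesgue_point (real DIM('a)) w x"
proof (rule AE_lebesgue_point)
  fix r
  have [measurable]: "ball (0::'a) r \<in> sets borel" by simp
  have "(LNINT y. ennreal (norm (w y)) * indicator (ball 0 r) y) \<le> (LNINT y. ennreal ((norm (w y))\<^sup>2) + indicator (ball 0 r) y)"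
  proof (rule nn_integral_mono)
  fix y :: 'a
  have "norm (w y) \<le> (norm (w y))\<^sup>2 + 1"
  proof -
   have "0 \<le> (norm (w y) - 1 / 2)\<^sup>2" by simp
   also have "\<dots> = (norm (w y))\<^sup>2 - norm (w y) + 1 / 4" by (simp add: power2_diff power2_eq_square[of "1 / 2"])
   finally show ?thesis by linarith
  qed
  then have "ennreal (norm (w y)) \<le> ennreal ((norm (w y))\<^sup>2) + 1"
   by (metis ennreal_1 ennreal_leI ennreal_plus zero_le_one zero_le_power2)
  then show "ennreal (norm (w y)) * indicator (ball 0 r) y \<le> ennreal ((norm (w y))\<^sup>2) + indicator (ball 0 r) y"
   by (simp add: indicator_def)
  qed
  also have "\<dots> = (LNINT y. ennreal ((norm (w y))\<^sup>2)) + emeasure lborel (ball (0::'a) r)"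
  by (simp add: nn_integral_add)
  also have "\<dots> < \<infinity>"
  using w by (auto simp: integrable_iff_bounded emeasure_lborel_ball_finite[unfolded infinity_ennreal_def])
  finally show "(LNINT y. ennreal (norm (w y)) * indicator (ball 0 r) y) < \<infinity>" .
qed simp

text \<open>For fixed \<epsilon> the truncation is removed first: the mollified truncated gradients
  tend to the mollified limit w, and the comparison with the sharp cut-off holds uniformly along the
  way. Afterwards \<epsilon> tends to 0 at points that are Lebesgue points of both u and w. In this
  order the full limit in \<epsilon> is obtained, while L^2 convergence alone would give
  subsequences.\<close>

lemma AE_conv_shk_tendsto:
  fixes u :: "'a::euclidean_space \<Rightarrow> real"
  assumes \<beta>: "real DIM('a) / 2 + 1 < \<beta>" "real DIM('a) < \<beta>" "\<beta> < real DIM('a) + 2" and u: "L2c r u"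
  and L: "AE x in lborel. lebesgue_point (\<beta> - 1) u x"
  and w[measurable]: "w \<in> borel_measurable borel" and w2: "integrable lborel (\<lambda>x. (norm (w x))\<^sup>2)"
  and d: "\<And>i. integrable lborel (\<lambda>x. (norm (conv (kern \<beta> (trunc_seq i)) u x - w x))\<^sup>2)"
  and lim: "(\<lambda>i. LBINT x. (norm (conv (kern \<beta> (trunc_seq i)) u x - w x))\<^sup>2) \<longlonglongrightarrow> 0"
  shows "AE x in lborel. ((\<lambda>\<epsilon>. conv (shk \<beta> \<epsilon>) u x) \<longlongrightarrow> w x) (at_right 0)"
proof -
  have \<beta>1: "1 \<le> \<beta>" using dim_half_less[OF \<beta>(1)] by simp
  have [measurable]: "u \<in> borel_measurable borel" by (rule L2c_measurable[OF u])
  obtain C where C: "0 < C"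
  "\<And>\<epsilon> t r u x e. 0 < t \<Longrightarrow> t \<le> \<epsilon> \<Longrightarrow> L2c r u \<Longrightarrow> 0 \<le> e \<Longrightarrow>
   (LNINT y. ennreal (\<bar>u y - u x\<bar> * (\<epsilon> * max (norm (y - x)) \<epsilon> powr (- \<beta>)))) \<le> ennreal e \<Longrightarrow>
   norm (conv (shk \<beta> \<epsilon>) u (x::'a) - mollify \<epsilon> (conv (kern \<beta> t) u) x) \<le> C * e"
  using conv_shk_mollify_diff[OF \<beta>1 \<beta>(2,3)] by blast
  have tseq: "trunc_seq \<longlonglongrightarrow> 0" using LIMSEQ_inverse_real_of_nat unfolding trunc_seq_def[abs_def] .
  show ?thesis
  using L AE_lebesgue_point_L2[OF w w2]
  proof eventually_elim
  case (elim x)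
  have "((\<lambda>\<epsilon>. conv (shk \<beta> \<epsilon>) u x - mollify \<epsilon> w x) \<longlongrightarrow> 0) (at_right 0)"
  proof (rule tendstoI)
   fix e :: real assume e: "0 < e"
   define e' where "e' = e / (2 * C)"
   have e': "0 < e'" using e C(1) by (simp add: e'_def)
   obtain d' where d': "0 < d'" "\<And>\<epsilon>. 0 < \<epsilon> \<Longrightarrow> \<epsilon> < d' \<Longrightarrow>
    (LNINT y. ennreal (\<bar>u y - u x\<bar> * (\<epsilon> * max (norm (y - x)) \<epsilon> powr (- \<beta>)))) \<le> ennreal e'"
    by (rule lebesgue_point_average[OF \<beta>(2) u elim(1) e'], rule that)
   have "dist (conv (shk \<beta> \<epsilon>) u x - mollify \<epsilon> w x) 0 < e" if \<epsilon>: "0 < \<epsilon>" "\<epsilon> < d'" for \<epsilon>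
   proof -
    have "norm (conv (shk \<beta> \<epsilon>) u x - mollify \<epsilon> w x) \<le> C * e'"
    proof (rule LIMSEQ_le_const2)
     show "(\<lambda>i. norm (conv (shk \<beta> \<epsilon>) u x - mollify \<epsilon> (conv (kern \<beta> (trunc_seq i)) u) x)) \<longlonglongrightarrow> norm (conv (shk \<beta> \<epsilon>) u x - mollify \<epsilon> w x)"
      using conv_kern_square_integrable(1)[OF \<beta>(1) trunc_seq_pos u]
      by (intro tendsto_intros tendsto_mollify \<epsilon> d lim w2) auto
     obtain N where "\<And>i. N \<le> i \<Longrightarrow> trunc_seq i < \<epsilon>"
      using order_tendstoD(2)[OF tseq \<epsilon>(1)] by (auto simp: eventually_sequentially)
     then show "\<exists>N. \<forall>i\<ge>N. norm (conv (shk \<beta> \<epsilon>) u x - mollify \<epsilon> (conv (kern \<beta> (trunc_seq i)) u) x) \<le> C * e'"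
      using C(2)[OF trunc_seq_pos _ u less_imp_le[OF e'] d'(2)[OF \<epsilon>]] less_imp_le by blast
    qed
    also have "\<dots> < e" using C(1) e by (simp add: e'_def)
    finally show ?thesis by simp
   qed
   then show "eventually (\<lambda>\<epsilon>. dist (conv (shk \<beta> \<epsilon>) u x - mollify \<epsilon> w x) 0 < e) (at_right 0)"
    using d'(1) by (intro eventually_at_rightI[of 0 d']) auto
  qed
  from tendsto_add[OF this mollify_lebesgue_point[OF w w2 elim(2)]]
  show ?case by simp
  qed
qed

section \<open>Existence of minimisers\<close>

text \<open>One operation for sums, differences and multiples, so that closure of a set of functions
  and linearity of a functional are a single condition each.\<close>

definition lincomb :: "('b \<Rightarrow> real) \<Rightarrow> real \<Rightarrow> ('b \<Rightarrow> real) \<Rightarrow> 'b \<Rightarrow> real" where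
  "lincomb u c v x = u x + c * v x"

lemma discriminant_le:
  fixes a b c :: real
  assumes q: "\<And>s. 0 \<le> a + 2 * s * b + s\<^sup>2 * c" and "0 \<le> c"
  shows "b\<^sup>2 \<le> a * c"
proof (cases "c = 0")
  case True
  have "b = 0"
  proof (rule ccontr)
  assume b: "b \<noteq> 0"
  \<comment> \<open>With c = 0 the expression is linear in s, and this value of s makes it
    -1.\<close>
  then have "2 * (- (a + 1) / (2 * b)) * b = - (a + 1)" by simp
  with q[of "- (a + 1) / (2 * b)"] True show False by simp
  qed
  then show ?thesis using True by simp
next
  case False
  then have c: "0 < c" using \<open>0 \<le> c\<close> by simp
  have "0 \<le> c * (a + 2 * (- b / c) * b + (- b / c)\<^sup>2 * c)" using q[of "- b / c"] c by simp
  also have "\<dots> = a * c - b\<^sup>2" using c by (simp add: field_simps power2_eq_square)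
  finally show ?thesis by simp
qed

text \<open>By the parallelogram identity, a minimising sequence of \<open>B v v - 2 f v\<close> is Cauchy.\<close>

lemma riesz_representation:
  fixes V :: "('b \<Rightarrow> real) set" and B :: "('b \<Rightarrow> real) \<Rightarrow> ('b \<Rightarrow> real) \<Rightarrow> real" and f :: "('b \<Rightarrow> real) \<Rightarrow> real"
  assumes V0: "V \<noteq> {}" and lin: "\<And>u v c. u \<in> V \<Longrightarrow> v \<in> V \<Longrightarrow> lincomb u c v \<in> V"
  and sym: "\<And>u v. u \<in> V \<Longrightarrow> v \<in> V \<Longrightarrow> B u v = B v u"
  and Blin: "\<And>u v w c. u \<in> V \<Longrightarrow> v \<in> V \<Longrightarrow> w \<in> V \<Longrightarrow> B (lincomb u c v) w = B u w + c * B v w"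
  and nonneg: "\<And>v. v \<in> V \<Longrightarrow> 0 \<le> B v v"
  and flin: "\<And>u v c. u \<in> V \<Longrightarrow> v \<in> V \<Longrightarrow> f (lincomb u c v) = f u + c * f v"
  and fb: "\<And>v. v \<in> V \<Longrightarrow> \<bar>f v\<bar> \<le> K * sqrt (B v v)"
  and complete: "\<And>g. (\<And>i::nat. g i \<in> V) \<Longrightarrow>
   (\<And>e. 0 < e \<Longrightarrow> \<exists>N. \<forall>i\<ge>N. \<forall>j\<ge>N. B (lincomb (g i) (- 1) (g j)) (lincomb (g i) (- 1) (g j)) \<le> e) \<Longrightarrow>
   \<exists>u\<in>V. (\<lambda>i. B (lincomb (g i) (- 1) u) (lincomb (g i) (- 1) u)) \<longlonglongrightarrow> 0"
  obtains u where "u \<in> V" "\<And>v. v \<in> V \<Longrightarrow> B u v = f v"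
proof -
  define J where "J v = B v v - 2 * f v" for v
  have Bq: "B (lincomb u c v) (lincomb u c v) = B u u + 2 * c * B u v + c\<^sup>2 * B v v" if "u \<in> V" "v \<in> V" for u v c
  proof -
  note l = lin[OF that, of c]
  have "B (lincomb u c v) (lincomb u c v) = B u (lincomb u c v) + c * B v (lincomb u c v)"
   by (rule Blin[OF that l])
  also have "B u (lincomb u c v) = B u u + c * B v u" unfolding sym[OF that(1) l] by (rule Blin[OF that that(1)])
  also have "B v (lincomb u c v) = B u v + c * B v v" unfolding sym[OF that(2) l] by (rule Blin[OF that that(2)])
  finally show ?thesis unfolding sym[OF that(2,1)] by (simp add: algebra_simps power2_eq_square)
  qed
  have CS: "(B u v)\<^sup>2 \<le> B u u * B v v" if "u \<in> V" "v \<in> V" for u v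
  proof (rule discriminant_le)
  show "0 \<le> B u u + 2 * s * B u v + s\<^sup>2 * B v v" for s
   using nonneg[OF lin[OF that, of s]] Bq[OF that, of s] by simp
  qed (use nonneg that in auto)
  have Jq: "J (lincomb u c v) = J u + 2 * c * (B u v - f v) + c\<^sup>2 * B v v" if "u \<in> V" "v \<in> V" for u v c
  unfolding J_def Bq[OF that] flin[OF that] by (simp add: algebra_simps)
  have lb: "- K\<^sup>2 \<le> J v" if "v \<in> V" for v
  proof -
  have "0 \<le> (sqrt (B v v) - K)\<^sup>2" by simp
  also have "\<dots> = B v v - 2 * (K * sqrt (B v v)) + K\<^sup>2" using nonneg[OF that] by (simp add: power2_diff)
  finally show ?thesis using fb[OF that] unfolding J_def by linarith
  qed
  define m where "m = Inf (J ` V)"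
  have bdd: "bdd_below (J ` V)" by (rule bdd_belowI2[OF lb])
  have mJ: "m \<le> J v" if "v \<in> V" for v unfolding m_def using that by (intro cInf_lower bdd) auto
  have "\<exists>v\<in>V. J v < m + inverse (real (Suc i))" for i
  proof -
  have "Inf (J ` V) < m + inverse (real (Suc i))" unfolding m_def by simp
  from cInf_lessD[OF _ this] V0 show ?thesis by blast
  qed
  then have "\<exists>g. \<forall>i. g i \<in> V \<and> J (g i) < m + inverse (real (Suc i))" by (intro choice) blast
  then obtain g where g: "\<And>i. g i \<in> V" "\<And>i. J (g i) < m + inverse (real (Suc i))" by blast
  have "\<exists>u\<in>V. (\<lambda>i. B (lincomb (g i) (- 1) u) (lincomb (g i) (- 1) u)) \<longlonglongrightarrow> 0"
  proof (rule complete[OF g(1)])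
  fix e :: real assume e: "0 < e"
  obtain N where N: "inverse (real (Suc N)) < e / 4" using reals_Archimedean[of "e / 4"] e by auto
  have "B (lincomb (g i) (- 1) (g j)) (lincomb (g i) (- 1) (g j)) \<le> e" if "N \<le> i" "N \<le> j" for i j
  proof -
   let ?d = "lincomb (g i) (- 1) (g j)"
   have d: "?d \<in> V" by (rule lin[OF g(1) g(1)])
   have "B (g i) ?d = B (g i) (g i) - B (g i) (g j)"
    unfolding sym[OF g(1) d] Blin[OF g(1) g(1) g(1)] sym[OF g(1)[of j] g(1)[of i]] by simp
   moreover have "f ?d = f (g i) - f (g j)" using flin[OF g(1) g(1), of i "- 1" j] by simp
   moreover have Bd: "B ?d ?d = B (g i) (g i) - 2 * B (g i) (g j) + B (g j) (g j)" using Bq[OF g(1) g(1), of i "- 1" j] by simp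
   \<comment> \<open>g i minus half of the difference is the midpoint of g i and g j, where J is
     still at least its infimum m.\<close>
   moreover have "m \<le> J (g i) + 2 * (- 1 / 2) * (B (g i) ?d - f ?d) + (- 1 / 2)\<^sup>2 * B ?d ?d"
    using mJ[OF lin[OF g(1) d], of i "- 1 / 2"] Jq[OF g(1) d, of i "- 1 / 2"] by simp
   ultimately have "m \<le> J (g i) - B (g i) (g i) + B (g i) (g j) + f (g i) - f (g j) + B ?d ?d / 4"
    by (simp add: power2_eq_square)
   then have le: "B ?d ?d \<le> 2 * (J (g i) - m) + 2 * (J (g j) - m)"
    unfolding Bd J_def by (simp add: field_simps)
   have *: "J (g k) - m < e / 4" if "N \<le> k" for k
   proof -
    have "inverse (real (Suc k)) \<le> inverse (real (Suc N))" using that by (simp add: le_imp_inverse_le)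
    from order_le_less_trans[OF this N] have "m + inverse (real (Suc k)) < m + e / 4" by simp
    from less_trans[OF g(2) this] show ?thesis by simp
   qed
   from *[OF that(1)] *[OF that(2)] have "2 * (J (g i) - m) + 2 * (J (g j) - m) \<le> e" by simp
   with le show ?thesis by (rule order_trans)
  qed
  then show "\<exists>N. \<forall>i\<ge>N. \<forall>j\<ge>N. B (lincomb (g i) (- 1) (g j)) (lincomb (g i) (- 1) (g j)) \<le> e" by blast
  qed
  then obtain u where u: "u \<in> V" "(\<lambda>i. B (lincomb (g i) (- 1) u) (lincomb (g i) (- 1) u)) \<longlonglongrightarrow> 0" by blast
  show thesis
  proof (rule that[OF u(1)])
  fix v assume v: "v \<in> V"
  have gv: "(\<lambda>i. B (g i) v) \<longlonglongrightarrow> B u v"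
  proof -
   have "(\<lambda>i. B (g i) v - B u v) \<longlonglongrightarrow> 0"
   proof (rule Lim_null_comparison)
    show "eventually (\<lambda>i. norm (B (g i) v - B u v) \<le> sqrt (B (lincomb (g i) (- 1) u) (lincomb (g i) (- 1) u) * B v v)) sequentially"
    proof (intro always_eventually allI)
     fix i
     have "B (g i) v - B u v = B (lincomb (g i) (- 1) u) v" using Blin[OF g(1) u(1) v, of i "- 1"] by simp
     then show "norm (B (g i) v - B u v) \<le> sqrt (B (lincomb (g i) (- 1) u) (lincomb (g i) (- 1) u) * B v v)"
      using CS[OF lin[OF g(1) u(1)] v, of i "- 1"] by (simp add: real_le_rsqrt)
    qed
    have "(\<lambda>i. sqrt (B (lincomb (g i) (- 1) u) (lincomb (g i) (- 1) u) * B v v)) \<longlonglongrightarrow> sqrt (0 * B v v)"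
     by (intro tendsto_intros u(2))
    then show "(\<lambda>i. sqrt (B (lincomb (g i) (- 1) u) (lincomb (g i) (- 1) u) * B v v)) \<longlonglongrightarrow> 0" by simp
   qed
   then show ?thesis by (simp add: LIM_zero_iff)
  qed
  \<comment> \<open>The Euler equation: in the limit the quadratic polynomial J (u + t v) - m in t
    is nonnegative and has constant term 0, which forces its linear coefficient to vanish.\<close>
  have "(B u v - f v)\<^sup>2 \<le> 0 * B v v"
  proof (rule discriminant_le)
   fix t :: real
   have "(\<lambda>i. inverse (real (Suc i)) + 2 * t * (B (g i) v - f v) + t\<^sup>2 * B v v) \<longlonglongrightarrow> 0 + 2 * t * (B u v - f v) + t\<^sup>2 * B v v"
    by (intro tendsto_intros LIMSEQ_inverse_real_of_nat gv)
   moreover have "0 \<le> inverse (real (Suc i)) + 2 * t * (B (g i) v - f v) + t\<^sup>2 * B v v" for i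
    using mJ[OF lin[OF g(1) v], of i t] Jq[OF g(1) v, of i t] g(2)[of i] by linarith
   ultimately show "0 \<le> 0 + 2 * t * (B u v - f v) + t\<^sup>2 * B v v"
    by (intro LIMSEQ_le_const[where a=0 and X="\<lambda>i. inverse (real (Suc i)) + 2 * t * (B (g i) v - f v) + t\<^sup>2 * B v v"]) auto
  qed (rule nonneg[OF v])
  then show "B u v = f v" by simp
  qed
qed

section \<open>Coercivity, lower semicontinuity and completeness for the energy\<close>

lemma lincomb_measurable [measurable (raw)]:
  "u \<in> borel_measurable M \<Longrightarrow> v \<in> borel_measurable M \<Longrightarrow> lincomb u c v \<in> borel_measurable M"
  unfolding lincomb_def[abs_def] by simp

lemma square_lincomb_le: "(a + c * b)\<^sup>2 \<le> 2 * a\<^sup>2 + 2 * c\<^sup>2 * (b::real)\<^sup>2"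
proof -
  have "0 \<le> (a - c * b)\<^sup>2" by simp
  then show ?thesis by (simp add: power2_eq_square algebra_simps)
qed

lemma L2c_lincomb:
  fixes u v :: "'a::euclidean_space \<Rightarrow> real"
  assumes u: "L2c r u" and v: "L2c r v"
  shows "L2c r (lincomb u c v)"
proof -
  have [measurable]: "u \<in> borel_measurable borel" "v \<in> borel_measurable borel"
  using assms by (simp_all add: L2c_measurable)
  have "integrable lborel (\<lambda>x. (lincomb u c v x)\<^sup>2)"
  proof (rule Bochner_Integration.integrable_bound)
  show "integrable lborel (\<lambda>x. 2 * (u x)\<^sup>2 + 2 * c\<^sup>2 * (v x)\<^sup>2)" using assms by (simp add: L2c_def)
  show "AE x in lborel. norm ((lincomb u c v x)\<^sup>2) \<le> norm (2 * (u x)\<^sup>2 + 2 * c\<^sup>2 * (v x)\<^sup>2)"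
   unfolding real_norm_def abs_power2 lincomb_def by (intro AE_I2 order_trans[OF square_lincomb_le abs_ge_self])
  qed simp
  then show ?thesis using assms by (simp add: L2c_def) (simp add: lincomb_def)
qed

lemma msd_lincomb_le:
  fixes u v :: "'a::euclidean_space \<Rightarrow> real"
  assumes u: "L2c r u" and v: "L2c r v"
  shows "msd (lincomb u c v) z \<le> 2 * msd u z + 2 * c\<^sup>2 * msd v z"
proof -
  have "msd (lincomb u c v) z \<le> (LBINT y. 2 * (u (y + z) - u y)\<^sup>2 + 2 * c\<^sup>2 * (v (y + z) - v y)\<^sup>2)"
  unfolding msd_def
  proof (rule integral_mono)
  show "integrable lborel (\<lambda>y. (lincomb u c v (y + z) - lincomb u c v y)\<^sup>2)"
   by (rule msd_integrable[OF L2c_lincomb[OF u v]])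
  show "integrable lborel (\<lambda>y. 2 * (u (y + z) - u y)\<^sup>2 + 2 * c\<^sup>2 * (v (y + z) - v y)\<^sup>2)"
   using msd_integrable[OF u, of z] msd_integrable[OF v, of z] by simp
  show "(lincomb u c v (y + z) - lincomb u c v y)\<^sup>2 \<le> 2 * (u (y + z) - u y)\<^sup>2 + 2 * c\<^sup>2 * (v (y + z) - v y)\<^sup>2" for y
   using square_lincomb_le[of "u (y + z) - u y" c "v (y + z) - v y"] by (simp add: lincomb_def algebra_simps)
  qed
  also have "\<dots> = 2 * msd u z + 2 * c\<^sup>2 * msd v z"
  unfolding msd_def using msd_integrable[OF u, of z] msd_integrable[OF v, of z] by simp
  finally show ?thesis .
qed

definition msd_energy :: "real \<Rightarrow> ('a::euclidean_space \<Rightarrow> real) \<Rightarrow> ennreal" where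
  "msd_energy p u = (LNINT z. ennreal (norm z powr p * msd u z))"

lemma msd_energy_lincomb_le:
  fixes u v :: "'a::euclidean_space \<Rightarrow> real"
  assumes u: "L2c r u" and v: "L2c r v"
  shows "msd_energy p (lincomb u c v) \<le> 2 * msd_energy p u + ennreal (2 * c\<^sup>2) * msd_energy p v"
proof -
  have [measurable]: "u \<in> borel_measurable borel" "v \<in> borel_measurable borel"
  using assms by (simp_all add: L2c_measurable)
  have "msd_energy p (lincomb u c v) \<le> (LNINT z. 2 * ennreal (norm z powr p * msd u z) + ennreal (2 * c\<^sup>2) * ennreal (norm z powr p * msd v z))"
  unfolding msd_energy_def
  proof (rule nn_integral_mono)
  fix z :: 'a
  have n: "0 \<le> norm z powr p * msd u z" "0 \<le> norm z powr p * msd v z" "0 \<le> 2 * c\<^sup>2" by (simp_all add: msd_nonneg)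
  have "norm z powr p * msd (lincomb u c v) z \<le> 2 * (norm z powr p * msd u z) + 2 * c\<^sup>2 * (norm z powr p * msd v z)"
   using mult_left_mono[OF msd_lincomb_le[OF u v, of c z], of "norm z powr p"] by (simp add: algebra_simps)
  then have "ennreal (norm z powr p * msd (lincomb u c v) z) \<le> ennreal (2 * (norm z powr p * msd u z) + 2 * c\<^sup>2 * (norm z powr p * msd v z))"
   by (rule ennreal_leI)
  also have "\<dots> = ennreal 2 * ennreal (norm z powr p * msd u z) + ennreal (2 * c\<^sup>2) * ennreal (norm z powr p * msd v z)"
   using n by (simp only: ennreal_plus mult_nonneg_nonneg zero_le_numeral ennreal_mult)
  finally show "ennreal (norm z powr p * msd (lincomb u c v) z) \<le> 2 * ennreal (norm z powr p * msd u z) + ennreal (2 * c\<^sup>2) * ennreal (norm z powr p * msd v z)"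
   by simp
  qed
  also have "\<dots> = 2 * msd_energy p u + ennreal (2 * c\<^sup>2) * msd_energy p v"
  unfolding msd_energy_def by (simp add: nn_integral_add nn_integral_cmult)
  finally show ?thesis .
qed

lemma msd_far:
  assumes "L2c r u" "2 * r \<le> norm z"
  shows "msd u z = 2 * (LBINT y. (u y)\<^sup>2)"
  using msd_eq[OF assms(1)] autocorr_eq_0[OF assms] by simp

text \<open>For |z| \<ge> 2r the supports of u and its translate are disjoint and \<open>msd\<close>
  equals twice the squared norm of u. So a kernel of infinite mass at infinity forces u to vanish,
  and one of finite mass still controls the norm of u.\<close>

lemma nn_integral_msd_ge:
  fixes u :: "'a::euclidean_space \<Rightarrow> real"
  assumes u: "L2c r u" and [measurable]: "k \<in> borel_measurable borel"
  shows "ennreal (2 * (LBINT y. (u y)\<^sup>2)) * (LNINT z. k z * indicator (- ball (0::'a) (2 * r)) z) \<le> (LNINT z. k z * ennreal (msd u z))"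
proof -
  have [measurable]: "ball (0::'a) (2 * r) \<in> sets borel" by simp
  have "ennreal (2 * (LBINT y. (u y)\<^sup>2)) * (LNINT z. k z * indicator (- ball (0::'a) (2 * r)) z)
  = (LNINT z. ennreal (2 * (LBINT y. (u y)\<^sup>2)) * (k z * indicator (- ball (0::'a) (2 * r)) z))"
  by (rule nn_integral_cmult[symmetric]) measurable
  also have "\<dots> \<le> (LNINT z. k z * ennreal (msd u z))"
  proof (rule nn_integral_mono)
  fix z :: 'a
  show "ennreal (2 * (LBINT y. (u y)\<^sup>2)) * (k z * indicator (- ball (0::'a) (2 * r)) z) \<le> k z * ennreal (msd u z)"
   using msd_far[OF u, of z] by (cases "2 * r \<le> norm z") (auto simp: mult.commute)
  qed
  finally show ?thesis .
qed

text \<open>A Poincare inequality: m is twice the mass of |z|^p outside the ball of radius 2r,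
  finite because p < -n.\<close>

lemma msd_energy_ge:
  assumes p: "p < - real DIM('a::euclidean_space)" and r: "0 < r"
  obtains m where "0 < m" "\<And>u :: 'a \<Rightarrow> real. L2c r u \<Longrightarrow> ennreal (m * (LBINT y. (u y)\<^sup>2)) \<le> msd_energy p u"
proof
  let ?n = "real DIM('a)"
  let ?W = "sphere_area TYPE('a) / (- p - ?n) * (2 * r) powr (?n - (- p))"
  show "0 < 2 * ?W" using p r sphere_area_pos[where 'a='a] by simp
  fix u :: "'a \<Rightarrow> real" assume u: "L2c r u"
  have "(LNINT z. ennreal (norm z powr - (- p)) * indicator (- ball (0::'a) (2 * r)) z) = ennreal ?W"
  using p r by (intro nn_integral_norm_powr_out) auto
  with nn_integral_msd_ge[OF u, of "\<lambda>z. ennreal (norm z powr p)"]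
  have "ennreal (2 * (LBINT y. (u y)\<^sup>2)) * ennreal ?W \<le> msd_energy p u"
  by (simp add: msd_energy_def ennreal_mult' del: ennreal_mult_less_top)
  then show "ennreal (2 * ?W * (LBINT y. (u y)\<^sup>2)) \<le> msd_energy p u"
  by (subst (asm) ennreal_mult[symmetric]) (use p sphere_area_pos[where 'a='a] in \<open>auto simp: mult_ac\<close>)
qed

lemma msd_tendsto:
  fixes u :: "'a::euclidean_space \<Rightarrow> real"
  assumes u: "L2c r u" and g: "\<And>i. L2c r (g i)" and lim: "(\<lambda>i. LBINT x. (lincomb (g i) (- 1) u x)\<^sup>2) \<longlonglongrightarrow> 0"
  shows "(\<lambda>i. msd (g i) z) \<longlonglongrightarrow> msd u z"
proof -
  have [measurable]: "u \<in> borel_measurable borel" "\<And>i. g i \<in> borel_measurable borel"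
  by (rule L2c_measurable[OF u], rule L2c_measurable[OF g])
  have eq: "(LBINT y. (norm ((g i (y + z) - g i y) - (u (y + z) - u y)))\<^sup>2) = msd (lincomb (g i) (- 1) u) z" for i
  unfolding msd_def lincomb_def by (rule Bochner_Integration.integral_cong) (auto simp: algebra_simps)
  have "(\<lambda>i. LBINT y. (norm (g i (y + z) - g i y))\<^sup>2) \<longlonglongrightarrow> (LBINT y. (norm (u (y + z) - u y))\<^sup>2)"
  proof (rule tendsto_integral_norm_square)
  show "(\<lambda>i. LBINT y. (norm ((g i (y + z) - g i y) - (u (y + z) - u y)))\<^sup>2) \<longlonglongrightarrow> 0"
   unfolding eq
  proof (rule tendsto_sandwich[OF _ _ tendsto_const])
   show "(\<lambda>i. 4 * (LBINT x. (lincomb (g i) (- 1) u x)\<^sup>2)) \<longlonglongrightarrow> 0" using tendsto_mult_left[OF lim, of 4] by simp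
  qed (auto intro!: always_eventually msd_nonneg msd_le[OF L2c_lincomb[OF g u]])
  qed (use msd_integrable[OF u] msd_integrable[OF g] in simp_all)
  then show ?thesis by (simp add: msd_def)
qed

lemma msd_energy_lower_semicontinuous:
  fixes u :: "'a::euclidean_space \<Rightarrow> real"
  assumes u: "L2c r u" and g: "\<And>i. L2c r (g i)" and lim: "(\<lambda>i. LBINT x. (lincomb (g i) (- 1) u x)\<^sup>2) \<longlonglongrightarrow> 0"
  and le: "\<And>i. N \<le> i \<Longrightarrow> msd_energy p (g i) \<le> e"
  shows "msd_energy p u \<le> e"
proof -
  have [measurable]: "u \<in> borel_measurable borel" "\<And>i. g i \<in> borel_measurable borel"
  by (rule L2c_measurable[OF u], rule L2c_measurable[OF g])
  have "msd_energy p u = (LNINT z. liminf (\<lambda>i. ennreal (norm z powr p * msd (g i) z)))"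
  unfolding msd_energy_def
  proof (rule nn_integral_cong)
  fix z :: 'a
  have "(\<lambda>i. ennreal (norm z powr p * msd (g i) z)) \<longlonglongrightarrow> ennreal (norm z powr p * msd u z)"
   by (intro tendsto_intros msd_tendsto[OF u g lim])
  then show "ennreal (norm z powr p * msd u z) = liminf (\<lambda>i. ennreal (norm z powr p * msd (g i) z))"
   by (simp add: lim_imp_Liminf)
  qed
  also have "\<dots> \<le> liminf (\<lambda>i. msd_energy p (g i))"
  unfolding msd_energy_def by (rule nn_integral_liminf) measurable
  also have "\<dots> \<le> e"
  proof (rule Liminf_le)
  show "eventually (\<lambda>i. msd_energy p (g i) \<le> e) sequentially" using le by (auto simp: eventually_sequentially)
  qed simp
  finally show ?thesis .
qed

lemma lincomb_lincomb_diff: "lincomb (lincomb h (- 1) f) (- 1) (lincomb h (- 1) g) = (\<lambda>x. - lincomb f (- 1) g x)"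
  by (auto simp: lincomb_def fun_eq_iff)

text \<open>The Poincare inequality turns a Cauchy sequence for the energy into one in L^2. Its L^2
  limit is also the limit in energy, because the energy is lower semicontinuous and the tail of the
  sequence stays within e of each of its late members.\<close>

lemma msd_energy_complete:
  fixes g :: "nat \<Rightarrow> 'a::euclidean_space \<Rightarrow> real"
  assumes p: "p < - real DIM('a)" and g: "\<And>i. L2c r (g i)"
  and cauchy: "\<And>e. 0 < e \<Longrightarrow> \<exists>N. \<forall>i\<ge>N. \<forall>j\<ge>N. msd_energy p (lincomb (g i) (- 1) (g j)) \<le> ennreal e"
  and z: "\<And>i. AE x in lborel. x \<notin> \<Omega> \<longrightarrow> g i x = 0"
  obtains u where "L2c r u" "AE x in lborel. x \<notin> \<Omega> \<longrightarrow> u x = 0"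
  "\<And>e. 0 < e \<Longrightarrow> \<exists>N. \<forall>i\<ge>N. msd_energy p (lincomb (g i) (- 1) u) \<le> ennreal e"
proof -
  have r: "0 < r" using g[of 0] by (simp add: L2c_def)
  have [measurable]: "\<And>i. g i \<in> borel_measurable borel" by (rule L2c_measurable[OF g])
  obtain m where m: "0 < m" "\<And>u :: 'a \<Rightarrow> real. L2c r u \<Longrightarrow> ennreal (m * (LBINT y. (u y)\<^sup>2)) \<le> msd_energy p u"
  using msd_energy_ge[OF p r] by blast
  have nn: "(LNINT x. ennreal ((h x)\<^sup>2)) = ennreal (LBINT x. (h x)\<^sup>2)" if "L2c r h" for h :: "'a \<Rightarrow> real"
  using that by (intro nn_integral_eq_integral) (auto simp: L2c_def)
  have c2: "\<exists>N. \<forall>i\<ge>N. \<forall>j\<ge>N. (LNINT x. ennreal ((norm (g i x - g j x))\<^sup>2)) \<le> ennreal e" if e: "0 < e" for e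
  proof -
  obtain N where N: "\<And>i j. N \<le> i \<Longrightarrow> N \<le> j \<Longrightarrow> msd_energy p (lincomb (g i) (- 1) (g j)) \<le> ennreal (m * e)"
   using cauchy[of "m * e"] e m(1) by auto
  have "(LNINT x. ennreal ((norm (g i x - g j x))\<^sup>2)) \<le> ennreal e" if "N \<le> i" "N \<le> j" for i j
  proof -
   have l: "L2c r (lincomb (g i) (- 1) (g j))" by (rule L2c_lincomb[OF g g])
   have "ennreal (m * (LBINT y. (lincomb (g i) (- 1) (g j) y)\<^sup>2)) \<le> ennreal (m * e)"
    by (rule order_trans[OF m(2)[OF l] N[OF that]])
   then have "(LBINT y. (lincomb (g i) (- 1) (g j) y)\<^sup>2) \<le> e" using m(1) e by (simp add: ennreal_le_iff)
   with nn[OF l] show ?thesis by (simp add: lincomb_def ennreal_leI)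
  qed
  then show ?thesis by blast
  qed
  obtain w \<rho> where w[measurable]: "w \<in> borel_measurable lborel" and \<rho>: "strict_mono \<rho>" "AE x in lborel. (\<lambda>k. g (\<rho> k) x) \<longlonglongrightarrow> w x"
  and gw: "\<And>e. 0 < e \<Longrightarrow> \<exists>N. \<forall>i\<ge>N. (LNINT x. ennreal ((norm (g i x - w x))\<^sup>2)) \<le> ennreal e"
  proof (rule L2_complete[of g lborel])
  show "g i \<in> borel_measurable lborel" for i by simp
  qed (use c2 that in blast)+
  \<comment> \<open>The L^2 limit w vanishes outside the ball only almost everywhere;
    \<open>L2c\<close> asks for it everywhere.\<close>
  define u where "u x = (if norm x < r then w x else 0)" for x
  have [measurable]: "w \<in> borel_measurable borel" using w by simp
  have [measurable]: "u \<in> borel_measurable borel" unfolding u_def[abs_def] by measurable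
  have uw: "AE x in lborel. u x = w x"
  using \<rho>(2)
  proof eventually_elim
  case (elim x)
  show ?case
  proof (cases "norm x < r")
   case False
   then have "g i x = 0" for i using g[of i] by (simp add: L2c_def)
   then have "(\<lambda>k. 0) \<longlonglongrightarrow> w x" using elim by simp
   then show ?thesis using False by (simp add: u_def LIMSEQ_const_iff)
  qed (simp add: u_def)
  qed
  have gu: "\<exists>N. \<forall>i\<ge>N. (LNINT x. ennreal ((lincomb (g i) (- 1) u x)\<^sup>2)) \<le> ennreal e" if e: "0 < e" for e
  proof -
  have "(LNINT x. ennreal ((lincomb (g i) (- 1) u x)\<^sup>2)) = (LNINT x. ennreal ((norm (g i x - w x))\<^sup>2))" for i
   using uw by (intro nn_integral_cong_AE) (auto simp: lincomb_def)
  then show ?thesis using gw[OF e] by simp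
  qed
  have u: "L2c r u"
  proof -
  obtain N where N: "(LNINT x. ennreal ((lincomb (g N) (- 1) u x)\<^sup>2)) \<le> ennreal 1" using gu[of 1] by auto
  have "(LNINT x. ennreal (norm ((u x)\<^sup>2))) \<le> (LNINT x. ennreal 2 * ennreal ((g N x)\<^sup>2) + ennreal 2 * ennreal ((lincomb (g N) (- 1) u x)\<^sup>2))"
  proof (rule nn_integral_mono)
   fix x
   have "(u x)\<^sup>2 \<le> 2 * (g N x)\<^sup>2 + 2 * (lincomb (g N) (- 1) u x)\<^sup>2"
    using square_lincomb_le[of "g N x" "- 1" "lincomb (g N) (- 1) u x"] by (simp add: lincomb_def)
   then show "ennreal (norm ((u x)\<^sup>2)) \<le> ennreal 2 * ennreal ((g N x)\<^sup>2) + ennreal 2 * ennreal ((lincomb (g N) (- 1) u x)\<^sup>2)"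
    by (simp only: real_norm_def abs_power2 ennreal_mult'[symmetric] ennreal_plus[symmetric] ennreal_leI zero_le_power2 mult_nonneg_nonneg zero_le_numeral)
  qed
  also have "\<dots> = ennreal 2 * (LNINT x. ennreal ((g N x)\<^sup>2)) + ennreal 2 * (LNINT x. ennreal ((lincomb (g N) (- 1) u x)\<^sup>2))"
   by (simp add: nn_integral_add nn_integral_cmult)
  also have "\<dots> < \<infinity>"
   using N nn[OF g[of N]] by (auto simp: ennreal_mult_less_top intro: le_less_trans)
  finally have "integrable lborel (\<lambda>x. (u x)\<^sup>2)" by (intro integrableI_bounded) auto
  then show ?thesis using r by (simp add: L2c_def) (simp add: u_def)
  qed
  have lim: "(\<lambda>i. LBINT x. (lincomb (g i) (- 1) u x)\<^sup>2) \<longlonglongrightarrow> 0"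
  proof (rule LIMSEQ_I)
  fix e :: real assume e: "0 < e"
  then obtain N where N: "\<And>i. N \<le> i \<Longrightarrow> (LNINT x. ennreal ((lincomb (g i) (- 1) u x)\<^sup>2)) \<le> ennreal (e / 2)"
   using gu[of "e / 2"] by auto
  have "norm ((LBINT x. (lincomb (g i) (- 1) u x)\<^sup>2) - 0) < e" if "N \<le> i" for i
  proof -
   have "ennreal (LBINT x. (lincomb (g i) (- 1) u x)\<^sup>2) \<le> ennreal (e / 2)"
    using N[OF that] nn[OF L2c_lincomb[OF g u]] by simp
   then show ?thesis using e by (simp add: ennreal_le_iff)
  qed
  then show "\<exists>N. \<forall>i\<ge>N. norm ((LBINT x. (lincomb (g i) (- 1) u x)\<^sup>2) - 0) < e" by blast
  qed
  show thesis
  proof (rule that[OF u])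
  have "AE x in lborel. \<forall>k. x \<notin> \<Omega> \<longrightarrow> g (\<rho> k) x = 0" unfolding AE_all_countable using z by blast
  with \<rho>(2) uw show "AE x in lborel. x \<notin> \<Omega> \<longrightarrow> u x = 0"
  proof eventually_elim
   case (elim x)
   show ?case
   proof
    assume "x \<notin> \<Omega>"
    then have "(\<lambda>k. 0) \<longlonglongrightarrow> w x" using elim by simp
    then show "u x = 0" using elim by (simp add: LIMSEQ_const_iff)
   qed
  qed
  fix e :: real assume e: "0 < e"
  obtain N where N: "\<And>i j. N \<le> i \<Longrightarrow> N \<le> j \<Longrightarrow> msd_energy p (lincomb (g i) (- 1) (g j)) \<le> ennreal e"
   using cauchy[OF e] by auto
  have "msd_energy p (lincomb (g i) (- 1) u) \<le> ennreal e" if "N \<le> i" for i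
  proof (rule msd_energy_lower_semicontinuous[where g="\<lambda>j. lincomb (g i) (- 1) (g j)" and N=N])
   show "(\<lambda>j. LBINT x. (lincomb (lincomb (g i) (- 1) (g j)) (- 1) (lincomb (g i) (- 1) u) x)\<^sup>2) \<longlonglongrightarrow> 0"
    unfolding lincomb_lincomb_diff using lim by simp
  qed (use N that L2c_lincomb[OF g u] L2c_lincomb[OF g g] in auto)
  then show "\<exists>N. \<forall>i\<ge>N. msd_energy p (lincomb (g i) (- 1) u) \<le> ennreal e" by blast
  qed
qed

section \<open>Functions with a square integrable principal value gradient\<close>

lemma conv_lincomb:
  fixes k :: "'a::euclidean_space \<Rightarrow> 'a"
  assumes u: "L2c r u" and v: "L2c r v" and [measurable]: "k \<in> borel_measurable borel" and b: "\<And>w. norm (k w) \<le> b"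
  shows "conv k (lincomb u c v) x = conv k u x + c *\<^sub>R conv k v x"
proof -
  note i = integrable_conv[OF L2c_integrable[OF u] assms(3) b, of x] integrable_conv[OF L2c_integrable[OF v] assms(3) b, of x]
  have "conv k (lincomb u c v) x = (LBINT y. u y *\<^sub>R k (y - x) + c *\<^sub>R (v y *\<^sub>R k (y - x)))"
  unfolding conv_def lincomb_def by (simp add: scaleR_add_left)
  also have "\<dots> = conv k u x + c *\<^sub>R conv k v x"
  unfolding conv_def Bochner_Integration.integral_add[OF i(1) integrable_scaleR_right[OF i(2)]] integral_scaleR_right ..
  finally show ?thesis .
qed

text \<open>A relation between u and a Borel measurable representative w of its gradient, since the
  limit exists only almost everywhere and w is determined only up to null sets.\<close>

definition pv_gradient :: "real \<Rightarrow> ('a::euclidean_space \<Rightarrow> real) \<Rightarrow> ('a \<Rightarrow> 'a) \<Rightarrow> bool" where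
  "pv_gradient \<beta> u w \<longleftrightarrow> w \<in> borel_measurable borel \<and> integrable lborel (\<lambda>x. (norm (w x))\<^sup>2) \<and>
  (AE x in lborel. ((\<lambda>\<epsilon>. conv (shk \<beta> \<epsilon>) u x) \<longlongrightarrow> w x) (at_right 0))"

lemma pv_gradient_zero: "pv_gradient \<beta> (\<lambda>x. 0) (\<lambda>x. 0)"
  by (simp add: pv_gradient_def conv_def)

lemma pv_gradient_lincomb:
  fixes u v :: "'a::euclidean_space \<Rightarrow> real"
  assumes \<beta>: "1 \<le> \<beta>" and u: "L2c r u" "pv_gradient \<beta> u w" and v: "L2c r v" "pv_gradient \<beta> v w'"
  shows "pv_gradient \<beta> (lincomb u c v) (\<lambda>x. w x + c *\<^sub>R w' x)"
proof -
  have [measurable]: "w \<in> borel_measurable borel" "w' \<in> borel_measurable borel"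
  using u v by (simp_all add: pv_gradient_def)
  have "integrable lborel (\<lambda>x. (norm (w x + c *\<^sub>R w' x))\<^sup>2)"
  proof (rule Bochner_Integration.integrable_bound)
  show "integrable lborel (\<lambda>x. 2 * (norm (w x))\<^sup>2 + 2 * c\<^sup>2 * (norm (w' x))\<^sup>2)"
   using u v by (simp add: pv_gradient_def)
  have "(norm (w x + c *\<^sub>R w' x))\<^sup>2 \<le> 2 * (norm (w x))\<^sup>2 + 2 * c\<^sup>2 * (norm (w' x))\<^sup>2" for x
  proof -
   have "(norm (w x + c *\<^sub>R w' x))\<^sup>2 \<le> (norm (w x) + \<bar>c\<bar> * norm (w' x))\<^sup>2"
    using norm_triangle_ineq[of "w x" "c *\<^sub>R w' x"] by (intro power_mono) auto
   also have "\<dots> \<le> 2 * (norm (w x))\<^sup>2 + 2 * c\<^sup>2 * (norm (w' x))\<^sup>2"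
    using square_lincomb_le[of "norm (w x)" "\<bar>c\<bar>" "norm (w' x)"] by simp
   finally show ?thesis .
  qed
  then show "AE x in lborel. norm ((norm (w x + c *\<^sub>R w' x))\<^sup>2) \<le> norm (2 * (norm (w x))\<^sup>2 + 2 * c\<^sup>2 * (norm (w' x))\<^sup>2)"
   unfolding real_norm_def abs_power2 by (intro AE_I2 order_trans[OF _ abs_ge_self])
  qed simp
  moreover have "AE x in lborel. ((\<lambda>\<epsilon>. conv (shk \<beta> \<epsilon>) (lincomb u c v) x) \<longlongrightarrow> w x + c *\<^sub>R w' x) (at_right 0)"
  proof -
  have "AE x in lborel. ((\<lambda>\<epsilon>. conv (shk \<beta> \<epsilon>) u x) \<longlongrightarrow> w x) (at_right 0)" "AE x in lborel. ((\<lambda>\<epsilon>. conv (shk \<beta> \<epsilon>) v x) \<longlongrightarrow> w' x) (at_right 0)"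
   using u v by (simp_all add: pv_gradient_def)
  then show ?thesis
  proof eventually_elim
   case (elim x)
   have "((\<lambda>\<epsilon>. conv (shk \<beta> \<epsilon>) u x + c *\<^sub>R conv (shk \<beta> \<epsilon>) v x) \<longlongrightarrow> w x + c *\<^sub>R w' x) (at_right 0)"
    by (intro tendsto_intros elim)
   moreover have "eventually (\<lambda>\<epsilon>. conv (shk \<beta> \<epsilon>) u x + c *\<^sub>R conv (shk \<beta> \<epsilon>) v x = conv (shk \<beta> \<epsilon>) (lincomb u c v) x) (at_right 0)"
    using eventually_at_right_less[of 0]
    by eventually_elim (rule conv_lincomb[OF u(1) v(1) shk_measurable norm_shk_le[OF \<beta>], symmetric])
   ultimately show ?case by (rule Lim_transform_eventually)
  qed
  qed
  ultimately show ?thesis by (simp add: pv_gradient_def)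
qed

lemma pv_gradient_exists:
  fixes u :: "'a::euclidean_space \<Rightarrow> real"
  assumes \<beta>: "real DIM('a) / 2 + 1 < \<beta>" "real DIM('a) < \<beta>" "\<beta> < real DIM('a) + 2" and u: "L2c r u"
  and L: "AE x in lborel. lebesgue_point (\<beta> - 1) u x" and reg: "regularizable \<beta> u"
  and lim: "(\<lambda>i. LBINT x. (norm (conv (kern \<beta> (trunc_seq i)) u x))\<^sup>2) \<longlonglongrightarrow> Q"
  obtains w where "pv_gradient \<beta> u w" "(LBINT x. (norm (w x))\<^sup>2) = Q"
proof (rule regularizable_limit[OF \<beta>(1) u reg])
  fix w :: "'a \<Rightarrow> 'a"
  assume w: "w \<in> borel_measurable borel" "integrable lborel (\<lambda>x. (norm (w x))\<^sup>2)"
  "\<And>i. integrable lborel (\<lambda>x. (norm (conv (kern \<beta> (trunc_seq i)) u x - w x))\<^sup>2)"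
  "(\<lambda>i. LBINT x. (norm (conv (kern \<beta> (trunc_seq i)) u x - w x))\<^sup>2) \<longlonglongrightarrow> 0"
  "(\<lambda>i. LBINT x. (norm (conv (kern \<beta> (trunc_seq i)) u x))\<^sup>2) \<longlonglongrightarrow> (LBINT x. (norm (w x))\<^sup>2)"
  show thesis
  proof (rule that)
  show "pv_gradient \<beta> u w" unfolding pv_gradient_def
   using w(1,2) AE_conv_shk_tendsto[OF \<beta> u L w(1-4)] by blast
  show "(LBINT x. (norm (w x))\<^sup>2) = Q" by (rule LIMSEQ_unique[OF w(5) lim])
  qed
qed

lemma pv_gradient_finite_energy:
  fixes u :: "'a::euclidean_space \<Rightarrow> real"
  assumes \<beta>: "real DIM('a) + 1 < \<beta>" "\<beta> < real DIM('a) + 2" and u: "L2c r u"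
  and c: "\<And>z::'a. z \<noteq> 0 \<Longrightarrow> kappa \<beta> z = c * norm z powr (real DIM('a) + 2 - 2 * \<beta>)"
  and E: "msd_energy (real DIM('a) + 2 - 2 * \<beta>) u < \<infinity>"
  obtains w where "pv_gradient \<beta> u w"
  "(LBINT x. (norm (w x))\<^sup>2) = - c / 2 * enn2real (msd_energy (real DIM('a) + 2 - 2 * \<beta>) u)"
proof -
  let ?p = "real DIM('a) + 2 - 2 * \<beta>"
  have [measurable]: "u \<in> borel_measurable borel" by (rule L2c_measurable[OF u])
  have \<beta>': "real DIM('a) / 2 + 1 < \<beta>" "real DIM('a) < \<beta>" using \<beta>(1) by (smt (verit) field_sum_of_halves of_nat_0_le_iff)+
  have i: "integrable lborel (\<lambda>z. norm z powr ?p * msd u z)"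
  using E by (intro integrableI_nonneg) (auto simp: msd_energy_def msd_nonneg)
  then have i': "integrable lborel (\<lambda>z. msd u z * norm z powr ?p)" by (simp add: mult.commute)
  have e: "(LBINT z. norm z powr ?p * msd u z) = enn2real (msd_energy ?p u)"
  unfolding msd_energy_def by (intro integral_eq_nn_integral) (auto simp: msd_nonneg)
  have "(LBINT z. msd u z * kappa \<beta> z) = (LBINT z. c * (norm z powr ?p * msd u z))"
  proof (rule Bochner_Integration.integral_cong)
  fix z :: 'a
  show "msd u z * kappa \<beta> z = c * (norm z powr ?p * msd u z)"
   using c[of z] by (cases "z = 0") (auto simp: msd_def)
  qed simp
  then have eq: "- (LBINT z. msd u z * kappa \<beta> z) / 2 = - c / 2 * enn2real (msd_energy ?p u)"
  using e by simp
  show thesis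
  using pv_gradient_exists[OF \<beta>' \<beta>(2) u AE_lebesgue_point_finite_energy[OF \<beta>'(1) u i']
    regularizable_finite_energy[OF \<beta>'(1) \<beta>(2) u i'] conv_square_limit_finite_energy[OF \<beta> u i'], unfolded eq] that by blast
qed

lemma pv_gradient_critical:
  assumes \<beta>: "\<beta> = real DIM('a::euclidean_space) + 1" and kappa: "\<And>z::'a. z \<noteq> 0 \<Longrightarrow> kappa \<beta> z = 0"
  obtains M where "0 < M"
  "\<And>r u. L2c r (u :: 'a \<Rightarrow> real) \<Longrightarrow> \<exists>w. pv_gradient \<beta> u w \<and> (LBINT x. (norm (w x))\<^sup>2) = M * (LBINT x. (u x)\<^sup>2)"
proof -
  obtain M where M: "\<And>r u. L2c r (u :: 'a \<Rightarrow> real) \<Longrightarrow>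
  (\<lambda>i. LBINT x. (norm (conv (kern \<beta> (trunc_seq i)) u x))\<^sup>2) \<longlonglongrightarrow> M * (LBINT x. (u x)\<^sup>2)"
  using conv_square_limit_critical[OF \<beta> kappa] by blast
  show thesis
  proof (rule that[OF critical_mass_pos[OF \<beta> M]])
  fix r and u :: "'a \<Rightarrow> real" assume u: "L2c r u"
  have "0 < real DIM('a)" by simp
  then have \<beta>': "real DIM('a) / 2 + 1 < \<beta>" "real DIM('a) < \<beta>" "\<beta> < real DIM('a) + 2" unfolding \<beta> by linarith+
  have L: "AE x in lborel. lebesgue_point (\<beta> - 1) u x"
  proof -
   have "AE x in lborel. lebesgue_point (real DIM('a)) u x"
   proof (rule AE_lebesgue_point)
    fix R
    have "(LNINT y. ennreal (norm (u y)) * indicator (ball 0 R) y) \<le> (LNINT y. ennreal (norm (u y)))"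
     by (intro nn_integral_mono) (auto simp: indicator_def)
    also have "\<dots> < \<infinity>" using L2c_integrable[OF u] by (simp add: integrable_iff_bounded)
    finally show "(LNINT y. ennreal (norm (u y)) * indicator (ball 0 R) y) < \<infinity>" .
   qed (rule L2c_measurable[OF u])
   then show ?thesis by (simp add: \<beta>)
  qed
  show "\<exists>w. pv_gradient \<beta> u w \<and> (LBINT x. (norm (w x))\<^sup>2) = M * (LBINT x. (u x)\<^sup>2)"
   using pv_gradient_exists[OF \<beta>' u L regularizable_critical[OF \<beta> kappa u] M[OF u]] by blast
  qed
qed

section \<open>The energy space and well-posedness\<close>

lemma borel_measurable_lebesgue_AE:
  fixes f :: "'a::euclidean_space \<Rightarrow> 'b::euclidean_space"
  assumes u: "u \<in> borel_measurable borel" and ae: "AE x in lborel. f x = u x"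
  shows "f \<in> borel_measurable lebesgue"
proof (rule measurableI)
  fix A :: "'b set" assume A: "A \<in> sets borel"
  show "f -` A \<inter> space lebesgue \<in> sets lebesgue"
  proof (rule completion.in_sets_AE[of "u -` A"])
  show "AE x in lebesgue. (x \<in> u -` A) = (x \<in> f -` A \<inter> space lebesgue)"
   unfolding AE_completion_iff using ae by eventually_elim simp
  have "u -` A \<in> sets borel" using measurable_sets[OF u A] by simp
  then show "u -` A \<in> sets lebesgue" by simp
  qed simp
qed simp

lemma integral_lebesgue_AE:
  fixes f g :: "'a::euclidean_space \<Rightarrow> 'b::euclidean_space"
  assumes g: "g \<in> borel_measurable borel" and ae: "AE x in lborel. f x = g x"
  shows "integral\<^sup>L lebesgue f = integral\<^sup>L lborel g"
  and "integrable lborel g \<Longrightarrow> integrable lebesgue f"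
proof -
  have f: "f \<in> borel_measurable lebesgue" by (rule borel_measurable_lebesgue_AE[OF g ae])
  have g': "g \<in> borel_measurable lborel" "g \<in> borel_measurable lebesgue" using g by (auto intro: measurable_completion)
  have ae': "AE x in lebesgue. f x = g x" unfolding AE_completion_iff by (rule ae)
  show "integral\<^sup>L lebesgue f = integral\<^sup>L lborel g"
  using integral_cong_AE[OF f g'(2) ae'] integral_completion[OF g'(1)] by simp
  show "integrable lebesgue f" if "integrable lborel g"
  using integrable_cong_AE[OF f g'(2) ae'] integrable_completion[OF g'(1)] that by simp
qed

lemma domain_UNIV [simp]: "\<Omega> \<union> interaction_domain \<Omega> = UNIV"
  by (auto simp: interaction_domain_def)

lemma energy_eq:
  fixes v :: "real ^ 'n::finite \<Rightarrow> real"
  shows "energy \<omega> \<alpha> \<Omega> v = (LNINT x. (LNINT y. ennreal ((v y - v x)\<^sup>2) * energy_kernel \<omega> \<alpha> x y))"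
  by (simp add: energy_def nn_integral_completion)

lemma volume_constraint_iff: "volume_constraint \<Omega> v \<longleftrightarrow> (AE x in lborel. x \<notin> \<Omega> \<longrightarrow> v x = 0)"
  by (simp add: volume_constraint_def interaction_domain_def AE_completion_iff)

text \<open>Elements of the energy space are Lebesgue measurable and vanish outside \<Omega> almost
  everywhere. The analysis is carried out for a Borel function that agrees with them almost
  everywhere and vanishes identically off a ball.\<close>

definition borel_rep :: "real \<Rightarrow> ('a::euclidean_space \<Rightarrow> real) \<Rightarrow> ('a \<Rightarrow> real) \<Rightarrow> bool" where
  "borel_rep r v u \<longleftrightarrow> L2c r u \<and> (AE x in lborel. v x = u x)"

lemma borel_rep_lincomb:
  assumes "borel_rep r v u" "borel_rep r v' u'"
  shows "borel_rep r (lincomb v c v') (lincomb u c u')"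
proof -
  have "AE x in lborel. v x = u x" "AE x in lborel. v' x = u' x" using assms by (simp_all add: borel_rep_def)
  then have "AE x in lborel. lincomb v c v' x = lincomb u c u' x" by eventually_elim (simp add: lincomb_def)
  then show ?thesis using assms by (simp add: borel_rep_def L2c_lincomb)
qed

lemma energy_space_iff:
  fixes \<Omega> :: "(real ^ 'n::finite) set"
  assumes r: "0 < r" and \<Omega>: "\<Omega> \<subseteq> ball 0 r"
  shows "v \<in> energy_space \<omega> \<alpha> \<Omega> \<longleftrightarrow>
  (\<exists>u. borel_rep r v u) \<and> energy \<omega> \<alpha> \<Omega> v < \<infinity> \<and> (AE x in lborel. x \<notin> \<Omega> \<longrightarrow> v x = 0)"
proof
  assume v: "v \<in> energy_space \<omega> \<alpha> \<Omega>"
  then have m: "v \<in> borel_measurable lebesgue" and i: "integrable lebesgue (\<lambda>x. (v x)\<^sup>2)"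
  and z: "AE x in lborel. x \<notin> \<Omega> \<longrightarrow> v x = 0"
  by (auto simp: energy_space_def set_borel_measurable_def set_integrable_def volume_constraint_iff)
  obtain u0 where u0: "u0 \<in> borel_measurable lborel" "AE x in lborel. v x = u0 x"
  using completion_ex_borel_measurable_real[OF m] by auto
  have [measurable]: "u0 \<in> borel_measurable borel" using u0 by simp
  define u where "u x = (if norm x < r then u0 x else 0)" for x
  have u[measurable]: "u \<in> borel_measurable borel" unfolding u_def[abs_def] by measurable
  have ae: "AE x in lborel. v x = u x"
  using u0(2) z
  proof eventually_elim
  case (elim x)
  show ?case
  proof (cases "norm x < r")
   case False
   then have "x \<notin> \<Omega>" using \<Omega> by auto
   then show ?thesis using elim False by (simp add: u_def)
  qed (use elim in \<open>simp add: u_def\<close>)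
  qed
  have "AE x in lebesgue. (v x)\<^sup>2 = (u x)\<^sup>2" unfolding AE_completion_iff using ae by eventually_elim simp
  then have "integrable lebesgue (\<lambda>x. (u x)\<^sup>2)"
  using i by (rule integrable_cong_AE_imp[rotated 2]) (auto intro: measurable_completion)
  then have "integrable lborel (\<lambda>x. (u x)\<^sup>2)" by (simp add: integrable_completion)
  then have "borel_rep r v u" using r ae by (simp add: borel_rep_def L2c_def) (simp add: u_def)
  then show "(\<exists>u. borel_rep r v u) \<and> energy \<omega> \<alpha> \<Omega> v < \<infinity> \<and> (AE x in lborel. x \<notin> \<Omega> \<longrightarrow> v x = 0)"
  using v z by (auto simp: energy_space_def)
next
  assume "(\<exists>u. borel_rep r v u) \<and> energy \<omega> \<alpha> \<Omega> v < \<infinity> \<and> (AE x in lborel. x \<notin> \<Omega> \<longrightarrow> v x = 0)"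
  then obtain u where u: "L2c r u" "AE x in lborel. v x = u x" and e: "energy \<omega> \<alpha> \<Omega> v < \<infinity>" "AE x in lborel. x \<notin> \<Omega> \<longrightarrow> v x = 0"
  by (auto simp: borel_rep_def)
  have [measurable]: "u \<in> borel_measurable borel" by (rule L2c_measurable[OF u(1)])
  have "v \<in> borel_measurable lebesgue" by (rule borel_measurable_lebesgue_AE[OF _ u(2)]) simp
  moreover have "integrable lebesgue (\<lambda>x. (v x)\<^sup>2)"
  proof (rule integral_lebesgue_AE(2)[where g="\<lambda>x. (u x)\<^sup>2"])
  show "AE x in lborel. (v x)\<^sup>2 = (u x)\<^sup>2" using u(2) by eventually_elim simp
  qed (use u(1) in \<open>simp_all add: L2c_def\<close>)
  ultimately show "v \<in> energy_space \<omega> \<alpha> \<Omega>"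
  using e by (simp add: energy_space_def set_borel_measurable_def set_integrable_def volume_constraint_iff)
qed

text \<open>The diagonal is null for each x, so the kernel has to be known off it only; substituting
  y = x + z and exchanging the integrals gives the formula.\<close>

lemma energy_msd:
  fixes v :: "real ^ 'n::finite \<Rightarrow> real"
  assumes v: "borel_rep r v u" and [measurable]: "k \<in> borel_measurable borel"
  and k: "\<And>x y. x \<noteq> y \<Longrightarrow> energy_kernel \<omega> \<alpha> x y = k (y - x)"
  shows "energy \<omega> \<alpha> \<Omega> v = (LNINT z. k z * ennreal (msd u z))"
proof -
  have u: "L2c r u" and ae: "AE x in lborel. v x = u x" using v by (auto simp: borel_rep_def)
  have [measurable]: "u \<in> borel_measurable borel" by (rule L2c_measurable[OF u])
  let ?F = "\<lambda>x z. ennreal ((u (x + z) - u x)\<^sup>2) * k z"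
  have "energy \<omega> \<alpha> \<Omega> v = (LNINT x. (LNINT z. ?F x z))"
  unfolding energy_eq
  proof (rule nn_integral_cong_AE)
  show "AE x in lborel. (LNINT y. ennreal ((v y - v x)\<^sup>2) * energy_kernel \<omega> \<alpha> x y) = (LNINT z. ?F x z)"
   using ae
  proof eventually_elim
   case (elim x)
   have "(LNINT y. ennreal ((v y - v x)\<^sup>2) * energy_kernel \<omega> \<alpha> x y) = (LNINT y. ennreal ((u y - u x)\<^sup>2) * k (y - x))"
   proof (rule nn_integral_cong_AE)
    show "AE y in lborel. ennreal ((v y - v x)\<^sup>2) * energy_kernel \<omega> \<alpha> x y = ennreal ((u y - u x)\<^sup>2) * k (y - x)"
     using ae AE_lborel_singleton[of x]
    proof eventually_elim
     case (elim y)
     then show ?case using \<open>v x = u x\<close> k[of x y] by simp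
    qed
   qed
   also have "\<dots> = (LNINT z. ?F x z)"
    using nn_integral_shift[of "\<lambda>y. ennreal ((u y - u x)\<^sup>2) * k (y - x)" x] by (simp add: add.commute)
   finally show ?case .
  qed
  qed
  also have "\<dots> = (LNINT z. (LNINT x. ?F x z))"
  by (rule lborel_pair.Fubini'[symmetric]) measurable
  also have "\<dots> = (LNINT z. k z * ennreal (msd u z))"
  proof (rule nn_integral_cong)
  fix z
  have "(LNINT x. ennreal ((u (x + z) - u x)\<^sup>2)) = ennreal (msd u z)"
   unfolding msd_def by (intro nn_integral_eq_integral msd_integrable[OF u]) simp
  moreover have "(LNINT x. ?F x z) = (LNINT x. ennreal ((u (x + z) - u x)\<^sup>2)) * k z"
   by (rule nn_integral_multc) measurable
  ultimately show "(LNINT x. ?F x z) = k z * ennreal (msd u z)" by (simp only: mult.commute)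
  qed
  finally show ?thesis .
qed

text \<open>Once R \<ge> |x| + r the outer cut-off does not meet the support of u, and the term with
  v x vanishes by oddness of the cut-off kernel. The cut-off gradient is then independent of R and
  equal to the convolution with the sharp inner cut-off, so the joint limit is a limit in \<epsilon>
  alone.\<close>

lemma cutoff_gradient_tendsto:
  fixes v :: "real ^ 'n::finite \<Rightarrow> real"
  assumes eta: "\<And>a b. eta \<omega> \<alpha> a b = kern \<beta> 0 (b - a)" and \<beta>: "0 \<le> \<beta>" and v: "borel_rep r v u"
  and lim: "((\<lambda>\<epsilon>. conv (shk \<beta> \<epsilon>) u x) \<longlongrightarrow> l) (at_right 0)"
  shows "(cutoff_gradient \<omega> \<alpha> v x \<longlongrightarrow> l) pv_filter"
proof (rule Lim_transform_eventually)
  have u: "L2c r u" and ae: "AE x in lborel. v x = u x" using v by (auto simp: borel_rep_def)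
  have [measurable]: "u \<in> borel_measurable borel" by (rule L2c_measurable[OF u])
  show "((\<lambda>p. conv (shk \<beta> (fst p)) u x) \<longlongrightarrow> l) pv_filter"
  unfolding pv_filter_def by (rule filterlim_compose[OF lim filterlim_fst])
  show "eventually (\<lambda>p. conv (shk \<beta> (fst p)) u x = cutoff_gradient \<omega> \<alpha> v x p) pv_filter"
  proof (rule eventually_pv_filter[of 1 "norm x + r"])
  fix \<epsilon> R :: real assume \<epsilon>: "0 < \<epsilon>" and R: "norm x + r \<le> R"
  let ?k = "cutk \<beta> \<epsilon> R :: real ^ 'n \<Rightarrow> real ^ 'n"
  have i1: "integrable lborel (\<lambda>y. u y *\<^sub>R ?k (y - x))"
   by (rule integrable_conv[OF L2c_integrable[OF u] cutk_measurable norm_cutk_le_const[OF \<beta> \<epsilon>]])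
  have i2: "integrable lborel (\<lambda>y. ?k (y - x))"
   using integrable_shift[OF integrable_cutk[OF \<beta> \<epsilon>], of R "- x"] by simp
  have "(LBINT z. ?k z) = 0" by (rule integral_odd) auto
  then have k0: "(LBINT y. ?k (y - x)) = 0" using integral_shift[of ?k "- x"] by simp
  have "cutoff_gradient \<omega> \<alpha> v x (\<epsilon>, R) = (LINT y|lebesgue. (v y - v x) *\<^sub>R ?k (y - x))"
   unfolding cutoff_gradient_def cutoff_def cutk_def eta by simp
  also have "\<dots> = (LBINT y. u y *\<^sub>R ?k (y - x) - v x *\<^sub>R ?k (y - x))"
  proof (rule integral_lebesgue_AE(1))
   show "AE y in lborel. (v y - v x) *\<^sub>R ?k (y - x) = u y *\<^sub>R ?k (y - x) - v x *\<^sub>R ?k (y - x)"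
    using ae by eventually_elim (simp add: scaleR_diff_left)
  qed simp
  also have "\<dots> = (LBINT y. u y *\<^sub>R ?k (y - x))"
   unfolding Bochner_Integration.integral_diff[OF i1 integrable_scaleR_right[OF i2]] integral_scaleR_right k0 by simp
  also have "\<dots> = conv (shk \<beta> \<epsilon>) u x"
   unfolding conv_def
  proof (rule Bochner_Integration.integral_cong)
   fix y
   show "u y *\<^sub>R ?k (y - x) = u y *\<^sub>R shk \<beta> \<epsilon> (y - x)"
   proof (cases "norm y < r")
    case True
    then have "norm (y - x) < R" using R norm_triangle_ineq4[of y x] by linarith
    then show ?thesis by (simp add: cutk_def shk_def)
   next
    case False
    then show ?thesis using u by (simp add: L2c_def)
   qed
  qed simp
  finally show "conv (shk \<beta> (fst (\<epsilon>, R))) u x = cutoff_gradient \<omega> \<alpha> v x (\<epsilon>, R)" by simp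
  qed simp
qed

lemma AE_gradient:
  fixes v :: "real ^ 'n::finite \<Rightarrow> real"
  assumes eta: "\<And>a b. eta \<omega> \<alpha> a b = kern \<beta> 0 (b - a)" and \<beta>: "0 \<le> \<beta>" and v: "borel_rep r v u" "pv_gradient \<beta> u w"
  shows "AE x in lborel. (\<exists>l. (cutoff_gradient \<omega> \<alpha> v x \<longlongrightarrow> l) pv_filter) \<and> gradient \<omega> \<alpha> v x = w x"
proof -
  have "AE x in lborel. ((\<lambda>\<epsilon>. conv (shk \<beta> \<epsilon>) u x) \<longlongrightarrow> w x) (at_right 0)" using v(2) by (simp add: pv_gradient_def)
  then show ?thesis
  proof eventually_elim
  case (elim x)
  note t = cutoff_gradient_tendsto[OF eta \<beta> v(1) elim]
  have "Lim pv_filter (cutoff_gradient \<omega> \<alpha> v x) = w x"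
   by (rule tendsto_Lim[OF _ t]) (simp add: pv_filter_def prod_filter_eq_bot)
  with t show ?case by (auto simp: gradient_def)
  qed
qed

lemma bilinear_form_pv_gradient:
  fixes v v' :: "real ^ 'n::finite \<Rightarrow> real"
  assumes eta: "\<And>a b. eta \<omega> \<alpha> a b = kern \<beta> 0 (b - a)" and \<beta>: "0 \<le> \<beta>"
  and v: "borel_rep r v u" "pv_gradient \<beta> u w" and v': "borel_rep r v' u'" "pv_gradient \<beta> u' w'"
  shows "bilinear_form_defined \<omega> \<alpha> \<Omega> v v'" and "bilinear_form \<omega> \<alpha> \<Omega> v v' = (LBINT x. w x \<bullet> w' x)"
proof -
  have w: "w \<in> borel_measurable borel" "w' \<in> borel_measurable borel"
  "integrable lborel (\<lambda>x. (norm (w x))\<^sup>2)" "integrable lborel (\<lambda>x. (norm (w' x))\<^sup>2)"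
  using v(2) v'(2) by (simp_all add: pv_gradient_def)
  note [measurable] = w(1,2)
  note g = AE_gradient[OF eta \<beta> v] AE_gradient[OF eta \<beta> v']
  have ae: "AE x in lborel. gradient \<omega> \<alpha> v x \<bullet> gradient \<omega> \<alpha> v' x = w x \<bullet> w' x"
  using g by eventually_elim simp
  have m: "(\<lambda>x. w x \<bullet> w' x) \<in> borel_measurable borel" by simp
  have i: "integrable lborel (\<lambda>x. w x \<bullet> w' x)" using w by (intro integrable_inner_L2) auto
  show "bilinear_form \<omega> \<alpha> \<Omega> v v' = (LBINT x. w x \<bullet> w' x)"
  using integral_lebesgue_AE(1)[OF m ae] by (simp add: bilinear_form_def set_lebesgue_integral_def)
  have "AE x in lborel. (\<exists>l. (cutoff_gradient \<omega> \<alpha> v x \<longlongrightarrow> l) pv_filter) \<and> (\<exists>l. (cutoff_gradient \<omega> \<alpha> v' x \<longlongrightarrow> l) pv_filter)"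
  using g by eventually_elim blast
  then show "bilinear_form_defined \<omega> \<alpha> \<Omega> v v'"
  using integral_lebesgue_AE(2)[OF m ae i]
  by (simp add: bilinear_form_defined_def set_integrable_def AE_completion_iff)
qed

section \<open>Well-posedness when the energy vanishes on the whole space\<close>

lemma energy_eq_0:
  fixes v :: "real ^ 'n::finite \<Rightarrow> real"
  assumes ae: "AE x in lborel. v x = 0"
  shows "energy \<omega> \<alpha> \<Omega> v = 0"
proof -
  have "energy \<omega> \<alpha> \<Omega> v = (\<integral>\<^sup>+x. 0 \<partial>(lborel :: (real ^ 'n) measure))"
  unfolding energy_eq
  proof (rule nn_integral_cong_AE)
  show "AE x in lborel. (LNINT y. ennreal ((v y - v x)\<^sup>2) * energy_kernel \<omega> \<alpha> x y) = 0"
   using ae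
  proof eventually_elim
   case (elim x)
   have "(LNINT y. ennreal ((v y - v x)\<^sup>2) * energy_kernel \<omega> \<alpha> x y) = (\<integral>\<^sup>+y. 0 \<partial>(lborel :: (real ^ 'n) measure))"
   proof (rule nn_integral_cong_AE)
    show "AE y in lborel. ennreal ((v y - v x)\<^sup>2) * energy_kernel \<omega> \<alpha> x y = 0"
     using ae by eventually_elim (simp add: elim)
   qed
   then show ?case by simp
  qed
  qed
  then show ?thesis by simp
qed

lemma borel_rep_zero: "0 < r \<Longrightarrow> AE x in lborel. v x = 0 \<Longrightarrow> borel_rep r v (\<lambda>x. 0)"
  by (simp add: borel_rep_def L2c_def)

lemma zero_in_energy_space:
  fixes \<Omega> :: "(real ^ 'n::finite) set"
  assumes "0 < r" "\<Omega> \<subseteq> ball 0 r"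
  shows "(\<lambda>x. 0) \<in> energy_space \<omega> \<alpha> \<Omega>"
  unfolding energy_space_iff[OF assms] using borel_rep_zero[OF assms(1), of "\<lambda>x. 0"] energy_eq_0[of "\<lambda>x. 0" \<omega> \<alpha> \<Omega>] by auto

lemma L2c_integral_eq_0:
  assumes u: "L2c r u" and "(LBINT x. (u x)\<^sup>2) \<le> 0"
  shows "AE x in lborel. u x = 0"
proof -
  have "(LBINT x. (u x)\<^sup>2) = 0" using assms(2) by (simp add: antisym)
  then have "AE x in lborel. (u x)\<^sup>2 = 0"
  using u by (subst (asm) integral_nonneg_eq_0_iff_AE) (auto simp: L2c_def)
  then show ?thesis by simp
qed

text \<open>If the energy vanishes on the space, so do all bounded functionals, and \<open>0\<close> is the only solution.\<close>

lemma well_posed_degenerate: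
  fixes \<Omega> :: "(real ^ 'n::finite) set"
  assumes r: "0 < r" "\<Omega> \<subseteq> ball 0 r" and eta: "\<And>a b. eta \<omega> \<alpha> a b = kern \<beta> 0 (b - a)" and \<beta>: "0 \<le> \<beta>"
  and E: "\<And>v. v \<in> energy_space \<omega> \<alpha> \<Omega> \<Longrightarrow> energy \<omega> \<alpha> \<Omega> v = 0"
  and ex: "\<And>v. v \<in> energy_space \<omega> \<alpha> \<Omega> \<Longrightarrow> \<exists>u w. borel_rep r v u \<and> pv_gradient \<beta> u w \<and>
   ((LBINT x. (norm (w x))\<^sup>2) = 0 \<longrightarrow> (AE x in lborel. v x = 0))"
  shows "well_posed \<omega> \<alpha> \<Omega>"
proof -
  let ?V = "energy_space \<omega> \<alpha> \<Omega>"
  have f0: "f v = 0" if f: "f \<in> dual_energy_space \<omega> \<alpha> \<Omega>" and v: "v \<in> ?V" for f v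
  proof -
  obtain K where "\<bar>f v\<bar> \<le> K * energy_norm \<omega> \<alpha> \<Omega> v" using f v by (auto simp: dual_energy_space_def)
  then show ?thesis using E[OF v] by (simp add: energy_norm_def)
  qed
  have solution_0: "AE x in lborel. u x = 0"
  if f: "f \<in> dual_energy_space \<omega> \<alpha> \<Omega>" and u: "weak_solution \<omega> \<alpha> \<Omega> f u" for f u
  proof -
  \<comment> \<open>The datum is zero, so testing the equation with its own solution gives A (u, u)
    = 0, that is, a gradient of norm 0.\<close>
  have uV: "u \<in> ?V" and B: "bilinear_form \<omega> \<alpha> \<Omega> u u = 0" using u f0[OF f] by (auto simp: weak_solution_def)
  obtain u' w where w: "borel_rep r u u'" "pv_gradient \<beta> u' w"
   "(LBINT x. (norm (w x))\<^sup>2) = 0 \<longrightarrow> (AE x in lborel. u x = 0)"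
   using ex[OF uV] by blast
  show ?thesis
   using w(3) B bilinear_form_pv_gradient(2)[OF eta \<beta> w(1,2) w(1,2), of \<Omega>] by (simp add: power2_norm_eq_inner)
  qed
  have def: "bilinear_form_defined \<omega> \<alpha> \<Omega> u v" if uv: "u \<in> ?V" "v \<in> ?V" for u v
  proof -
  obtain u' w where w: "borel_rep r u u'" "pv_gradient \<beta> u' w" using ex[OF uv(1)] by blast
  obtain v' w' where w': "borel_rep r v v'" "pv_gradient \<beta> v' w'" using ex[OF uv(2)] by blast
  show ?thesis by (rule bilinear_form_pv_gradient(1)[OF eta \<beta> w w'])
  qed
  have sol: "weak_solution \<omega> \<alpha> \<Omega> f (\<lambda>x. 0)" if f: "f \<in> dual_energy_space \<omega> \<alpha> \<Omega>" for f
  proof -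
  have "bilinear_form \<omega> \<alpha> \<Omega> (\<lambda>x. 0) v = f v" if v: "v \<in> ?V" for v
  proof -
   obtain v' w' where w': "borel_rep r v v'" "pv_gradient \<beta> v' w'" using ex[OF v] by blast
   have z: "borel_rep r (\<lambda>x::real ^ 'n. 0) (\<lambda>x. 0)" by (rule borel_rep_zero[OF r(1)]) simp
   show ?thesis
    using bilinear_form_pv_gradient(2)[OF eta \<beta> z pv_gradient_zero w', of \<Omega>] f0[OF f v] by simp
  qed
  then show ?thesis using zero_in_energy_space[OF r] by (simp add: weak_solution_def volume_constraint_def)
  qed
  have uniq: "AE x in lebesgue. x \<in> \<Omega> \<union> interaction_domain \<Omega> \<longrightarrow> u x = u' x"
  if "f \<in> dual_energy_space \<omega> \<alpha> \<Omega>" "weak_solution \<omega> \<alpha> \<Omega> f u" "weak_solution \<omega> \<alpha> \<Omega> f u'" for f u u'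
  unfolding AE_completion_iff using solution_0[OF that(1,2)] solution_0[OF that(1,3)] by eventually_elim simp
  have stable: "energy_norm \<omega> \<alpha> \<Omega> u \<le> 0 * dual_norm \<omega> \<alpha> \<Omega> f" if "weak_solution \<omega> \<alpha> \<Omega> f u" for f u
  using E[of u] that by (simp add: energy_norm_def weak_solution_def)
  show ?thesis
  unfolding well_posed_def using def sol uniq stable by blast
qed

text \<open>Finite energy together with the infinite tail mass \<open>top\<close> leaves only
  functions that are 0 almost everywhere; their gradient exists trivially, which also settles that
  the form is defined.\<close>

lemma well_posed_trivial:
  fixes \<Omega> :: "(real ^ 'n::finite) set"
  assumes r: "0 < r" "\<Omega> \<subseteq> ball 0 r" and eta: "\<And>a b. eta \<omega> \<alpha> a b = kern \<beta> 0 (b - a)" and \<beta>: "0 \<le> \<beta>"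
  and m: "k \<in> borel_measurable borel" and k: "\<And>x y. x \<noteq> y \<Longrightarrow> energy_kernel \<omega> \<alpha> x y = k (y - x)"
  and top: "(LNINT z. k z * indicator (- ball 0 (2 * r)) z) = \<infinity>"
  shows "well_posed \<omega> \<alpha> \<Omega>"
proof -
  have z: "AE x in lborel. v x = 0" if v: "v \<in> energy_space \<omega> \<alpha> \<Omega>" for v
  proof -
  obtain u where u: "borel_rep r v u" using v by (auto simp: energy_space_iff[OF r])
  then have "L2c r u" "AE x in lborel. v x = u x" by (auto simp: borel_rep_def)
  have fin: "energy \<omega> \<alpha> \<Omega> v < \<infinity>" using v by (simp add: energy_space_def)
  have "energy \<omega> \<alpha> \<Omega> v = (LNINT z. k z * ennreal (msd u z))" by (rule energy_msd[OF u m k])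
  with nn_integral_msd_ge[OF \<open>L2c r u\<close> m, unfolded top] have "ennreal (2 * (LBINT x. (u x)\<^sup>2)) * \<infinity> \<le> energy \<omega> \<alpha> \<Omega> v"
   by simp
  then have "ennreal (2 * (LBINT x. (u x)\<^sup>2)) * \<infinity> < \<infinity>" using fin by (rule le_less_trans)
  then have "(LBINT x. (u x)\<^sup>2) \<le> 0" by (auto simp: ennreal_mult_less_top ennreal_eq_0_iff)
  with L2c_integral_eq_0[OF \<open>L2c r u\<close>] have "AE x in lborel. u x = 0" by blast
  with \<open>AE x in lborel. v x = u x\<close> show ?thesis by eventually_elim simp
  qed
  show ?thesis
  proof (rule well_posed_degenerate[OF r eta \<beta>])
  fix v assume "v \<in> energy_space \<omega> \<alpha> \<Omega>"
  then have v: "AE x in lborel. v x = 0" by (rule z)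
  then show "energy \<omega> \<alpha> \<Omega> v = 0" by (rule energy_eq_0)
  show "\<exists>u w. borel_rep r v u \<and> pv_gradient \<beta> u w \<and> ((LBINT x. (norm (w x))\<^sup>2) = 0 \<longrightarrow> (AE x in lborel. v x = 0))"
   using borel_rep_zero[OF r(1) v] pv_gradient_zero v by blast
  qed
qed

section \<open>Bounded functionals and the value of the energy kernel\<close>

lemma dual_energy_space_lincomb:
  assumes f: "f \<in> dual_energy_space \<omega> \<alpha> \<Omega>" and u: "u \<in> energy_space \<omega> \<alpha> \<Omega>" "v \<in> energy_space \<omega> \<alpha> \<Omega>"
  and cv: "(\<lambda>x. c * v x) \<in> energy_space \<omega> \<alpha> \<Omega>"
  shows "f (lincomb u c v) = f u + c * f v"
proof -
  have "lincomb u c v = (\<lambda>x. u x + (\<lambda>x. c * v x) x)" by (simp add: lincomb_def fun_eq_iff)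
  moreover have "f (\<lambda>x. u x + (\<lambda>x. c * v x) x) = f u + f (\<lambda>x. c * v x)"
  proof -
  have "\<forall>v\<in>energy_space \<omega> \<alpha> \<Omega>. \<forall>w\<in>energy_space \<omega> \<alpha> \<Omega>. f (\<lambda>x. v x + w x) = f v + f w"
   using f by (simp add: dual_energy_space_def)
  from bspec[OF bspec[OF this u(1)] cv] show ?thesis .
  qed
  moreover have "f (\<lambda>x. c * v x) = c * f v" using f u by (simp add: dual_energy_space_def)
  ultimately show ?thesis by simp
qed

lemma abs_le_dual_norm:
  assumes f: "f \<in> dual_energy_space \<omega> \<alpha> \<Omega>" and v: "v \<in> energy_space \<omega> \<alpha> \<Omega>" "energy_norm \<omega> \<alpha> \<Omega> v \<le> 1"
  shows "\<bar>f v\<bar> \<le> dual_norm \<omega> \<alpha> \<Omega> f"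
  unfolding dual_norm_def
proof (rule cSUP_upper)
  obtain K where K: "\<And>v. v \<in> energy_space \<omega> \<alpha> \<Omega> \<Longrightarrow> \<bar>f v\<bar> \<le> K * energy_norm \<omega> \<alpha> \<Omega> v"
  using f unfolding dual_energy_space_def by blast
  show "bdd_above ((\<lambda>v. \<bar>f v\<bar>) ` {v \<in> energy_space \<omega> \<alpha> \<Omega>. energy_norm \<omega> \<alpha> \<Omega> v \<le> 1})"
  proof (rule bdd_aboveI2)
  fix v assume v: "v \<in> {v \<in> energy_space \<omega> \<alpha> \<Omega>. energy_norm \<omega> \<alpha> \<Omega> v \<le> 1}"
  have "K * energy_norm \<omega> \<alpha> \<Omega> v \<le> \<bar>K\<bar> * energy_norm \<omega> \<alpha> \<Omega> v"
   by (intro mult_right_mono) (auto simp: energy_norm_def)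
  also have "\<dots> \<le> \<bar>K\<bar> * 1" using v by (intro mult_left_mono) auto
  finally show "\<bar>f v\<bar> \<le> \<bar>K\<bar>" using K[of v] v by simp
  qed
qed (use v in simp)

lemma dual_pairing_le:
  assumes f: "f \<in> dual_energy_space \<omega> \<alpha> \<Omega>" and u: "u \<in> energy_space \<omega> \<alpha> \<Omega>"
  and closed: "\<And>c. (\<lambda>x. c * u x) \<in> energy_space \<omega> \<alpha> \<Omega>"
  and scale: "\<And>c. energy_norm \<omega> \<alpha> \<Omega> (\<lambda>x. c * u x) = \<bar>c\<bar> * energy_norm \<omega> \<alpha> \<Omega> u"
  shows "f u \<le> dual_norm \<omega> \<alpha> \<Omega> f * energy_norm \<omega> \<alpha> \<Omega> u"
proof -
  let ?N = "energy_norm \<omega> \<alpha> \<Omega> u"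
  have hom: "f (\<lambda>x. c * u x) = c * f u" for c using f u by (simp add: dual_energy_space_def)
  have N: "0 \<le> ?N" by (simp add: energy_norm_def)
  show ?thesis
  proof (cases "?N = 0")
  case True
  obtain K where "\<And>v. v \<in> energy_space \<omega> \<alpha> \<Omega> \<Longrightarrow> \<bar>f v\<bar> \<le> K * energy_norm \<omega> \<alpha> \<Omega> v"
   using f unfolding dual_energy_space_def by blast
  from this[OF u] True show ?thesis by simp
  next
  case False
  then have N: "0 < ?N" using N by simp
  have "\<bar>f (\<lambda>x. 1 / ?N * u x)\<bar> \<le> dual_norm \<omega> \<alpha> \<Omega> f"
   using scale[of "1 / ?N"] N by (intro abs_le_dual_norm f closed) simp
  from order_trans[OF abs_ge_self this] have "f u / ?N \<le> dual_norm \<omega> \<alpha> \<Omega> f" unfolding hom by simp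
  then show ?thesis using N by (simp add: divide_le_eq)
  qed
qed

lemma energy_kernel_infinity:
  fixes x y :: "real ^ 'n::finite"
  assumes eta: "\<And>a b. eta \<omega> \<alpha> a b = kern \<beta> 0 (b - a)" and \<beta>: "0 < \<beta>" "\<beta> \<le> real CARD('n) / 2 + 1 \<or> real CARD('n) + 2 \<le> \<beta>"
  and "x \<noteq> y"
  shows "energy_kernel \<omega> \<alpha> x y = \<infinity>"
proof (cases "\<beta> \<le> real CARD('n) / 2 + 1")
  case True
  note g = gamma_eq_minus_infinity[OF eta \<beta>(1) True]
  have "\<forall>x' y'. x' \<noteq> y' \<longrightarrow> gamma_eq \<omega> \<alpha> x' y' \<le> 0" using g by simp
  then show ?thesis using g[OF \<open>x \<noteq> y\<close>] by (simp add: energy_kernel_def)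
next
  case False
  with \<beta> have g: "gamma_eq \<omega> \<alpha> x y = \<infinity>" by (intro gamma_eq_infinity[OF eta _ \<open>x \<noteq> y\<close>]) simp
  then have "\<not> (\<forall>x' y'. x' \<noteq> y' \<longrightarrow> gamma_eq \<omega> \<alpha> x' y' \<le> 0)" using \<open>x \<noteq> y\<close> by force
  then show ?thesis unfolding energy_kernel_def g by (simp only: if_False e2ennreal_infty infinity_ennreal_def)
qed

text \<open>For c \<ge> 0 the equivalence kernel is nonpositive off the diagonal and the sign
  convention reverses it; for c < 0 it is positive and kept. Both cases give |c|/2.\<close>

lemma energy_kernel_kappa:
  fixes x y :: "real ^ 'n::finite"
  assumes eta: "\<And>a b. eta \<omega> \<alpha> a b = kern \<beta> 0 (b - a)"
  and \<beta>: "real CARD('n) / 2 + 1 < \<beta>" "\<beta> < real CARD('n) + 2"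
  and c: "\<And>z::real ^ 'n. z \<noteq> 0 \<Longrightarrow> kappa \<beta> z = c * norm z powr p"
  and "x \<noteq> y"
  shows "energy_kernel \<omega> \<alpha> x y = ennreal (\<bar>c\<bar> / 2 * norm (y - x) powr p)"
proof -
  have g: "gamma_eq \<omega> \<alpha> a b = ereal (- c / 2 * norm (b - a) powr p)" if "a \<noteq> b" for a b :: "real ^ 'n"
  using gamma_eq_kappa[OF eta \<beta> that] c[of "a - b"] that by (simp add: norm_minus_commute)
  show ?thesis
  proof (cases "0 \<le> c")
  case True
  have "\<forall>x' y'. x' \<noteq> y' \<longrightarrow> gamma_eq \<omega> \<alpha> x' y' \<le> 0" using g True by simp
  then show ?thesis using g[OF \<open>x \<noteq> y\<close>] True by (simp add: energy_kernel_def)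
  next
  case False
  then have "0 < - c / 2 * norm (y - x) powr p" using \<open>x \<noteq> y\<close> by (simp add: mult_neg_pos)
  then have "\<not> (\<forall>x' y'. x' \<noteq> y' \<longrightarrow> gamma_eq \<omega> \<alpha> x' y' \<le> 0)"
   using g[OF \<open>x \<noteq> y\<close>] \<open>x \<noteq> y\<close> by (metis ereal_less(2) not_less)
  then have "energy_kernel \<omega> \<alpha> x y = e2ennreal (gamma_eq \<omega> \<alpha> x y)" unfolding energy_kernel_def by (simp only: if_False)
  then show ?thesis using g[OF \<open>x \<noteq> y\<close>] False by simp
  qed
qed

lemma well_posed_critical:
  fixes \<Omega> :: "(real ^ 'n::finite) set"
  assumes r: "0 < r" "\<Omega> \<subseteq> ball 0 r" and eta: "\<And>a b. eta \<omega> \<alpha> a b = kern \<beta> 0 (b - a)"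
  and \<beta>: "\<beta> = real CARD('n) + 1" and kappa: "\<And>z::real ^ 'n. z \<noteq> 0 \<Longrightarrow> kappa \<beta> z = 0"
  shows "well_posed \<omega> \<alpha> \<Omega>"
proof -
  have "0 < real CARD('n)" by simp
  then have \<beta>': "real CARD('n) / 2 + 1 < \<beta>" "\<beta> < real CARD('n) + 2" "0 \<le> \<beta>" unfolding \<beta> by linarith+
  have k: "energy_kernel \<omega> \<alpha> x y = 0" if "x \<noteq> y" for x y :: "real ^ 'n"
  using energy_kernel_kappa[OF eta \<beta>'(1,2), of 0 0] kappa that by simp
  have \<beta>n: "\<beta> = real DIM(real ^ 'n) + 1" using \<beta> by simp
  obtain M where M: "0 < M" "\<And>r u. L2c r (u :: real ^ 'n \<Rightarrow> real) \<Longrightarrow>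
  \<exists>w. pv_gradient \<beta> u w \<and> (LBINT x. (norm (w x))\<^sup>2) = M * (LBINT x. (u x)\<^sup>2)"
  using pv_gradient_critical[OF \<beta>n kappa] by blast
  show ?thesis
  proof (rule well_posed_degenerate[OF r eta \<beta>'(3)])
  fix v assume "v \<in> energy_space \<omega> \<alpha> \<Omega>"
  then obtain u where v: "borel_rep r v u" by (auto simp: energy_space_iff[OF r])
  then have u: "L2c r u" "AE x in lborel. v x = u x" by (auto simp: borel_rep_def)
  show "energy \<omega> \<alpha> \<Omega> v = 0"
   using energy_msd[OF v, of "\<lambda>z. 0" \<omega> \<alpha> \<Omega>] k by simp
  obtain w where w: "pv_gradient \<beta> u w" "(LBINT x. (norm (w x))\<^sup>2) = M * (LBINT x. (u x)\<^sup>2)"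
   using M(2)[OF u(1)] by blast
  have "AE x in lborel. v x = 0" if "(LBINT x. (norm (w x))\<^sup>2) = 0"
  proof -
   have "(LBINT x. (u x)\<^sup>2) \<le> 0" using that w(2) M(1) by simp
   with u(2) L2c_integral_eq_0[OF u(1)] show ?thesis by auto
  qed
  then show "\<exists>u w. borel_rep r v u \<and> pv_gradient \<beta> u w \<and> ((LBINT x. (norm (w x))\<^sup>2) = 0 \<longrightarrow> (AE x in lborel. v x = 0))"
   using v w(1) by blast
  qed
qed

text \<open>The form is the L^2 product of gradients and its diagonal is exactly the squared energy
  norm. With the Poincare inequality and completeness the space is a Hilbert space up to null
  functions, so the weak problem is the Riesz representation of f.\<close>

lemma well_posed_supercritical:
  fixes \<Omega> :: "(real ^ 'n::finite) set"
  assumes r: "0 < r" "\<Omega> \<subseteq> ball 0 r" and eta: "\<And>a b. eta \<omega> \<alpha> a b = kern \<beta> 0 (b - a)"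
  and \<beta>: "real CARD('n) + 1 < \<beta>" "\<beta> < real CARD('n) + 2"
  shows "well_posed \<omega> \<alpha> \<Omega>"
proof -
  let ?V = "energy_space \<omega> \<alpha> \<Omega>" and ?B = "bilinear_form \<omega> \<alpha> \<Omega>"
  have \<beta>': "real CARD('n) / 2 + 1 < \<beta>" "1 \<le> \<beta>" "0 \<le> \<beta>" using \<beta>(1) by (smt (verit) field_sum_of_halves of_nat_0_le_iff)+
  have \<beta>n: "real DIM(real ^ 'n) + 1 < \<beta>" "\<beta> < real DIM(real ^ 'n) + 2" using \<beta> by simp_all
  define p where "p = real CARD('n) + 2 - 2 * \<beta>"
  have p: "p < - real DIM(real ^ 'n)" using \<beta> by (simp add: p_def)
  obtain c where c: "\<And>z::real ^ 'n. z \<noteq> 0 \<Longrightarrow> kappa \<beta> z = c * norm z powr p"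
  using kappa_homogeneous unfolding p_def by blast
  then have c': "\<And>z::real ^ 'n. z \<noteq> 0 \<Longrightarrow> kappa \<beta> z = c * norm z powr (real DIM(real ^ 'n) + 2 - 2 * \<beta>)"
  by (simp add: p_def)
  have c0: "c < 0" by (rule kappa_negative_supercritical[OF \<beta>n c'])
  \<comment> \<open>The same number is the factor of |z|^p in the energy kernel, where it appears as
    |c|/2, and the factor in the squared norm of the gradient. This coincidence makes A (v, v) equal
    to the energy, and it rests on c < 0.\<close>
  define a where "a = - c / 2"
  have a: "0 < a" using c0 by (simp add: a_def)
  obtain m where m: "0 < m" "\<And>u :: real ^ 'n \<Rightarrow> real. L2c r u \<Longrightarrow> ennreal (m * (LBINT y. (u y)\<^sup>2)) \<le> msd_energy p u"
  using msd_energy_ge[OF p r(1)] by blast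
  have en: "energy \<omega> \<alpha> \<Omega> v = ennreal a * msd_energy p u" if v: "borel_rep r v u" for v u
  proof -
  have [measurable]: "u \<in> borel_measurable borel" using v by (auto simp: borel_rep_def L2c_def)
  have "energy \<omega> \<alpha> \<Omega> v = (LNINT z. ennreal (a * norm z powr p) * ennreal (msd u z))"
  proof (rule energy_msd[OF v])
   show "energy_kernel \<omega> \<alpha> x y = ennreal (a * norm (y - x) powr p)" if "x \<noteq> y" for x y :: "real ^ 'n"
    using energy_kernel_kappa[OF eta \<beta>'(1) \<beta>(2) c that] c0 by (simp add: a_def)
  qed simp
  also have "\<dots> = (LNINT z. ennreal a * ennreal (norm z powr p * msd u z))"
   using a by (intro nn_integral_cong) (simp add: ennreal_mult'[symmetric] msd_nonneg mult.assoc)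
  also have "\<dots> = ennreal a * msd_energy p u"
   unfolding msd_energy_def by (rule nn_integral_cmult) measurable
  finally show ?thesis .
  qed
  have V: "v \<in> ?V \<longleftrightarrow> (\<exists>u. borel_rep r v u \<and> msd_energy p u < \<infinity>) \<and> (AE x in lborel. x \<notin> \<Omega> \<longrightarrow> v x = 0)" for v
  proof -
  have "energy \<omega> \<alpha> \<Omega> v < \<infinity> \<longleftrightarrow> msd_energy p u < \<infinity>" if "borel_rep r v u" for u
   unfolding en[OF that] using a by (auto simp: ennreal_mult_less_top)
  then show ?thesis unfolding energy_space_iff[OF r] by blast
  qed
  have grad: "\<exists>w. pv_gradient \<beta> u w \<and> (LBINT x. (norm (w x))\<^sup>2) = a * enn2real (msd_energy p u)"
  if "borel_rep r v u" "msd_energy p u < \<infinity>" for v u :: "real ^ 'n \<Rightarrow> real"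
  proof -
  have u: "L2c r u" using that by (simp add: borel_rep_def)
  have pd: "p = real DIM(real ^ 'n) + 2 - 2 * \<beta>" by (simp add: p_def)
  show ?thesis
   using pv_gradient_finite_energy[OF \<beta>n u c' that(2)[unfolded pd]] unfolding pd a_def by blast
  qed
  have V0: "(\<lambda>x. 0) \<in> ?V" by (rule zero_in_energy_space[OF r])
  have lin: "lincomb u d v \<in> ?V" if uv: "u \<in> ?V" "v \<in> ?V" for u v d
  proof -
  obtain u' v' where h: "borel_rep r u u'" "msd_energy p u' < \<infinity>" "borel_rep r v v'" "msd_energy p v' < \<infinity>"
   using uv V by blast
  have "L2c r u'" "L2c r v'" using h by (auto simp: borel_rep_def)
  from msd_energy_lincomb_le[OF this, of p d]
  have "msd_energy p (lincomb u' d v') < \<infinity>"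
   using h(2,4) by (auto simp: ennreal_mult_less_top intro: le_less_trans)
  moreover have "AE x in lborel. x \<notin> \<Omega> \<longrightarrow> u x = 0" "AE x in lborel. x \<notin> \<Omega> \<longrightarrow> v x = 0" using uv V by auto
  then have "AE x in lborel. x \<notin> \<Omega> \<longrightarrow> lincomb u d v x = 0" by eventually_elim (simp add: lincomb_def)
  ultimately show ?thesis using V borel_rep_lincomb[OF h(1,3)] by blast
  qed
  have scaled: "(\<lambda>x. d * v x) = lincomb (\<lambda>x. 0) d v" for d and v :: "real ^ 'n \<Rightarrow> real"
  by (simp add: lincomb_def fun_eq_iff)
  have def: "bilinear_form_defined \<omega> \<alpha> \<Omega> u v" and sym: "?B u v = ?B v u"
  and Blin: "w \<in> ?V \<Longrightarrow> ?B (lincomb u d v) w = ?B u w + d * ?B v w" if uv: "u \<in> ?V" "v \<in> ?V" for u v w d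
  proof -
  obtain u' w1 where 1: "borel_rep r u u'" "pv_gradient \<beta> u' w1" using uv(1) V grad by blast
  obtain v' w2 where 2: "borel_rep r v v'" "pv_gradient \<beta> v' w2" using uv(2) V grad by blast
  note B = bilinear_form_pv_gradient[OF eta \<beta>'(3), of r]
  show "bilinear_form_defined \<omega> \<alpha> \<Omega> u v" by (rule B(1)[OF 1 2])
  show "?B u v = ?B v u" unfolding B(2)[OF 1 2] B(2)[OF 2 1] by (simp add: inner_commute)
  show "?B (lincomb u d v) w = ?B u w + d * ?B v w" if w: "w \<in> ?V"
  proof -
   obtain w' w3 where 3: "borel_rep r w w'" "pv_gradient \<beta> w' w3" using w V grad by blast
   have L: "L2c r u'" "L2c r v'" using 1 2 by (auto simp: borel_rep_def)
   have i: "integrable lborel (\<lambda>x. w1 x \<bullet> w3 x)" "integrable lborel (\<lambda>x. w2 x \<bullet> w3 x)"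
    using 1 2 3 by (auto simp: pv_gradient_def intro!: integrable_inner_L2)
   show ?thesis
    unfolding B(2)[OF borel_rep_lincomb[OF 1(1) 2(1)] pv_gradient_lincomb[OF \<beta>'(2) L(1) 1(2) L(2) 2(2)] 3] B(2)[OF 1 3] B(2)[OF 2 3]
    using i by (simp add: inner_add_left)
  qed
  qed
  have Bq: "?B v v = a * enn2real (msd_energy p u)" if v: "borel_rep r v u" "msd_energy p u < \<infinity>" for v u
  proof -
  obtain w where w: "pv_gradient \<beta> u w" "(LBINT x. (norm (w x))\<^sup>2) = a * enn2real (msd_energy p u)"
   using grad[OF v] by blast
  show ?thesis
   using bilinear_form_pv_gradient(2)[OF eta \<beta>'(3) v(1) w(1) v(1) w(1), of \<Omega>] w(2) by (simp add: power2_norm_eq_inner)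
  qed
  have nonneg: "0 \<le> ?B v v" if v: "v \<in> ?V" for v
  proof -
  obtain u where "borel_rep r v u" "msd_energy p u < \<infinity>" using v V by blast
  then show ?thesis using Bq a by simp
  qed
  have norm_eq: "energy_norm \<omega> \<alpha> \<Omega> v = sqrt (?B v v)" if v: "v \<in> ?V" for v
  proof -
  obtain u where u: "borel_rep r v u" "msd_energy p u < \<infinity>" using v V by blast
  show ?thesis unfolding energy_norm_def en[OF u(1)] Bq[OF u] using a by (simp add: enn2real_mult)
  qed
  have scale: "energy_norm \<omega> \<alpha> \<Omega> (\<lambda>x. d * v x) = \<bar>d\<bar> * energy_norm \<omega> \<alpha> \<Omega> v" if v: "v \<in> ?V" for d v
  proof -
  note l = lin[OF V0 v, of d]
  have z: "?B (\<lambda>x. 0) w = 0" if w: "w \<in> ?V" for w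
   using Blin[OF V0 V0 w, of 1] by (simp add: lincomb_def[abs_def])
  have "?B (lincomb (\<lambda>x. 0) d v) (lincomb (\<lambda>x. 0) d v) = d\<^sup>2 * ?B v v"
   unfolding Blin[OF V0 v l] z[OF l] sym[OF v l] Blin[OF V0 v v] z[OF v] by (simp add: power2_eq_square)
  then show ?thesis unfolding scaled norm_eq[OF l] norm_eq[OF v] by (simp add: real_sqrt_mult)
  qed
  have complete: "\<exists>u\<in>?V. (\<lambda>i. ?B (lincomb (g i) (- 1) u) (lincomb (g i) (- 1) u)) \<longlonglongrightarrow> 0"
  if g: "\<And>i::nat. g i \<in> ?V" and cauchy: "\<And>e. 0 < e \<Longrightarrow>
   \<exists>N. \<forall>i\<ge>N. \<forall>j\<ge>N. ?B (lincomb (g i) (- 1) (g j)) (lincomb (g i) (- 1) (g j)) \<le> e" for g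
  proof -
  have "\<exists>h. \<forall>i. borel_rep r (g i) (h i) \<and> msd_energy p (h i) < \<infinity>" using g V by (intro choice) blast
  then obtain h where h: "\<And>i. borel_rep r (g i) (h i)" "\<And>i. msd_energy p (h i) < \<infinity>" by blast
  have hL: "\<And>i. L2c r (h i)" using h(1) by (simp add: borel_rep_def)
  have fin: "msd_energy p (lincomb u d v) < \<infinity>" if "L2c r u" "L2c r v" "msd_energy p u < \<infinity>" "msd_energy p v < \<infinity>" for u v d
   using msd_energy_lincomb_le[OF that(1,2), of p d] that(3,4) by (auto simp: ennreal_mult_less_top intro: le_less_trans)
  obtain u where u: "L2c r u" "AE x in lborel. x \<notin> \<Omega> \<longrightarrow> u x = 0"
   "\<And>e. 0 < e \<Longrightarrow> \<exists>N. \<forall>i\<ge>N. msd_energy p (lincomb (h i) (- 1) u) \<le> ennreal e"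
  proof (rule msd_energy_complete[where \<Omega>=\<Omega>, OF p hL])
   fix e :: real assume e: "0 < e"
   obtain N where N: "\<And>i j. N \<le> i \<Longrightarrow> N \<le> j \<Longrightarrow> ?B (lincomb (g i) (- 1) (g j)) (lincomb (g i) (- 1) (g j)) \<le> a * e"
    using cauchy[of "a * e"] e a by auto
   have "msd_energy p (lincomb (h i) (- 1) (h j)) \<le> ennreal e" if ij: "N \<le> i" "N \<le> j" for i j
   proof -
    note f = fin[OF hL hL h(2) h(2), of i "- 1" j]
    have "a * enn2real (msd_energy p (lincomb (h i) (- 1) (h j))) \<le> a * e"
     using N[OF ij] unfolding Bq[OF borel_rep_lincomb[OF h(1) h(1)] f] .
    then have "enn2real (msd_energy p (lincomb (h i) (- 1) (h j))) \<le> e" using a by simp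
    from ennreal_leI[OF this] show ?thesis using f by simp
   qed
   then show "\<exists>N. \<forall>i\<ge>N. \<forall>j\<ge>N. msd_energy p (lincomb (h i) (- 1) (h j)) \<le> ennreal e" by blast
  next
   fix i
   have "AE x in lborel. g i x = h i x" using h(1)[of i] by (simp add: borel_rep_def)
   moreover have "AE x in lborel. x \<notin> \<Omega> \<longrightarrow> g i x = 0" using g[of i] V by blast
   ultimately show "AE x in lborel. x \<notin> \<Omega> \<longrightarrow> h i x = 0" by eventually_elim simp
  qed (use that in blast)
  have ru: "borel_rep r u u" using u(1) by (simp add: borel_rep_def)
  obtain N where N: "msd_energy p (lincomb (h N) (- 1) u) \<le> ennreal 1" using u(3)[of 1] by auto
  \<comment> \<open>u is the difference of h N and h N - u, both of finite energy.\<close>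
  have "u = lincomb (h N) (- 1) (lincomb (h N) (- 1) u)" by (simp add: lincomb_def fun_eq_iff)
  moreover have "msd_energy p (lincomb (h N) (- 1) (lincomb (h N) (- 1) u)) < \<infinity>"
   by (rule fin[OF hL L2c_lincomb[OF hL u(1)] h(2) le_less_trans[OF N]]) simp
  ultimately have eu: "msd_energy p u < \<infinity>" by simp
  have uV: "u \<in> ?V" using V ru eu u(2) by blast
  have B: "?B (lincomb (g i) (- 1) u) (lincomb (g i) (- 1) u) = a * enn2real (msd_energy p (lincomb (h i) (- 1) u))" for i
   by (rule Bq[OF borel_rep_lincomb[OF h(1) ru] fin[OF hL u(1) h(2) eu]])
  have "(\<lambda>i. enn2real (msd_energy p (lincomb (h i) (- 1) u))) \<longlonglongrightarrow> 0"
  proof (rule LIMSEQ_I)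
   fix e :: real assume e: "0 < e"
   then obtain N where N: "\<And>i. N \<le> i \<Longrightarrow> msd_energy p (lincomb (h i) (- 1) u) \<le> ennreal (e / 2)"
    using u(3)[of "e / 2"] by auto
   have "norm (enn2real (msd_energy p (lincomb (h i) (- 1) u)) - 0) < e" if "N \<le> i" for i
    using enn2real_leI[OF _ N[OF that]] e by simp
   then show "\<exists>N. \<forall>i\<ge>N. norm (enn2real (msd_energy p (lincomb (h i) (- 1) u)) - 0) < e" by blast
  qed
  from tendsto_mult_left[OF this, of a] have "(\<lambda>i. ?B (lincomb (g i) (- 1) u) (lincomb (g i) (- 1) u)) \<longlonglongrightarrow> 0"
   unfolding B by simp
  with uV show ?thesis by blast
  qed
  have ex: "\<exists>u. weak_solution \<omega> \<alpha> \<Omega> f u" if f: "f \<in> dual_energy_space \<omega> \<alpha> \<Omega>" for f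
  proof -
  obtain K where K: "\<And>v. v \<in> ?V \<Longrightarrow> \<bar>f v\<bar> \<le> K * energy_norm \<omega> \<alpha> \<Omega> v"
   using f unfolding dual_energy_space_def by blast
  have "f (lincomb u d v) = f u + d * f v" if "u \<in> ?V" "v \<in> ?V" for u v d
   using lin[OF V0 that(2), of d] by (intro dual_energy_space_lincomb[OF f that]) (simp add: scaled)
  note f_lin = this
  have bound: "\<bar>f v\<bar> \<le> K * sqrt (?B v v)" if "v \<in> ?V" for v using K[OF that] norm_eq[OF that] by simp
  have ne: "?V \<noteq> {}" using V0 by blast
  obtain u where u: "u \<in> ?V" "\<And>v. v \<in> ?V \<Longrightarrow> ?B u v = f v"
   using riesz_representation[of ?V ?B f K, OF ne lin sym Blin nonneg f_lin bound complete] by blast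
  then have "weak_solution \<omega> \<alpha> \<Omega> f u" by (simp add: weak_solution_def energy_space_def)
  then show ?thesis by blast
  qed
  have uniq: "AE x in lebesgue. x \<in> \<Omega> \<union> interaction_domain \<Omega> \<longrightarrow> u x = u' x"
  if f: "f \<in> dual_energy_space \<omega> \<alpha> \<Omega>" and u: "weak_solution \<omega> \<alpha> \<Omega> f u" "weak_solution \<omega> \<alpha> \<Omega> f u'" for f u u'
  proof -
  have uV: "u \<in> ?V" "u' \<in> ?V" using u by (auto simp: weak_solution_def)
  let ?d = "lincomb u (- 1) u'"
  have d: "?d \<in> ?V" by (rule lin[OF uV])
  have "?B ?d ?d = 0" using Blin[OF uV d, of "- 1"] u d by (simp add: weak_solution_def)
  moreover obtain h where h: "borel_rep r ?d h" "msd_energy p h < \<infinity>" using d V by blast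
  ultimately have "enn2real (msd_energy p h) = 0" using Bq[OF h] a by simp
  then have "msd_energy p h = 0" using h(2) by (auto simp: enn2real_eq_0_iff)
  moreover have hL: "L2c r h" "AE x in lborel. ?d x = h x" using h(1) by (auto simp: borel_rep_def)
  \<comment> \<open>Zero energy alone would allow constants; the Poincare inequality on the fixed
    ball excludes them.\<close>
  ultimately have "ennreal (m * (LBINT y. (h y)\<^sup>2)) \<le> 0" using m(2)[of h] by simp
  then have "(LBINT y. (h y)\<^sup>2) \<le> 0" using m(1) by (simp add: ennreal_eq_0_iff mult_le_0_iff)
  then have "AE x in lborel. h x = 0" by (rule L2c_integral_eq_0[OF hL(1)])
  with hL(2) show ?thesis unfolding AE_completion_iff by eventually_elim (simp add: lincomb_def)
  qed
  have stable: "energy_norm \<omega> \<alpha> \<Omega> u \<le> 1 * dual_norm \<omega> \<alpha> \<Omega> f"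
  if f: "f \<in> dual_energy_space \<omega> \<alpha> \<Omega>" and u: "weak_solution \<omega> \<alpha> \<Omega> f u" for f u
  proof -
  have uV: "u \<in> ?V" using u by (simp add: weak_solution_def)
  let ?N = "energy_norm \<omega> \<alpha> \<Omega> u" and ?D = "dual_norm \<omega> \<alpha> \<Omega> f"
  have "\<bar>f (\<lambda>x. 0)\<bar> \<le> ?D" using energy_eq_0[of "\<lambda>x. 0" \<omega> \<alpha> \<Omega>] by (intro abs_le_dual_norm f V0) (simp add: energy_norm_def)
  then have D: "0 \<le> ?D" by (rule order_trans[OF abs_ge_zero])
  have "?N * ?N = ?B u u" using norm_eq[OF uV] nonneg[OF uV] by simp
  also have "\<dots> = f u" using u uV by (simp add: weak_solution_def)
  also have "\<dots> \<le> ?D * ?N"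
   using lin[OF V0 uV] by (intro dual_pairing_le f uV scale) (simp add: scaled)
  finally have "?N * ?N \<le> ?D * ?N" .
  then show ?thesis using D by (cases "0 < ?N") auto
  qed
  show ?thesis
  unfolding well_posed_def using def ex uniq stable zero_le_one by blast
qed

theorem corollary5p1:
  fixes \<Omega> :: "(real ^ 'n::finite) set" and \<beta> :: real
    and \<phi> :: "real \<Rightarrow> real"
    and \<omega> :: "real ^ 'n \<Rightarrow> real ^ 'n \<Rightarrow> real"
    and \<alpha> :: "real ^ 'n \<Rightarrow> real ^ 'n \<Rightarrow> real ^ 'n"
  assumes "CARD('n) \<in> {1, 2, 3}"
    and "open \<Omega>" and "bounded \<Omega>"
    and "\<beta> > real CARD('n) / 2"
    and "\<And>r. \<phi> r = r powr (- \<beta>)"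
    and "\<And>x y. \<omega> x y = norm (y - x) * \<phi> (norm (y - x))"
    and "\<And>x y. \<alpha> x y = (y - x) /\<^sub>R norm (y - x)"
  shows "well_posed \<omega> \<alpha> \<Omega>"
proof -
  \<comment> \<open>On the diagonal, where \<alpha> divides by 0, both sides are 0; elsewhere |b -
    a| cancels against the normalisation of \<alpha>.\<close>
  have eta: "eta \<omega> \<alpha> a b = kern \<beta> 0 (b - a)" for a b
  by (cases "a = b") (simp_all add: eta_def kern_def assms(5-7))
  obtain r where r: "0 < r" "\<Omega> \<subseteq> ball 0 r" using bounded_subset_ballD[OF assms(3), of 0] by blast
  have \<beta>: "0 < \<beta>" using assms(4) by (smt (verit) divide_nonneg_nonneg of_nat_0_le_iff)
  have out: "(LNINT z. ennreal (norm z powr (- q)) * indicator (- ball (0 :: real ^ 'n) (2 * r)) z) = \<infinity>"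
  if "q \<le> real CARD('n)" for q
  using that by (intro nn_integral_norm_powr_out_top) simp
  have [measurable]: "ball (0 :: real ^ 'n) (2 * r) \<in> sets borel" by simp
  \<comment> \<open>The ranges are those of an infinite energy kernel, of a finite one that is not
    integrable at infinity unless it vanishes, and of a finite one integrable at infinity.\<close>
  consider "\<beta> \<le> real CARD('n) / 2 + 1 \<or> real CARD('n) + 2 \<le> \<beta>"
  | "real CARD('n) / 2 + 1 < \<beta>" "\<beta> \<le> real CARD('n) + 1"
  | "real CARD('n) + 1 < \<beta>" "\<beta> < real CARD('n) + 2" by linarith
  then show ?thesis
  proof cases
  case 1
  show ?thesis
  proof (rule well_posed_trivial[OF r eta less_imp_le[OF \<beta>]])
   show "energy_kernel \<omega> \<alpha> x y = (\<lambda>z. \<infinity>) (y - x)" if "x \<noteq> y" for x y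
    using energy_kernel_infinity[OF eta \<beta> 1 that] .
   have "(LNINT z. ennreal (norm z powr (- real CARD('n))) * indicator (- ball (0 :: real ^ 'n) (2 * r)) z)
    \<le> (LNINT z. \<infinity> * indicator (- ball (0 :: real ^ 'n) (2 * r)) z)"
    by (intro nn_integral_mono mult_right_mono) auto
   then show "(LNINT z. \<infinity> * indicator (- ball (0 :: real ^ 'n) (2 * r)) z) = \<infinity>"
    using out[of "real CARD('n)"] by (simp add: top_unique)
  qed simp
  next
  case 2
  have \<beta>2: "\<beta> < real CARD('n) + 2" using 2 by simp
  obtain c where c: "\<And>z::real ^ 'n. z \<noteq> 0 \<Longrightarrow> kappa \<beta> z = c * norm z powr (real CARD('n) + 2 - 2 * \<beta>)"
   using kappa_homogeneous by blast
  \<comment> \<open>Whether the constant vanishes at \<beta> = n + 1 is not decided here. If c = 0,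
    smaller exponents are excluded by the test function and the critical case applies; if c is
    nonzero, the energy space is trivial.\<close>
  show ?thesis
  proof (cases "c = 0")
   case True
   have "\<not> \<beta> < real CARD('n) + 1"
   proof
    assume "\<beta> < real CARD('n) + 1"
    then have "c \<noteq> 0" using 2 c by (intro kappa_nonzero_subcritical[where 'a="real ^ 'n" and \<beta>=\<beta>]) auto
    with True show False by simp
   qed
   then have "\<beta> = real CARD('n) + 1" using 2 by simp
   then show ?thesis using c True by (intro well_posed_critical[OF r eta]) auto
  next
   case False
   let ?q = "2 * \<beta> - real CARD('n) - 2"
   let ?k = "\<lambda>z :: real ^ 'n. ennreal (\<bar>c\<bar> / 2 * norm z powr (real CARD('n) + 2 - 2 * \<beta>))"
   show ?thesis
   proof (rule well_posed_trivial[OF r eta less_imp_le[OF \<beta>]])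
    show "energy_kernel \<omega> \<alpha> x y = ?k (y - x)" if "x \<noteq> y" for x y
     by (rule energy_kernel_kappa[OF eta 2(1) \<beta>2 c that])
    have "(LNINT z. ?k z * indicator (- ball 0 (2 * r)) z)
     = (LNINT z. ennreal (\<bar>c\<bar> / 2) * (ennreal (norm z powr (- ?q)) * indicator (- ball (0 :: real ^ 'n) (2 * r)) z))"
    proof (rule nn_integral_cong)
     fix z :: "real ^ 'n"
     have q: "real CARD('n) + 2 - 2 * \<beta> = - ?q" by simp
     have "?k z = ennreal (\<bar>c\<bar> / 2) * ennreal (norm z powr (- ?q))" unfolding q by (rule ennreal_mult') simp
     then show "?k z * indicator (- ball 0 (2 * r)) z = ennreal (\<bar>c\<bar> / 2) * (ennreal (norm z powr (- ?q)) * indicator (- ball 0 (2 * r)) z)"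
      by (simp only: mult.assoc)
    qed
    also have "\<dots> = ennreal (\<bar>c\<bar> / 2) * \<infinity>"
     using out[of ?q] 2(2) by (subst nn_integral_cmult) auto
    also have "\<dots> = \<infinity>" using False by (simp add: ennreal_mult_top)
    finally show "(LNINT z. ?k z * indicator (- ball 0 (2 * r)) z) = \<infinity>" .
   qed simp
  qed
  next
  case 3
  then show ?thesis by (rule well_posed_supercritical[OF r eta])
  qed
qed

end
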